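(* Let $\mathfrak{s}\in\{+1,-1\}$ and let $\Gamma$ be a contour of sign $\mathfrak{s}$ (as defined in the context) such that $$\|B_\Gamma\|_{\mathsf{E}_{D_\Gamma}}\,\|C_\Gamma\|_{\mathsf{E}_{D_\Gamma}}<\frac{d(\Gamma)^2}{4},\qquad d(\Gamma)=\operatorname{dist}(\sigma_A,\Gamma). \qquad ( * )$$ Put $d=d(\Gamma)$. Then the operator Riccati equations $$XA-D_\Gamma X+XB_\Gamma X=C_\Gamma,\quad X\in\mathcal{B}(\mathfrak{H}_A,\mathfrak{H}_{D,\Gamma}),\qquad (1)$$ $$YD_\Gamma-AY+YC_\Gamma Y=B_\Gamma,\quad Y\in\mathcal{B}(\mathfrak{H}_{D,\Gamma},\mathfrak{H}_A),\qquad (2)$$ have respective solutions $X_\Gamma\in\mathcal{B}(\mathfrak{H}_A,\mathfrak{H}_{D,\Gamma})$ and $Y_\Gamma\in\mathcal{B}(\mathfrak{H}_{D,\Gamma},\mathfrak{H}_A)$ with the following properties. (i) If $B_\Gamma\neq0$, then $X_\Gamma$ is the unique solution of (1) in the ball $$\Bigl\{T\in\mathcal{B}(\mathfrak{H}_A,\mathfrak{H}_{D,\Gamma})\ \Big|\ \|T\|<\|B_\Gamma\|_{\mathsf{E}_{D_\Gamma}}^{-1}\Bigl(d-\sqrt{\|B_\Gamma\|_{\mathsf{E}_{D_\Gamma}}\|C_\Gamma\|_{\mathsf{E}_{D_\Gamma}}}\Bigr)\Bigr\},$$ and $X_\Gamma$ has a finite $\mathsf{E}_{D_\Gamma}$-norm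 satisfying $$\|X_\Gamma\|_{\mathsf{E}_{D_\Gamma}}\le\frac{1}{\|B_\Gamma\|_{\mathsf{E}_{D_\Gamma}}}\Bigl(\frac d2-\sqrt{\frac{d^2}{4}-\|B_\Gamma\|_{\mathsf{E}_{D_\Gamma}}\|C_\Gamma\|_{\mathsf{E}_{D_\Gamma}}}\Bigr).$$ (ii) If $C_\Gamma\neq0$, then $Y_\Gamma$ is the unique solution of (2) in the ball $$\Bigl\{T\in\mathcal{B}(\mathfrak{H}_{D,\Gamma},\mathfrak{H}_A)\ \Big|\ \|T\|<\|C_\Gamma\|_{\mathsf{E}_{D_\Gamma}}^{-1}\Bigl(d-\sqrt{\|B_\Gamma\|_{\mathsf{E}_{D_\Gamma}}\|C_\Gamma\|_{\mathsf{E}_{D_\Gamma}}}\Bigr)\Bigr\},$$ and $Y_\Gamma$ has a finite $\mathsf{E}_{D_\Gamma}$-norm satisfying $$\|Y_\Gamma\|_{\mathsf{E}_{D_\Gamma}}\le\frac{1}{\|C_\Gamma\|_{\mathsf{E}_{D_\Gamma}}}\Bigl(\frac d2-\sqrt{\frac{d^2}{4}-\|B_\Gamma\|_{\mathsf{E}_{D_\Gamma}}\|C_\Gamma\|_{\mathsf{E}_{D_\Gamma}}}\Bigr).$$ Furthermore, the solution $Z_A^{\mathfrak{s}}$ (defined in the context) of the equation $Z=A-\int_\Gamma d\mu\,\mathfrak{b}(\mu)\mathfrak{c}(\mu)(Z-\mu)^{-1}$ is $$Z_A^{\mathfrak{s}}=A+B_\Gamma X_\Gamma,$$ and it is independent of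 the choice of the contour $\Gamma$ of sign $\mathfrak{s}$ satisfying $( * )$.
   Context: Notation. $\mathcal{B}(\mathfrak{L},\mathfrak{M})$ is the space of bounded linear operators between Hilbert spaces; $\sigma_S$ is the spectrum of $S$; $\mathbb{C}^{\pm}=\{z\in\mathbb{C}:\pm\operatorname{Im}z>0\}$; $\Delta=(\alpha,\beta)$ with $-\infty<\alpha<\beta<\infty$. Superscripts $+1,-1$ are identified with $+,-$. Standing setting. $\mathfrak{H}_A$ and $\mathfrak{h}$ are Hilbert spaces; $A\in\mathcal{B}(\mathfrak{H}_A)$ is self-adjoint with $\sigma_A\subset\Delta$. The functions $\mathfrak{b}:\Delta\to\mathcal{B}(\mathfrak{h},\mathfrak{H}_A)$ and $\mathfrak{c}:\Delta\to\mathcal{B}(\mathfrak{H}_A,\mathfrak{h})$ are real analytic on $\Delta$ and admit analytic continuation (denoted by the same letters) to a domain $\mathcal{D}\subset\mathbb{C}$ with $\Delta\subset\mathcal{D}$ and $\alpha,\beta\notin\mathcal{D}$. Put $\mathcal{D}^{\pm}=\mathcal{D}\cap\mathbb{C}^{\pm}$. There are constants $c>0$, $0\le\nu_{\mathfrak b}<1/2$, $0\le\nu_{\mathfrak c}<1/2$ such that, for each $\omega\in\{\alpha,\beta\}$, $\|\mathfrak{b}(\mu)\|\le c|\mu-\omega|^{-\nu_{\mathfrak b}}$ and $\|\mathfrak{c}(\mu)\|\le c|\mu-\omega|^{-\nu_{\mathfrak c}}$ for all $\mu\in\mathcal{D}$ in some open complex neighborhood of $\omega$. Contours. For $\mathfrak{s}=\pm1$,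 a contour of sign $\mathfrak{s}$ is a piecewise smooth Jordan arc $\Gamma$ with end points $\alpha,\beta$ (oriented from $\alpha$ to $\beta$), obtained from $\Delta$ by a continuous deformation with fixed end points and lying, except for its end points, in $\mathcal{D}^{\mathfrak{s}}\cup\Delta$; the region $\Omega(\Gamma)$ enclosed by the closed curve formed by $\Delta$ and $\Gamma$ satisfies $\Omega(\Gamma)\subset\mathcal{D}^{\mathfrak{s}}$. Deformed operators. $\mathfrak{H}_{D,\Gamma}=L^2(\Gamma\to\mathfrak{h})$ is the Hilbert space of $\mathfrak{h}$-valued functions on $\Gamma$ with inner product $\langle f,g\rangle=\int_\Gamma|d\lambda|\,\langle f(\lambda),g(\lambda)\rangle_{\mathfrak h}$. The operators $D_\Gamma\in\mathcal{B}(\mathfrak{H}_{D,\Gamma})$, $C_\Gamma\in\mathcal{B}(\mathfrak{H}_A,\mathfrak{H}_{D,\Gamma})$, $B_\Gamma\in\mathcal{B}(\mathfrak{H}_{D,\Gamma},\mathfrak{H}_A)$ are $$(D_\Gamma f)(\lambda)=\lambda f(\lambda),\qquad (C_\Gamma f_A)(\lambda)=\mathfrak{c}(\lambda)f_A,\qquad B_\Gamma f=\int_\Gamma d\lambda\,\mathfrak{b}(\lambda)f(\lambda),$$ where $d\lambda$ is the complex line element. $D_\Gamma$ is normal with spectrum $\overline\Gamma=\Gamma\cup\{\alpha,\beta\}$ and spectral measure $(\mathsf{E}_{D_\Gamma}(\delta)f)(\lambda)=\chi_\delta(\lambda)f(\lambda)$, $\delta\subset\overline\Gamma$ Borel. $\mathsf{E}$-norm.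 For $S\in\mathcal{B}(\mathfrak{H}_A,\mathfrak{H}_{D,\Gamma})$, $$\|S\|_{\mathsf{E}_{D_\Gamma}}=\Bigl(\sup_{\{\delta_j\}}\sum_j\|S^*\mathsf{E}_{D_\Gamma}(\delta_j)S\|\Bigr)^{1/2},$$ the supremum being over finite or countable systems of mutually disjoint Borel subsets $\delta_j$ of $\sigma_{D_\Gamma}$. For $T\in\mathcal{B}(\mathfrak{H}_{D,\Gamma},\mathfrak{H}_A)$, $\|T\|_{\mathsf{E}_{D_\Gamma}}:=\|T^*\|_{\mathsf{E}_{D_\Gamma}}$. Definition of $Z_A^{\mathfrak{s}}$. Let $\mathcal{V}(\Gamma)=\int_\Gamma|d\mu|\,\|\mathfrak{b}(\mu)\mathfrak{c}(\mu)\|$. Whenever $\mathcal{V}(\Gamma)<d(\Gamma)^2/4$ (which is the case under condition $( * )$ of the claim, since $\mathcal{V}(\Gamma)\le\|B_\Gamma\|_{\mathsf{E}_{D_\Gamma}}\|C_\Gamma\|_{\mathsf{E}_{D_\Gamma}}$), the equation $Z=A-\int_\Gamma d\mu\,\mathfrak{b}(\mu)\mathfrak{c}(\mu)(Z-\mu)^{-1}$ for $Z\in\mathcal{B}(\mathfrak{H}_A)$ with $\sigma_Z\cap\Gamma=\emptyset$ has a solution $Z=A+T$ with $\|T\|\le\frac{d(\Gamma)}2-\sqrt{\frac{d(\Gamma)^2}4-\mathcal{V}(\Gamma)}$, and it is the only solution of the form $A+T$ with $\|T\|\le d(\Gamma)-\sqrt{\mathcal{V}(\Gamma)}$. This solution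 is denoted $Z_A^{\mathfrak{s}}$.
   Formalization: The equation defining Z_A^s is taken with a plus sign, Z = A + ∫_Γ dμ b(μ)c(μ)(Z−μ)^{-1}, since Riccati equation (1) forces B_Γ X_Γ = +∫_Γ b c (Z−μ)^{-1} and the printed minus sign contradicts Z_A^s = A + B_Γ X_Γ. *)

theory Defs
  imports "HOL-Analysis.Analysis"
begin

section \<open>Complex normed and Hilbert spaces\<close>

class cnormed = real_normed_vector +
  fixes scaleC :: "complex \<Rightarrow> 'a \<Rightarrow> 'a" (infixr "*\<^sub>C" 75)
  assumes scaleC_add_right: "a *\<^sub>C (x + y) = a *\<^sub>C x + a *\<^sub>C y"
    and scaleC_add_left: "(a + b) *\<^sub>C x = a *\<^sub>C x + b *\<^sub>C x"
    and scaleC_scaleC: "a *\<^sub>C (b *\<^sub>C x) = (a * b) *\<^sub>C x"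
    and scaleR_scaleC: "r *\<^sub>R x = complex_of_real r *\<^sub>C x"
    and norm_scaleC: "norm (a *\<^sub>C x) = cmod a * norm x"

class chilbert = cnormed + banach +
  fixes cinner :: "'a \<Rightarrow> 'a \<Rightarrow> complex"
  assumes cinner_commute: "cinner x y = cnj (cinner y x)"
    and cinner_add_left: "cinner (x + y) z = cinner x z + cinner y z"
    and cinner_scaleC_left: "cinner (a *\<^sub>C x) y = a * cinner x y"
    and norm_eq_sqrt_cinner: "norm x = sqrt (Re (cinner x x))"

instantiation complex :: chilbert
begin

definition "scaleC_complex (a::complex) (x::complex) = a * x"
definition "cinner_complex (x::complex) (y::complex) = x * cnj y"

instance
proof
  fix x :: complex
  show "norm x = sqrt (Re (cinner x x))"
    by (simp add: cinner_complex_def complex_mult_cnj cmod_def)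
qed (simp_all add: scaleC_complex_def cinner_complex_def algebra_simps norm_mult
      scaleR_conv_of_real)

end

lemma bounded_linear_scaleC: "bounded_linear (\<lambda>x::'a::cnormed. a *\<^sub>C x)"
proof (rule bounded_linear_intro[where K = "cmod a"])
  fix r and x :: 'a
  show "a *\<^sub>C (r *\<^sub>R x) = r *\<^sub>R (a *\<^sub>C x)"
    by (simp add: scaleR_scaleC scaleC_scaleC mult.commute)
qed (simp_all add: scaleC_add_right norm_scaleC mult.commute)

text \<open>Bounded operators between complex spaces are elements of \<open>'a \<Rightarrow>\<^sub>L 'b\<close>, which are a priori
  only real-linear, satisfying \<open>clinear_op\<close>. The real and the complex operator norm agree.\<close>

instantiation blinfun :: (real_normed_vector, cnormed) cnormed
begin

definition "scaleC_blinfun (a::complex) (F::'a \<Rightarrow>\<^sub>L 'b) = Blinfun (\<lambda>x. a *\<^sub>C blinfun_apply F x)"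

lemma scaleC_blinfun_apply:
  "blinfun_apply (a *\<^sub>C (F::'a \<Rightarrow>\<^sub>L 'b)) x = a *\<^sub>C blinfun_apply F x"
  unfolding scaleC_blinfun_def
  by (subst bounded_linear_Blinfun_apply)
    (auto intro: bounded_linear_compose[OF bounded_linear_scaleC] blinfun.bounded_linear_right)

instance
proof
  fix a b :: complex and r :: real and F G :: "'a \<Rightarrow>\<^sub>L 'b"
  show "a *\<^sub>C (F + G) = a *\<^sub>C F + a *\<^sub>C G"
    by (rule blinfun_eqI) (simp add: scaleC_blinfun_apply blinfun.add_left scaleC_add_right)
  show "(a + b) *\<^sub>C F = a *\<^sub>C F + b *\<^sub>C F"
    by (rule blinfun_eqI) (simp add: scaleC_blinfun_apply blinfun.add_left scaleC_add_left)
  show "a *\<^sub>C b *\<^sub>C F = (a * b) *\<^sub>C F"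
    by (rule blinfun_eqI) (simp add: scaleC_blinfun_apply scaleC_scaleC)
  show "r *\<^sub>R F = complex_of_real r *\<^sub>C F"
    by (rule blinfun_eqI) (simp add: scaleC_blinfun_apply blinfun.scaleR_left scaleR_scaleC)
  have le: "norm (z *\<^sub>C G) \<le> cmod z * norm G" for z and G :: "'a \<Rightarrow>\<^sub>L 'b"
    by (rule norm_blinfun_bound)
      (auto simp: scaleC_blinfun_apply norm_scaleC mult.assoc intro!: mult_left_mono norm_blinfun)
  show "norm (a *\<^sub>C F) = cmod a * norm F"
  proof (cases "a = 0")
    case True
    then show ?thesis using le[of a F] by simp
  next
    case False
    have "inverse a *\<^sub>C (a *\<^sub>C F) = F"
    proof (rule blinfun_eqI)
      fix x
      have "1 *\<^sub>C blinfun_apply F x = blinfun_apply F x"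
        using scaleR_scaleC[of 1 "blinfun_apply F x"] by simp
      then show "blinfun_apply (inverse a *\<^sub>C (a *\<^sub>C F)) x = blinfun_apply F x"
        using False by (simp add: scaleC_blinfun_apply scaleC_scaleC)
    qed
    then have "norm F \<le> cmod (inverse a) * norm (a *\<^sub>C F)"
      using le[of "inverse a" "a *\<^sub>C F"] by simp
    then have "cmod a * norm F \<le> norm (a *\<^sub>C F)"
      using False by (simp add: norm_inverse norm_divide field_simps)
    then show ?thesis using le[of a F] by simp
  qed
qed

end

definition clinear_op :: "('a::cnormed \<Rightarrow>\<^sub>L 'b::cnormed) \<Rightarrow> bool" where
  "clinear_op T \<longleftrightarrow> (\<forall>a x. blinfun_apply T (a *\<^sub>C x) = a *\<^sub>C blinfun_apply T x)"

definition selfadjoint :: "('a::chilbert \<Rightarrow>\<^sub>L 'a) \<Rightarrow> bool" where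
  "selfadjoint T \<longleftrightarrow> clinear_op T \<and>
     (\<forall>x y. cinner (blinfun_apply T x) y = cinner x (blinfun_apply T y))"

text \<open>For \<open>T\<close> satisfying \<open>clinear_op\<close>, a two-sided inverse of \<open>T - z\<close> is automatically
  complex-linear.\<close>

definition is_resolvent :: "('a::cnormed \<Rightarrow>\<^sub>L 'a) \<Rightarrow> complex \<Rightarrow> ('a \<Rightarrow>\<^sub>L 'a) \<Rightarrow> bool" where
  "is_resolvent T z R \<longleftrightarrow>
     R o\<^sub>L (T - z *\<^sub>C id_blinfun) = id_blinfun \<and> (T - z *\<^sub>C id_blinfun) o\<^sub>L R = id_blinfun"

definition resolvent :: "('a::cnormed \<Rightarrow>\<^sub>L 'a) \<Rightarrow> complex \<Rightarrow> ('a \<Rightarrow>\<^sub>L 'a)" where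
  "resolvent T z = (THE R. is_resolvent T z R)"

definition spectrum :: "('a::cnormed \<Rightarrow>\<^sub>L 'a) \<Rightarrow> complex set" where
  "spectrum T = {z. \<nexists>R. is_resolvent T z R}"

definition vholomorphic_on :: "(complex \<Rightarrow> 'a::cnormed) \<Rightarrow> complex set \<Rightarrow> bool" where
  "vholomorphic_on F S \<longleftrightarrow>
     (\<forall>z\<in>S. \<exists>L. ((\<lambda>w. inverse (w - z) *\<^sub>C (F w - F z)) \<longlongrightarrow> L) (at z within S))"


section \<open>Hilbert spaces with a carrier set, and their bounded operators\<close>

text \<open>The space $L^2(\Gamma \to \mathfrak{h})$ depends on the variable \<open>\<Gamma>\<close> and hence cannot be a
  type; it is given by its carrier and operations. Operators defined on a carrier are
  \<open>undefined\<close> outside it, so that equality of operators is equality of functions.\<close>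

record 'v hspace =
  vecs :: "'v set"
  vzero :: 'v
  vadd :: "'v \<Rightarrow> 'v \<Rightarrow> 'v"
  vscale :: "complex \<Rightarrow> 'v \<Rightarrow> 'v"
  vinner :: "'v \<Rightarrow> 'v \<Rightarrow> complex"

definition vminus :: "'v hspace \<Rightarrow> 'v \<Rightarrow> 'v \<Rightarrow> 'v" where
  "vminus H x y = vadd H x (vscale H (-1) y)"

definition vnorm :: "'v hspace \<Rightarrow> 'v \<Rightarrow> real" where
  "vnorm H x = sqrt (Re (vinner H x x))"

definition whole :: "'a::chilbert hspace" where
  "whole = \<lparr>vecs = UNIV, vzero = 0, vadd = (+), vscale = scaleC, vinner = cinner\<rparr>"

definition bounded_ops :: "'v hspace \<Rightarrow> 'w hspace \<Rightarrow> ('v \<Rightarrow> 'w) set" where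
  "bounded_ops H K = {T \<in> vecs H \<rightarrow>\<^sub>E vecs K.
     (\<forall>x\<in>vecs H. \<forall>y\<in>vecs H. T (vadd H x y) = vadd K (T x) (T y)) \<and>
     (\<forall>a. \<forall>x\<in>vecs H. T (vscale H a x) = vscale K a (T x)) \<and>
     (\<exists>M. \<forall>x\<in>vecs H. vnorm K (T x) \<le> M * vnorm H x)}"

definition zero_op :: "'v hspace \<Rightarrow> 'w hspace \<Rightarrow> 'v \<Rightarrow> 'w" where
  "zero_op H K = (\<lambda>x\<in>vecs H. vzero K)"

definition op_norm :: "'v hspace \<Rightarrow> 'w hspace \<Rightarrow> ('v \<Rightarrow> 'w) \<Rightarrow> real" where
  "op_norm H K T = Inf {M. 0 \<le> M \<and> (\<forall>x\<in>vecs H. vnorm K (T x) \<le> M * vnorm H x)}"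

definition op_adjoint :: "'v hspace \<Rightarrow> 'w hspace \<Rightarrow> ('v \<Rightarrow> 'w) \<Rightarrow> 'w \<Rightarrow> 'v" where
  "op_adjoint H K T =
     (\<lambda>y\<in>vecs K. THE x. x \<in> vecs H \<and> (\<forall>z\<in>vecs H. vinner K (T z) y = vinner H z x))"


section \<open>The Hilbert space of square integrable vector-valued functions\<close>

text \<open>No separability of the value space is assumed, so measurability is Bochner's strong
  measurability. Vectors are classes modulo equality almost everywhere; the choice of
  representatives in the operations is immaterial.\<close>

definition strongly_measurable :: "'p measure \<Rightarrow> ('p \<Rightarrow> 'h::topological_space) \<Rightarrow> bool" where
  "strongly_measurable M f \<longleftrightarrow>
     (\<exists>s. (\<forall>n::nat. simple_function M (s n)) \<and> (\<forall>x\<in>space M. (\<lambda>n. s n x) \<longlonglongrightarrow> f x))"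

definition L2_fun :: "'p measure \<Rightarrow> ('p \<Rightarrow> 'h::chilbert) set" where
  "L2_fun M = {f. strongly_measurable M f \<and> integrable M (\<lambda>x. (norm (f x))\<^sup>2)}"

definition L2_class :: "'p measure \<Rightarrow> ('p \<Rightarrow> 'h::chilbert) \<Rightarrow> ('p \<Rightarrow> 'h) set" where
  "L2_class M f = {g \<in> L2_fun M. AE x in M. g x = f x}"

definition rep :: "('p \<Rightarrow> 'h) set \<Rightarrow> 'p \<Rightarrow> 'h" where
  "rep F = (SOME f. f \<in> F)"

definition L2 :: "'p measure \<Rightarrow> ('p \<Rightarrow> 'h::chilbert) set hspace" where
  "L2 M = \<lparr>vecs = L2_class M ` L2_fun M,
     vzero = L2_class M (\<lambda>x. 0),
     vadd = (\<lambda>F G. L2_class M (\<lambda>x. rep F x + rep G x)),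
     vscale = (\<lambda>a F. L2_class M (\<lambda>x. a *\<^sub>C rep F x)),
     vinner = (\<lambda>F G. LINT x|M. cinner (rep F x) (rep G x))\<rparr>"


section \<open>Contours\<close>

text \<open>A Jordan arc \<open>\<Gamma>\<close> is given by an injective parametrization \<open>\<gamma>\<close> on \<open>{0..1}\<close>. The set \<open>\<Gamma>\<close>
  itself does not contain the end points; its closure is \<open>path_image \<gamma>\<close>.\<close>

definition open_arc :: "(real \<Rightarrow> complex) \<Rightarrow> complex set" where
  "open_arc \<gamma> = \<gamma> ` {0<..<1}"

definition smooth_on_interval :: "real \<Rightarrow> real \<Rightarrow> (real \<Rightarrow> complex) \<Rightarrow> bool" where
  "smooth_on_interval s t \<gamma> \<longleftrightarrow> (\<exists>\<gamma>'. continuous_on {s..t} \<gamma>' \<and>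
     (\<forall>u\<in>{s..t}. (\<gamma> has_vector_derivative \<gamma>' u) (at u within {s..t}) \<and> \<gamma>' u \<noteq> 0))"

definition piecewise_smooth :: "(real \<Rightarrow> complex) \<Rightarrow> bool" where
  "piecewise_smooth \<gamma> \<longleftrightarrow> (\<exists>K. finite K \<and> {0, 1} \<subseteq> K \<and> K \<subseteq> {0..1} \<and>
     (\<forall>s\<in>K. \<forall>t\<in>K. s < t \<and> K \<inter> {s<..<t} = {} \<longrightarrow> smooth_on_interval s t \<gamma>))"

definition half_part :: "int \<Rightarrow> complex set \<Rightarrow> complex set" where
  "half_part \<s> D = {z \<in> D. of_int \<s> * Im z > 0}"

text \<open>The last condition says that the region enclosed by the closed curve formed by the interval
  and the arc lies in \<open>half_part \<s> D\<close>; \<open>inside S\<close> is the union of the bounded components of \<open>- S\<close>.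
  The deformation of the interval into the arc takes place in \<open>D\<close> together with the two end
  points, which do not belong to \<open>D\<close>.\<close>

definition contour :: "real \<Rightarrow> real \<Rightarrow> complex set \<Rightarrow> int \<Rightarrow> (real \<Rightarrow> complex) \<Rightarrow> bool" where
  "contour \<alpha> \<beta> D \<s> \<gamma> \<longleftrightarrow>
     arc \<gamma> \<and> pathstart \<gamma> = of_real \<alpha> \<and> pathfinish \<gamma> = of_real \<beta> \<and> piecewise_smooth \<gamma> \<and>
     homotopic_paths (D \<union> {of_real \<alpha>, of_real \<beta>}) (linepath (of_real \<alpha>) (of_real \<beta>)) \<gamma> \<and>
     open_arc \<gamma> \<subseteq> half_part \<s> D \<union> of_real ` {\<alpha><..<\<beta>} \<and>
     inside (path_image \<gamma> \<union> closed_segment (of_real \<alpha>) (of_real \<beta>)) \<subseteq> half_part \<s> D"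

text \<open>Integration over the arc: \<open>arclen \<gamma>\<close> is the measure $|d\lambda|$ on \<open>\<Gamma>\<close>;
  \<open>has_arc_integral\<close> and \<open>arc_integral\<close> refer to the complex line element $d\lambda$ and extend
  the library's \<open>has_contour_integral\<close> to vector-valued integrands.\<close>

definition arclen :: "(real \<Rightarrow> complex) \<Rightarrow> complex measure" where
  "arclen \<gamma> = distr
     (density (restrict_space lborel {0<..<1})
        (\<lambda>t. ennreal (cmod (vector_derivative \<gamma> (at t within {0..1})))))
     (restrict_space borel (open_arc \<gamma>)) \<gamma>"

definition has_arc_integral ::
  "(complex \<Rightarrow> 'a::cnormed) \<Rightarrow> 'a \<Rightarrow> (real \<Rightarrow> complex) \<Rightarrow> bool" where
  "has_arc_integral F I \<gamma> \<longleftrightarrow>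
     ((\<lambda>t. vector_derivative \<gamma> (at t within {0..1}) *\<^sub>C F (\<gamma> t)) has_integral I) {0..1}"

definition arc_integral :: "(real \<Rightarrow> complex) \<Rightarrow> (complex \<Rightarrow> 'a::cnormed) \<Rightarrow> 'a" where
  "arc_integral \<gamma> F =
     integral {0..1} (\<lambda>t. vector_derivative \<gamma> (at t within {0..1}) *\<^sub>C F (\<gamma> t))"


section \<open>The operators associated with a contour\<close>

abbreviation HD :: "(real \<Rightarrow> complex) \<Rightarrow> (complex \<Rightarrow> 'h::chilbert) set hspace" where
  "HD \<gamma> \<equiv> L2 (arclen \<gamma>)"

definition D_op :: "(real \<Rightarrow> complex) \<Rightarrow> (complex \<Rightarrow> 'h::chilbert) set \<Rightarrow> (complex \<Rightarrow> 'h) set" where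
  "D_op \<gamma> = (\<lambda>F\<in>vecs (HD \<gamma>). L2_class (arclen \<gamma>) (\<lambda>z. z *\<^sub>C rep F z))"

definition C_op ::
  "(complex \<Rightarrow> 'a::chilbert \<Rightarrow>\<^sub>L 'h::chilbert) \<Rightarrow> (real \<Rightarrow> complex) \<Rightarrow> 'a \<Rightarrow> (complex \<Rightarrow> 'h) set" where
  "C_op \<c> \<gamma> = (\<lambda>x. L2_class (arclen \<gamma>) (\<lambda>z. blinfun_apply (\<c> z) x))"

definition B_op ::
  "(complex \<Rightarrow> 'h::chilbert \<Rightarrow>\<^sub>L 'a::chilbert) \<Rightarrow> (real \<Rightarrow> complex) \<Rightarrow> (complex \<Rightarrow> 'h) set \<Rightarrow> 'a" where
  "B_op \<b> \<gamma> = (\<lambda>F\<in>vecs (HD \<gamma>). arc_integral \<gamma> (\<lambda>z. blinfun_apply (\<b> z) (rep F z)))"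

definition spectral_proj ::
  "(real \<Rightarrow> complex) \<Rightarrow> complex set \<Rightarrow> (complex \<Rightarrow> 'h::chilbert) set \<Rightarrow> (complex \<Rightarrow> 'h) set" where
  "spectral_proj \<gamma> \<delta> =
     (\<lambda>F\<in>vecs (HD \<gamma>). L2_class (arclen \<gamma>) (\<lambda>z. indicat_real \<delta> z *\<^sub>R rep F z))"

definition esqrt :: "ennreal \<Rightarrow> ennreal" where
  "esqrt x = (if x = top then top else ennreal (sqrt (enn2real x)))"

text \<open>The spectrum of \<open>D_op \<gamma>\<close> is \<open>path_image \<gamma>\<close>. Finite systems of Borel sets are included as
  sequences that are eventually empty.\<close>

definition E_norm ::
  "(real \<Rightarrow> complex) \<Rightarrow> ('a::chilbert \<Rightarrow> (complex \<Rightarrow> 'h::chilbert) set) \<Rightarrow> ennreal" where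
  "E_norm \<gamma> S = esqrt
     (SUP \<delta> \<in> {\<delta> :: nat \<Rightarrow> complex set.
         (\<forall>j. \<delta> j \<in> sets borel \<and> \<delta> j \<subseteq> path_image \<gamma>) \<and> disjoint_family \<delta>}.
       (\<Sum>j. ennreal (op_norm whole whole
          (\<lambda>x. op_adjoint whole (HD \<gamma>) S (spectral_proj \<gamma> (\<delta> j) (S x))))))"

definition E_norm_dual ::
  "(real \<Rightarrow> complex) \<Rightarrow> ((complex \<Rightarrow> 'h::chilbert) set \<Rightarrow> 'a::chilbert) \<Rightarrow> ennreal" where
  "E_norm_dual \<gamma> T = E_norm \<gamma> (op_adjoint (HD \<gamma>) whole T)"

definition spec_dist :: "('a::chilbert \<Rightarrow>\<^sub>L 'a) \<Rightarrow> (real \<Rightarrow> complex) \<Rightarrow> real" where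
  "spec_dist A \<gamma> = setdist (spectrum A) (open_arc \<gamma>)"

definition smallness ::
  "('a::chilbert \<Rightarrow>\<^sub>L 'a) \<Rightarrow> (complex \<Rightarrow> 'h::chilbert \<Rightarrow>\<^sub>L 'a) \<Rightarrow> (complex \<Rightarrow> 'a \<Rightarrow>\<^sub>L 'h)
     \<Rightarrow> (real \<Rightarrow> complex) \<Rightarrow> bool" where
  "smallness A \<b> \<c> \<gamma> \<longleftrightarrow>
     E_norm_dual \<gamma> (B_op \<b> \<gamma>) * E_norm \<gamma> (C_op \<c> \<gamma>) < ennreal ((spec_dist A \<gamma>)\<^sup>2 / 4)"

definition riccati_X ::
  "('a::chilbert \<Rightarrow>\<^sub>L 'a) \<Rightarrow> (complex \<Rightarrow> 'h::chilbert \<Rightarrow>\<^sub>L 'a) \<Rightarrow> (complex \<Rightarrow> 'a \<Rightarrow>\<^sub>L 'h)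
     \<Rightarrow> (real \<Rightarrow> complex) \<Rightarrow> ('a \<Rightarrow> (complex \<Rightarrow> 'h) set) \<Rightarrow> bool" where
  "riccati_X A \<b> \<c> \<gamma> X \<longleftrightarrow> X \<in> bounded_ops whole (HD \<gamma>) \<and>
     (\<forall>x. vadd (HD \<gamma>)
            (vminus (HD \<gamma>) (X (blinfun_apply A x)) (D_op \<gamma> (X x)))
            (X (B_op \<b> \<gamma> (X x))) = C_op \<c> \<gamma> x)"

definition riccati_Y ::
  "('a::chilbert \<Rightarrow>\<^sub>L 'a) \<Rightarrow> (complex \<Rightarrow> 'h::chilbert \<Rightarrow>\<^sub>L 'a) \<Rightarrow> (complex \<Rightarrow> 'a \<Rightarrow>\<^sub>L 'h)
     \<Rightarrow> (real \<Rightarrow> complex) \<Rightarrow> ((complex \<Rightarrow> 'h) set \<Rightarrow> 'a) \<Rightarrow> bool" where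
  "riccati_Y A \<b> \<c> \<gamma> Y \<longleftrightarrow> Y \<in> bounded_ops (HD \<gamma>) whole \<and>
     (\<forall>F\<in>vecs (HD \<gamma>). Y (D_op \<gamma> F) - blinfun_apply A (Y F) + Y (C_op \<c> \<gamma> (Y F)) = B_op \<b> \<gamma> F)"

definition variation ::
  "(complex \<Rightarrow> 'h::chilbert \<Rightarrow>\<^sub>L 'a::chilbert) \<Rightarrow> (complex \<Rightarrow> 'a \<Rightarrow>\<^sub>L 'h) \<Rightarrow> (real \<Rightarrow> complex) \<Rightarrow> real" where
  "variation \<b> \<c> \<gamma> = (LINT z|arclen \<gamma>. norm (\<b> z o\<^sub>L \<c> z))"

text \<open>The equation is $Z = A + \int_\Gamma d\mu\, \mathfrak{b}(\mu)\mathfrak{c}(\mu)(Z-\mu)^{-1}$, that is,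
  $Z = A - \int_\Gamma d\mu\, \mathfrak{b}(\mu)\mathfrak{c}(\mu)(\mu-Z)^{-1}$. This is the sign that goes with
  the Riccati equation: \<open>riccati_X\<close> reads $X(Z - \cdot) = C$ for $Z = A + BX$, so that
  $(Xf)(\mu) = \mathfrak{c}(\mu)(Z-\mu)^{-1}f$ and
  $BX = \int_\Gamma d\mu\, \mathfrak{b}(\mu)\mathfrak{c}(\mu)(Z-\mu)^{-1}$.\<close>

definition solves_Z ::
  "('a::chilbert \<Rightarrow>\<^sub>L 'a) \<Rightarrow> (complex \<Rightarrow> 'h::chilbert \<Rightarrow>\<^sub>L 'a) \<Rightarrow> (complex \<Rightarrow> 'a \<Rightarrow>\<^sub>L 'h)
     \<Rightarrow> (real \<Rightarrow> complex) \<Rightarrow> ('a \<Rightarrow>\<^sub>L 'a) \<Rightarrow> bool" where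
  "solves_Z A \<b> \<c> \<gamma> Z \<longleftrightarrow> clinear_op Z \<and> spectrum Z \<inter> open_arc \<gamma> = {} \<and>
     (\<exists>I. has_arc_integral (\<lambda>\<mu>. \<b> \<mu> o\<^sub>L \<c> \<mu> o\<^sub>L resolvent Z \<mu>) I \<gamma> \<and> Z = A + I)"

definition Z_op ::
  "('a::chilbert \<Rightarrow>\<^sub>L 'a) \<Rightarrow> (complex \<Rightarrow> 'h::chilbert \<Rightarrow>\<^sub>L 'a) \<Rightarrow> (complex \<Rightarrow> 'a \<Rightarrow>\<^sub>L 'h)
     \<Rightarrow> (real \<Rightarrow> complex) \<Rightarrow> ('a \<Rightarrow>\<^sub>L 'a)" where
  "Z_op A \<b> \<c> \<gamma> = (THE Z. solves_Z A \<b> \<c> \<gamma> Z \<and>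
     norm (Z - A) \<le> spec_dist A \<gamma> / 2 - sqrt ((spec_dist A \<gamma>)\<^sup>2 / 4 - variation \<b> \<c> \<gamma>))"

end

theory Submission
  imports Defs "HOL-Complex_Analysis.Complex_Analysis"
begin

text \<open>
  The key is that the Riccati equations can be solved once a single operator on the space of \<open>A\<close> is
  known. If \<open>X\<close> solves the first one and \<open>Z = A + B X\<close>, then \<open>X Z - D X = C\<close>. Since \<open>D\<close> is multiplication by
  \<open>\<lambda>\<close>, this says that \<open>X\<close> is multiplication by \<open>c(\<lambda>) (Z - \<lambda>)\<inverse>\<close>, and inserting this into \<open>Z = A + B X\<close> gives
  \<open>T = \<integral> b c (A + T - \<lambda>)\<inverse> d\<lambda>\<close> for \<open>T = Z - A\<close>. Conversely every small solution \<open>T\<close> yields a solution \<open>X\<close>. The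
  second equation leads in the same way, with \<open>T = - Y C\<close>, to \<open>T = \<integral> (A + T - \<lambda>)\<inverse> b c d\<lambda>\<close>. For
  \<open>norm T < d\<close> the resolvent is bounded by \<open>1 / (d - norm T)\<close>, because that of \<open>A\<close> is bounded by the reciprocal
  distance to the spectrum (\<open>resolvent_bound_perturbed\<close>). So the right-hand sides map the ball of radius
  \<open>r = d/2 - sqrt (d\<^sup>2/4 - V)\<close> into itself and are contractions there, \<open>V\<close> being the integral of
  \<open>norm (b c)\<close> (\<open>resolvent_integral_fixpoint\<close>).

  That every Riccati solution in the large ball has this form (\<open>riccati_X_form\<close>, \<open>riccati_Y_form\<close>) is the
  uniqueness of the solution of the linear equation: a bounded operator \<open>u\<close> with \<open>u Z = D u\<close> vanishes, as
  \<open>Z\<close> has no spectrum on the arc (\<open>intertwining_zero\<close>). The E-norms enter through one identity: the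
  E-norm of a multiplication operator is the square root of the integral of the squared norms of its
  values (\<open>E_norm_mult_op\<close>). The adjoint of \<open>B\<close> is again a multiplication operator, up to the unit tangent
  which relates \<open>d\<lambda>\<close> to arc length (\<open>op_adjoint_B_op\<close>). By the Cauchy-Schwarz inequality \<open>V\<close> is at most the
  product of the E-norms of \<open>B\<close> and \<open>C\<close>, and the bounds for \<open>X\<close> and \<open>Y\<close> follow from the bound of the
  resolvent.

  For the independence of the contour, let \<open>Z\<close> be the operator of the contour with the smaller distance
  \<open>d\<close>. It suffices that the integral of \<open>b c (Z - \<lambda>)\<inverse>\<close> is the same over the other contour, since the
  solution is unique there even in the ball of radius \<open>d/2\<close> (\<open>Z_op_props\<close>). The spectrum of \<open>Z\<close> lies within
  \<open>d/2\<close> of the spectrum of \<open>A\<close>, in discs around real points which neither contour meets; a loop in a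
  closed half plane does not wind around them. Both contours are homotopic to the interval and so wind
  alike around the points outside \<open>D\<close>. The integrand is singular at the end points, which do not belong
  to \<open>D\<close>. Therefore both arcs are cut off at distance \<open>\<rho>\<close> from the end points and joined by circular
  arcs. That these arcs lie in \<open>D\<close> is a matter of winding numbers (\<open>close_with_circular_arc\<close>). Cauchy's theorem
  applies to the resulting loop, and the circular arcs contribute \<open>O(\<rho>\<^bsup>1 - \<nu>\<^esup>)\<close>, where \<open>\<nu> < 1\<close> is the sum of the
  two exponents (\<open>contour_integral_deformation\<close>).
\<close>

section \<open>Complex Hilbert spaces: adjoints and resolvents\<close>

lemma scaleC_1 [simp]: "(1::complex) *\<^sub>C (x::'a::cnormed) = x"
  using scaleR_scaleC[of 1 x] by simp

lemma scaleC_0_left [simp]: "(0::complex) *\<^sub>C (x::'a::cnormed) = 0"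
  using scaleR_scaleC[of 0 x] by simp

lemma scaleC_0_right [simp]: "a *\<^sub>C (0::'a::cnormed) = 0"
  using norm_scaleC[of a "0::'a"] by simp

lemma scaleC_minus_left: "(- a) *\<^sub>C (x::'a::cnormed) = - (a *\<^sub>C x)"
  using scaleC_add_left[of "-a" a x] by (simp add: eq_neg_iff_add_eq_0)

lemma scaleC_minus_right: "a *\<^sub>C (- x::'a::cnormed) = - (a *\<^sub>C x)"
  using scaleC_add_right[of a "-x" x] by (simp add: eq_neg_iff_add_eq_0)

lemma scaleC_diff_left: "(a - b) *\<^sub>C (x::'a::cnormed) = a *\<^sub>C x - b *\<^sub>C x"
  using scaleC_add_left[of a "-b" x] by (simp add: scaleC_minus_left)

lemma scaleC_diff_right: "a *\<^sub>C (x - y::'a::cnormed) = a *\<^sub>C x - a *\<^sub>C y"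
  using scaleC_add_right[of a x "-y"] by (simp add: scaleC_minus_right)

lemma bounded_bilinear_scaleC:
  "bounded_bilinear (\<lambda>a (x::'a::cnormed). a *\<^sub>C x)"
proof
  fix a b :: complex and x y :: 'a and r :: real
  show "(a + b) *\<^sub>C x = a *\<^sub>C x + b *\<^sub>C x" by (rule scaleC_add_left)
  show "a *\<^sub>C (x + y) = a *\<^sub>C x + a *\<^sub>C y" by (rule scaleC_add_right)
  show "(r *\<^sub>R a) *\<^sub>C x = r *\<^sub>R (a *\<^sub>C x)"
    by (simp add: scaleR_scaleC[where 'a = 'a] scaleC_scaleC scaleR_conv_of_real)
  show "a *\<^sub>C (r *\<^sub>R x) = r *\<^sub>R (a *\<^sub>C x)"
    by (simp add: scaleR_scaleC scaleC_scaleC mult.commute)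
  show "\<exists>K. \<forall>a (b::'a). norm (a *\<^sub>C b) \<le> norm a * norm b * K"
    by (rule exI[of _ 1]) (simp add: norm_scaleC)
qed

subsection \<open>The inner product\<close>

lemma cinner_add_right: "cinner x (y + z) = cinner x y + cinner (x::'a::chilbert) z"
  by (metis cinner_add_left cinner_commute complex_cnj_add)

lemma cinner_scaleC_right: "cinner x (a *\<^sub>C y) = cnj a * cinner (x::'a::chilbert) y"
  by (metis cinner_commute cinner_scaleC_left complex_cnj_mult)

lemma cinner_zero_left [simp]: "cinner 0 (x::'a::chilbert) = 0"
  using cinner_scaleC_left[of 0 0 x] by simp

lemma cinner_zero_right [simp]: "cinner (x::'a::chilbert) 0 = 0"
  using cinner_scaleC_right[of x 0 0] by simp

lemma cinner_minus_left: "cinner (- x) (y::'a::chilbert) = - cinner x y"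
  using cinner_scaleC_left[of "-1" x y] by (simp add: scaleC_minus_left)

lemma cinner_minus_right: "cinner x (- y::'a::chilbert) = - cinner x y"
  using cinner_scaleC_right[of x "-1" y] by (simp add: scaleC_minus_left)

lemma cinner_diff_left: "cinner (x - y) (z::'a::chilbert) = cinner x z - cinner y z"
  using cinner_add_left[of x "-y" z] by (simp add: cinner_minus_left)

lemma cinner_diff_right: "cinner x (y - z::'a::chilbert) = cinner x y - cinner x z"
  using cinner_add_right[of x y "-z"] by (simp add: cinner_minus_right)

lemma cinner_self: "cinner x (x::'a::chilbert) = of_real ((norm x)\<^sup>2)"
proof -
  have "sqrt (Re (cinner x x)) \<ge> 0" by (metis norm_eq_sqrt_cinner norm_ge_zero)
  then have "(norm x)\<^sup>2 = Re (cinner x x)" by (simp add: norm_eq_sqrt_cinner)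
  moreover have "Im (cinner x x) = 0"
    using cinner_commute[of x x] by (metis complex_cnj_cancel_iff Reals_cnj_iff complex_is_Real_iff)
  ultimately show ?thesis by (simp add: complex_eq_iff)
qed

lemma norm_add_sq: "(norm (x + y))\<^sup>2 = (norm x)\<^sup>2 + 2 * Re (cinner x y) + (norm (y::'a::chilbert))\<^sup>2"
proof -
  have "Re (cinner (x + y) (x + y)) = Re (cinner x x) + Re (cinner x y) + Re (cinner y x) + Re (cinner y y)"
    by (simp add: cinner_add_left cinner_add_right)
  moreover have "Re (cinner y x) = Re (cinner x y)" by (subst cinner_commute) simp
  ultimately show ?thesis by (simp add: cinner_self)
qed

lemma norm_diff_sq: "(norm (x - y))\<^sup>2 = (norm x)\<^sup>2 - 2 * Re (cinner x y) + (norm (y::'a::chilbert))\<^sup>2"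
  using norm_add_sq[of x "-y"] by (simp add: cinner_minus_right)

lemma cinner_norm_le: "cmod (cinner x y) \<le> norm x * norm (y::'a::chilbert)"
proof (cases "y = 0")
  case False
  define a where "a = cinner x y / of_real ((norm y)\<^sup>2)"
  have ny: "(norm y)\<^sup>2 > 0" using False by simp
  have "(norm (x - a *\<^sub>C y))\<^sup>2 = (norm x)\<^sup>2 - 2 * Re (cnj a * cinner x y) + (cmod a)\<^sup>2 * (norm y)\<^sup>2"
    by (simp add: norm_diff_sq cinner_scaleC_right norm_scaleC power_mult_distrib)
  moreover have "cnj a * cinner x y = of_real ((cmod (cinner x y))\<^sup>2 / (norm y)\<^sup>2)"
    using complex_norm_square[of "cinner x y"] by (simp add: a_def mult.commute)
  moreover have "(cmod a)\<^sup>2 * (norm y)\<^sup>2 = (cmod (cinner x y))\<^sup>2 / (norm y)\<^sup>2"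
    using ny by (simp add: a_def norm_divide norm_power power_divide) (simp add: power2_eq_square power4_eq_xxxx)
  ultimately have "(norm (x - a *\<^sub>C y))\<^sup>2 = (norm x)\<^sup>2 - (cmod (cinner x y))\<^sup>2 / (norm y)\<^sup>2"
    by simp
  then have "(cmod (cinner x y))\<^sup>2 / (norm y)\<^sup>2 \<le> (norm x)\<^sup>2"
    by (metis diff_ge_0_iff_ge zero_le_power2)
  then have "(cmod (cinner x y))\<^sup>2 \<le> (norm x * norm y)\<^sup>2"
    using ny by (simp add: divide_le_eq power_mult_distrib)
  then show ?thesis by (rule power2_le_imp_le) simp
qed simp

lemma bounded_bilinear_cinner: "bounded_bilinear (cinner :: 'a::chilbert \<Rightarrow> 'a \<Rightarrow> complex)"
proof
  fix a b x y :: 'a and r :: real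
  show "cinner (r *\<^sub>R a) b = r *\<^sub>R cinner a b"
    by (simp add: scaleR_scaleC[where 'a = 'a] cinner_scaleC_left scaleR_conv_of_real)
  show "cinner a (r *\<^sub>R b) = r *\<^sub>R cinner a b"
    by (simp add: scaleR_scaleC[where 'a = 'a] cinner_scaleC_right scaleR_conv_of_real)
  show "\<exists>K. \<forall>a (b::'a). norm (cinner a b) \<le> norm a * norm b * K"
    by (rule exI[of _ 1]) (simp add: cinner_norm_le)
qed (simp_all add: cinner_add_left cinner_add_right)

lemma cinner_eq_zeroD: "(\<And>y. cinner x y = 0) \<Longrightarrow> x = (0::'a::chilbert)"
  by (metis cinner_self norm_eq_zero of_real_eq_0_iff zero_eq_power2)

lemma cinner_ext: "(\<And>z. cinner z x = cinner z y) \<Longrightarrow> x = (y::'a::chilbert)"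
proof -
  assume a: "\<And>z. cinner z x = cinner z y"
  have "cinner (x - y) (x - y) = 0" by (subst cinner_diff_right) (simp add: a)
  then show ?thesis by (simp add: cinner_self)
qed

lemma parallelogram:
  "(norm (x - y))\<^sup>2 = 2 * (norm x)\<^sup>2 + 2 * (norm y)\<^sup>2 - (norm (x + (y::'a::chilbert)))\<^sup>2"
  by (simp add: norm_add_sq norm_diff_sq)

text \<open>The representing vector is the multiple of a vector of minimal norm in the affine hyperplane
  \<open>f x = 1\<close>; minimality makes it orthogonal to the kernel of \<open>f\<close>, and the parallelogram law makes
  every minimizing sequence a Cauchy sequence.\<close>

lemma Riesz_representation:
  fixes f :: "'a::chilbert \<Rightarrow> complex"
  assumes add: "\<And>x y. f (x + y) = f x + f y" and scale: "\<And>a x. f (a *\<^sub>C x) = a * f x"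
    and bd: "\<And>x. cmod (f x) \<le> K * norm x"
  shows "\<exists>u. \<forall>x. f x = cinner x u"
proof (cases "\<forall>x. f x = 0")
  case True
  then show ?thesis by (intro exI[of _ 0]) simp
next
  case False
  then obtain x0 where x0: "f x0 \<noteq> 0" by blast
  have diff: "f (x - y) = f x - f y" for x y
    using add[of "x - y" y] by simp
  define S where "S = {x. f x = 1}"
  have "f (inverse (f x0) *\<^sub>C x0) = 1" using x0 by (simp add: scale)
  then have Sne: "S \<noteq> {}" by (auto simp: S_def)
  define m where "m = Inf ((\<lambda>x. (norm x)\<^sup>2) ` S)"
  have bdd: "bdd_below ((\<lambda>x. (norm x)\<^sup>2) ` S)" by (rule bdd_belowI[of _ 0]) auto
  have m_le: "m \<le> (norm x)\<^sup>2" if "f x = 1" for x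
    unfolding m_def by (rule cInf_lower) (use that bdd in \<open>auto simp: S_def\<close>)
  have "\<exists>x. f x = 1 \<and> (norm x)\<^sup>2 < m + 1 / real (Suc n)" for n
  proof -
    have "\<exists>y\<in>(\<lambda>x. (norm x)\<^sup>2) ` S. y < m + 1 / real (Suc n)"
      using cInf_less_iff[of "(\<lambda>x. (norm x)\<^sup>2) ` S" "m + 1 / real (Suc n)"] Sne bdd
      by (simp add: m_def)
    then show ?thesis by (auto simp: S_def)
  qed
  then obtain s where s: "\<And>n. f (s n) = 1" "\<And>n. (norm (s n))\<^sup>2 < m + 1 / real (Suc n)" by metis
  have close: "(norm (s i - s j))\<^sup>2 \<le> 2 / real (Suc i) + 2 / real (Suc j)" for i j
  proof -
    have "f ((1/2) *\<^sub>C (s i + s j)) = 1" by (simp add: add scale s)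
    then have "m \<le> (norm ((1/2) *\<^sub>C (s i + s j)))\<^sup>2" by (rule m_le)
    then have "4 * m \<le> (norm (s i + s j))\<^sup>2" by (simp add: norm_scaleC power_divide)
    then show ?thesis using s(2)[of i] s(2)[of j] by (simp add: parallelogram)
  qed
  have "Cauchy s"
  proof (rule metric_CauchyI)
    fix e :: real assume e: "e > 0"
    obtain N where N: "4 / e\<^sup>2 < real N" using reals_Archimedean2 by blast
    have "dist (s i) (s j) < e" if "i \<ge> N" "j \<ge> N" for i j
    proof -
      have Np: "real N > 0" using N e by (meson divide_pos_pos less_trans zero_less_numeral zero_less_power)
      have "2 / real (Suc i) \<le> 2 / real (Suc N)" "2 / real (Suc j) \<le> 2 / real (Suc N)"
        using that by (auto intro!: divide_left_mono)
      then have "(norm (s i - s j))\<^sup>2 \<le> 4 / real (Suc N)" using close[of i j] by simp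
      also have "\<dots> < 4 / real N" using Np by (simp add: divide_strict_left_mono)
      also have "\<dots> < e\<^sup>2" using N e Np by (simp add: field_simps)
      finally show ?thesis using e by (simp add: dist_norm power2_less_imp_less)
    qed
    then show "\<exists>M. \<forall>i\<ge>M. \<forall>j\<ge>M. dist (s i) (s j) < e" by blast
  qed
  then obtain v where v: "s \<longlonglongrightarrow> v" by (auto simp: Cauchy_convergent_iff convergent_def)
  have "cmod (f v - 1) \<le> 0"
  proof (rule LIMSEQ_le_const)
    show "(\<lambda>n. K * norm (v - s n)) \<longlonglongrightarrow> 0"
      using tendsto_mult[OF tendsto_const tendsto_norm[OF tendsto_diff[OF tendsto_const[of v] v]], of K] by simp
    show "\<exists>N. \<forall>n\<ge>N. cmod (f v - 1) \<le> K * norm (v - s n)"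
      using bd[of "v - s _"] by (simp add: diff s)
  qed
  then have fv: "f v = 1" by simp
  have "(\<lambda>n. (norm (s n))\<^sup>2) \<longlonglongrightarrow> (norm v)\<^sup>2" by (intro tendsto_intros v)
  moreover have "(\<lambda>n. m + 1 / real (Suc n)) \<longlonglongrightarrow> m + 0"
    using lim_inverse_n'[THEN LIMSEQ_Suc] by (intro tendsto_intros) auto
  ultimately have "(norm v)\<^sup>2 \<le> m"
    by (intro LIMSEQ_le[of _ _ "\<lambda>n. m + 1 / real (Suc n)" m]) (use s(2) less_imp_le in \<open>auto intro!: exI[of _ 0] simp del: of_nat_Suc\<close>)
  then have vmin: "(norm v)\<^sup>2 \<le> (norm x)\<^sup>2" if "f x = 1" for x
    using m_le[OF that] by linarith
  have orth: "cinner v y = 0" if "f y = 0" for y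
  proof (rule ccontr)
    assume nz: "cinner v y \<noteq> 0"
    then have ny: "(norm y)\<^sup>2 > 0" by auto
    define a where "a = cinner v y / of_real ((norm y)\<^sup>2)"
    have "f (v - a *\<^sub>C y) = 1" by (simp add: diff scale that fv)
    then have "(norm v)\<^sup>2 \<le> (norm (v - a *\<^sub>C y))\<^sup>2" by (rule vmin)
    also have "\<dots> = (norm v)\<^sup>2 - 2 * Re (cnj a * cinner v y) + (cmod a)\<^sup>2 * (norm y)\<^sup>2"
      by (simp add: norm_diff_sq cinner_scaleC_right norm_scaleC power_mult_distrib)
    also have "cnj a * cinner v y = of_real ((cmod (cinner v y))\<^sup>2 / (norm y)\<^sup>2)"
      using complex_norm_square[of "cinner v y"] by (simp add: a_def mult.commute)
    also have "(cmod a)\<^sup>2 * (norm y)\<^sup>2 = (cmod (cinner v y))\<^sup>2 / (norm y)\<^sup>2"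
      using ny by (simp add: a_def norm_divide norm_power power_divide) (simp add: power2_eq_square power4_eq_xxxx)
    finally have "(cmod (cinner v y))\<^sup>2 / (norm y)\<^sup>2 \<le> 0" by simp
    then show False using ny nz by (simp add: divide_le_0_iff)
  qed
  have "v \<noteq> 0" using fv scale[of 0 0] by auto
  define u where "u = of_real (1 / (norm v)\<^sup>2) *\<^sub>C v"
  have "f x = cinner x u" for x
  proof -
    have "f (x - f x *\<^sub>C v) = 0" by (simp add: diff scale fv)
    then have "cinner v (x - f x *\<^sub>C v) = 0" by (rule orth)
    then have "cinner v x = cnj (f x) * of_real ((norm v)\<^sup>2)"
      by (simp add: cinner_diff_right cinner_scaleC_right cinner_self)
    then have "cinner x v = f x * of_real ((norm v)\<^sup>2)"
      by (subst cinner_commute) simp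
    then show ?thesis using \<open>v \<noteq> 0\<close> by (simp add: u_def cinner_scaleC_right)
  qed
  then show ?thesis by blast
qed

subsection \<open>Complex-linear operators and their adjoints\<close>

lemma clinear_op_compose: "clinear_op S \<Longrightarrow> clinear_op T \<Longrightarrow> clinear_op (S o\<^sub>L T)"
  by (simp add: clinear_op_def)

lemma clinear_op_add: "clinear_op S \<Longrightarrow> clinear_op T \<Longrightarrow> clinear_op (S + T)"
  by (simp add: clinear_op_def blinfun.add_left scaleC_add_right)

lemma clinear_op_diff: "clinear_op S \<Longrightarrow> clinear_op T \<Longrightarrow> clinear_op (S - T)"
  by (simp add: clinear_op_def blinfun.diff_left scaleC_diff_right)

lemma clinear_op_uminus: "clinear_op S \<Longrightarrow> clinear_op (- S)"
  by (simp add: clinear_op_def blinfun.minus_left scaleC_minus_right)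

lemma clinear_op_id: "clinear_op id_blinfun"
  by (simp add: clinear_op_def)

lemma clinear_op_scaleC: "clinear_op S \<Longrightarrow> clinear_op (a *\<^sub>C S)"
  by (simp add: clinear_op_def scaleC_blinfun_apply scaleC_scaleC mult.commute)

lemma blinfun_apply_clinear: "clinear_op T \<Longrightarrow> blinfun_apply T (a *\<^sub>C x) = a *\<^sub>C blinfun_apply T x"
  by (simp add: clinear_op_def)

lemma blinfun_compose_scaleC_left: "(a *\<^sub>C S) o\<^sub>L T = a *\<^sub>C (S o\<^sub>L T)"
  by (rule blinfun_eqI) (simp add: scaleC_blinfun_apply)

lemma blinfun_compose_scaleC_right: "clinear_op S \<Longrightarrow> S o\<^sub>L (a *\<^sub>C T) = a *\<^sub>C (S o\<^sub>L T)"
  by (rule blinfun_eqI) (simp add: scaleC_blinfun_apply clinear_op_def)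

lemma closed_clinear_op: "closed {T :: 'a::cnormed \<Rightarrow>\<^sub>L 'b::cnormed. clinear_op T}"
  unfolding clinear_op_def
  by (intro closed_Collect_all closed_Collect_eq continuous_intros
      bounded_bilinear.continuous_on[OF bounded_bilinear_scaleC])

text \<open>The defining property determines the value for complex-linear \<open>T\<close>; the value for other operators
  is arbitrary.\<close>

definition adj :: "('a::chilbert \<Rightarrow>\<^sub>L 'b::chilbert) \<Rightarrow> ('b \<Rightarrow>\<^sub>L 'a)" where
  "adj T = (SOME S. \<forall>x y. cinner (blinfun_apply T x) y = cinner x (blinfun_apply S y))"

lemma cinner_adj:
  assumes "clinear_op (T :: 'a::chilbert \<Rightarrow>\<^sub>L 'b::chilbert)"
  shows "cinner (blinfun_apply T x) y = cinner x (blinfun_apply (adj T) y)"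
proof -
  have "\<exists>u. \<forall>x. cinner (blinfun_apply T x) y = cinner x u" for y
  proof (rule Riesz_representation)
    show "cmod (cinner (blinfun_apply T x) y) \<le> (norm T * norm y) * norm x" for x
      using order_trans[OF cinner_norm_le mult_right_mono[OF norm_blinfun]] by (simp add: mult_ac)
  qed (use assms in \<open>simp_all add: blinfun.add_right cinner_add_left clinear_op_def cinner_scaleC_left\<close>)
  then obtain g where g: "\<And>x y. cinner (blinfun_apply T x) y = cinner x (g y)" by metis
  have "bounded_linear g"
  proof (rule bounded_linear_intro[where K = "norm T"])
    show "g (x + y) = g x + g y" for x y
      by (rule cinner_ext) (simp add: cinner_add_right flip: g)
    show "g (r *\<^sub>R x) = r *\<^sub>R g x" for r x
      by (rule cinner_ext) (simp add: scaleR_scaleC cinner_scaleC_right flip: g)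
    show "norm (g y) \<le> norm y * norm T" for y
    proof (cases "g y = 0")
      case False
      have "(norm (g y))\<^sup>2 = cmod (cinner (g y) (g y))" by (simp add: cinner_self del: of_real_power)
      also have "\<dots> = cmod (cinner (blinfun_apply T (g y)) y)" by (simp add: g)
      also have "\<dots> \<le> (norm T * norm (g y)) * norm y"
        by (rule order_trans[OF cinner_norm_le mult_right_mono[OF norm_blinfun]]) simp
      finally show ?thesis using False by (simp add: power2_eq_square mult_ac)
    qed simp
  qed
  then have "\<exists>S. \<forall>x y. cinner (blinfun_apply T x) y = cinner x (blinfun_apply S y)"
    by (intro exI[of _ "Blinfun g"]) (simp add: bounded_linear_Blinfun_apply g)
  then show ?thesis unfolding adj_def by (rule someI2_ex) blast
qed

lemma cinner_adj': "clinear_op T \<Longrightarrow> cinner (blinfun_apply (adj T) y) x = cinner y (blinfun_apply T x)"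
  by (metis cinner_adj cinner_commute)

lemma clinear_op_adj: "clinear_op T \<Longrightarrow> clinear_op (adj T)"
  unfolding clinear_op_def[of "adj T"]
  by (rule allI, rule allI, rule cinner_ext) (simp add: cinner_adj[symmetric] cinner_scaleC_right)

lemma adj_diff: "clinear_op S \<Longrightarrow> clinear_op T \<Longrightarrow> adj (S - T) = adj S - adj T"
  by (rule blinfun_eqI, rule cinner_ext)
    (simp add: cinner_adj[symmetric] clinear_op_diff blinfun.diff_left cinner_diff_right cinner_diff_left)

lemma norm_le_via_cinner:
  assumes "\<And>z. cmod (cinner z (v::'a::chilbert)) \<le> norm z * K" "K \<ge> 0"
  shows "norm v \<le> K"
proof (cases "v = 0")
  case False
  have "norm v * norm v = cmod (cinner v v)" by (simp add: cinner_self norm_mult power2_eq_square)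
  also have "\<dots> \<le> norm v * K" by (rule assms)
  finally show ?thesis using False by simp
qed (use assms in simp)

lemma norm_adj:
  assumes "clinear_op T" shows "norm (adj T) = norm T"
proof (rule antisym)
  show "norm (adj T) \<le> norm T"
  proof (rule norm_blinfun_bound, simp, rule norm_le_via_cinner)
    show "cmod (cinner z (blinfun_apply (adj T) x)) \<le> norm z * (norm T * norm x)" for z x
      using order_trans[OF cinner_norm_le mult_right_mono[OF norm_blinfun[of T z]], of x]
      by (simp add: cinner_adj[OF assms, symmetric] mult_ac)
  qed auto
  show "norm T \<le> norm (adj T)"
  proof (rule norm_blinfun_bound, simp, rule norm_le_via_cinner)
    show "cmod (cinner z (blinfun_apply T x)) \<le> norm z * (norm (adj T) * norm x)" for z x
      using order_trans[OF cinner_norm_le mult_right_mono[OF norm_blinfun[of "adj T" z]], of x]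
      by (simp add: cinner_adj'[OF assms, symmetric] mult_ac)
  qed auto
qed

subsection \<open>Inverses and resolvents\<close>

definition inverse_op :: "('a::cnormed \<Rightarrow>\<^sub>L 'a) \<Rightarrow> ('a \<Rightarrow>\<^sub>L 'a) \<Rightarrow> bool" where
  "inverse_op P R \<longleftrightarrow> R o\<^sub>L P = id_blinfun \<and> P o\<^sub>L R = id_blinfun"

lemma is_resolvent_iff: "is_resolvent T z R \<longleftrightarrow> inverse_op (T - z *\<^sub>C id_blinfun) R"
  by (simp add: is_resolvent_def inverse_op_def)

lemma blinfun_compose_assoc: "(R o\<^sub>L S) o\<^sub>L T = R o\<^sub>L (S o\<^sub>L T)"
  by (rule blinfun_eqI) simp

lemma compose_id_left [simp]: "id_blinfun o\<^sub>L T = T"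
  by (rule blinfun_eqI) simp

lemma compose_id_right [simp]: "T o\<^sub>L id_blinfun = T"
  by (rule blinfun_eqI) simp

lemma blinfun_compose_add_left: "(S + T) o\<^sub>L R = (S o\<^sub>L R) + (T o\<^sub>L R)"
  by (rule blinfun_eqI) (simp add: blinfun.add_left)

lemma blinfun_compose_add_right: "R o\<^sub>L (S + T) = (R o\<^sub>L S) + (R o\<^sub>L T)"
  by (rule blinfun_eqI) (simp add: blinfun.add_left blinfun.add_right)

lemma blinfun_compose_diff_left: "(S - T) o\<^sub>L R = (S o\<^sub>L R) - (T o\<^sub>L R)"
  by (rule blinfun_eqI) (simp add: blinfun.diff_left)

lemma blinfun_compose_diff_right: "R o\<^sub>L (S - T) = (R o\<^sub>L S) - (R o\<^sub>L T)"
  by (rule blinfun_eqI) (simp add: blinfun.diff_left blinfun.diff_right)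

lemma inverse_op_unique: "inverse_op P R \<Longrightarrow> inverse_op P R' \<Longrightarrow> R = R'"
  unfolding inverse_op_def by (metis blinfun_compose_assoc compose_id_left compose_id_right)

lemma resolvent_eqI: "is_resolvent T z R \<Longrightarrow> resolvent T z = R"
  unfolding resolvent_def is_resolvent_iff by (rule the_equality) (auto intro: inverse_op_unique)

lemma is_resolvent_resolvent: "z \<notin> spectrum T \<Longrightarrow> is_resolvent T z (resolvent T z)"
  unfolding spectrum_def using resolvent_eqI by fastforce

lemma resolvent_apply:
  assumes "z \<notin> spectrum T"
  shows "blinfun_apply (resolvent T z) (blinfun_apply T x - z *\<^sub>C x) = x"
    and "blinfun_apply T (blinfun_apply (resolvent T z) x) - z *\<^sub>C blinfun_apply (resolvent T z) x = x"
proof -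
  note * = is_resolvent_resolvent[OF assms, unfolded is_resolvent_def]
  show "blinfun_apply (resolvent T z) (blinfun_apply T x - z *\<^sub>C x) = x"
    using arg_cong[OF conjunct1[OF *], of "\<lambda>S. blinfun_apply S x"]
    by (simp add: blinfun.diff_left scaleC_blinfun_apply)
  show "blinfun_apply T (blinfun_apply (resolvent T z) x) - z *\<^sub>C blinfun_apply (resolvent T z) x = x"
    using arg_cong[OF conjunct2[OF *], of "\<lambda>S. blinfun_apply S x"]
    by (simp add: blinfun.diff_left scaleC_blinfun_apply)
qed

lemma clinear_op_inverse:
  assumes "clinear_op P" "inverse_op P R" shows "clinear_op R"
proof -
  have 1: "blinfun_apply R (blinfun_apply P x) = x" "blinfun_apply P (blinfun_apply R x) = x" for x
    using assms(2) unfolding inverse_op_def by (metis blinfun_apply_blinfun_compose blinfun_apply_id_blinfun id_apply)+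
  show ?thesis using assms(1) 1 unfolding clinear_op_def by metis
qed

lemma clinear_op_resolvent:
  assumes "clinear_op T" "z \<notin> spectrum T" shows "clinear_op (resolvent T z)"
proof (rule clinear_op_inverse)
  show "inverse_op (T - z *\<^sub>C id_blinfun) (resolvent T z)"
    using is_resolvent_resolvent[OF assms(2)] by (simp add: is_resolvent_iff)
  show "clinear_op (T - z *\<^sub>C id_blinfun)"
    by (intro clinear_op_diff clinear_op_scaleC clinear_op_id assms)
qed

text \<open>The perturbed inverse is the fixed point of the contraction \<open>V \<mapsto> R - R T V\<close>; it is a right
  inverse of \<open>P + T\<close> and agrees with the left inverse that \<open>V \<mapsto> R - V T R\<close> provides.\<close>

lemma inverse_op_perturb:
  fixes P R T :: "'a::{cnormed, banach} \<Rightarrow>\<^sub>L 'a"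
  assumes inv: "inverse_op P R" and small: "norm R * norm T < 1"
  obtains V where "inverse_op (P + T) V" "norm V \<le> norm R / (1 - norm R * norm T)"
proof -
  have RP: "R o\<^sub>L P = id_blinfun" and PR: "P o\<^sub>L R = id_blinfun" using inv by (auto simp: inverse_op_def)
  have lip: "norm ((R o\<^sub>L T) o\<^sub>L X) \<le> (norm R * norm T) * norm X"
    "norm (X o\<^sub>L (T o\<^sub>L R)) \<le> (norm R * norm T) * norm X" for X
  proof -
    show "norm ((R o\<^sub>L T) o\<^sub>L X) \<le> (norm R * norm T) * norm X"
      by (rule order_trans[OF norm_blinfun_compose mult_right_mono[OF norm_blinfun_compose]]) simp
    have "norm (X o\<^sub>L (T o\<^sub>L R)) \<le> norm X * (norm T * norm R)"
      by (rule order_trans[OF norm_blinfun_compose mult_left_mono[OF norm_blinfun_compose]]) simp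
    then show "norm (X o\<^sub>L (T o\<^sub>L R)) \<le> (norm R * norm T) * norm X" by (simp add: mult_ac)
  qed
  have "\<exists>!V. R - ((R o\<^sub>L T) o\<^sub>L V) = V"
  proof (rule banach_fix_type[OF _ small])
    show "\<forall>x y. dist (R - (R o\<^sub>L T o\<^sub>L x)) (R - (R o\<^sub>L T o\<^sub>L y)) \<le> norm R * norm T * dist x y"
    proof (intro allI)
      fix x y :: "'a \<Rightarrow>\<^sub>L 'a"
      show "dist (R - (R o\<^sub>L T o\<^sub>L x)) (R - (R o\<^sub>L T o\<^sub>L y)) \<le> norm R * norm T * dist x y"
        using lip(1)[of "y - x"] by (simp add: dist_norm blinfun_compose_diff_right norm_minus_commute[of x y])
    qed
  qed simp
  then obtain V where V: "R - ((R o\<^sub>L T) o\<^sub>L V) = V" by blast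
  have "\<exists>!V. R - (V o\<^sub>L (T o\<^sub>L R)) = V"
  proof (rule banach_fix_type[OF _ small])
    show "\<forall>x y. dist (R - (x o\<^sub>L (T o\<^sub>L R))) (R - (y o\<^sub>L (T o\<^sub>L R))) \<le> norm R * norm T * dist x y"
    proof (intro allI)
      fix x y :: "'a \<Rightarrow>\<^sub>L 'a"
      show "dist (R - (x o\<^sub>L (T o\<^sub>L R))) (R - (y o\<^sub>L (T o\<^sub>L R))) \<le> norm R * norm T * dist x y"
        using lip(2)[of "y - x"] by (simp add: dist_norm blinfun_compose_diff_left norm_minus_commute[of x y])
    qed
  qed simp
  then obtain W where W: "R - (W o\<^sub>L (T o\<^sub>L R)) = W" by blast
  have 1: "(P + T) o\<^sub>L V = id_blinfun"
  proof -
    have "P o\<^sub>L V = P o\<^sub>L (R - ((R o\<^sub>L T) o\<^sub>L V))" by (simp add: V)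
    also have "\<dots> = (P o\<^sub>L R) - ((P o\<^sub>L R) o\<^sub>L (T o\<^sub>L V))"
      by (simp add: blinfun_compose_diff_right blinfun_compose_assoc)
    finally show ?thesis by (simp add: PR blinfun_compose_add_left)
  qed
  have 2: "W o\<^sub>L (P + T) = id_blinfun"
  proof -
    have "W o\<^sub>L P = (R - (W o\<^sub>L (T o\<^sub>L R))) o\<^sub>L P" by (simp add: W)
    also have "\<dots> = (R o\<^sub>L P) - ((W o\<^sub>L T) o\<^sub>L (R o\<^sub>L P))"
      by (simp add: blinfun_compose_diff_left blinfun_compose_assoc)
    finally show ?thesis by (simp add: RP blinfun_compose_add_right)
  qed
  have "V = W" using 1 2 by (metis blinfun_compose_assoc compose_id_left compose_id_right)
  have "norm V \<le> norm R + (norm R * norm T) * norm V"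
    by (subst V[symmetric]) (rule order_trans[OF norm_triangle_ineq4 add_left_mono[OF lip(1)]])
  then have "norm V * (1 - norm R * norm T) \<le> norm R" by (simp add: algebra_simps)
  then have "norm V \<le> norm R / (1 - norm R * norm T)" using small by (simp add: pos_le_divide_eq)
  moreover have "inverse_op (P + T) V" using 1 2 \<open>V = W\<close> by (simp add: inverse_op_def)
  ultimately show ?thesis using that by blast
qed

lemma resolvent_perturb_point:
  fixes T :: "'a::{cnormed, banach} \<Rightarrow>\<^sub>L 'a"
  assumes "z \<notin> spectrum T" "norm (resolvent T z) * cmod (w - z) < 1"
  shows "w \<notin> spectrum T"
    "norm (resolvent T w) \<le> norm (resolvent T z) / (1 - norm (resolvent T z) * cmod (w - z))"
proof -
  have inv: "inverse_op (T - z *\<^sub>C id_blinfun) (resolvent T z)"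
    using is_resolvent_resolvent[OF assms(1)] by (simp add: is_resolvent_iff)
  have n: "norm ((z - w) *\<^sub>C (id_blinfun :: 'a \<Rightarrow>\<^sub>L 'a)) \<le> cmod (w - z)"
    using norm_blinfun_id_le mult_left_mono[of _ 1 "cmod (z - w)"] by (simp add: norm_scaleC norm_minus_commute)
  have n': "norm (resolvent T z) * norm ((z - w) *\<^sub>C (id_blinfun :: 'a \<Rightarrow>\<^sub>L 'a)) \<le> norm (resolvent T z) * cmod (w - z)"
    by (rule mult_left_mono[OF n]) simp
  obtain V where V: "inverse_op (T - z *\<^sub>C id_blinfun + (z - w) *\<^sub>C id_blinfun) V"
    "norm V \<le> norm (resolvent T z) / (1 - norm (resolvent T z) * norm ((z - w) *\<^sub>C (id_blinfun :: 'a \<Rightarrow>\<^sub>L 'a)))"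
    using inverse_op_perturb[OF inv, of "(z - w) *\<^sub>C id_blinfun"] n' assms(2) by (metis le_less_trans)
  have e: "T - z *\<^sub>C id_blinfun + (z - w) *\<^sub>C id_blinfun = T - w *\<^sub>C id_blinfun"
    by (simp add: scaleC_diff_left)
  have "is_resolvent T w V" using V(1) by (simp only: is_resolvent_iff e)
  then show "w \<notin> spectrum T" by (auto simp: spectrum_def)
  have "norm V \<le> norm (resolvent T z) / (1 - norm (resolvent T z) * cmod (w - z))"
    by (rule order_trans[OF V(2) divide_left_mono]) (use n' assms(2) in auto)
  then show "norm (resolvent T w) \<le> norm (resolvent T z) / (1 - norm (resolvent T z) * cmod (w - z))"
    using resolvent_eqI[OF \<open>is_resolvent T w V\<close>] by simp
qed

lemma resolvent_identity:
  fixes T :: "'a::cnormed \<Rightarrow>\<^sub>L 'a"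
  assumes "clinear_op T" "z \<notin> spectrum T" "w \<notin> spectrum T"
  shows "resolvent T w - resolvent T z = (w - z) *\<^sub>C (resolvent T w o\<^sub>L resolvent T z)"
proof -
  let ?W = "resolvent T w" and ?Z = "resolvent T z"
  have telescope: "(R1 o\<^sub>L (P - Q)) o\<^sub>L R2 = R1 - R2"
    if "P o\<^sub>L R2 = id_blinfun" "R1 o\<^sub>L Q = id_blinfun" for P Q R1 R2 :: "'a \<Rightarrow>\<^sub>L 'a"
  proof -
    have "(R1 o\<^sub>L (P - Q)) o\<^sub>L R2 = (R1 o\<^sub>L (P o\<^sub>L R2)) - ((R1 o\<^sub>L Q) o\<^sub>L R2)"
      by (simp add: blinfun_compose_diff_right blinfun_compose_diff_left blinfun_compose_assoc)
    then show ?thesis by (simp add: that)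
  qed
  have "?W o\<^sub>L ((T - z *\<^sub>C id_blinfun) - (T - w *\<^sub>C id_blinfun)) o\<^sub>L ?Z = ?W - ?Z"
    by (rule telescope)
      (use is_resolvent_resolvent[OF assms(2)] is_resolvent_resolvent[OF assms(3)] in \<open>simp_all add: is_resolvent_def\<close>)
  moreover have "(T - z *\<^sub>C id_blinfun) - (T - w *\<^sub>C id_blinfun) = (w - z) *\<^sub>C id_blinfun"
    by (simp add: scaleC_diff_left)
  ultimately show ?thesis
    by (simp add: blinfun_compose_scaleC_right[OF clinear_op_resolvent[OF assms(1,3)]] blinfun_compose_scaleC_left)
qed

lemma open_resolvent_set: "open (- spectrum (T :: 'a::{cnormed, banach} \<Rightarrow>\<^sub>L 'a))"
proof (rule openI)
  fix z assume z: "z \<in> - spectrum T"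
  define e where "e = 1 / (norm (resolvent T z) + 1)"
  have "e > 0" by (simp add: e_def add_nonneg_pos)
  moreover have "w \<in> - spectrum T" if "w \<in> ball z e" for w
  proof -
    have "cmod (w - z) < e" using that by (simp add: dist_norm norm_minus_commute)
    then have "cmod (w - z) * (norm (resolvent T z) + 1) < 1"
      by (simp add: e_def pos_less_divide_eq add_nonneg_pos)
    then have "norm (resolvent T z) * cmod (w - z) < 1"
      by (simp add: algebra_simps) (smt (verit) norm_ge_zero)
    then show ?thesis using resolvent_perturb_point(1) z by blast
  qed
  ultimately show "\<exists>e>0. ball z e \<subseteq> - spectrum T" by blast
qed

lemma isCont_resolvent:
  fixes T :: "'a::{cnormed, banach} \<Rightarrow>\<^sub>L 'a"
  assumes "clinear_op T" "z \<notin> spectrum T"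
  shows "isCont (resolvent T) z"
proof -
  let ?n = "norm (resolvent T z)"
  define e where "e = 1 / (2 * (?n + 1))"
  have e: "e > 0" by (simp add: e_def add_nonneg_pos)
  have key: "w \<notin> spectrum T \<and> norm (resolvent T w - resolvent T z) \<le> cmod (w - z) * (2 * ?n * ?n)"
    if "cmod (w - z) < e" for w
  proof -
    have "cmod (w - z) * (2 * (?n + 1)) < 1"
      using that by (simp add: e_def pos_less_divide_eq add_nonneg_pos)
    then have h: "?n * cmod (w - z) < 1/2"
      by (simp add: algebra_simps) (smt (verit) norm_ge_zero)
    then have w: "w \<notin> spectrum T" using resolvent_perturb_point(1)[OF assms(2)] by force
    have "norm (resolvent T w) \<le> ?n / (1 - ?n * cmod (w - z))"
      using resolvent_perturb_point(2)[OF assms(2)] h by force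
    also have "\<dots> \<le> ?n / (1/2)" by (rule divide_left_mono) (use h in auto)
    finally have "norm (resolvent T w) \<le> 2 * ?n" by simp
    then have "norm (resolvent T w o\<^sub>L resolvent T z) \<le> 2 * ?n * ?n"
      by (meson mult_right_mono norm_blinfun_compose norm_ge_zero order_trans)
    then show ?thesis
      using w by (simp add: resolvent_identity[OF assms w] norm_scaleC mult_left_mono)
  qed
  have "((\<lambda>w. cmod (w - z) * (2 * ?n * ?n)) \<longlongrightarrow> cmod (z - z) * (2 * ?n * ?n)) (at z)"
    by (intro tendsto_intros)
  then have "((\<lambda>w. resolvent T w - resolvent T z) \<longlongrightarrow> 0) (at z)"
    by (rule_tac Lim_null_comparison[of _ "\<lambda>w. cmod (w - z) * (2 * ?n * ?n)"])
      (use key e in \<open>auto simp: eventually_at dist_norm\<close>)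
  then show ?thesis by (simp add: isCont_def LIM_zero_iff)
qed

subsection \<open>The resolvent of a self-adjoint operator\<close>

text \<open>Let \<open>m = norm T\<close>. If both \<open>T - m\<close> and \<open>T + m\<close> were invertible, then so would be their product
  \<open>T\<^sup>2 - m\<^sup>2\<close>. Since \<open>(norm ((T\<^sup>2 - m\<^sup>2) x))\<^sup>2 \<le> m\<^sup>2 (m\<^sup>2 (norm x)\<^sup>2 - (norm (T x))\<^sup>2)\<close> by self-adjointness, this would
  bound \<open>norm (T x)\<close> by a multiple of \<open>norm x\<close> with a factor less than \<open>m\<close>.\<close>

lemma selfadjoint_norm_attained:
  fixes T :: "'a::chilbert \<Rightarrow>\<^sub>L 'a"
  assumes sa: "selfadjoint T" and nz: "norm T \<noteq> 0"
  shows "of_real (norm T) \<in> spectrum T \<or> - of_real (norm T) \<in> spectrum T"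
proof (rule ccontr)
  define m where "m = norm T"
  have m: "m > 0" using nz by (simp add: m_def)
  have cl: "clinear_op T" using sa by (simp add: selfadjoint_def)
  assume "\<not> ?thesis"
  then have r: "of_real m \<notin> spectrum T" "- of_real m \<notin> spectrum T" by (auto simp: m_def)
  define S where "S = resolvent T (- of_real m) o\<^sub>L resolvent T (of_real m)"
  have S: "blinfun_apply S (blinfun_apply T (blinfun_apply T x) - of_real (m\<^sup>2) *\<^sub>C x) = x" for x
  proof -
    let ?y = "blinfun_apply T x - (- of_real m) *\<^sub>C x"
    have "blinfun_apply T (blinfun_apply T x) - of_real (m\<^sup>2) *\<^sub>C x = blinfun_apply T ?y - of_real m *\<^sub>C ?y"
      using cl by (simp add: blinfun.diff_right blinfun.add_right clinear_op_def scaleC_minus_left scaleC_diff_right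
          scaleC_add_right scaleC_scaleC power2_eq_square blinfun.minus_right scaleC_minus_right)
    then show ?thesis unfolding S_def using resolvent_apply(1)[OF r(1), of ?y] resolvent_apply(1)[OF r(2), of x]
      by simp
  qed
  have low: "(norm x)\<^sup>2 \<le> (norm S)\<^sup>2 * (m\<^sup>2 * (m\<^sup>2 * (norm x)\<^sup>2 - (norm (blinfun_apply T x))\<^sup>2))" for x
  proof -
    let ?TT = "blinfun_apply T (blinfun_apply T x)"
    have "norm x \<le> norm S * norm (?TT - of_real (m\<^sup>2) *\<^sub>C x)"
      by (metis S norm_blinfun)
    then have 1: "(norm x)\<^sup>2 \<le> (norm S)\<^sup>2 * (norm (?TT - of_real (m\<^sup>2) *\<^sub>C x))\<^sup>2"
      by (metis norm_ge_zero power_mono power_mult_distrib)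
    have c: "Re (cinner ?TT x) = (norm (blinfun_apply T x))\<^sup>2"
      using sa by (simp add: selfadjoint_def cinner_self)
    have "(norm (?TT - of_real (m\<^sup>2) *\<^sub>C x))\<^sup>2
        = (norm ?TT)\<^sup>2 - 2 * m\<^sup>2 * (norm (blinfun_apply T x))\<^sup>2 + (m\<^sup>2)\<^sup>2 * (norm x)\<^sup>2"
      using c by (simp add: norm_diff_sq cinner_scaleC_right norm_scaleC power_mult_distrib norm_power del: of_real_power)
    moreover have "(norm ?TT)\<^sup>2 \<le> m\<^sup>2 * (norm (blinfun_apply T x))\<^sup>2"
      by (metis m_def norm_blinfun norm_ge_zero power_mono power_mult_distrib)
    ultimately have "(norm (?TT - of_real (m\<^sup>2) *\<^sub>C x))\<^sup>2 \<le> m\<^sup>2 * (m\<^sup>2 * (norm x)\<^sup>2 - (norm (blinfun_apply T x))\<^sup>2)"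
      by (simp add: algebra_simps power2_eq_square)
    then show ?thesis using 1 by (meson mult_left_mono order_trans zero_le_power2)
  qed
  define q where "q = (norm S)\<^sup>2 * m\<^sup>2"
  have q: "q \<ge> 0" by (simp add: q_def)
  define k where "k = m\<^sup>2 - 1 / (q + 1)"
  have "norm T \<le> sqrt (max 0 k)"
  proof (rule norm_blinfun_bound)
    fix x
    have "(norm x)\<^sup>2 \<le> (q + 1) * (m\<^sup>2 * (norm x)\<^sup>2 - (norm (blinfun_apply T x))\<^sup>2)"
    proof -
      have "norm (blinfun_apply T x) \<le> m * norm x" by (simp add: m_def norm_blinfun)
      then have "(norm (blinfun_apply T x))\<^sup>2 \<le> m\<^sup>2 * (norm x)\<^sup>2"
        by (metis norm_ge_zero power_mono power_mult_distrib)
      then show ?thesis using low[of x] by (simp add: q_def algebra_simps)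
    qed
    then have "(norm (blinfun_apply T x))\<^sup>2 \<le> k * (norm x)\<^sup>2"
      using q by (simp add: k_def field_simps)
    also have "\<dots> \<le> max 0 k * (norm x)\<^sup>2" by (simp add: mult_right_mono)
    finally have "(norm (blinfun_apply T x))\<^sup>2 \<le> (sqrt (max 0 k) * norm x)\<^sup>2"
      by (simp add: power_mult_distrib)
    then show "norm (blinfun_apply T x) \<le> sqrt (max 0 k) * norm x"
      by (rule power2_le_imp_le) simp
  qed simp
  also have "sqrt (max 0 k) < m"
  proof -
    have "max 0 k < m\<^sup>2" using m q by (auto simp: k_def)
    then show ?thesis using m by (metis real_sqrt_abs real_sqrt_less_mono abs_of_pos)
  qed
  finally show False by (simp add: m_def)
qed

lemma resolvent_selfadjoint_real:
  assumes sa: "selfadjoint A" and l: "of_real l \<notin> spectrum A"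
  shows "selfadjoint (resolvent A (of_real l))"
proof -
  have cl: "clinear_op A" using sa by (simp add: selfadjoint_def)
  let ?R = "resolvent A (of_real l)"
  have "cinner (blinfun_apply ?R x) y = cinner x (blinfun_apply ?R y)" for x y
  proof -
    let ?u = "blinfun_apply ?R x" and ?v = "blinfun_apply ?R y"
    have "cinner ?u y = cinner ?u (blinfun_apply A ?v - of_real l *\<^sub>C ?v)"
      by (simp add: resolvent_apply(2)[OF l])
    also have "\<dots> = cinner (blinfun_apply A ?u - of_real l *\<^sub>C ?u) ?v"
      using sa by (simp add: cinner_diff_left cinner_diff_right selfadjoint_def cinner_scaleC_left cinner_scaleC_right)
    finally show ?thesis by (simp add: resolvent_apply(2)[OF l])
  qed
  then show ?thesis using clinear_op_resolvent[OF cl l] by (simp add: selfadjoint_def)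
qed

text \<open>For \<open>R = (A - l)\<inverse>\<close> and \<open>k \<noteq> 0\<close>, the factorization \<open>A - (l + 1 / k) = - (1 / k) (A - l) (R - k)\<close> sends
  a point \<open>k\<close> of the spectrum of \<open>R\<close> to the point \<open>l + 1 / k\<close> of the spectrum of \<open>A\<close>; it is applied
  to \<open>k = \<plusminus> norm R\<close>.\<close>

lemma spectrum_point_near:
  assumes sa: "selfadjoint A" and l: "complex_of_real l \<notin> spectrum A" and nz: "norm (resolvent A (of_real l)) \<noteq> 0"
  shows "\<exists>a. complex_of_real a \<in> spectrum A \<and> \<bar>a - l\<bar> = 1 / norm (resolvent A (of_real l))"
proof -
  let ?T = "resolvent A (of_real l)"
  have cl: "clinear_op A" using sa by (simp add: selfadjoint_def)
  have clT: "clinear_op ?T" by (rule clinear_op_resolvent[OF cl l])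
  have pt: "complex_of_real (l + 1 / k) \<in> spectrum A" if k: "complex_of_real k \<in> spectrum ?T" "k \<noteq> 0" for k
  proof (rule ccontr)
    assume n: "complex_of_real (l + 1 / k) \<notin> spectrum A"
    let ?z = "complex_of_real (l + 1 / k)"
    let ?V = "- (of_real (1 / k)) *\<^sub>C (resolvent A ?z o\<^sub>L (A - of_real l *\<^sub>C id_blinfun))"
    have comm: "blinfun_apply (resolvent A ?z) (blinfun_apply A x - of_real l *\<^sub>C x)
       = x + of_real (1/k) *\<^sub>C blinfun_apply (resolvent A ?z) x" for x
    proof -
      have "blinfun_apply A x - of_real l *\<^sub>C x = (blinfun_apply A x - ?z *\<^sub>C x) + of_real (1/k) *\<^sub>C x"
        by (simp add: scaleC_add_left)
      then show ?thesis using clinear_op_resolvent[OF cl n]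
        by (simp only: blinfun.add_right resolvent_apply(1)[OF n] blinfun_apply_clinear)
    qed
    have comm2: "blinfun_apply A (blinfun_apply (resolvent A ?z) x) - of_real l *\<^sub>C blinfun_apply (resolvent A ?z) x
       = x + of_real (1/k) *\<^sub>C blinfun_apply (resolvent A ?z) x" for x
    proof -
      have "blinfun_apply A (blinfun_apply (resolvent A ?z) x) - of_real l *\<^sub>C blinfun_apply (resolvent A ?z) x
        = (blinfun_apply A (blinfun_apply (resolvent A ?z) x) - ?z *\<^sub>C blinfun_apply (resolvent A ?z) x)
           + of_real (1/k) *\<^sub>C blinfun_apply (resolvent A ?z) x"
        by (simp add: scaleC_add_left)
      then show ?thesis by (simp only: resolvent_apply(2)[OF n])
    qed
    have a1: "?V o\<^sub>L (?T - of_real k *\<^sub>C id_blinfun) = id_blinfun"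
    proof (rule blinfun_eqI)
      fix x
      let ?y = "blinfun_apply ?T x"
      have "blinfun_apply A (?y - of_real k *\<^sub>C x) - of_real l *\<^sub>C (?y - of_real k *\<^sub>C x)
          = - of_real k *\<^sub>C (blinfun_apply A x - ?z *\<^sub>C x)"
        using k(2) resolvent_apply(2)[OF l, of x]
        by (simp add: blinfun.diff_right blinfun_apply_clinear[OF cl] scaleC_diff_right scaleC_scaleC
            scaleC_minus_left algebra_simps scaleC_add_left scaleC_minus_right)
          (simp add: scaleC_add_right scaleC_scaleC)
      then show "blinfun_apply (?V o\<^sub>L (?T - of_real k *\<^sub>C id_blinfun)) x = blinfun_apply id_blinfun x"
        using k(2) clinear_op_resolvent[OF cl n] resolvent_apply(1)[OF n, of x]
        by (simp add: scaleC_blinfun_apply blinfun.diff_left blinfun_apply_clinear scaleC_scaleC)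
    qed
    have a2: "(?T - of_real k *\<^sub>C id_blinfun) o\<^sub>L ?V = id_blinfun"
    proof (rule blinfun_eqI)
      fix x
      let ?w = "blinfun_apply (resolvent A ?z) x"
      have Vx: "blinfun_apply ?V x = - (of_real (1/k)) *\<^sub>C (blinfun_apply A ?w - of_real l *\<^sub>C ?w)"
        by (simp only: scaleC_blinfun_apply blinfun_apply_blinfun_compose blinfun.diff_left
            blinfun_apply_id_blinfun id_apply comm comm2)
      have "blinfun_apply ?T (blinfun_apply ?V x) = - (of_real (1/k)) *\<^sub>C ?w"
        by (simp only: Vx blinfun_apply_clinear[OF clT] resolvent_apply(1)[OF l])
      moreover have "of_real k *\<^sub>C blinfun_apply ?V x = - (x + of_real (1/k) *\<^sub>C ?w)"
        unfolding Vx comm2 using k(2) by (simp add: scaleC_scaleC scaleC_minus_left scaleC_minus_right)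
      ultimately show "blinfun_apply ((?T - of_real k *\<^sub>C id_blinfun) o\<^sub>L ?V) x = blinfun_apply id_blinfun x"
        by (simp add: blinfun.diff_left scaleC_blinfun_apply scaleC_minus_left)
    qed
    show False using k(1) a1 a2 by (auto simp: spectrum_def is_resolvent_def)
  qed
  from selfadjoint_norm_attained[OF resolvent_selfadjoint_real[OF sa l] nz]
  show ?thesis
  proof
    assume "complex_of_real (norm ?T) \<in> spectrum ?T"
    then show ?thesis using pt[of "norm ?T"] nz by (intro exI[of _ "l + 1 / norm ?T"]) auto
  next
    assume "- complex_of_real (norm ?T) \<in> spectrum ?T"
    then show ?thesis using pt[of "- norm ?T"] nz by (intro exI[of _ "l + 1 / (- norm ?T)"]) auto
  qed
qed

text \<open>Self-adjointness splits \<open>(norm ((A - z) x))\<^sup>2\<close> into \<open>(norm ((A - Re z) x))\<^sup>2\<close> and \<open>(Im z)\<^sup>2 (norm x)\<^sup>2\<close>.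
  Unless \<open>Re z\<close> lies in the spectrum, the first part is estimated by a point of the spectrum whose
  distance from \<open>Re z\<close> is the reciprocal norm of the resolvent at \<open>Re z\<close>. This replaces the functional calculus in the
  estimate of the resolvent by the distance to the spectrum.\<close>

lemma selfadjoint_bounded_below:
  assumes sa: "selfadjoint A" and real: "spectrum A \<subseteq> \<real>" and dist: "\<And>a. a \<in> spectrum A \<Longrightarrow> d \<le> cmod (z - a)"
    and d: "d \<ge> 0"
  shows "d * norm x \<le> norm (blinfun_apply A x - z *\<^sub>C x)"
proof -
  define l where "l = Re z"
  have split: "(norm (blinfun_apply A x - z *\<^sub>C x))\<^sup>2 = (norm (blinfun_apply A x - of_real l *\<^sub>C x))\<^sup>2 + (Im z)\<^sup>2 * (norm x)\<^sup>2"
  proof -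
    let ?y = "blinfun_apply A x - of_real l *\<^sub>C x"
    have "z *\<^sub>C x = of_real l *\<^sub>C x + (\<i> * of_real (Im z)) *\<^sub>C x"
      using complex_eq[of z] by (simp add: l_def scaleC_add_left[symmetric])
    then have e: "blinfun_apply A x - z *\<^sub>C x = ?y - (\<i> * of_real (Im z)) *\<^sub>C x" by simp
    have "cinner ?y x = cinner x ?y"
      using sa by (simp add: cinner_diff_left cinner_diff_right selfadjoint_def cinner_scaleC_left cinner_scaleC_right)
    then have "Im (cinner ?y x) = 0"
      by (metis Reals_cnj_iff cinner_commute complex_is_Real_iff)
    then have "Re (cinner ?y ((\<i> * of_real (Im z)) *\<^sub>C x)) = 0"
      by (simp add: cinner_scaleC_right)
    then show ?thesis unfolding e norm_diff_sq by (simp add: norm_scaleC norm_mult power_mult_distrib)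
  qed
  show ?thesis
  proof (cases "norm x = 0")
    case False
    have low: "\<exists>e\<ge>0. d\<^sup>2 \<le> e\<^sup>2 + (Im z)\<^sup>2 \<and> e * norm x \<le> norm (blinfun_apply A x - of_real l *\<^sub>C x)"
    proof (cases "complex_of_real l \<in> spectrum A")
      case True
      have "d \<le> cmod (z - of_real l)" by (rule dist[OF True])
      also have "\<dots> = \<bar>Im z\<bar>" by (simp add: l_def cmod_def)
      finally have "d\<^sup>2 \<le> \<bar>Im z\<bar>\<^sup>2" by (rule power_mono[OF _ d])
      then show ?thesis by (intro exI[of _ 0]) auto
    next
      case l: False
      let ?R = "resolvent A (of_real l)"
      have "x = blinfun_apply ?R (blinfun_apply A x - of_real l *\<^sub>C x)" using resolvent_apply(1)[OF l] by simp
      then have xle: "norm x \<le> norm ?R * norm (blinfun_apply A x - of_real l *\<^sub>C x)" by (metis norm_blinfun)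
      with False have nz: "norm ?R \<noteq> 0" by force
      then obtain a where a: "complex_of_real a \<in> spectrum A" "\<bar>a - l\<bar> = 1 / norm ?R"
        using spectrum_point_near[OF sa l] by blast
      have "d\<^sup>2 \<le> (cmod (z - of_real a))\<^sup>2" by (rule power_mono[OF dist[OF a(1)] d])
      also have "\<dots> = (a - l)\<^sup>2 + (Im z)\<^sup>2" by (simp add: cmod_power2 l_def power2_commute)
      also have "(a - l)\<^sup>2 = (1 / norm ?R)\<^sup>2" by (metis a(2) power2_abs)
      finally show ?thesis using xle nz by (intro exI[of _ "1 / norm ?R"]) (auto simp: divide_le_eq mult.commute)
    qed
    then obtain e where e: "e \<ge> 0" "d\<^sup>2 \<le> e\<^sup>2 + (Im z)\<^sup>2" "e * norm x \<le> norm (blinfun_apply A x - of_real l *\<^sub>C x)" by blast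
    have "(d * norm x)\<^sup>2 \<le> (e * norm x)\<^sup>2 + (Im z)\<^sup>2 * (norm x)\<^sup>2"
      using mult_right_mono[OF e(2), of "(norm x)\<^sup>2"] by (simp add: power_mult_distrib distrib_right)
    also have "\<dots> \<le> (norm (blinfun_apply A x - z *\<^sub>C x))\<^sup>2"
      unfolding split using e by (simp add: power_mono)
    finally show ?thesis by (rule power2_le_imp_le) simp
  qed simp
qed

lemma resolvent_bound_selfadjoint:
  assumes sa: "selfadjoint A" and real: "spectrum A \<subseteq> \<real>" and dist: "\<And>a. a \<in> spectrum A \<Longrightarrow> d \<le> cmod (z - a)"
    and d: "d > 0"
  shows "z \<notin> spectrum A" "norm (resolvent A z) \<le> 1 / d"
proof -
  show z: "z \<notin> spectrum A" using dist[of z] d by auto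
  show "norm (resolvent A z) \<le> 1 / d"
  proof (rule norm_blinfun_bound)
    fix x
    have "d * norm (blinfun_apply (resolvent A z) x) \<le> norm x"
      using selfadjoint_bounded_below[OF sa real dist, where x = "blinfun_apply (resolvent A z) x"] d
      by (simp add: resolvent_apply(2)[OF z])
    then show "norm (blinfun_apply (resolvent A z) x) \<le> 1 / d * norm x" using d by (simp add: field_simps)
  qed (use d in simp)
qed

text \<open>The form in which perturbed resolvents are estimated along a contour.\<close>

lemma resolvent_bound_perturbed:
  assumes sa: "selfadjoint A" and real: "spectrum A \<subseteq> \<real>" and dist: "\<And>a. a \<in> spectrum A \<Longrightarrow> d \<le> cmod (z - a)"
    and T: "norm T < d"
  shows "z \<notin> spectrum (A + T)" "norm (resolvent (A + T) z) \<le> 1 / (d - norm T)"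
proof -
  have d: "d > 0" using T norm_ge_zero[of T] by linarith
  note R = resolvent_bound_selfadjoint[OF sa real dist d]
  let ?R = "resolvent A z"
  have "norm ?R * norm T \<le> 1 / d * norm T" by (rule mult_right_mono[OF R(2)]) (auto)
  also have "\<dots> < 1" using T d by (simp)
  finally have small: "norm ?R * norm T < 1" .
  have inv: "inverse_op (A - z *\<^sub>C id_blinfun) ?R"
    using is_resolvent_resolvent[OF R(1)] by (simp add: is_resolvent_iff)
  obtain V where V: "inverse_op (A - z *\<^sub>C id_blinfun + T) V" "norm V \<le> norm ?R / (1 - norm ?R * norm T)"
    using inverse_op_perturb[OF inv small] by blast
  have "is_resolvent (A + T) z V" using V(1) by (simp add: is_resolvent_iff algebra_simps)
  moreover have "norm ?R / (1 - norm ?R * norm T) \<le> 1 / (d - norm T)"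
  proof -
    have "norm ?R * d \<le> 1" using R(2) d by (simp add: pos_le_divide_eq)
    then show ?thesis using small T by (simp add: divide_simps) (simp add: algebra_simps)
  qed
  ultimately show "z \<notin> spectrum (A + T)" "norm (resolvent (A + T) z) \<le> 1 / (d - norm T)"
    using V(2) by (auto simp: spectrum_def resolvent_eqI)
qed

section \<open>Strong measurability\<close>

lemma strongly_measurable_tendsto:
  assumes "\<And>n::nat. simple_function M (s n)" "\<And>x. x \<in> space M \<Longrightarrow> (\<lambda>n. s n x) \<longlonglongrightarrow> f x"
  shows "strongly_measurable M f"
  unfolding strongly_measurable_def using assms by blast

lemma strongly_measurable_cong:
  assumes "strongly_measurable M f" "\<And>x. x \<in> space M \<Longrightarrow> f x = g x"
  shows "strongly_measurable M g"
  using assms unfolding strongly_measurable_def by metis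

lemma strongly_measurable_const: "strongly_measurable M (\<lambda>x. c)"
  by (rule strongly_measurable_tendsto[where s = "\<lambda>n x. c"]) auto

lemma strongly_measurable_isCont:
  assumes "strongly_measurable M f" "\<And>x. x \<in> space M \<Longrightarrow> isCont h (f x)"
  shows "strongly_measurable M (\<lambda>x. h (f x))"
proof -
  obtain s where s: "\<And>n::nat. simple_function M (s n)" "\<And>x. x \<in> space M \<Longrightarrow> (\<lambda>n. s n x) \<longlonglongrightarrow> f x"
    using assms(1) unfolding strongly_measurable_def by blast
  show ?thesis
    by (rule strongly_measurable_tendsto[where s = "\<lambda>n x. h (s n x)"])
      (auto intro: simple_function_compose1 s isCont_tendsto_compose assms(2))
qed

lemma strongly_measurable_tendsto2:
  assumes "strongly_measurable M f" "strongly_measurable M g"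
    and "\<And>u v a b. u \<longlonglongrightarrow> a \<Longrightarrow> v \<longlonglongrightarrow> b \<Longrightarrow> (\<lambda>n. h (u n) (v n)) \<longlonglongrightarrow> h a b"
  shows "strongly_measurable M (\<lambda>x. h (f x) (g x))"
proof -
  obtain s t where s: "\<And>n::nat. simple_function M (s n)" "\<And>x. x \<in> space M \<Longrightarrow> (\<lambda>n. s n x) \<longlonglongrightarrow> f x"
    and t: "\<And>n::nat. simple_function M (t n)" "\<And>x. x \<in> space M \<Longrightarrow> (\<lambda>n. t n x) \<longlonglongrightarrow> g x"
    using assms(1,2) unfolding strongly_measurable_def by blast
  show ?thesis
    by (rule strongly_measurable_tendsto[where s = "\<lambda>n x. h (s n x) (t n x)"])
      (auto intro: simple_function_compose2 s t assms(3))
qed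

lemma strongly_measurable_bilinear:
  assumes "bounded_bilinear h" "strongly_measurable M f" "strongly_measurable M g"
  shows "strongly_measurable M (\<lambda>x. h (f x) (g x))"
  by (rule strongly_measurable_tendsto2[OF assms(2,3)]) (rule bounded_bilinear.tendsto[OF assms(1)])

lemma strongly_measurable_add:
  "strongly_measurable M f \<Longrightarrow> strongly_measurable M g
    \<Longrightarrow> strongly_measurable M (\<lambda>x. f x + g x :: 'a::real_normed_vector)"
  by (rule strongly_measurable_tendsto2[of M f g "(+)"]) (auto intro: tendsto_add)

lemma strongly_measurable_diff:
  "strongly_measurable M f \<Longrightarrow> strongly_measurable M g
    \<Longrightarrow> strongly_measurable M (\<lambda>x. f x - g x :: 'a::real_normed_vector)"
  by (rule strongly_measurable_tendsto2[of M f g "(-)"]) (auto intro: tendsto_diff)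

lemma strongly_measurable_apply:
  "strongly_measurable M F \<Longrightarrow> strongly_measurable M f
    \<Longrightarrow> strongly_measurable M (\<lambda>x. blinfun_apply (F x) (f x))"
  by (rule strongly_measurable_bilinear[OF bounded_bilinear_blinfun_apply])

lemma strongly_measurable_compose:
  "strongly_measurable M F \<Longrightarrow> strongly_measurable M G \<Longrightarrow> strongly_measurable M (\<lambda>x. F x o\<^sub>L G x)"
  by (rule strongly_measurable_bilinear[OF bounded_bilinear_blinfun_compose])

lemma strongly_measurable_scaleC:
  "strongly_measurable M a \<Longrightarrow> strongly_measurable M f
    \<Longrightarrow> strongly_measurable M (\<lambda>x. a x *\<^sub>C (f x :: 'a::cnormed))"
  by (rule strongly_measurable_bilinear[OF bounded_bilinear_scaleC])

lemma strongly_measurable_norm: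
  "strongly_measurable M f \<Longrightarrow> strongly_measurable M (\<lambda>x. norm (f x :: 'a::real_normed_vector))"
  by (rule strongly_measurable_isCont) auto

lemma strongly_measurable_cinner:
  "strongly_measurable M f \<Longrightarrow> strongly_measurable M g
    \<Longrightarrow> strongly_measurable M (\<lambda>x. cinner (f x) (g x :: 'a::chilbert))"
  by (rule strongly_measurable_bilinear[OF bounded_bilinear_cinner])

lemma borel_measurable_strongly:
  fixes f :: "'p \<Rightarrow> 'a::metric_space"
  assumes "strongly_measurable M f" shows "f \<in> borel_measurable M"
proof -
  obtain s where s: "\<And>n::nat. simple_function M (s n)" "\<And>x. x \<in> space M \<Longrightarrow> (\<lambda>n. s n x) \<longlonglongrightarrow> f x"
    using assms unfolding strongly_measurable_def by blast
  show ?thesis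
    by (rule borel_measurable_LIMSEQ_metric[of s]) (auto intro: borel_measurable_simple_function s)
qed

lemma strongly_measurable_borel:
  fixes f :: "'p \<Rightarrow> 'a::{metric_space, second_countable_topology}"
  assumes "f \<in> borel_measurable M" shows "strongly_measurable M f"
proof -
  obtain s where "\<And>i. simple_function M (s i)" "\<And>x. x \<in> space M \<Longrightarrow> (\<lambda>i. s i x) \<longlonglongrightarrow> f x"
    using borel_measurable_implies_sequence_metric[OF assms, of undefined] by metis
  then show ?thesis by (rule strongly_measurable_tendsto)
qed

lemma borel_measurable_norm_strongly:
  "strongly_measurable M f \<Longrightarrow> (\<lambda>x. norm (f x :: 'a::real_normed_vector)) \<in> borel_measurable M"
  by (intro borel_measurable_strongly strongly_measurable_norm)

section \<open>The space of square integrable functions\<close>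

lemma LINT_norm_le:
  fixes f :: "'p \<Rightarrow> 'a::{banach, second_countable_topology}"
  assumes "integrable M f" "integrable M g" "\<And>x. x \<in> space M \<Longrightarrow> norm (f x) \<le> g x"
  shows "norm (LINT x|M. f x) \<le> (LINT x|M. g x)"
  by (rule order_trans[OF integral_norm_bound integral_mono]) (use assms in auto)

lemma integral_Cauchy_Schwarz:
  fixes u v :: "'p \<Rightarrow> real"
  assumes [measurable]: "u \<in> borel_measurable M" "v \<in> borel_measurable M"
    and u: "integrable M (\<lambda>x. (u x)\<^sup>2)" and v: "integrable M (\<lambda>x. (v x)\<^sup>2)"
  shows "integrable M (\<lambda>x. u x * v x)"
    and "\<bar>LINT x|M. u x * v x\<bar> \<le> sqrt (LINT x|M. (u x)\<^sup>2) * sqrt (LINT x|M. (v x)\<^sup>2)"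
proof -
  show i: "integrable M (\<lambda>x. u x * v x)"
  proof (rule Bochner_Integration.integrable_bound)
    show "integrable M (\<lambda>x. (u x)\<^sup>2 + (v x)\<^sup>2)" using u v by simp
    have "\<bar>a * b\<bar> \<le> \<bar>a\<^sup>2 + b\<^sup>2\<bar>" for a b :: real
    proof -
      have "0 \<le> (\<bar>a\<bar> - \<bar>b\<bar>)\<^sup>2" by simp
      then have "2 * \<bar>a * b\<bar> \<le> a\<^sup>2 + b\<^sup>2" by (simp add: power2_diff abs_mult)
      then show ?thesis by linarith
    qed
    then show "AE x in M. norm (u x * v x) \<le> norm ((u x)\<^sup>2 + (v x)\<^sup>2)" by simp
  qed measurable
  define a b c where "a = (LINT x|M. (u x)\<^sup>2)" and "b = (LINT x|M. u x * v x)" and "c = (LINT x|M. (v x)\<^sup>2)"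
  have ac: "a \<ge> 0" "c \<ge> 0" by (auto simp: a_def c_def intro!: integral_nonneg_AE)
  have disc: "0 \<le> a - 2 * t * b + t\<^sup>2 * c" for t
  proof -
    have "0 \<le> (LINT x|M. (u x - t * v x)\<^sup>2)" by (intro integral_nonneg_AE) auto
    also have "(\<lambda>x. (u x - t * v x)\<^sup>2) = (\<lambda>x. (u x)\<^sup>2 - 2 * t * (u x * v x) + t\<^sup>2 * (v x)\<^sup>2)"
      by (auto simp: power2_eq_square algebra_simps)
    also have "(LINT x|M. (u x)\<^sup>2 - 2 * t * (u x * v x) + t\<^sup>2 * (v x)\<^sup>2) = a - 2 * t * b + t\<^sup>2 * c"
      using i u v by (simp add: a_def b_def c_def)
    finally show ?thesis .
  qed
  have "b\<^sup>2 \<le> a * c"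
  proof (cases "c = 0")
    case True
    have "b = 0"
    proof (rule ccontr)
      assume "b \<noteq> 0"
      then show False using disc[of "(a + 1) / (2 * b)"] True by simp
    qed
    then show ?thesis using True by simp
  next
    case False
    then show ?thesis using disc[of "b / c"] ac by (simp add: field_simps power2_eq_square)
  qed
  then have "\<bar>b\<bar> \<le> sqrt (a * c)" by (metis real_sqrt_abs real_sqrt_le_mono)
  then show "\<bar>LINT x|M. u x * v x\<bar> \<le> sqrt (LINT x|M. (u x)\<^sup>2) * sqrt (LINT x|M. (v x)\<^sup>2)"
    by (simp add: a_def b_def c_def real_sqrt_mult)
qed

lemma L2_funD:
  assumes "f \<in> L2_fun M"
  shows "strongly_measurable M f" "integrable M (\<lambda>x. (norm (f x))\<^sup>2)"
  using assms by (auto simp: L2_fun_def)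

lemma L2_fun_dominated:
  assumes sm: "strongly_measurable M g" and f: "integrable M f"
    and le: "\<And>x. x \<in> space M \<Longrightarrow> (norm (g x))\<^sup>2 \<le> f x"
  shows "g \<in> L2_fun M"
proof -
  have "integrable M (\<lambda>x. (norm (g x))\<^sup>2)"
  proof (rule Bochner_Integration.integrable_bound[OF f])
    show "(\<lambda>x. (norm (g x))\<^sup>2) \<in> borel_measurable M"
      using borel_measurable_norm_strongly[OF sm] by measurable
    show "AE x in M. norm ((norm (g x))\<^sup>2) \<le> norm (f x)" using le by (intro AE_I2) force
  qed
  then show ?thesis using sm by (simp add: L2_fun_def)
qed

lemma L2_fun_0: "(\<lambda>x. 0) \<in> L2_fun M"
  by (simp add: L2_fun_def strongly_measurable_const)

lemma L2_fun_add:
  assumes "f \<in> L2_fun M" "g \<in> L2_fun M" shows "(\<lambda>x. f x + g x) \<in> L2_fun M"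
proof (rule L2_fun_dominated)
  show "integrable M (\<lambda>x. 2 * (norm (f x))\<^sup>2 + 2 * (norm (g x))\<^sup>2)"
    using L2_funD[OF assms(1)] L2_funD[OF assms(2)] by simp
  show "strongly_measurable M (\<lambda>x. f x + g x)"
    using L2_funD[OF assms(1)] L2_funD[OF assms(2)] by (simp add: strongly_measurable_add)
  show "(norm (f x + g x))\<^sup>2 \<le> 2 * (norm (f x))\<^sup>2 + 2 * (norm (g x))\<^sup>2" for x
    using parallelogram[of "f x" "g x"] zero_le_power2[of "norm (f x - g x)"] by linarith
qed

lemma L2_fun_scaleC_bounded:
  assumes a: "strongly_measurable M a" and f: "f \<in> L2_fun M" and K: "\<And>x. x \<in> space M \<Longrightarrow> cmod (a x) \<le> K"
  shows "(\<lambda>x. a x *\<^sub>C f x) \<in> L2_fun M"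
proof (rule L2_fun_dominated)
  show "integrable M (\<lambda>x. K\<^sup>2 * (norm (f x))\<^sup>2)" using L2_funD[OF f] by simp
  show "strongly_measurable M (\<lambda>x. a x *\<^sub>C f x)" using L2_funD[OF f] a by (simp add: strongly_measurable_scaleC)
  show "(norm (a x *\<^sub>C f x))\<^sup>2 \<le> K\<^sup>2 * (norm (f x))\<^sup>2" if "x \<in> space M" for x
    using K[OF that] by (simp add: norm_scaleC power_mult_distrib mult_right_mono power_mono)
qed

lemma L2_fun_scaleC: "f \<in> L2_fun M \<Longrightarrow> (\<lambda>x. a *\<^sub>C f x) \<in> L2_fun M"
  by (rule L2_fun_scaleC_bounded[where K = "cmod a"]) (auto simp: strongly_measurable_const)

lemma strongly_measurable_indicator:
  assumes "\<delta> \<inter> space M \<in> sets M"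
  shows "strongly_measurable M (\<lambda>x. complex_of_real (indicat_real \<delta> x))"
proof (rule strongly_measurable_borel)
  have "(\<lambda>x. complex_of_real (indicat_real (\<delta> \<inter> space M) x)) \<in> borel_measurable M"
    using assms by measurable
  then show "(\<lambda>x. complex_of_real (indicat_real \<delta> x)) \<in> borel_measurable M"
    by (rule measurable_cong[THEN iffD1, rotated]) (auto simp: indicator_def)
qed

lemma L2_fun_indicator:
  assumes "\<delta> \<inter> space M \<in> sets M" "f \<in> L2_fun M"
  shows "(\<lambda>x. indicat_real \<delta> x *\<^sub>R f x) \<in> L2_fun M"
  using L2_fun_scaleC_bounded[OF strongly_measurable_indicator[OF assms(1)] assms(2), of 1]
  by (simp add: scaleR_scaleC indicator_def)

lemma integrable_cinner:
  assumes "f \<in> L2_fun M" "g \<in> L2_fun M"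
  shows "integrable M (\<lambda>x. cinner (f x) (g x))"
    and "cmod (LINT x|M. cinner (f x) (g x)) \<le> sqrt (LINT x|M. (norm (f x))\<^sup>2) * sqrt (LINT x|M. (norm (g x))\<^sup>2)"
proof -
  note f = L2_funD[OF assms(1)] and g = L2_funD[OF assms(2)]
  note CS = integral_Cauchy_Schwarz[OF borel_measurable_norm_strongly[OF f(1)] borel_measurable_norm_strongly[OF g(1)] f(2) g(2)]
  show i: "integrable M (\<lambda>x. cinner (f x) (g x))"
    by (rule Bochner_Integration.integrable_bound[OF CS(1)])
      (use f g in \<open>auto intro!: borel_measurable_strongly strongly_measurable_cinner AE_I2 cinner_norm_le\<close>)
  have "cmod (LINT x|M. cinner (f x) (g x)) \<le> (LINT x|M. norm (f x) * norm (g x))"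
    by (rule LINT_norm_le[OF i CS(1)]) (rule cinner_norm_le)
  then show "cmod (LINT x|M. cinner (f x) (g x)) \<le> sqrt (LINT x|M. (norm (f x))\<^sup>2) * sqrt (LINT x|M. (norm (g x))\<^sup>2)"
    using CS(2) by linarith
qed

subsection \<open>Vectors as classes of functions\<close>

lemma L2_class_cong: "AE x in M. f x = g x \<Longrightarrow> L2_class M f = L2_class M g"
  unfolding L2_class_def by (auto elim: eventually_elim2)

lemma L2_class_eqD:
  assumes "f \<in> L2_fun M" "L2_class M f = L2_class M g" shows "AE x in M. f x = g x"
proof -
  have "f \<in> L2_class M f" using assms(1) by (simp add: L2_class_def)
  then show ?thesis unfolding assms(2) by (simp add: L2_class_def)
qed

lemma rep_L2_class:
  assumes "f \<in> L2_fun M"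
  shows "rep (L2_class M f) \<in> L2_fun M" "AE x in M. rep (L2_class M f) x = f x"
proof -
  have "f \<in> L2_class M f" using assms by (simp add: L2_class_def)
  then have "rep (L2_class M f) \<in> L2_class M f"
    unfolding rep_def by (rule someI[where P = "\<lambda>g. g \<in> L2_class M f"])
  then show "rep (L2_class M f) \<in> L2_fun M" "AE x in M. rep (L2_class M f) x = f x"
    by (auto simp: L2_class_def)
qed

lemma vecs_L2: "vecs (L2 M) = L2_class M ` L2_fun M"
  by (simp add: L2_def)

lemma L2_class_in [simp, intro]: "f \<in> L2_fun M \<Longrightarrow> L2_class M f \<in> vecs (L2 M)"
  by (simp add: vecs_L2)

lemma rep_vecs:
  assumes "F \<in> vecs (L2 M)"
  shows "rep F \<in> L2_fun M" "L2_class M (rep F) = F"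
proof -
  obtain f where f: "f \<in> L2_fun M" "F = L2_class M f" using assms by (auto simp: vecs_L2)
  show "rep F \<in> L2_fun M" unfolding f(2) by (rule rep_L2_class(1)[OF f(1)])
  show "L2_class M (rep F) = F" unfolding f(2) by (rule L2_class_cong[OF rep_L2_class(2)[OF f(1)]])
qed

lemma vzero_L2: "vzero (L2 M) = L2_class M (\<lambda>x. 0)"
  by (simp add: L2_def)

lemma vadd_L2_class:
  assumes "f \<in> L2_fun M" "g \<in> L2_fun M"
  shows "vadd (L2 M) (L2_class M f) (L2_class M g) = L2_class M (\<lambda>x. f x + g x)"
  using rep_L2_class(2)[OF assms(1)] rep_L2_class(2)[OF assms(2)]
  by (auto simp: L2_def intro!: L2_class_cong)

lemma vscale_L2_class:
  assumes "f \<in> L2_fun M"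
  shows "vscale (L2 M) a (L2_class M f) = L2_class M (\<lambda>x. a *\<^sub>C f x)"
  using rep_L2_class(2)[OF assms(1)] by (auto simp: L2_def intro!: L2_class_cong)

lemma vminus_L2_class:
  assumes "f \<in> L2_fun M" "g \<in> L2_fun M"
  shows "vminus (L2 M) (L2_class M f) (L2_class M g) = L2_class M (\<lambda>x. f x - g x)"
  using vadd_L2_class[OF assms(1) L2_fun_scaleC[OF assms(2), of "-1"]]
  by (simp add: vminus_def vscale_L2_class[OF assms(2)] scaleC_minus_left)

lemma vinner_L2_class:
  assumes "f \<in> L2_fun M" "g \<in> L2_fun M"
  shows "vinner (L2 M) (L2_class M f) (L2_class M g) = (LINT x|M. cinner (f x) (g x))"
proof -
  note rf = rep_L2_class[OF assms(1)] and rg = rep_L2_class[OF assms(2)]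
  have "(LINT x|M. cinner (rep (L2_class M f) x) (rep (L2_class M g) x)) = (LINT x|M. cinner (f x) (g x))"
  proof (rule integral_cong_AE)
    show "AE x in M. cinner (rep (L2_class M f) x) (rep (L2_class M g) x) = cinner (f x) (g x)"
      using rf(2) rg(2) by eventually_elim simp
  qed (use assms rf rg L2_funD(1) in \<open>auto intro!: borel_measurable_strongly strongly_measurable_cinner\<close>)
  then show ?thesis by (simp add: L2_def)
qed

lemma vnorm_L2_class:
  assumes "f \<in> L2_fun M"
  shows "vnorm (L2 M) (L2_class M f) = sqrt (LINT x|M. (norm (f x))\<^sup>2)"
  unfolding vnorm_def vinner_L2_class[OF assms assms] by (simp add: cinner_self del: of_real_power)

lemma vnorm_L2_nonneg: "F \<in> vecs (L2 M) \<Longrightarrow> vnorm (L2 M) F \<ge> 0"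
  by (auto simp: vecs_L2 vnorm_L2_class intro!: integral_nonneg_AE)

lemma vnorm_eq_0_L2:
  assumes "f \<in> L2_fun M" "vnorm (L2 M) (L2_class M f) = 0" shows "AE x in M. f x = 0"
proof -
  have "(LINT x|M. (norm (f x))\<^sup>2) = 0" using assms by (simp add: vnorm_L2_class)
  then show ?thesis
    using integral_nonneg_eq_0_iff_AE[OF L2_funD(2)[OF assms(1)]] by simp
qed

section \<open>Bounded operators\<close>

lemma whole_simps [simp]:
  "vecs whole = UNIV" "vzero whole = 0" "vadd whole = (+)" "vscale whole = scaleC" "vinner whole = cinner"
  "vnorm whole = norm"
  by (auto simp: whole_def vnorm_def fun_eq_iff norm_eq_sqrt_cinner)

lemma op_norm_le:
  assumes "K \<ge> 0" "\<And>x. x \<in> vecs H \<Longrightarrow> vnorm H' (T x) \<le> K * vnorm H x"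
  shows "op_norm H H' T \<le> K"
  unfolding op_norm_def by (rule cInf_lower) (use assms in \<open>auto intro!: bdd_belowI[of _ 0]\<close>)

lemma op_norm_bound:
  assumes bd: "\<And>x. x \<in> vecs H \<Longrightarrow> vnorm H' (T x) \<le> K * vnorm H x" and nn: "\<And>x. x \<in> vecs H \<Longrightarrow> vnorm H x \<ge> 0"
  shows "op_norm H H' T \<ge> 0" "x \<in> vecs H \<Longrightarrow> vnorm H' (T x) \<le> op_norm H H' T * vnorm H x"
proof -
  let ?S = "{M. 0 \<le> M \<and> (\<forall>x\<in>vecs H. vnorm H' (T x) \<le> M * vnorm H x)}"
  have "\<bar>K\<bar> \<in> ?S" using bd nn by (auto intro!: order_trans[OF bd mult_right_mono])
  then have ne: "?S \<noteq> {}" by blast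
  show "op_norm H H' T \<ge> 0" unfolding op_norm_def by (rule cInf_greatest[OF ne]) auto
  show "vnorm H' (T x) \<le> op_norm H H' T * vnorm H x" if x: "x \<in> vecs H"
  proof (cases "vnorm H x = 0")
    case True
    then show ?thesis using bd[OF x] by simp
  next
    case False
    then have pos: "vnorm H x > 0" using nn[OF x] by simp
    have "vnorm H' (T x) / vnorm H x \<le> op_norm H H' T"
      unfolding op_norm_def by (rule cInf_greatest[OF ne]) (use x pos in \<open>auto simp: divide_le_eq\<close>)
    then show ?thesis using pos by (simp add: divide_le_eq)
  qed
qed

lemma bounded_opsD:
  assumes "T \<in> bounded_ops H H'"
  shows "x \<in> vecs H \<Longrightarrow> T x \<in> vecs H'"
    "x \<in> vecs H \<Longrightarrow> y \<in> vecs H \<Longrightarrow> T (vadd H x y) = vadd H' (T x) (T y)"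
    "x \<in> vecs H \<Longrightarrow> T (vscale H a x) = vscale H' a (T x)"
    "T \<in> vecs H \<rightarrow>\<^sub>E vecs H'"
  using assms by (auto simp: bounded_ops_def)

lemma bounded_ops_norm:
  assumes "T \<in> bounded_ops H H'" "\<And>x. x \<in> vecs H \<Longrightarrow> vnorm H x \<ge> 0"
  shows "op_norm H H' T \<ge> 0" "x \<in> vecs H \<Longrightarrow> vnorm H' (T x) \<le> op_norm H H' T * vnorm H x"
proof -
  obtain K where "\<And>x. x \<in> vecs H \<Longrightarrow> vnorm H' (T x) \<le> K * vnorm H x"
    using assms(1) unfolding bounded_ops_def by blast
  from op_norm_bound[OF this assms(2)]
  show "op_norm H H' T \<ge> 0" "x \<in> vecs H \<Longrightarrow> vnorm H' (T x) \<le> op_norm H H' T * vnorm H x" by auto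
qed

subsection \<open>Operators given by square integrable kernels\<close>

definition L2_kernel :: "'p measure \<Rightarrow> ('p \<Rightarrow> 'a::chilbert \<Rightarrow>\<^sub>L 'h::chilbert) \<Rightarrow> bool" where
  "L2_kernel M F \<longleftrightarrow> strongly_measurable M F \<and> (\<forall>z\<in>space M. clinear_op (F z))
     \<and> integrable M (\<lambda>z. (norm (F z))\<^sup>2)"

definition mult_op :: "'p measure \<Rightarrow> ('p \<Rightarrow> 'a::chilbert \<Rightarrow>\<^sub>L 'h::chilbert) \<Rightarrow> 'a \<Rightarrow> ('p \<Rightarrow> 'h) set" where
  "mult_op M F = (\<lambda>x. L2_class M (\<lambda>z. blinfun_apply (F z) x))"

lemma L2_kernelD:
  assumes "L2_kernel M F"
  shows "strongly_measurable M F" "z \<in> space M \<Longrightarrow> clinear_op (F z)" "integrable M (\<lambda>z. (norm (F z))\<^sup>2)"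
  using assms by (auto simp: L2_kernel_def)

lemma L2_kernel_apply: "L2_kernel M F \<Longrightarrow> (\<lambda>z. blinfun_apply (F z) x) \<in> L2_fun M"
proof (rule L2_fun_dominated)
  assume F: "L2_kernel M F"
  show "strongly_measurable M (\<lambda>z. blinfun_apply (F z) x)"
    by (rule strongly_measurable_apply[OF L2_kernelD(1)[OF F] strongly_measurable_const])
  show "integrable M (\<lambda>z. (norm (F z))\<^sup>2 * (norm x)\<^sup>2)" using L2_kernelD(3)[OF F] by simp
  show "(norm (blinfun_apply (F z) x))\<^sup>2 \<le> (norm (F z))\<^sup>2 * (norm x)\<^sup>2" for z
    by (metis norm_blinfun norm_ge_zero power_mono power_mult_distrib)
qed

lemma vnorm_mult_op:
  assumes F: "L2_kernel M F"
  shows "vnorm (L2 M) (mult_op M F x) \<le> sqrt (LINT z|M. (norm (F z))\<^sup>2) * norm x"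
proof -
  have "(LINT z|M. (norm (blinfun_apply (F z) x))\<^sup>2) \<le> (LINT z|M. (norm (F z))\<^sup>2 * (norm x)\<^sup>2)"
  proof (rule integral_mono)
    show "(norm (blinfun_apply (F z) x))\<^sup>2 \<le> (norm (F z))\<^sup>2 * (norm x)\<^sup>2" for z
      by (metis norm_blinfun norm_ge_zero power_mono power_mult_distrib)
  qed (use L2_kernelD(3)[OF F] L2_funD(2)[OF L2_kernel_apply[OF F]] in auto)
  then have "sqrt (LINT z|M. (norm (blinfun_apply (F z) x))\<^sup>2) \<le> sqrt ((LINT z|M. (norm (F z))\<^sup>2) * (norm x)\<^sup>2)"
    by simp
  then show ?thesis
    unfolding mult_op_def vnorm_L2_class[OF L2_kernel_apply[OF F]] by (simp add: real_sqrt_mult)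
qed

lemma mult_op_bounded:
  assumes F: "L2_kernel M F"
  shows "mult_op M F \<in> bounded_ops whole (L2 M)"
    "op_norm whole (L2 M) (mult_op M F) \<le> sqrt (LINT z|M. (norm (F z))\<^sup>2)"
proof -
  show "op_norm whole (L2 M) (mult_op M F) \<le> sqrt (LINT z|M. (norm (F z))\<^sup>2)"
    by (rule op_norm_le) (auto simp: vnorm_mult_op[OF F] intro!: integral_nonneg_AE)
  have "mult_op M F (x + y) = vadd (L2 M) (mult_op M F x) (mult_op M F y)" for x y
    by (simp add: mult_op_def vadd_L2_class L2_kernel_apply[OF F] blinfun.add_right)
  moreover have "mult_op M F (a *\<^sub>C x) = vscale (L2 M) a (mult_op M F x)" for a x
    by (auto simp: mult_op_def vscale_L2_class L2_kernel_apply[OF F]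
        intro!: L2_class_cong AE_I2 blinfun_apply_clinear L2_kernelD(2)[OF F])
  moreover have "mult_op M F x \<in> vecs (L2 M)" for x
    by (simp add: mult_op_def L2_kernel_apply[OF F])
  ultimately show "mult_op M F \<in> bounded_ops whole (L2 M)"
    unfolding bounded_ops_def using vnorm_mult_op[OF F] by auto
qed

text \<open>The quadratic form of the positive operator \<open>S\<^sup>* E(\<delta>) S\<close> is the integral of \<open>(norm (F z x))\<^sup>2\<close> over
  \<open>\<delta>\<close>, which bounds the operator norm on both sides.\<close>

lemma mult_op_compression:
  fixes F :: "'p \<Rightarrow> 'a::chilbert \<Rightarrow>\<^sub>L 'h::chilbert"
  assumes F: "L2_kernel M F" and \<delta>: "\<delta> \<inter> space M \<in> sets M"
  defines "Q \<equiv> \<lambda>x. op_adjoint whole (L2 M) (mult_op M F)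
      (L2_class M (\<lambda>z. indicat_real \<delta> z *\<^sub>R rep (mult_op M F x) z))"
  shows "op_norm whole whole Q \<ge> 0"
    and "op_norm whole whole Q \<le> (LINT z|M. indicat_real \<delta> z * (norm (F z))\<^sup>2)"
    and "(LINT z|M. indicat_real \<delta> z * (norm (blinfun_apply (F z) x))\<^sup>2) \<le> op_norm whole whole Q * (norm x)\<^sup>2"
proof -
  have Fx: "(\<lambda>z. blinfun_apply (F z) x) \<in> L2_fun M" for x by (rule L2_kernel_apply[OF F])
  have Fd: "(\<lambda>z. indicat_real \<delta> z *\<^sub>R blinfun_apply (F z) x) \<in> L2_fun M" for x
    by (rule L2_fun_indicator[OF \<delta> Fx])
  have cls: "L2_class M (\<lambda>z. indicat_real \<delta> z *\<^sub>R rep (mult_op M F x) z)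
      = L2_class M (\<lambda>z. indicat_real \<delta> z *\<^sub>R blinfun_apply (F z) x)" for x
    using rep_L2_class(2)[OF Fx[of x]] by (intro L2_class_cong) (auto simp: mult_op_def)
  have adj: "vinner (L2 M) (mult_op M F z) y = cinner z (op_adjoint whole (L2 M) (mult_op M F) y)"
    if y: "y \<in> vecs (L2 M)" for y z
  proof -
    obtain g where g: "g \<in> L2_fun M" "y = L2_class M g" using y by (auto simp: vecs_L2)
    have vin: "vinner (L2 M) (mult_op M F z) y = (LINT w|M. cinner (blinfun_apply (F w) z) (g w))" for z
      using vinner_L2_class[OF Fx g(1)] by (simp add: mult_op_def g(2))
    have "\<exists>u. \<forall>z. vinner (L2 M) (mult_op M F z) y = cinner z u"
    proof (rule Riesz_representation)
      fix x z :: 'a and a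
      show "vinner (L2 M) (mult_op M F (x + z)) y = vinner (L2 M) (mult_op M F x) y + vinner (L2 M) (mult_op M F z) y"
        using integrable_cinner(1)[OF Fx g(1)] by (simp add: vin blinfun.add_right cinner_add_left)
      have "(LINT w|M. cinner (blinfun_apply (F w) (a *\<^sub>C x)) (g w)) = (LINT w|M. a * cinner (blinfun_apply (F w) x) (g w))"
        by (intro Bochner_Integration.integral_cong)
          (auto simp: blinfun_apply_clinear L2_kernelD(2)[OF F] cinner_scaleC_left)
      then show "vinner (L2 M) (mult_op M F (a *\<^sub>C x)) y = a * vinner (L2 M) (mult_op M F x) y"
        by (simp add: vin)
      have "cmod (vinner (L2 M) (mult_op M F x) y) \<le> vnorm (L2 M) (mult_op M F x) * vnorm (L2 M) y"
        using integrable_cinner(2)[OF Fx[of x] g(1)]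
        by (simp add: vin) (simp add: mult_op_def g(2) vnorm_L2_class[OF Fx] vnorm_L2_class[OF g(1)])
      also have "\<dots> \<le> (sqrt (LINT z|M. (norm (F z))\<^sup>2) * norm x) * vnorm (L2 M) y"
        by (rule mult_right_mono[OF vnorm_mult_op[OF F] vnorm_L2_nonneg[OF y]])
      finally show "cmod (vinner (L2 M) (mult_op M F x) y) \<le> (sqrt (LINT z|M. (norm (F z))\<^sup>2) * vnorm (L2 M) y) * norm x"
        by (simp add: mult_ac)
    qed
    then obtain u where u: "\<And>z. vinner (L2 M) (mult_op M F z) y = cinner z u" by blast
    have "op_adjoint whole (L2 M) (mult_op M F) y = u"
      unfolding op_adjoint_def using y by (auto simp: u intro!: the_equality intro: cinner_ext)
    then show ?thesis by (simp add: u)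
  qed
  have form: "cinner z (Q x) = (LINT w|M. indicat_real \<delta> w *\<^sub>R cinner (blinfun_apply (F w) z) (blinfun_apply (F w) x))" for x z
  proof -
    have "cinner z (Q x) = vinner (L2 M) (mult_op M F z) (L2_class M (\<lambda>w. indicat_real \<delta> w *\<^sub>R blinfun_apply (F w) x))"
      unfolding Q_def cls using adj Fd by simp
    then show ?thesis
      unfolding mult_op_def vinner_L2_class[OF Fx Fd]
      by (simp add: bounded_bilinear.scaleR_right[OF bounded_bilinear_cinner])
  qed
  define I where "I = (LINT z|M. indicat_real \<delta> z * (norm (F z))\<^sup>2)"
  have I0: "I \<ge> 0" by (auto simp: I_def intro!: integral_nonneg_AE)
  have ind_int: "integrable M (\<lambda>z. indicat_real \<delta> z * g z)" if "integrable M g" for g :: "'p \<Rightarrow> real"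
  proof -
    have "integrable M (\<lambda>z. indicat_real (\<delta> \<inter> space M) z *\<^sub>R g z)"
      using integrable_mult_indicator[OF \<delta> that] by simp
    then show ?thesis
      by (rule Bochner_Integration.integrable_cong[THEN iffD1, rotated 2]) (auto simp: indicator_def)
  qed
  have Qle: "norm (Q x) \<le> I * norm x" for x
  proof (rule norm_le_via_cinner)
    fix z
    have "cmod (cinner z (Q x)) \<le> (LINT w|M. (indicat_real \<delta> w * (norm (F w))\<^sup>2) * (norm z * norm x))"
      unfolding form
    proof (rule LINT_norm_le)
      show "integrable M (\<lambda>w. indicat_real \<delta> w *\<^sub>R cinner (blinfun_apply (F w) z) (blinfun_apply (F w) x))"
        using integrable_cinner(1)[OF Fx Fd] by (simp add: bounded_bilinear.scaleR_right[OF bounded_bilinear_cinner])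
      show "integrable M (\<lambda>w. (indicat_real \<delta> w * (norm (F w))\<^sup>2) * (norm z * norm x))"
        using ind_int[OF L2_kernelD(3)[OF F]] by simp
      fix w
      have "norm (blinfun_apply (F w) z) * norm (blinfun_apply (F w) x) \<le> (norm (F w) * norm z) * (norm (F w) * norm x)"
        by (intro mult_mono norm_blinfun) auto
      then have "cmod (cinner (blinfun_apply (F w) z) (blinfun_apply (F w) x)) \<le> (norm (F w))\<^sup>2 * (norm z * norm x)"
        using cinner_norm_le[of "blinfun_apply (F w) z" "blinfun_apply (F w) x"] by (simp add: power2_eq_square mult_ac)
      then show "norm (indicat_real \<delta> w *\<^sub>R cinner (blinfun_apply (F w) z) (blinfun_apply (F w) x))
          \<le> (indicat_real \<delta> w * (norm (F w))\<^sup>2) * (norm z * norm x)"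
        by (simp add: indicator_def)
    qed
    also have "\<dots> = norm z * (I * norm x)" by (simp add: I_def mult_ac)
    finally show "cmod (cinner z (Q x)) \<le> norm z * (I * norm x)" .
  qed (use I0 in simp)
  show "op_norm whole whole Q \<le> (LINT z|M. indicat_real \<delta> z * (norm (F z))\<^sup>2)"
    using op_norm_le[of I whole whole Q] Qle I0 by (simp add: I_def)
  note b = op_norm_bound[of whole whole Q I, simplified, OF Qle]
  show "op_norm whole whole Q \<ge> 0" by (rule b(1))
  have "(LINT z|M. indicat_real \<delta> z * (norm (blinfun_apply (F z) x))\<^sup>2) = Re (cinner x (Q x))"
  proof -
    have "cinner x (Q x) = (LINT w|M. complex_of_real (indicat_real \<delta> w * (norm (blinfun_apply (F w) x))\<^sup>2))"
      unfolding form by (simp add: cinner_self scaleR_conv_of_real)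
    then show ?thesis by (simp only: integral_complex_of_real Re_complex_of_real)
  qed
  also have "\<dots> \<le> norm x * norm (Q x)" using cinner_norm_le[of x "Q x"] complex_Re_le_cmod order_trans by blast
  also have "\<dots> \<le> norm x * (op_norm whole whole Q * norm x)" by (rule mult_left_mono[OF b(2)]) simp
  finally show "(LINT z|M. indicat_real \<delta> z * (norm (blinfun_apply (F z) x))\<^sup>2) \<le> op_norm whole whole Q * (norm x)\<^sup>2"
    by (simp add: power2_eq_square mult_ac)
qed

text \<open>Strong measurability provides countably many operators that come within \<open>\<epsilon>\<close> of every value
  of \<open>F\<close>. On the part of the space where \<open>F\<close> is within \<open>\<epsilon>\<close> of one of them, a single vector almost
  attains the norm of all values of \<open>F\<close>.\<close>

lemma strongly_measurable_partition:
  fixes F :: "'p \<Rightarrow> 'a::real_normed_vector \<Rightarrow>\<^sub>L 'b::real_normed_vector"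
  assumes F: "strongly_measurable M F" and \<epsilon>: "\<epsilon> > 0"
  obtains \<delta> :: "nat \<Rightarrow> 'p set" and x :: "nat \<Rightarrow> 'a"
  where "\<And>j. \<delta> j \<in> sets M" "disjoint_family \<delta>" "(\<Union>j. \<delta> j) = space M" "\<And>j. norm (x j) \<le> 1"
    "\<And>j z. z \<in> \<delta> j \<Longrightarrow> (norm (F z))\<^sup>2 - 6 * \<epsilon> * norm (F z) \<le> (norm (blinfun_apply (F z) (x j)))\<^sup>2"
proof -
  obtain s where s: "\<And>n::nat. simple_function M (s n)" "\<And>z. z \<in> space M \<Longrightarrow> (\<lambda>n. s n z) \<longlonglongrightarrow> F z"
    using F unfolding strongly_measurable_def by blast
  \<comment> \<open>The element \<open>0\<close> keeps \<open>Q\<close> nonempty over an empty space.\<close>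
  define Q where "Q = insert 0 (\<Union>n. s n ` space M)"
  have "countable Q"
    unfolding Q_def using s(1) by (intro countable_insert countable_UN) (auto simp: simple_function_def countable_finite)
  define q where "q = from_nat_into Q"
  have rq: "range q = Q" unfolding q_def by (rule range_from_nat_into) (use \<open>countable Q\<close> in \<open>auto simp: Q_def\<close>)
  define U where "U j = {z \<in> space M. norm (F z - q j) < \<epsilon>}" for j
  have Usets: "U j \<in> sets M" for j
  proof -
    have "(\<lambda>z. norm (F z - q j)) \<in> borel_measurable M"
      by (intro borel_measurable_norm_strongly strongly_measurable_diff F strongly_measurable_const)
    then show ?thesis unfolding U_def by measurable
  qed
  have UU: "(\<Union>j. U j) = space M"
  proof (intro equalityI subsetI)
    fix z assume z: "z \<in> space M"
    then obtain n where n: "norm (s n z - F z) < \<epsilon>"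
      using s(2)[OF z] \<epsilon> by (meson LIMSEQ_iff order_refl)
    have "s n z \<in> range q" using z by (auto simp: rq Q_def)
    then obtain j where "q j = s n z" by auto
    then have "z \<in> U j" using z n by (simp add: U_def norm_minus_commute)
    then show "z \<in> (\<Union>j. U j)" by blast
  qed (auto simp: U_def)
  have "\<exists>x. norm x \<le> 1 \<and> norm (q j) - \<epsilon> \<le> norm (blinfun_apply (q j) x)" for j
  proof (rule ccontr)
    assume "\<not> ?thesis"
    then have c: "norm (blinfun_apply (q j) x) < norm (q j) - \<epsilon>" if "norm x \<le> 1" for x using that by force
    have "norm (q j) - \<epsilon> > 0" using c[of 0] by simp
    moreover have "norm (q j) \<le> norm (q j) - \<epsilon>"
    proof (rule norm_blinfun_bound)
      fix x
      show "norm (blinfun_apply (q j) x) \<le> (norm (q j) - \<epsilon>) * norm x"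
      proof (cases "x = 0")
        case False
        have "norm (blinfun_apply (q j) ((1 / norm x) *\<^sub>R x)) < norm (q j) - \<epsilon>"
          by (rule c) (use False in simp)
        then show ?thesis using False by (simp add: blinfun.scaleR_right field_simps)
      qed simp
    qed (use calculation in simp)
    ultimately show False using \<epsilon> by simp
  qed
  then obtain x where x: "\<And>j. norm (x j) \<le> 1" "\<And>j. norm (q j) - \<epsilon> \<le> norm (blinfun_apply (q j) (x j))" by metis
  show ?thesis
  proof (rule that[of "disjointed U" x])
    show "disjointed U j \<in> sets M" for j
      using sets.range_disjointed_sets[of U M] Usets by auto
    show "disjoint_family (disjointed U)" by (rule disjoint_family_disjointed)
    show "(\<Union>j. disjointed U j) = space M" using UN_disjointed_eq[of U] UU by simp
    show "norm (x j) \<le> 1" for j by (rule x)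
    fix j z assume "z \<in> disjointed U j"
    then have z: "norm (F z - q j) < \<epsilon>" using disjointed_subset[of U j] by (auto simp: U_def)
    have "norm (blinfun_apply (q j - F z) (x j)) \<le> norm (q j - F z) * norm (x j)" by (rule norm_blinfun)
    also have "\<dots> \<le> norm (q j - F z) * 1" by (rule mult_left_mono[OF x(1)]) simp
    finally have a: "norm (blinfun_apply (q j) (x j) - blinfun_apply (F z) (x j)) \<le> \<epsilon>"
      using z by (simp add: blinfun.diff_left norm_minus_commute)
    \<comment> \<open>One \<open>\<epsilon>\<close> for the passage from \<open>F z\<close> to \<open>q j\<close>, one for the choice of \<open>x j\<close>, one for the way back.\<close>
    have lo: "norm (F z) - 3 * \<epsilon> \<le> norm (blinfun_apply (F z) (x j))"
      using a x(2)[of j] z norm_triangle_ineq2[of "blinfun_apply (q j) (x j)" "blinfun_apply (F z) (x j)"]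
        norm_triangle_ineq2[of "F z" "q j"] by linarith
    show "(norm (F z))\<^sup>2 - 6 * \<epsilon> * norm (F z) \<le> (norm (blinfun_apply (F z) (x j)))\<^sup>2"
    proof (cases "norm (F z) \<ge> 3 * \<epsilon>")
      case True
      then have "(norm (F z) - 3 * \<epsilon>)\<^sup>2 \<le> (norm (blinfun_apply (F z) (x j)))\<^sup>2"
        using lo by (intro power_mono) auto
      moreover have "(norm (F z) - 3 * \<epsilon>)\<^sup>2 = (norm (F z))\<^sup>2 - 6 * \<epsilon> * norm (F z) + 9 * \<epsilon>\<^sup>2"
        by (simp add: power2_eq_square algebra_simps)
      moreover have "0 \<le> 9 * \<epsilon>\<^sup>2" by simp
      ultimately show ?thesis by linarith
    next
      case False
      have "norm (F z) * (norm (F z) - 6 * \<epsilon>) \<le> 0"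
        by (rule mult_nonneg_nonpos) (use False \<epsilon> in auto)
      then have "(norm (F z))\<^sup>2 - 6 * \<epsilon> * norm (F z) \<le> 0" by (simp add: power2_eq_square algebra_simps)
      then show ?thesis by (meson order_trans zero_le_power2)
    qed
  qed
qed

section \<open>Integration along a piecewise smooth arc\<close>

text \<open>The Riemann sums of \<open>f - s n\<close> are dominated by those of \<open>e n\<close>. This is how integrals of strongly
  measurable functions are obtained: their values may lie in a nonseparable space, such as a space
  of operators.\<close>

lemma has_integral_mean_limit:
  fixes f :: "real \<Rightarrow> 'v::banach" and s :: "nat \<Rightarrow> real \<Rightarrow> 'v" and e :: "nat \<Rightarrow> real \<Rightarrow> real"
  assumes s: "\<And>n. (s n has_integral I n) {a..b}" and e: "\<And>n. (e n has_integral J n) {a..b}"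
    and le: "\<And>n t. t \<in> {a..b} \<Longrightarrow> norm (f t - s n t) \<le> e n t" and J: "J \<longlonglongrightarrow> 0"
  shows "f integrable_on {a..b}"
proof -
  have dist: "norm (I n - I m) \<le> J n + J m" for n m
  proof -
    have "((\<lambda>t. s n t - s m t) has_integral (I n - I m)) {a..b}" by (intro has_integral_diff s)
    moreover have "((\<lambda>t. e n t + e m t) has_integral (J n + J m)) {a..b}" by (intro has_integral_add e)
    moreover have "norm (s n t - s m t) \<le> e n t + e m t" if "t \<in> {a..b}" for t
      using le[OF that, of n] le[OF that, of m] norm_triangle_ineq4[of "f t - s m t" "f t - s n t"] by simp
    ultimately show ?thesis
      using integral_norm_bound_integral[of "\<lambda>t. s n t - s m t" "{a..b}" "\<lambda>t. e n t + e m t"]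
      by (metis (no_types, lifting) has_integral_integrable_integral)
  qed
  have "Cauchy I"
  proof (rule CauchyI)
    fix r :: real assume r: "r > 0"
    then obtain N where N: "\<And>n. n \<ge> N \<Longrightarrow> norm (J n - 0) < r / 2" using J by (meson LIMSEQ_iff half_gt_zero)
    have "norm (I m - I n) < r" if "m \<ge> N" "n \<ge> N" for m n
      using dist[of m n] N[OF that(1)] N[OF that(2)] by simp
    then show "\<exists>M. \<forall>m\<ge>M. \<forall>n\<ge>M. norm (I m - I n) < r" by blast
  qed
  then obtain I0 where I0: "I \<longlonglongrightarrow> I0" by (auto simp: Cauchy_convergent_iff convergent_def)
  have "(f has_integral I0) {a..b}"
    unfolding has_integral_real
  proof (intro allI impI)
    fix r :: real assume r: "r > 0"
    obtain N1 where N1: "\<And>n. n \<ge> N1 \<Longrightarrow> norm (J n - 0) < r / 4"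
      using J r by (meson LIMSEQ_iff divide_pos_pos zero_less_numeral)
    obtain N2 where N2: "\<And>n. n \<ge> N2 \<Longrightarrow> norm (I n - I0) < r / 4"
      using I0 r by (meson LIMSEQ_iff divide_pos_pos zero_less_numeral)
    define n where "n = max N1 N2"
    have n: "J n < r / 4" "norm (I n - I0) < r / 4" using N1[of n] N2[of n] by (auto simp: n_def)
    have r4: "r / 4 > 0" using r by simp
    obtain g1 where g1: "gauge g1" "\<And>p. p tagged_division_of {a..b} \<Longrightarrow> g1 fine p \<Longrightarrow>
        norm (sum (\<lambda>(x,k). measure lborel k *\<^sub>R s n x) p - I n) < r / 4"
      using s[of n, unfolded has_integral_real] r4 by metis
    obtain g2 where g2: "gauge g2" "\<And>p. p tagged_division_of {a..b} \<Longrightarrow> g2 fine p \<Longrightarrow>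
        norm (sum (\<lambda>(x,k). measure lborel k *\<^sub>R e n x) p - J n) < r / 4"
      using e[of n, unfolded has_integral_real] r4 by metis
    have "norm (sum (\<lambda>(x,k). measure lborel k *\<^sub>R f x) p - I0) < r"
      if p: "p tagged_division_of {a..b}" and fine: "(\<lambda>x. g1 x \<inter> g2 x) fine p" for p
    proof -
      have "g1 fine p" "g2 fine p" using fine by (auto simp: fine_Int)
      note b1 = g1(2)[OF p this(1)] and b2 = g2(2)[OF p this(2)]
      have "norm (sum (\<lambda>(x,k). measure lborel k *\<^sub>R f x) p - sum (\<lambda>(x,k). measure lborel k *\<^sub>R s n x) p)
          = norm (sum (\<lambda>(x,k). measure lborel k *\<^sub>R (f x - s n x)) p)"
        by (simp add: sum_subtractf[symmetric] case_prod_beta scaleR_diff_right)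
      also have "\<dots> \<le> sum (\<lambda>(x,k). measure lborel k *\<^sub>R e n x) p"
      proof (rule sum_norm_le)
        fix xk assume xk: "xk \<in> p"
        obtain x k where [simp]: "xk = (x, k)" by (cases xk)
        have "x \<in> {a..b}" using tagged_division_ofD(2,3)[OF p, of x k] xk by auto
        then show "norm (case xk of (x, k) \<Rightarrow> measure lborel k *\<^sub>R (f x - s n x)) \<le> (case xk of (x, k) \<Rightarrow> measure lborel k *\<^sub>R e n x)"
          using le by (simp add: mult_left_mono)
      qed
      also have "\<dots> < r / 4 + J n" using b2 by (simp add: abs_if split: if_splits)
      finally have "norm (sum (\<lambda>(x,k). measure lborel k *\<^sub>R f x) p - sum (\<lambda>(x,k). measure lborel k *\<^sub>R s n x) p) < r / 2"
        using n(1) by linarith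
      moreover have "norm (sum (\<lambda>(x,k). measure lborel k *\<^sub>R s n x) p - I0) < r / 2"
        using norm_triangle_ineq[of "sum (\<lambda>(x,k). measure lborel k *\<^sub>R s n x) p - I n" "I n - I0"] b1 n(2) by simp
      ultimately show ?thesis
        using norm_triangle_ineq[of "sum (\<lambda>(x,k). measure lborel k *\<^sub>R f x) p - sum (\<lambda>(x,k). measure lborel k *\<^sub>R s n x) p"
            "sum (\<lambda>(x,k). measure lborel k *\<^sub>R s n x) p - I0"] by simp
    qed
    then show "\<exists>g. gauge g \<and> (\<forall>p. p tagged_division_of {a..b} \<and> g fine p \<longrightarrow>
        norm (sum (\<lambda>(x,k). measure lborel k *\<^sub>R f x) p - I0) < r)"
      using gauge_Int[OF g1(1) g2(1)] by blast
  qed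
  then show ?thesis by blast
qed

subsection \<open>The arc and its derivative\<close>

text \<open>Away from the break points the derivative relative to \<open>{0..1}\<close> is the two-sided derivative, so that
  the one-sided derivatives on the finitely many pieces give the global statements.\<close>

lemma piecewise_smooth_pieces:
  assumes "piecewise_smooth \<gamma>"
  obtains K B where "finite K" "{0, 1} \<subseteq> K" "K \<subseteq> {0..1::real}" "B \<ge> 0"
    "\<And>u. u \<in> {0..1} - K \<Longrightarrow> (\<gamma> has_vector_derivative vector_derivative \<gamma> (at u within {0..1})) (at u)"
    "\<And>u. u \<in> {0..1} - K \<Longrightarrow> isCont (\<lambda>u. vector_derivative \<gamma> (at u within {0..1})) u"
    "\<And>u. u \<in> {0..1} - K \<Longrightarrow> norm (vector_derivative \<gamma> (at u within {0..1})) \<le> B"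
    "\<And>s t. s \<in> K \<Longrightarrow> t \<in> K \<Longrightarrow> s < t \<Longrightarrow> K \<inter> {s<..<t} = {} \<Longrightarrow> smooth_on_interval s t \<gamma>"
proof -
  define d where "d = (\<lambda>u. vector_derivative \<gamma> (at u within {0..1}))"
  obtain K where K0: "finite K" "{0, 1} \<subseteq> K" "K \<subseteq> {0..1::real}"
    "\<forall>s\<in>K. \<forall>t\<in>K. s < t \<and> K \<inter> {s<..<t} = {} \<longrightarrow> smooth_on_interval s t \<gamma>"
    using assms unfolding piecewise_smooth_def by (elim exE conjE) (rule that)
  have K4: "smooth_on_interval s t \<gamma>" if "s \<in> K" "t \<in> K" "s < t" "K \<inter> {s<..<t} = {}" for s t
    using K0(4) that by simp
  note K = K0(1,2,3) K4
  have piece: "\<exists>B\<ge>0. \<forall>u\<in>{s<..<t}. (\<gamma> has_vector_derivative d u) (at u) \<and> isCont d u \<and> norm (d u) \<le> B"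
    if st: "s \<in> K" "t \<in> K" "s < t" "K \<inter> {s<..<t} = {}" for s t
  proof -
    obtain g where g: "continuous_on {s..t} g" "\<And>u. u \<in> {s..t} \<Longrightarrow> (\<gamma> has_vector_derivative g u) (at u within {s..t})"
      using K(4)[OF st] unfolding smooth_on_interval_def by blast
    have sub: "{s..t} \<subseteq> {0..1}" using st K(3) by auto
    have dg: "d u = g u \<and> (\<gamma> has_vector_derivative g u) (at u)" if u: "u \<in> {s<..<t}" for u
    proof -
      have "at u within {s..t} = at u" by (rule at_within_interior) (use u in \<open>simp add: interior_atLeastAtMost_real\<close>)
      then have h: "(\<gamma> has_vector_derivative g u) (at u)" using g(2)[of u] u by simp
      have "u \<in> interior {0..1}" using u sub by (auto simp: interior_atLeastAtMost_real)
      then have "at u within {0..1} = at u" by (rule at_within_interior)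
      then have "d u = g u" using h by (simp add: d_def vector_derivative_at)
      then show ?thesis using h by simp
    qed
    have cont: "isCont d u" if u: "u \<in> {s<..<t}" for u
    proof -
      have "continuous_on {s<..<t} g" using g(1) by (rule continuous_on_subset) auto
      then have "isCont g u" using u by (simp add: continuous_on_eq_continuous_at)
      moreover have "eventually (\<lambda>v. g v = d v) (nhds u)"
        unfolding eventually_nhds using u dg by (intro exI[of _ "{s<..<t}"]) auto
      ultimately show ?thesis using isCont_cong by blast
    qed
    have "bounded (g ` {s..t})" by (intro compact_imp_bounded compact_continuous_image g(1)) simp
    then obtain B where "\<And>u. u \<in> {s..t} \<Longrightarrow> norm (g u) \<le> B" unfolding bounded_iff by blast
    then show ?thesis using dg cont
      by (intro exI[of _ "\<bar>B\<bar>"]) (auto intro: order_trans[OF _ abs_ge_self])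
  qed
  define P where "P = {(s, t). s \<in> K \<and> t \<in> K \<and> s < t \<and> K \<inter> {s<..<t} = {}}"
  have finP: "finite P" by (rule finite_subset[of _ "K \<times> K"]) (use K(1) in \<open>auto simp: P_def\<close>)
  have "\<forall>p\<in>P. \<exists>B\<ge>0. \<forall>u\<in>{fst p<..<snd p}. (\<gamma> has_vector_derivative d u) (at u) \<and> isCont d u \<and> norm (d u) \<le> B"
    using piece by (auto simp: P_def)
  then obtain b where b: "\<And>p. p \<in> P \<Longrightarrow> b p \<ge> 0"
    "\<And>p u. p \<in> P \<Longrightarrow> u \<in> {fst p<..<snd p} \<Longrightarrow> (\<gamma> has_vector_derivative d u) (at u) \<and> isCont d u \<and> norm (d u) \<le> b p"
    by metis
  have cover: "\<exists>p\<in>P. u \<in> {fst p<..<snd p}" if u: "u \<in> {0..1} - K" for u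
  proof -
    define s t where "s = Max (K \<inter> {..u})" and "t = Min (K \<inter> {u..})"
    have "0 \<in> K \<inter> {..u}" "1 \<in> K \<inter> {u..}" using u K(2) by auto
    then have ne: "K \<inter> {..u} \<noteq> {}" "K \<inter> {u..} \<noteq> {}" by blast+
    have s: "s \<in> K \<inter> {..u}" unfolding s_def by (rule Max_in[OF _ ne(1)]) (use K(1) in simp)
    have t: "t \<in> K \<inter> {u..}" unfolding t_def by (rule Min_in[OF _ ne(2)]) (use K(1) in simp)
    have "s \<noteq> u" "t \<noteq> u" using s t u by auto
    then have "s < u" "u < t" using s t by auto
    moreover have "K \<inter> {s<..<t} = {}"
    proof (rule ccontr)
      assume "K \<inter> {s<..<t} \<noteq> {}"
      then obtain k where k: "k \<in> K" "s < k" "k < t" by auto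
      show False
      proof (cases "k \<le> u")
        case True
        then have "k \<le> s" unfolding s_def using k K(1) by (intro Max_ge) auto
        then show False using k by simp
      next
        case False
        then have "t \<le> k" unfolding t_def using k K(1) by (intro Min_le) auto
        then show False using k by simp
      qed
    qed
    ultimately show ?thesis using s t by (intro bexI[of _ "(s, t)"]) (auto simp: P_def)
  qed
  have all: "(\<gamma> has_vector_derivative d u) (at u) \<and> isCont d u \<and> norm (d u) \<le> sum b P" if u: "u \<in> {0..1} - K" for u
  proof -
    obtain p where p: "p \<in> P" "u \<in> {fst p<..<snd p}" using cover[OF u] by blast
    have "b p \<le> sum b P" by (rule member_le_sum) (use p b finP in auto)
    then show ?thesis using b(2)[OF p] by simp
  qed
  show ?thesis
  proof (rule that[of K "sum b P"])
    show "sum b P \<ge> 0" by (rule sum_nonneg) (use b in auto)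
    show "(\<gamma> has_vector_derivative vector_derivative \<gamma> (at u within {0..1})) (at u)" if "u \<in> {0..1} - K" for u
      using all[OF that] by (simp add: d_def)
    show "isCont (\<lambda>u. vector_derivative \<gamma> (at u within {0..1})) u" if "u \<in> {0..1} - K" for u
      using all[OF that] by (simp add: d_def)
    show "norm (vector_derivative \<gamma> (at u within {0..1})) \<le> sum b P" if "u \<in> {0..1} - K" for u
      using all[OF that] by (simp add: d_def)
  qed (rule K, assumption?)+
qed

locale smooth_arc =
  fixes \<gamma> :: "real \<Rightarrow> complex"
  assumes arc: "arc \<gamma>" and smooth: "piecewise_smooth \<gamma>"
begin

abbreviation "M \<equiv> arclen \<gamma>"
abbreviation "L \<equiv> restrict_space lborel {0<..<1::real}"
abbreviation "dg t \<equiv> vector_derivative \<gamma> (at t within {0..1})"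

lemma valid_path: "valid_path \<gamma>"
proof -
  obtain K B where K: "finite K" "{0, 1} \<subseteq> K" "K \<subseteq> {0..1::real}" "B \<ge> 0"
    "\<And>u. u \<in> {0..1} - K \<Longrightarrow> (\<gamma> has_vector_derivative dg u) (at u)"
    "\<And>u. u \<in> {0..1} - K \<Longrightarrow> isCont (\<lambda>u. dg u) u"
    "\<And>u. u \<in> {0..1} - K \<Longrightarrow> norm (dg u) \<le> B"
    "\<And>s t. s \<in> K \<Longrightarrow> t \<in> K \<Longrightarrow> s < t \<Longrightarrow> K \<inter> {s<..<t} = {} \<Longrightarrow> smooth_on_interval s t \<gamma>"
    by (rule piecewise_smooth_pieces[OF smooth]) (rule that)
  have "continuous_on {0..1} \<gamma>" using arc by (simp add: arc_def path_def)
  moreover have "\<gamma> C1_differentiable_on ({0..1} - K)"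
    unfolding C1_differentiable_on_def using K(5,6)
    by (intro exI[of _ "\<lambda>u. dg u"]) (auto intro: continuous_at_imp_continuous_on)
  ultimately show ?thesis
    unfolding valid_path_def piecewise_C1_differentiable_on_def using K(1) by blast
qed

lemma inj: "inj_on \<gamma> {0..1}" using arc by (simp add: arc_def)

lemma cont: "continuous_on {0..1} \<gamma>" using arc by (simp add: arc_def path_def)

lemma dg_measurable [measurable]: "(\<lambda>t. dg t) \<in> borel_measurable L"
proof -
  obtain K B where K: "finite K" "{0, 1} \<subseteq> K" "K \<subseteq> {0..1::real}" "B \<ge> 0"
    "\<And>u. u \<in> {0..1} - K \<Longrightarrow> (\<gamma> has_vector_derivative dg u) (at u)"
    "\<And>u. u \<in> {0..1} - K \<Longrightarrow> isCont (\<lambda>u. dg u) u"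
    "\<And>u. u \<in> {0..1} - K \<Longrightarrow> norm (dg u) \<le> B"
    "\<And>s t. s \<in> K \<Longrightarrow> t \<in> K \<Longrightarrow> s < t \<Longrightarrow> K \<inter> {s<..<t} = {} \<Longrightarrow> smooth_on_interval s t \<gamma>"
    by (rule piecewise_smooth_pieces[OF smooth]) (rule that)
  have "{0..1} - K \<in> sets borel" by (rule sets.Diff) (simp, rule borel_closed[OF finite_imp_closed[OF K(1)]])
  then have "(\<lambda>t. indicator ({0..1} - K) t *\<^sub>R dg t) \<in> borel_measurable borel"
    by (rule borel_measurable_continuous_on_indicator) (auto intro: continuous_at_imp_continuous_on K(6))
  then have 1: "(\<lambda>t. indicator ({0..1} - K) t *\<^sub>R dg t) \<in> borel_measurable L"
    by (intro measurable_restrict_space1) simp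
  show ?thesis
  proof (rule measurable_discrete_difference[OF 1])
    show "countable (K \<inter> {0<..<1})" using K(1) by (simp add: countable_finite)
    show "{x} \<in> sets L" if "x \<in> K \<inter> {0<..<1}" for x
      using that by (auto simp: sets_restrict_space)
    show "indicator ({0..1} - K) x *\<^sub>R dg x = dg x" if "x \<in> space L" "x \<notin> K \<inter> {0<..<1}" for x
      using that by (auto simp: space_restrict_space indicator_def)
  qed auto
qed

lemma dg_bounded: obtains B where "B \<ge> 0" "AE t in L. norm (dg t) \<le> B"
proof -
  obtain K B where K: "finite K" "{0, 1} \<subseteq> K" "K \<subseteq> {0..1::real}" "B \<ge> 0"
    "\<And>u. u \<in> {0..1} - K \<Longrightarrow> (\<gamma> has_vector_derivative dg u) (at u)"
    "\<And>u. u \<in> {0..1} - K \<Longrightarrow> isCont (\<lambda>u. dg u) u"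
    "\<And>u. u \<in> {0..1} - K \<Longrightarrow> norm (dg u) \<le> B"
    "\<And>s t. s \<in> K \<Longrightarrow> t \<in> K \<Longrightarrow> s < t \<Longrightarrow> K \<inter> {s<..<t} = {} \<Longrightarrow> smooth_on_interval s t \<gamma>"
    by (rule piecewise_smooth_pieces[OF smooth]) (rule that)
  have "AE t in lborel. t \<notin> K" using finite_imp_null_set_lborel[OF K(1)] by (rule AE_not_in)
  then have "AE t in L. norm (dg t) \<le> B"
    unfolding AE_restrict_space_iff[of "{0<..<1::real}" lborel, simplified]
    by eventually_elim (use K(7) in auto)
  then show ?thesis using that K(4) by blast
qed

lemma open_arc_borel [measurable]: "open_arc \<gamma> \<in> sets borel"
proof -
  have "open_arc \<gamma> = \<gamma> ` {0..1} - {\<gamma> 0, \<gamma> 1}"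
  proof (intro equalityI subsetI)
    fix z assume "z \<in> open_arc \<gamma>"
    then obtain t where t: "t \<in> {0<..<1}" "z = \<gamma> t" by (auto simp: open_arc_def)
    then show "z \<in> \<gamma> ` {0..1} - {\<gamma> 0, \<gamma> 1}" using inj_onD[OF inj, of t 0] inj_onD[OF inj, of t 1] by auto
  next
    fix z assume "z \<in> \<gamma> ` {0..1} - {\<gamma> 0, \<gamma> 1}"
    then obtain t where t: "t \<in> {0..1}" "z = \<gamma> t" "z \<noteq> \<gamma> 0" "z \<noteq> \<gamma> 1" by auto
    then have "t \<noteq> 0" "t \<noteq> 1" by auto
    then show "z \<in> open_arc \<gamma>" unfolding open_arc_def using t by auto
  qed
  moreover have "closed (\<gamma> ` {0..1})" by (intro compact_imp_closed compact_continuous_image cont) simp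
  ultimately show ?thesis by auto
qed

lemma space_M: "space M = open_arc \<gamma>"
  by (simp add: arclen_def space_restrict_space)

lemma sets_M: "sets M = sets (restrict_space borel (open_arc \<gamma>))"
  by (simp add: arclen_def)

lemma sets_M_borel: "\<delta> \<in> sets borel \<Longrightarrow> \<delta> \<inter> space M \<in> sets M"
  by (auto simp: sets_M space_M sets_restrict_space)

lemma sets_M_imp_borel: "\<delta> \<in> sets M \<Longrightarrow> \<delta> \<in> sets borel"
  by (auto simp: sets_M sets_restrict_space)

lemma id_measurable_M: "(\<lambda>z. z) \<in> borel_measurable M"
  by (subst measurable_cong_sets[OF sets_M refl]) (rule measurable_restrict_space1, simp)

lemma gamma_measurable: "\<gamma> \<in> measurable L (restrict_space borel (open_arc \<gamma>))"
proof (rule measurable_restrict_space2)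
  show "\<gamma> \<in> space L \<rightarrow> open_arc \<gamma>" by (auto simp: space_restrict_space open_arc_def)
  have "continuous_on {0<..<1} \<gamma>" by (rule continuous_on_subset[OF cont]) auto
  then have "\<gamma> \<in> borel_measurable (restrict_space borel {0<..<1})" by (rule borel_measurable_continuous_on_restrict)
  moreover have "sets L = sets (restrict_space borel {0<..<1})" by (intro sets_restrict_space_cong) simp
  ultimately show "\<gamma> \<in> borel_measurable L" by (subst measurable_cong_sets[OF _ refl]) auto
qed

lemma gamma_measurable_M: "\<gamma> \<in> measurable L M"
  by (subst measurable_cong_sets[OF refl sets_M]) (rule gamma_measurable)

lemma nn_integral_M:
  assumes "f \<in> borel_measurable M"
  shows "nn_integral M f = (\<integral>\<^sup>+t. ennreal (norm (dg t)) * f (\<gamma> t) \<partial>L)"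
proof -
  have f: "f \<in> borel_measurable (restrict_space borel (open_arc \<gamma>))"
    using assms by (subst (asm) measurable_cong_sets[OF sets_M refl])
  show ?thesis
    unfolding arclen_def
    by (subst nn_integral_distr) (use f gamma_measurable in \<open>auto intro!: nn_integral_density measurable_compose[OF gamma_measurable f]\<close>)
qed

lemma integral_M:
  fixes f :: "complex \<Rightarrow> 'b::{banach, second_countable_topology}"
  assumes "f \<in> borel_measurable M"
  shows "integrable M f \<longleftrightarrow> integrable L (\<lambda>t. norm (dg t) *\<^sub>R f (\<gamma> t))"
    "(LINT z|M. f z) = (LINT t|L. norm (dg t) *\<^sub>R f (\<gamma> t))"
proof -
  have f: "f \<in> borel_measurable (restrict_space borel (open_arc \<gamma>))"
    using assms by (subst (asm) measurable_cong_sets[OF sets_M refl])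
  have fg: "(\<lambda>t. f (\<gamma> t)) \<in> borel_measurable L" by (rule measurable_compose[OF gamma_measurable f])
  have d: "(\<lambda>t. norm (dg t)) \<in> borel_measurable L" by measurable
  show "integrable M f \<longleftrightarrow> integrable L (\<lambda>t. norm (dg t) *\<^sub>R f (\<gamma> t))"
    unfolding arclen_def
    by (subst integrable_distr_eq) (use f gamma_measurable integrable_density[OF fg d] in simp_all)
  show "(LINT z|M. f z) = (LINT t|L. norm (dg t) *\<^sub>R f (\<gamma> t))"
    unfolding arclen_def
    by (subst integral_distr) (use f gamma_measurable integral_density[OF fg d] in simp_all)
qed

lemma finite_measure_M: "finite_measure M"
proof (rule finite_measureI)
  obtain B where B: "B \<ge> 0" "AE t in L. norm (dg t) \<le> B" by (rule dg_bounded)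
  have "emeasure M (space M) = (\<integral>\<^sup>+z. 1 \<partial>M)" by simp
  also have "\<dots> = (\<integral>\<^sup>+t. ennreal (norm (dg t)) * 1 \<partial>L)" by (rule nn_integral_M) simp
  also have "\<dots> \<le> (\<integral>\<^sup>+t. ennreal B \<partial>L)"
    by (rule nn_integral_mono_AE) (use B in \<open>auto elim: eventually_mono intro!: ennreal_leI\<close>)
  also have "\<dots> < \<infinity>" by (simp add: emeasure_restrict_space space_restrict_space ennreal_mult_less_top)
  finally show "emeasure M (space M) \<noteq> \<infinity>" by simp
qed

lemma has_integral_L:
  fixes f :: "real \<Rightarrow> 'b::euclidean_space"
  assumes "integrable L f" shows "(f has_integral (LINT t|L. f t)) {0..1}"
proof -
  have i: "integrable lborel (\<lambda>t. indicator {0<..<1} t *\<^sub>R f t)"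
    using assms by (simp add: integrable_restrict_space)
  have "((\<lambda>t. indicator {0<..<1} t *\<^sub>R f t) has_integral (LINT t|L. f t)) UNIV"
    using has_integral_integral_lborel[OF i] by (simp add: integral_restrict_space)
  moreover have "(\<lambda>t. indicator {0<..<1} t *\<^sub>R f t) = (\<lambda>t. if t \<in> {0<..<1} then f t else 0)"
    by (auto simp: indicator_def)
  ultimately have "(f has_integral (LINT t|L. f t)) {0<..<1}" by (simp only: has_integral_restrict_UNIV)
  then show ?thesis by (simp add: has_integral_Icc_iff_Ioo)
qed

subsection \<open>The direction of the arc\<close>

text \<open>The unit tangent as a function on the arc: \<open>d\<lambda> = \<tau>(\<lambda>) |d\<lambda>|\<close>. The value where the
  derivative vanishes does not influence integrals; it is chosen to make \<open>\<tau>\<close> unimodular.\<close>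

definition tangent :: "complex \<Rightarrow> complex" where
  "tangent z = (let v = dg (inv_into {0..1} \<gamma> z) in if v = 0 then 1 else sgn v)"

lemma norm_tangent [simp]: "cmod (tangent z) = 1"
  by (simp add: tangent_def Let_def norm_sgn)

lemma tangent_gamma: "t \<in> {0..1} \<Longrightarrow> norm (dg t) *\<^sub>R tangent (\<gamma> t) = dg t"
  by (simp add: tangent_def Let_def inv_into_f_f[OF inj] sgn_div_norm)

lemma tangent_measurable: "tangent \<in> borel_measurable M"
proof -
  have inv: "inv_into {0..1} \<gamma> \<in> measurable M L"
  proof -
    have "continuous_on (\<gamma> ` {0..1}) (inv_into {0..1} \<gamma>)"
      by (rule continuous_on_inv) (auto simp: cont inv_into_f_f[OF inj])
    then have "continuous_on (open_arc \<gamma>) (inv_into {0..1} \<gamma>)"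
      by (rule continuous_on_subset) (auto simp: open_arc_def)
    then have "inv_into {0..1} \<gamma> \<in> borel_measurable M"
      by (subst measurable_cong_sets[OF sets_M refl]) (rule borel_measurable_continuous_on_restrict)
    moreover have "inv_into {0..1} \<gamma> \<in> space M \<rightarrow> {0<..<1}"
      by (auto simp: space_M open_arc_def inv_into_f_f[OF inj])
    ultimately show ?thesis by (intro measurable_restrict_space2) auto
  qed
  have "(\<lambda>t. if dg t = 0 then 1 else sgn (dg t)) \<in> borel_measurable L"
    unfolding sgn_div_norm by measurable
  from measurable_compose[OF inv this] show ?thesis by (simp add: tangent_def[abs_def] Let_def)
qed

subsection \<open>Strongly measurable functions on the arc\<close>

lemma strongly_measurable_id_M: "strongly_measurable M (\<lambda>z. z)"
  by (rule strongly_measurable_borel[OF id_measurable_M])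

lemma strongly_measurable_isCont_M:
  "(\<And>z. z \<in> open_arc \<gamma> \<Longrightarrow> isCont f z) \<Longrightarrow> strongly_measurable M f"
  using strongly_measurable_isCont[OF strongly_measurable_id_M, of f] by (simp add: space_M)

lemma has_arc_integral_scalar:
  assumes g: "integrable M g"
  shows "((\<lambda>t. dg t * g (\<gamma> t)) has_integral (LINT z|M. tangent z * g z)) {0..1}"
proof -
  note [measurable] = tangent_measurable borel_measurable_integrable[OF g]
  have m: "(\<lambda>z. tangent z * g z) \<in> borel_measurable M" by measurable
  have i: "integrable M (\<lambda>z. tangent z * g z)"
    by (rule Bochner_Integration.integrable_bound[OF g m]) (simp add: norm_mult)
  have "((\<lambda>t. norm (dg t) *\<^sub>R (tangent (\<gamma> t) * g (\<gamma> t))) has_integral (LINT z|M. tangent z * g z)) {0..1}"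
    using has_integral_L[OF iffD1[OF integral_M(1)[OF m] i]] integral_M(2)[OF m] by simp
  then show ?thesis
    by (rule has_integral_eq[rotated]) (simp add: tangent_gamma flip: mult_scaleR_left)
qed

lemma has_integral_arclen:
  assumes g: "integrable M g"
  shows "((\<lambda>t. norm (dg t) * g (\<gamma> t)) has_integral (LINT z|M. g z :: real)) {0..1}"
  using has_integral_L[OF iffD1[OF integral_M(1) g]] integral_M(2)[OF borel_measurable_integrable[OF g]]
    borel_measurable_integrable[OF g] by simp

text \<open>Resetting the approximating functions to \<open>0\<close> where they exceed twice the norm of \<open>f\<close> keeps the
  pointwise limit and makes dominated convergence applicable.\<close>

lemma simple_function_approx:
  fixes f :: "complex \<Rightarrow> 'v::real_normed_vector"
  assumes f: "strongly_measurable M f" and i: "integrable M (\<lambda>z. norm (f z))"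
  obtains s where "\<And>n::nat. simple_function M (s n)" "\<And>n. integrable M (\<lambda>z. norm (f z - s n z))"
    "(\<lambda>n. LINT z|M. norm (f z - s n z)) \<longlonglongrightarrow> 0"
proof -
  obtain s where s: "\<And>n::nat. simple_function M (s n)" "\<And>z. z \<in> space M \<Longrightarrow> (\<lambda>n. s n z) \<longlonglongrightarrow> f z"
    using f unfolding strongly_measurable_def by blast
  define r where "r n z = (if norm (s n z) \<le> 2 * norm (f z) then s n z else 0)" for n z
  have sn: "strongly_measurable M (s n)" for n by (rule strongly_measurable_tendsto[where s = "\<lambda>_. s n"]) (use s in auto)
  have r: "simple_function M (r n)" for n
    unfolding r_def
  proof (rule simple_function_If)
    show "{x \<in> space M. norm (s n x) \<le> 2 * norm (f x)} \<in> sets M"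
      using borel_measurable_norm_strongly[OF sn] borel_measurable_norm_strongly[OF f] by measurable
  qed (use s in auto)
  have rn: "strongly_measurable M (r n)" for n by (rule strongly_measurable_tendsto[where s = "\<lambda>_. r n"]) (use r in auto)
  have m: "(\<lambda>z. norm (f z - r n z)) \<in> borel_measurable M" for n
    by (intro borel_measurable_norm_strongly strongly_measurable_diff f rn)
  have le: "norm (f z - r n z) \<le> 3 * norm (f z)" for n z
  proof -
    have "norm (r n z) \<le> 2 * norm (f z)" by (simp add: r_def)
    then show ?thesis using norm_triangle_ineq4[of "f z" "r n z"] by linarith
  qed
  have lim: "(\<lambda>n. norm (f z - r n z)) \<longlonglongrightarrow> 0" if z: "z \<in> space M" for z
  proof -
    have ev: "eventually (\<lambda>n. s n z = r n z) sequentially" if "f z \<noteq> 0"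
    proof -
      have "(\<lambda>n. norm (s n z)) \<longlonglongrightarrow> norm (f z)" by (intro tendsto_norm s z)
      then have "eventually (\<lambda>n. norm (s n z) < 2 * norm (f z)) sequentially"
        by (rule order_tendstoD) (use that in simp)
      then show ?thesis by eventually_elim (simp add: r_def)
    qed
    have "(\<lambda>n. r n z) \<longlonglongrightarrow> f z"
    proof (cases "f z = 0")
      case True
      then have "(\<lambda>n. r n z) = (\<lambda>n. 0)" by (auto simp: r_def)
      then show ?thesis using True by simp
    next
      case False
      show ?thesis by (rule Lim_transform_eventually[OF s(2)[OF z] ev[OF False]])
    qed
    then have "(\<lambda>n. f z - r n z) \<longlonglongrightarrow> f z - f z" by (intro tendsto_diff tendsto_const)
    then show ?thesis by (simp add: tendsto_norm_zero)
  qed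
  have dom: "integrable M (\<lambda>z. 3 * norm (f z))" using i by simp
  have "integrable M (\<lambda>z. norm (f z - r n z))" for n
    by (rule Bochner_Integration.integrable_bound[OF dom m]) (use le in auto)
  moreover have "(\<lambda>n. LINT z|M. norm (f z - r n z)) \<longlonglongrightarrow> (LINT z|M. 0)"
    by (rule integral_dominated_convergence[where w = "\<lambda>z. 3 * norm (f z)"]) (use m dom lim le in auto)
  ultimately show ?thesis using that[OF r] by simp
qed

lemma arc_integrable_simple:
  fixes s :: "complex \<Rightarrow> 'v::cnormed"
  assumes s: "simple_function M s"
  shows "\<exists>I. ((\<lambda>t. if t \<in> {0<..<1} then dg t *\<^sub>C s (\<gamma> t) else 0) has_integral I) {0..1}"
proof -
  interpret finite_measure M by (rule finite_measure_M)
  define R where "R = s ` space M"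
  have finR: "finite R" using s by (simp add: R_def simple_function_def)
  define U where "U v = s -` {v} \<inter> space M" for v
  have U: "U v \<in> sets M" for v
  proof (cases "v \<in> s ` space M")
    case True
    then show ?thesis using s by (auto simp: U_def simple_function_def)
  next
    case False
    then have "U v = {}" by (auto simp: U_def)
    then show ?thesis by simp
  qed
  have "((\<lambda>t. (dg t * complex_of_real (indicat_real (U v) (\<gamma> t))) *\<^sub>C v)
      has_integral (LINT z|M. tangent z * complex_of_real (indicat_real (U v) z)) *\<^sub>C v) {0..1}" for v
  proof -
    have "integrable M (\<lambda>z. complex_of_real (indicat_real (U v) z))"
      using U[of v] by (simp add: integrable_indicator_iff emeasure_eq_measure)
    from has_integral_linear[OF has_arc_integral_scalar[OF this] bounded_bilinear.bounded_linear_left[OF bounded_bilinear_scaleC, of v]]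
    show ?thesis by (simp add: o_def)
  qed
  then have "((\<lambda>t. \<Sum>v\<in>R. (dg t * complex_of_real (indicat_real (U v) (\<gamma> t))) *\<^sub>C v)
      has_integral (\<Sum>v\<in>R. (LINT z|M. tangent z * complex_of_real (indicat_real (U v) z)) *\<^sub>C v)) {0..1}"
    by (intro has_integral_sum finR) auto
  moreover have "(\<Sum>v\<in>R. (dg t * complex_of_real (indicat_real (U v) (\<gamma> t))) *\<^sub>C v) = dg t *\<^sub>C s (\<gamma> t)"
    if t: "t \<in> {0<..<1}" for t
  proof -
    have sp: "\<gamma> t \<in> space M" using t by (auto simp: space_M open_arc_def)
    have "(\<Sum>v\<in>R. (dg t * complex_of_real (indicat_real (U v) (\<gamma> t))) *\<^sub>C v)
        = (\<Sum>v\<in>R. if v = s (\<gamma> t) then dg t *\<^sub>C s (\<gamma> t) else 0)"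
      by (rule sum.cong) (use sp in \<open>auto simp: U_def indicator_def\<close>)
    also have "\<dots> = dg t *\<^sub>C s (\<gamma> t)" using finR sp by (simp add: R_def)
    finally show ?thesis .
  qed
  ultimately have "((\<lambda>t. if t \<in> {0<..<1} then dg t *\<^sub>C s (\<gamma> t) else 0)
      has_integral (\<Sum>v\<in>R. (LINT z|M. tangent z * complex_of_real (indicat_real (U v) z)) *\<^sub>C v)) {0..1}"
    by (elim has_integral_spike_finite[of "{0, 1}", rotated 2]) auto
  then show ?thesis by blast
qed

text \<open>For simple functions the integral is a finite combination of scalar integrals; the general case
  follows by approximation in the mean.\<close>

lemma arc_integrable:
  fixes f :: "complex \<Rightarrow> 'v::{cnormed, banach}"
  assumes f: "strongly_measurable M f" and i: "integrable M (\<lambda>z. norm (f z))"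
  shows "has_arc_integral f (arc_integral \<gamma> f) \<gamma>"
proof -
  obtain s where s: "\<And>n::nat. simple_function M (s n)" "\<And>n. integrable M (\<lambda>z. norm (f z - s n z))"
    "(\<lambda>n. LINT z|M. norm (f z - s n z)) \<longlonglongrightarrow> 0"
    using simple_function_approx[OF assms] by blast
  obtain I where I: "\<And>n. ((\<lambda>t. if t \<in> {0<..<1} then dg t *\<^sub>C s n (\<gamma> t) else 0) has_integral I n) {0..1}"
    using arc_integrable_simple[OF s(1)] by metis
  have "(\<lambda>t. if t \<in> {0<..<1} then dg t *\<^sub>C f (\<gamma> t) else 0) integrable_on {0..1}"
  proof (rule has_integral_mean_limit[OF I has_integral_arclen[OF s(2)] _ s(3)])
    show "norm ((if t \<in> {0<..<1} then dg t *\<^sub>C f (\<gamma> t) else 0) - (if t \<in> {0<..<1} then dg t *\<^sub>C s n (\<gamma> t) else 0))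
        \<le> norm (dg t) * norm (f (\<gamma> t) - s n (\<gamma> t))" for n t
      by (simp add: norm_scaleC flip: scaleC_diff_right)
  qed
  then have "(\<lambda>t. dg t *\<^sub>C f (\<gamma> t)) integrable_on {0..1}"
    by (rule integrable_spike_finite[of "{0, 1}", rotated 2]) auto
  then show ?thesis unfolding has_arc_integral_def arc_integral_def by (rule integrable_integral)
qed

lemma arc_integral_norm_le:
  fixes f :: "complex \<Rightarrow> 'v::{cnormed, banach}"
  assumes f: "strongly_measurable M f" and i: "integrable M (\<lambda>z. norm (f z))"
  shows "norm (arc_integral \<gamma> f) \<le> (LINT z|M. norm (f z))"
proof -
  have "norm (arc_integral \<gamma> f) \<le> integral {0..1} (\<lambda>t. norm (dg t) * norm (f (\<gamma> t)))"
    unfolding arc_integral_def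
    by (rule integral_norm_bound_integral)
      (use arc_integrable[OF assms] has_integral_arclen[OF i] in \<open>auto simp: has_arc_integral_def norm_scaleC\<close>)
  then show ?thesis using has_integral_arclen[OF i] by (simp add: integral_unique)
qed

lemma arc_integral_linear:
  fixes f :: "complex \<Rightarrow> 'v::{cnormed, banach}" and h :: "'v \<Rightarrow> 'w::{cnormed}"
  assumes f: "strongly_measurable M f" and i: "integrable M (\<lambda>z. norm (f z))"
    and h: "bounded_linear h" "\<And>a x. h (a *\<^sub>C x) = a *\<^sub>C h x"
  shows "has_arc_integral (\<lambda>z. h (f z)) (h (arc_integral \<gamma> f)) \<gamma>"
  using has_integral_linear[OF arc_integrable[OF f i, unfolded has_arc_integral_def] h(1)]
  by (simp add: has_arc_integral_def o_def h(2))

lemma arc_integral_eqI: "has_arc_integral f I \<gamma> \<Longrightarrow> arc_integral \<gamma> f = I"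
  by (simp add: has_arc_integral_def arc_integral_def integral_unique)

lemma arc_integral_functional:
  fixes f :: "complex \<Rightarrow> 'v::{cnormed, banach}" and h :: "'v \<Rightarrow> complex"
  assumes f: "strongly_measurable M f" and i: "integrable M (\<lambda>z. norm (f z))"
    and h: "bounded_linear h" "\<And>a x. h (a *\<^sub>C x) = a * h x"
  shows "h (arc_integral \<gamma> f) = (LINT z|M. tangent z * h (f z))"
proof -
  have hi: "((\<lambda>t. dg t * h (f (\<gamma> t))) has_integral h (arc_integral \<gamma> f)) {0..1}"
    using arc_integral_linear[OF f i h(1)] h(2) by (simp add: has_arc_integral_def scaleC_complex_def)
  obtain K where K: "\<And>x. norm (h x) \<le> norm x * K" using bounded_linear.bounded[OF h(1)] by blast
  have sm: "strongly_measurable M (\<lambda>z. h (f z))"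
    by (rule strongly_measurable_isCont[OF f]) (rule linear_continuous_at[OF h(1)])
  have "integrable M (\<lambda>z. norm (f z) * K)" using i by simp
  then have "integrable M (\<lambda>z. h (f z))"
    by (rule Bochner_Integration.integrable_bound) (use borel_measurable_strongly[OF sm] K in \<open>auto intro!: AE_I2 order_trans[OF K abs_ge_self]\<close>)
  from has_integral_unique[OF hi has_arc_integral_scalar[OF this]] show ?thesis .
qed

lemma arc_integral_add:
  fixes f g :: "complex \<Rightarrow> 'v::{cnormed, banach}"
  assumes "strongly_measurable M f" "integrable M (\<lambda>z. norm (f z))" "strongly_measurable M g" "integrable M (\<lambda>z. norm (g z))"
  shows "arc_integral \<gamma> (\<lambda>z. f z + g z) = arc_integral \<gamma> f + arc_integral \<gamma> g"
  using has_integral_add[OF arc_integrable[OF assms(1,2), unfolded has_arc_integral_def]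
      arc_integrable[OF assms(3,4), unfolded has_arc_integral_def]]
  by (intro arc_integral_eqI) (simp add: has_arc_integral_def scaleC_add_right)

lemma arc_integral_diff:
  fixes f g :: "complex \<Rightarrow> 'v::{cnormed, banach}"
  assumes "strongly_measurable M f" "integrable M (\<lambda>z. norm (f z))" "strongly_measurable M g" "integrable M (\<lambda>z. norm (g z))"
  shows "arc_integral \<gamma> (\<lambda>z. f z - g z) = arc_integral \<gamma> f - arc_integral \<gamma> g"
  using has_integral_diff[OF arc_integrable[OF assms(1,2), unfolded has_arc_integral_def]
      arc_integrable[OF assms(3,4), unfolded has_arc_integral_def]]
  by (intro arc_integral_eqI) (simp add: has_arc_integral_def scaleC_diff_right)

lemma integrable_norm_diff:
  fixes f g :: "complex \<Rightarrow> 'v::real_normed_vector"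
  assumes "strongly_measurable M f" "integrable M (\<lambda>z. norm (f z))" "strongly_measurable M g" "integrable M (\<lambda>z. norm (g z))"
  shows "integrable M (\<lambda>z. norm (f z - g z))"
  by (rule Bochner_Integration.integrable_bound[OF Bochner_Integration.integrable_add[OF assms(2,4)]])
    (use assms in \<open>auto intro!: borel_measurable_norm_strongly strongly_measurable_diff norm_triangle_ineq4 AE_I2\<close>)

lemma arc_integral_cong_AE:
  fixes f g :: "complex \<Rightarrow> 'v::{cnormed, banach}"
  assumes f: "strongly_measurable M f" "integrable M (\<lambda>z. norm (f z))" and g: "strongly_measurable M g"
    and eq: "AE z in M. f z = g z"
  shows "arc_integral \<gamma> f = arc_integral \<gamma> g"
proof -
  have gi: "integrable M (\<lambda>z. norm (g z))"
    by (rule integrable_cong_AE_imp[OF f(2)])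
      (use eq borel_measurable_norm_strongly[OF g] in auto)
  have "norm (arc_integral \<gamma> f - arc_integral \<gamma> g) \<le> (LINT z|M. norm (f z - g z))"
    unfolding arc_integral_diff[OF f g gi, symmetric]
    by (rule arc_integral_norm_le) (intro strongly_measurable_diff integrable_norm_diff f g gi)+
  also have "\<dots> = (LINT z|M. 0)"
    by (rule integral_cong_AE)
      (use eq borel_measurable_norm_strongly[OF strongly_measurable_diff[OF f(1) g]] in auto)
  finally show ?thesis by simp
qed

end

section \<open>Measurability of the adjoint\<close>

text \<open>Simple functions approximating an operator-valued function need not have complex-linear
  values. Projecting onto the complex-linear operators first makes the adjoint a continuous map
  on all operators.\<close>

definition clin_part :: "('a::cnormed \<Rightarrow>\<^sub>L 'b::cnormed) \<Rightarrow> ('a \<Rightarrow>\<^sub>L 'b)" where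
  "clin_part T = (1/2) *\<^sub>R (T - ((\<i> *\<^sub>C id_blinfun) o\<^sub>L T o\<^sub>L (\<i> *\<^sub>C id_blinfun)))"

lemma clin_part_apply:
  "blinfun_apply (clin_part T) x = (1/2) *\<^sub>R (blinfun_apply T x - \<i> *\<^sub>C blinfun_apply T (\<i> *\<^sub>C x))"
  by (simp add: clin_part_def blinfun.scaleR_left blinfun.diff_left scaleC_blinfun_apply)

lemma clinear_op_clin_part: "clinear_op (clin_part T)"
  unfolding clinear_op_def
proof (intro allI)
  fix a x
  have i: "blinfun_apply (clin_part T) (\<i> *\<^sub>C y) = \<i> *\<^sub>C blinfun_apply (clin_part T) y" for y
    by (simp add: clin_part_apply scaleC_scaleC scaleC_minus_left blinfun.minus_right scaleC_minus_right
        scaleC_diff_right scaleR_scaleC mult.commute)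
      (simp add: scaleC_add_right scaleC_scaleC mult.commute)
  have "a *\<^sub>C y = Re a *\<^sub>R y + Im a *\<^sub>R (\<i> *\<^sub>C y)" for y :: "'c::cnormed"
    using complex_eq[of a] by (simp add: scaleR_scaleC scaleC_scaleC scaleC_add_left[symmetric] mult.commute)
  then show "blinfun_apply (clin_part T) (a *\<^sub>C x) = a *\<^sub>C blinfun_apply (clin_part T) x"
    by (metis i blinfun.add_right blinfun.scaleR_right)
qed

lemma clin_part_eq: "clinear_op T \<Longrightarrow> clin_part T = T"
  by (rule blinfun_eqI)
    (simp add: clin_part_apply clinear_op_def scaleC_scaleC scaleC_minus_left scaleR_2[symmetric] flip: scaleR_scaleC)

lemma clin_part_diff: "clin_part (S - T) = clin_part S - clin_part T"
  by (rule blinfun_eqI) (simp add: clin_part_apply blinfun.diff_left scaleC_diff_right scaleR_diff_right)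

lemma norm_clin_part: "norm (clin_part T) \<le> norm T"
proof (rule norm_blinfun_bound)
  fix x
  have "norm (blinfun_apply T x - \<i> *\<^sub>C blinfun_apply T (\<i> *\<^sub>C x)) \<le> norm T * norm x + norm T * norm x"
    using norm_triangle_ineq4[of "blinfun_apply T x" "\<i> *\<^sub>C blinfun_apply T (\<i> *\<^sub>C x)"]
      norm_blinfun[of T x] norm_blinfun[of T "\<i> *\<^sub>C x"] unfolding norm_scaleC norm_ii by linarith
  then show "norm (blinfun_apply (clin_part T) x) \<le> norm T * norm x" by (simp add: clin_part_apply mult.commute)
qed simp

lemma isCont_adj_clin_part:
  "isCont (\<lambda>T :: 'a::chilbert \<Rightarrow>\<^sub>L 'b::chilbert. adj (clin_part T)) S"
proof -
  have "((\<lambda>T. adj (clin_part T) - adj (clin_part S)) \<longlongrightarrow> 0) (at S)"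
  proof (rule Lim_null_comparison)
    show "\<forall>\<^sub>F T in at S. norm (adj (clin_part T) - adj (clin_part S)) \<le> norm (T - S)"
      using norm_clin_part
      by (intro always_eventually allI)
        (simp add: adj_diff[symmetric] clinear_op_clin_part clin_part_diff[symmetric] norm_adj)
    show "((\<lambda>T. norm (T - S)) \<longlongrightarrow> 0) (at S)"
      by (intro tendsto_norm_zero LIM_zero) (rule tendsto_ident_at)
  qed
  then show ?thesis by (simp add: isCont_def LIM_zero_iff)
qed

lemma strongly_measurable_adj:
  fixes K :: "'p \<Rightarrow> 'a::chilbert \<Rightarrow>\<^sub>L 'b::chilbert"
  assumes "strongly_measurable M K" "\<And>z. z \<in> space M \<Longrightarrow> clinear_op (K z)"
  shows "strongly_measurable M (\<lambda>z. adj (K z))"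
  by (rule strongly_measurable_cong[OF strongly_measurable_isCont[OF assms(1) isCont_adj_clin_part]])
    (simp add: clin_part_eq assms(2))

lemma L2_nondegenerate:
  assumes F: "F \<in> vecs (L2 M)" and G: "G \<in> vecs (L2 M)"
    and eq: "\<And>H. H \<in> vecs (L2 M) \<Longrightarrow> vinner (L2 M) H F = vinner (L2 M) H G"
  shows "F = G"
proof -
  obtain f g where f: "f \<in> L2_fun M" "F = L2_class M f" and g: "g \<in> L2_fun M" "G = L2_class M g"
    using F G by (auto simp: vecs_L2)
  have gm: "(\<lambda>x. - g x) \<in> L2_fun M" using L2_fun_scaleC[OF g(1), of "-1"] by (simp add: scaleC_minus_left)
  have h: "(\<lambda>x. f x - g x) \<in> L2_fun M" using L2_fun_add[OF f(1) gm] by simp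
  have "(LINT x|M. cinner (f x - g x) (f x)) = (LINT x|M. cinner (f x - g x) (g x))"
    using eq[OF L2_class_in[OF h]] by (simp add: f(2) g(2) vinner_L2_class[OF h f(1)] vinner_L2_class[OF h g(1)])
  then have "(LINT x|M. cinner (f x - g x) (f x - g x)) = 0"
    using integrable_cinner(1)[OF h f(1)] integrable_cinner(1)[OF h g(1)]
    by (subst cinner_diff_right) simp
  then have "vinner (L2 M) (L2_class M (\<lambda>x. f x - g x)) (L2_class M (\<lambda>x. f x - g x)) = 0"
    by (simp add: vinner_L2_class[OF h h])
  then have "AE x in M. f x - g x = 0" by (intro vnorm_eq_0_L2[OF h]) (simp add: vnorm_def)
  then show ?thesis unfolding f(2) g(2) by (intro L2_class_cong) simp
qed

section \<open>The E-norm\<close>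

context smooth_arc
begin

lemma L2_kernel_norm_integrable:
  assumes F: "L2_kernel M F" shows "integrable M (\<lambda>z. norm (F z))"
proof -
  interpret finite_measure M by (rule finite_measure_M)
  show ?thesis
  proof (rule Bochner_Integration.integrable_bound)
    show "integrable M (\<lambda>z. 1 + (norm (F z))\<^sup>2)" using L2_kernelD(3)[OF F] by simp
    have "x \<le> 1 + x\<^sup>2" for x :: real
      using zero_le_power2[of "x - 1/2"] by (simp add: power2_diff power2_eq_square algebra_simps)
    then show "AE z in M. norm (norm (F z)) \<le> norm (1 + (norm (F z))\<^sup>2)" by auto
  qed (rule borel_measurable_norm_strongly[OF L2_kernelD(1)[OF F]])
qed

text \<open>For a multiplication operator \<open>S\<close> with kernel \<open>F\<close>, the norm of \<open>S\<^sup>* E(\<delta>) S\<close> is at most the integral of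
  \<open>(norm (F z))\<^sup>2\<close> over \<open>\<delta>\<close>, whence the upper bound. The integral of operators may have a norm smaller
  than the integral of the norms, but not by much on a set where one vector almost attains all the
  norms of \<open>F z\<close>. Countably many such sets cover the arc, whence the lower bound.\<close>

lemma E_norm_mult_op:
  assumes F: "L2_kernel M F"
  shows "E_norm \<gamma> (mult_op M F) = ennreal (sqrt (LINT z|M. (norm (F z))\<^sup>2))"
proof -
  define Q where "Q \<delta> = (\<lambda>x. op_adjoint whole (L2 M) (mult_op M F) (spectral_proj \<gamma> \<delta> (mult_op M F x)))" for \<delta>
  define I where "I = (LINT z|M. (norm (F z))\<^sup>2)"
  define \<Delta> where "\<Delta> = {\<delta> :: nat \<Rightarrow> complex set. (\<forall>j. \<delta> j \<in> sets borel \<and> \<delta> j \<subseteq> path_image \<gamma>) \<and> disjoint_family \<delta>}"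
  have Q: "Q \<delta> = (\<lambda>x. op_adjoint whole (L2 M) (mult_op M F)
      (L2_class M (\<lambda>z. indicat_real \<delta> z *\<^sub>R rep (mult_op M F x) z)))" for \<delta>
    unfolding Q_def spectral_proj_def using bounded_opsD(1)[OF mult_op_bounded(1)[OF F]] by simp
  note comp = mult_op_compression[OF F sets_M_borel, folded Q]
  have I0: "I \<ge> 0" by (auto simp: I_def intro!: integral_nonneg_AE)
  have iF: "integrable M (\<lambda>z. (norm (F z))\<^sup>2)" by (rule L2_kernelD(3)[OF F])
  have mF: "(\<lambda>z. norm (F z)) \<in> borel_measurable M" by (rule borel_measurable_norm_strongly[OF L2_kernelD(1)[OF F]])
  have ind_int: "integrable M (\<lambda>z. indicat_real \<delta> z * g z)" if "\<delta> \<in> sets borel" "integrable M g"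
    for g :: "complex \<Rightarrow> real" and \<delta>
  proof -
    have "integrable M (\<lambda>z. indicat_real (\<delta> \<inter> space M) z *\<^sub>R g z)"
      using integrable_mult_indicator[OF sets_M_borel[OF that(1)] that(2)] by simp
    then show ?thesis
      by (rule Bochner_Integration.integrable_cong[THEN iffD1, rotated 2]) (auto simp: indicator_def)
  qed
  have upper: "(\<Sum>j. ennreal (op_norm whole whole (Q (\<delta> j)))) \<le> ennreal I" if \<delta>: "\<delta> \<in> \<Delta>" for \<delta>
  proof (rule suminf_le_const[OF summableI])
    fix n
    have b: "\<delta> j \<in> sets borel" for j using \<delta> by (auto simp: \<Delta>_def)
    have "(\<Sum>j<n. op_norm whole whole (Q (\<delta> j))) \<le> (\<Sum>j<n. LINT z|M. indicat_real (\<delta> j) z * (norm (F z))\<^sup>2)"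
      by (intro sum_mono comp(2) b)
    also have "\<dots> = (LINT z|M. (\<Sum>j<n. indicat_real (\<delta> j) z * (norm (F z))\<^sup>2))"
      by (rule Bochner_Integration.integral_sum[symmetric]) (intro ind_int b iF)
    also have "\<dots> \<le> I"
      unfolding I_def
    proof (rule integral_mono)
      show "integrable M (\<lambda>z. \<Sum>j<n. indicat_real (\<delta> j) z * (norm (F z))\<^sup>2)"
        by (intro Bochner_Integration.integrable_sum ind_int b iF)
      fix z
      have "(\<Sum>j<n. indicat_real (\<delta> j) z) = indicat_real (\<Union>(\<delta> ` {..<n})) z"
        by (rule indicator_UN_disjoint[symmetric]) (use \<delta> in \<open>auto simp: \<Delta>_def disjoint_family_on_def\<close>)
      also have "\<dots> \<le> 1" by (simp add: indicator_def)
      finally show "(\<Sum>j<n. indicat_real (\<delta> j) z * (norm (F z))\<^sup>2) \<le> (norm (F z))\<^sup>2"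
        by (simp add: mult_left_le_one_le sum_distrib_right[symmetric] sum_nonneg)
    qed (rule iF)
    finally have "ennreal (\<Sum>j<n. op_norm whole whole (Q (\<delta> j))) \<le> ennreal I" by (rule ennreal_leI)
    then show "(\<Sum>j<n. ennreal (op_norm whole whole (Q (\<delta> j)))) \<le> ennreal I"
      by (subst sum_ennreal) (auto intro: comp(1) b)
  qed
  define S where "S = (SUP \<delta>\<in>\<Delta>. (\<Sum>j. ennreal (op_norm whole whole (Q (\<delta> j)))))"
  have S_le: "S \<le> ennreal I" unfolding S_def by (rule SUP_least) (rule upper)
  then have S_real: "S = ennreal (enn2real S)" by (metis ennreal_enn2real ennreal_less_top le_less_trans)
  define L1 where "L1 = (LINT z|M. norm (F z))"
  have L1: "L1 \<ge> 0" by (auto simp: L1_def intro!: integral_nonneg_AE)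
  \<comment> \<open>The loss \<open>6 \<epsilon> norm (F z)\<close> comes from the choice of one vector on each set of the partition.\<close>
  have lower: "I - 6 * \<epsilon> * L1 \<le> enn2real S" if \<epsilon>: "\<epsilon> > 0" for \<epsilon>
  proof -
    define h where "h z = (norm (F z))\<^sup>2 - 6 * \<epsilon> * norm (F z)" for z
    obtain \<delta> :: "nat \<Rightarrow> complex set" and x where \<delta>: "\<And>j. \<delta> j \<in> sets M" "disjoint_family \<delta>" "(\<Union>j. \<delta> j) = space M"
      and x: "\<And>j. norm (x j) \<le> 1"
        "\<And>j z. z \<in> \<delta> j \<Longrightarrow> (norm (F z))\<^sup>2 - 6 * \<epsilon> * norm (F z) \<le> (norm (blinfun_apply (F z) (x j)))\<^sup>2"
    proof (rule strongly_measurable_partition[OF L2_kernelD(1)[OF F] \<epsilon>], goal_cases)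
      case (1 \<delta> x)
      show ?thesis by (rule that[of \<delta> x, OF 1(2,3,4,5,6)])
    qed
    have b: "\<delta> j \<in> sets borel" for j by (rule sets_M_imp_borel[OF \<delta>(1)])
    have "\<delta> j \<subseteq> path_image \<gamma>" for j
      using sets.sets_into_space[OF \<delta>(1)] by (force simp: space_M open_arc_def path_image_def)
    then have in\<Delta>: "\<delta> \<in> \<Delta>" using b \<delta>(2) by (auto simp: \<Delta>_def)
    have hi: "integrable M h"
      unfolding h_def using iF L2_kernel_norm_integrable[OF F] by simp
    \<comment> \<open>The positive part allows countably many sets to be summed in extended nonnegative numbers.\<close>
    have hp: "integrable M (\<lambda>z. max 0 (h z))" using hi by simp
    have each: "(\<integral>\<^sup>+z. ennreal (max 0 (h z)) * indicator (\<delta> j) z \<partial>M) \<le> ennreal (op_norm whole whole (Q (\<delta> j)))" for j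
    proof -
      have i2: "integrable M (\<lambda>z. indicat_real (\<delta> j) z * (norm (blinfun_apply (F z) (x j)))\<^sup>2)"
        by (rule ind_int[OF b L2_funD(2)[OF L2_kernel_apply[OF F]]])
      have "(\<integral>\<^sup>+z. ennreal (max 0 (h z)) * indicator (\<delta> j) z \<partial>M)
          \<le> (\<integral>\<^sup>+z. ennreal (indicat_real (\<delta> j) z * (norm (blinfun_apply (F z) (x j)))\<^sup>2) \<partial>M)"
        by (rule nn_integral_mono) (auto simp: indicator_def h_def intro!: ennreal_leI x(2))
      also have "\<dots> = ennreal (LINT z|M. indicat_real (\<delta> j) z * (norm (blinfun_apply (F z) (x j)))\<^sup>2)"
        by (rule nn_integral_eq_integral[OF i2]) simp
      also have "\<dots> \<le> ennreal (op_norm whole whole (Q (\<delta> j)) * (norm (x j))\<^sup>2)"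
        by (intro ennreal_leI comp(3) b)
      also have "\<dots> \<le> ennreal (op_norm whole whole (Q (\<delta> j)))"
        using x(1)[of j] comp(1)[OF b] by (intro ennreal_leI mult_left_le) (auto simp: power_le_one)
      finally show ?thesis .
    qed
    have "ennreal (I - 6 * \<epsilon> * L1) = ennreal (LINT z|M. h z)"
      unfolding h_def I_def L1_def using iF L2_kernel_norm_integrable[OF F] by simp
    also have "\<dots> \<le> ennreal (LINT z|M. max 0 (h z))"
      by (intro ennreal_leI integral_mono hi hp) simp
    also have "\<dots> = (\<integral>\<^sup>+z. ennreal (max 0 (h z)) \<partial>M)"
      by (rule nn_integral_eq_integral[symmetric, OF hp]) simp
    also have "\<dots> = (\<integral>\<^sup>+z. (\<Sum>j. ennreal (max 0 (h z)) * indicator (\<delta> j) z) \<partial>M)"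
    proof (rule nn_integral_cong)
      fix z assume "z \<in> space M"
      then have "(\<Sum>j. indicator (\<delta> j) z :: ennreal) = 1"
        using suminf_indicator[OF \<delta>(2), of z] \<delta>(3) by simp
      then show "ennreal (max 0 (h z)) = (\<Sum>j. ennreal (max 0 (h z)) * indicator (\<delta> j) z)"
        by (simp add: ennreal_suminf_cmult)
    qed
    also have "\<dots> = (\<Sum>j. \<integral>\<^sup>+z. ennreal (max 0 (h z)) * indicator (\<delta> j) z \<partial>M)"
      by (rule nn_integral_suminf) (use borel_measurable_integrable[OF hp] \<delta>(1) in measurable)
    also have "\<dots> \<le> (\<Sum>j. ennreal (op_norm whole whole (Q (\<delta> j))))"
      by (intro suminf_le each summableI)
    also have "\<dots> \<le> S" unfolding S_def by (rule SUP_upper[OF in\<Delta>])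
    finally have "ennreal (I - 6 * \<epsilon> * L1) \<le> ennreal (enn2real S)" using S_real by simp
    then show ?thesis by (simp add: ennreal_le_iff)
  qed
  have "I \<le> enn2real S"
  proof (rule field_le_epsilon)
    fix e :: real assume e: "e > 0"
    have "6 * (e / (6 * (L1 + 1))) * L1 \<le> e" using L1 e by (simp add: field_simps)
    then show "I \<le> enn2real S + e" using lower[of "e / (6 * (L1 + 1))"] e L1 by simp
  qed
  then have "S = ennreal I" using S_le S_real by (metis antisym ennreal_leI)
  then have "E_norm \<gamma> (mult_op M F) = esqrt (ennreal I)"
    unfolding E_norm_def S_def \<Delta>_def Q_def by simp
  then show ?thesis using I0 by (simp add: esqrt_def I_def)
qed

section \<open>Integral operators\<close>

lemma kernel_apply:
  assumes K: "L2_kernel M K" and f: "f \<in> L2_fun M"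
  shows "strongly_measurable M (\<lambda>z. blinfun_apply (K z) (f z))" "integrable M (\<lambda>z. norm (blinfun_apply (K z) (f z)))"
    "(LINT z|M. norm (blinfun_apply (K z) (f z))) \<le> sqrt (LINT z|M. (norm (K z))\<^sup>2) * sqrt (LINT z|M. (norm (f z))\<^sup>2)"
proof -
  show sm: "strongly_measurable M (\<lambda>z. blinfun_apply (K z) (f z))"
    by (rule strongly_measurable_apply[OF L2_kernelD(1)[OF K] L2_funD(1)[OF f]])
  note CS = integral_Cauchy_Schwarz[OF borel_measurable_norm_strongly[OF L2_kernelD(1)[OF K]]
    borel_measurable_norm_strongly[OF L2_funD(1)[OF f]] L2_kernelD(3)[OF K] L2_funD(2)[OF f]]
  show i: "integrable M (\<lambda>z. norm (blinfun_apply (K z) (f z)))"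
    by (rule Bochner_Integration.integrable_bound[OF CS(1)])
      (use borel_measurable_norm_strongly[OF sm] in \<open>auto intro: norm_blinfun\<close>)
  have "(LINT z|M. norm (blinfun_apply (K z) (f z))) \<le> (LINT z|M. norm (K z) * norm (f z))"
    by (rule integral_mono[OF i CS(1)]) (rule norm_blinfun)
  then show "(LINT z|M. norm (blinfun_apply (K z) (f z))) \<le> sqrt (LINT z|M. (norm (K z))\<^sup>2) * sqrt (LINT z|M. (norm (f z))\<^sup>2)"
    using CS(2) by linarith
qed

lemma kernel_compose:
  fixes K :: "complex \<Rightarrow> 'h::chilbert \<Rightarrow>\<^sub>L 'a::chilbert" and G :: "complex \<Rightarrow> 'a \<Rightarrow>\<^sub>L 'h"
  assumes K: "L2_kernel M K" and G: "L2_kernel M G"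
  shows "strongly_measurable M (\<lambda>z. K z o\<^sub>L G z)" "integrable M (\<lambda>z. norm (K z o\<^sub>L G z))"
    "(LINT z|M. norm (K z o\<^sub>L G z)) \<le> sqrt (LINT z|M. (norm (K z))\<^sup>2) * sqrt (LINT z|M. (norm (G z))\<^sup>2)"
proof -
  show sm: "strongly_measurable M (\<lambda>z. K z o\<^sub>L G z)"
    by (rule strongly_measurable_compose[OF L2_kernelD(1)[OF K] L2_kernelD(1)[OF G]])
  note CS = integral_Cauchy_Schwarz[OF borel_measurable_norm_strongly[OF L2_kernelD(1)[OF K]]
    borel_measurable_norm_strongly[OF L2_kernelD(1)[OF G]] L2_kernelD(3)[OF K] L2_kernelD(3)[OF G]]
  show i: "integrable M (\<lambda>z. norm (K z o\<^sub>L G z))"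
    by (rule Bochner_Integration.integrable_bound[OF CS(1)])
      (use borel_measurable_norm_strongly[OF sm] in \<open>auto intro: norm_blinfun_compose\<close>)
  have "(LINT z|M. norm (K z o\<^sub>L G z)) \<le> (LINT z|M. norm (K z) * norm (G z))"
    by (rule integral_mono[OF i CS(1)]) (rule norm_blinfun_compose)
  then show "(LINT z|M. norm (K z o\<^sub>L G z)) \<le> sqrt (LINT z|M. (norm (K z))\<^sup>2) * sqrt (LINT z|M. (norm (G z))\<^sup>2)"
    using CS(2) by linarith
qed

lemma B_op_class:
  assumes K: "L2_kernel M K" and f: "f \<in> L2_fun M"
  shows "B_op K \<gamma> (L2_class M f) = arc_integral \<gamma> (\<lambda>z. blinfun_apply (K z) (f z))"
proof -
  note r = rep_L2_class[OF f]
  have "arc_integral \<gamma> (\<lambda>z. blinfun_apply (K z) (rep (L2_class M f) z)) = arc_integral \<gamma> (\<lambda>z. blinfun_apply (K z) (f z))"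
    by (rule arc_integral_cong_AE[OF kernel_apply(1,2)[OF K r(1)] kernel_apply(1)[OF K f]]) (use r(2) in auto)
  then show ?thesis using f by (simp add: B_op_def)
qed

lemma norm_B_op:
  assumes K: "L2_kernel M K" and F: "F \<in> vecs (L2 M)"
  shows "norm (B_op K \<gamma> F) \<le> sqrt (LINT z|M. (norm (K z))\<^sup>2) * vnorm (L2 M) F"
proof -
  obtain f where f: "f \<in> L2_fun M" "F = L2_class M f" using F by (auto simp: vecs_L2)
  show ?thesis
    unfolding f(2) B_op_class[OF K f(1)] vnorm_L2_class[OF f(1)]
    by (rule order_trans[OF arc_integral_norm_le[OF kernel_apply(1,2)[OF K f(1)]] kernel_apply(3)[OF K f(1)]])
qed

lemma B_op_bounded:
  assumes K: "L2_kernel M K"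
  shows "B_op K \<gamma> \<in> bounded_ops (L2 M) whole"
    "op_norm (L2 M) whole (B_op K \<gamma>) \<le> sqrt (LINT z|M. (norm (K z))\<^sup>2)"
proof -
  show "op_norm (L2 M) whole (B_op K \<gamma>) \<le> sqrt (LINT z|M. (norm (K z))\<^sup>2)"
    by (rule op_norm_le) (auto simp: norm_B_op[OF K] intro!: integral_nonneg_AE)
  have "B_op K \<gamma> (vadd (L2 M) F G) = B_op K \<gamma> F + B_op K \<gamma> G" if F: "F \<in> vecs (L2 M)" and G: "G \<in> vecs (L2 M)" for F G
  proof -
    obtain f g where f: "f \<in> L2_fun M" "F = L2_class M f" and g: "g \<in> L2_fun M" "G = L2_class M g"
      using F G by (auto simp: vecs_L2)
    show ?thesis
      using arc_integral_add[OF kernel_apply(1,2)[OF K f(1)] kernel_apply(1,2)[OF K g(1)]]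
      by (simp add: f g vadd_L2_class B_op_class[OF K] L2_fun_add blinfun.add_right)
  qed
  moreover have "B_op K \<gamma> (vscale (L2 M) a F) = a *\<^sub>C B_op K \<gamma> F" if F: "F \<in> vecs (L2 M)" for a F
  proof -
    obtain f where f: "f \<in> L2_fun M" "F = L2_class M f" using F by (auto simp: vecs_L2)
    have sp: "AE z in M. blinfun_apply (K z) (a *\<^sub>C f z) = a *\<^sub>C blinfun_apply (K z) (f z)"
      by (rule AE_I2) (rule blinfun_apply_clinear[OF L2_kernelD(2)[OF K]])
    have "arc_integral \<gamma> (\<lambda>z. blinfun_apply (K z) (a *\<^sub>C f z)) = arc_integral \<gamma> (\<lambda>z. a *\<^sub>C blinfun_apply (K z) (f z))"
      by (rule arc_integral_cong_AE[OF kernel_apply(1,2)[OF K L2_fun_scaleC[OF f(1)]] _ sp])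
        (intro strongly_measurable_scaleC strongly_measurable_const kernel_apply(1)[OF K f(1)])
    also have "\<dots> = a *\<^sub>C arc_integral \<gamma> (\<lambda>z. blinfun_apply (K z) (f z))"
      by (intro arc_integral_eqI arc_integral_linear kernel_apply[OF K f(1)] bounded_linear_scaleC)
        (simp add: scaleC_scaleC mult.commute)
    finally show ?thesis by (simp add: f vscale_L2_class B_op_class[OF K] L2_fun_scaleC)
  qed
  moreover have "B_op K \<gamma> \<in> vecs (L2 M) \<rightarrow>\<^sub>E UNIV" by (simp add: B_op_def)
  moreover have "\<exists>N. \<forall>F\<in>vecs (L2 M). norm (B_op K \<gamma> F) \<le> N * vnorm (L2 M) F"
    using norm_B_op[OF K] by blast
  ultimately show "B_op K \<gamma> \<in> bounded_ops (L2 M) whole"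
    unfolding bounded_ops_def by auto
qed

definition adj_kernel :: "(complex \<Rightarrow> 'h::chilbert \<Rightarrow>\<^sub>L 'a::chilbert) \<Rightarrow> complex \<Rightarrow> 'a \<Rightarrow>\<^sub>L 'h" where
  "adj_kernel K = (\<lambda>z. cnj (tangent z) *\<^sub>C adj (K z))"

lemma norm_adj_kernel: "L2_kernel M K \<Longrightarrow> z \<in> space M \<Longrightarrow> norm (adj_kernel K z) = norm (K z)"
  by (simp add: adj_kernel_def norm_scaleC norm_adj L2_kernelD(2))

lemma L2_kernel_adj:
  assumes K: "L2_kernel M K"
  shows "L2_kernel M (adj_kernel K)" "(LINT z|M. (norm (adj_kernel K z))\<^sup>2) = (LINT z|M. (norm (K z))\<^sup>2)"
proof -
  show "(LINT z|M. (norm (adj_kernel K z))\<^sup>2) = (LINT z|M. (norm (K z))\<^sup>2)"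
    by (rule Bochner_Integration.integral_cong) (simp_all add: norm_adj_kernel[OF K])
  have "integrable M (\<lambda>z. (norm (adj_kernel K z))\<^sup>2) \<longleftrightarrow> integrable M (\<lambda>z. (norm (K z))\<^sup>2)"
    by (rule Bochner_Integration.integrable_cong) (simp_all add: norm_adj_kernel[OF K])
  moreover have "strongly_measurable M (adj_kernel K)"
  proof -
    have "(\<lambda>z. cnj (tangent z)) \<in> borel_measurable M"
      by (rule borel_measurable_continuous_on[OF _ tangent_measurable]) (intro continuous_intros)
    then show ?thesis unfolding adj_kernel_def
      by (intro strongly_measurable_scaleC strongly_measurable_borel strongly_measurable_adj L2_kernelD[OF K])
  qed
  moreover have "clinear_op (adj_kernel K z)" if "z \<in> space M" for z
    unfolding adj_kernel_def by (intro clinear_op_scaleC clinear_op_adj L2_kernelD(2)[OF K that])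
  ultimately show "L2_kernel M (adj_kernel K)" using L2_kernelD(3)[OF K] by (simp add: L2_kernel_def)
qed

text \<open>The complex line element of the operator and the arc length of the inner product differ by
  the unit tangent, which therefore appears in the adjoint.\<close>

lemma op_adjoint_B_op:
  fixes K :: "complex \<Rightarrow> 'h::chilbert \<Rightarrow>\<^sub>L 'a::chilbert"
  assumes K: "L2_kernel M K"
  shows "op_adjoint (L2 M) whole (B_op K \<gamma>) = mult_op M (adj_kernel K)"
proof
  fix y
  note K' = L2_kernel_adj(1)[OF K]
  have ad: "cinner (B_op K \<gamma> F) y = vinner (L2 M) F (mult_op M (adj_kernel K) y)" if F: "F \<in> vecs (L2 M)" for F
  proof -
    obtain f where f: "f \<in> L2_fun M" "F = L2_class M f" using F by (auto simp: vecs_L2)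
    have "cinner (B_op K \<gamma> F) y = (LINT z|M. tangent z * cinner (blinfun_apply (K z) (f z)) y)"
      unfolding f(2) B_op_class[OF K f(1)]
      by (rule arc_integral_functional[OF kernel_apply(1,2)[OF K f(1)]])
        (auto intro: bounded_bilinear.bounded_linear_left[OF bounded_bilinear_cinner] cinner_scaleC_left)
    also have "\<dots> = (LINT z|M. cinner (f z) (blinfun_apply (adj_kernel K z) y))"
      by (rule Bochner_Integration.integral_cong)
        (simp_all add: adj_kernel_def scaleC_blinfun_apply cinner_scaleC_right cinner_adj L2_kernelD(2)[OF K])
    also have "\<dots> = vinner (L2 M) F (mult_op M (adj_kernel K) y)"
      unfolding f(2) mult_op_def vinner_L2_class[OF f(1) L2_kernel_apply[OF K']] ..
    finally show ?thesis .
  qed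
  have "(THE x. x \<in> vecs (L2 M) \<and> (\<forall>z\<in>vecs (L2 M). vinner whole (B_op K \<gamma> z) y = vinner (L2 M) z x))
      = mult_op M (adj_kernel K) y"
  proof (rule the_equality)
    have v: "mult_op M (adj_kernel K) y \<in> vecs (L2 M)" using bounded_opsD(1)[OF mult_op_bounded(1)[OF K']] by simp
    then show "mult_op M (adj_kernel K) y \<in> vecs (L2 M) \<and> (\<forall>z\<in>vecs (L2 M).
        vinner whole (B_op K \<gamma> z) y = vinner (L2 M) z (mult_op M (adj_kernel K) y))" using ad by simp
    fix x :: "(complex \<Rightarrow> 'h) set" assume x: "x \<in> vecs (L2 M) \<and> (\<forall>z\<in>vecs (L2 M). vinner whole (B_op K \<gamma> z) y = vinner (L2 M) z x)"
    show "x = mult_op M (adj_kernel K) y"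
    proof (rule L2_nondegenerate)
      fix H :: "(complex \<Rightarrow> 'h) set" assume H: "H \<in> vecs (L2 M)"
      have "vinner (L2 M) H x = cinner (B_op K \<gamma> H) y" using x H by simp
      then show "vinner (L2 M) H x = vinner (L2 M) H (mult_op M (adj_kernel K) y)" by (simp only: ad[OF H])
    qed (use x v in auto)
  qed
  then show "op_adjoint (L2 M) whole (B_op K \<gamma>) y = mult_op M (adj_kernel K) y"
    by (simp add: op_adjoint_def)
qed

lemma E_norm_dual_B_op:
  assumes K: "L2_kernel M K"
  shows "E_norm_dual \<gamma> (B_op K \<gamma>) = ennreal (sqrt (LINT z|M. (norm (K z))\<^sup>2))"
  unfolding E_norm_dual_def op_adjoint_B_op[OF K] E_norm_mult_op[OF L2_kernel_adj(1)[OF K]] L2_kernel_adj(2)[OF K] ..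

lemma C_op_mult_op: "C_op F \<gamma> = mult_op M F"
  by (simp add: C_op_def mult_op_def)

lemma kernel_norm_zero_mult_op:
  assumes F: "L2_kernel M F" and 0: "(LINT z|M. (norm (F z))\<^sup>2) = 0"
  shows "mult_op M F = zero_op whole (L2 M)"
proof
  fix x
  have "AE z in M. (norm (F z))\<^sup>2 = 0" using integral_nonneg_eq_0_iff_AE[OF L2_kernelD(3)[OF F]] 0 by simp
  then have "AE z in M. blinfun_apply (F z) x = 0" by eventually_elim simp
  then show "mult_op M F x = zero_op whole (L2 M) x"
    unfolding mult_op_def zero_op_def by (simp add: vzero_L2) (rule L2_class_cong)
qed

lemma kernel_norm_zero_B_op:
  assumes K: "L2_kernel M K" and 0: "(LINT z|M. (norm (K z))\<^sup>2) = 0"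
  shows "B_op K \<gamma> = zero_op (L2 M) whole"
proof
  fix F
  show "B_op K \<gamma> F = zero_op (L2 M) whole F"
    using norm_B_op[OF K, of F] 0 by (cases "F \<in> vecs (L2 M)") (auto simp: zero_op_def B_op_def)
qed

end

section \<open>The Riccati equations on a fixed arc\<close>

context smooth_arc
begin

lemma arc_integral_cong:
  "(\<And>z. z \<in> open_arc \<gamma> \<Longrightarrow> f z = g z) \<Longrightarrow> has_arc_integral f I \<gamma> \<Longrightarrow> has_arc_integral g I \<gamma>"
  unfolding has_arc_integral_def
  by (erule has_integral_spike_finite[of "{0, 1}", rotated 2]) (auto simp: open_arc_def)

lemma arc_integral_apply:
  fixes f :: "complex \<Rightarrow> 'u::{cnormed} \<Rightarrow>\<^sub>L 'v::{cnormed, banach}"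
  assumes "strongly_measurable M f" "integrable M (\<lambda>z. norm (f z))"
  shows "blinfun_apply (arc_integral \<gamma> f) x = arc_integral \<gamma> (\<lambda>z. blinfun_apply (f z) x)"
  using arc_integral_linear[OF assms, of "\<lambda>S. blinfun_apply S x"]
  by (auto intro!: arc_integral_eqI[symmetric] simp: scaleC_blinfun_apply blinfun.bounded_linear_left)

lemma clinear_op_arc_integral:
  fixes f :: "complex \<Rightarrow> 'u::{cnormed} \<Rightarrow>\<^sub>L 'v::{cnormed, banach}"
  assumes sm: "strongly_measurable M f" and i: "integrable M (\<lambda>z. norm (f z))"
    and cl: "\<And>z. z \<in> open_arc \<gamma> \<Longrightarrow> clinear_op (f z)"
  shows "clinear_op (arc_integral \<gamma> f)"
  unfolding clinear_op_def
proof (intro allI)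
  fix a x
  let ?h = "\<lambda>S :: 'u \<Rightarrow>\<^sub>L 'v. blinfun_apply S (a *\<^sub>C x) - a *\<^sub>C blinfun_apply S x"
  have h: "bounded_linear ?h"
    by (intro bounded_linear_sub blinfun.bounded_linear_left bounded_linear_compose[OF bounded_linear_scaleC])
  have hs: "?h (k *\<^sub>C S) = k *\<^sub>C ?h S" for k S
    by (simp add: scaleC_blinfun_apply scaleC_diff_right scaleC_scaleC mult.commute)
  have "has_arc_integral (\<lambda>z. ?h (f z)) (?h (arc_integral \<gamma> f)) \<gamma>"
    by (rule arc_integral_linear[OF sm i h hs])
  then have "has_arc_integral (\<lambda>z. 0) (?h (arc_integral \<gamma> f)) \<gamma>"
    by (rule arc_integral_cong[rotated]) (simp add: blinfun_apply_clinear[OF cl])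
  then have "?h (arc_integral \<gamma> f) = 0"
    by (simp add: has_arc_integral_def has_integral_unique[OF _ has_integral_0])
  then show "blinfun_apply (arc_integral \<gamma> f) (a *\<^sub>C x) = a *\<^sub>C blinfun_apply (arc_integral \<gamma> f) x" by simp
qed

lemma L2_kernel_mult_right:
  fixes K :: "complex \<Rightarrow> 'u::chilbert \<Rightarrow>\<^sub>L 'v::chilbert" and R :: "complex \<Rightarrow> 'w::chilbert \<Rightarrow>\<^sub>L 'u"
  assumes K: "L2_kernel M K" and R: "strongly_measurable M R"
    and cl: "\<And>z. z \<in> open_arc \<gamma> \<Longrightarrow> clinear_op (R z)" and le: "\<And>z. z \<in> open_arc \<gamma> \<Longrightarrow> norm (R z) \<le> B"
  shows "L2_kernel M (\<lambda>z. K z o\<^sub>L R z)"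
    "(LINT z|M. (norm (K z o\<^sub>L R z))\<^sup>2) \<le> B\<^sup>2 * (LINT z|M. (norm (K z))\<^sup>2)"
proof -
  have sm: "strongly_measurable M (\<lambda>z. K z o\<^sub>L R z)"
    by (rule strongly_measurable_compose[OF L2_kernelD(1)[OF K] R])
  have i: "integrable M (\<lambda>z. B\<^sup>2 * (norm (K z))\<^sup>2)" using L2_kernelD(3)[OF K] by simp
  have le2: "(norm (K z o\<^sub>L R z))\<^sup>2 \<le> B\<^sup>2 * (norm (K z))\<^sup>2" if "z \<in> open_arc \<gamma>" for z
  proof -
    have "norm (K z o\<^sub>L R z) \<le> norm (K z) * B"
      by (rule order_trans[OF norm_blinfun_compose mult_left_mono[OF le[OF that]]]) simp
    then have "(norm (K z o\<^sub>L R z))\<^sup>2 \<le> (norm (K z) * B)\<^sup>2" by (rule power_mono) simp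
    then show ?thesis by (simp add: power_mult_distrib mult.commute)
  qed
  have m: "(\<lambda>z. (norm (K z o\<^sub>L R z))\<^sup>2) \<in> borel_measurable M"
    using borel_measurable_norm_strongly[OF sm] by measurable
  have i2: "integrable M (\<lambda>z. (norm (K z o\<^sub>L R z))\<^sup>2)"
    by (rule Bochner_Integration.integrable_bound[OF i m]) (use le2 in \<open>auto simp: space_M intro!: AE_I2\<close>)
  then show "L2_kernel M (\<lambda>z. K z o\<^sub>L R z)"
    using sm cl L2_kernelD(2)[OF K] by (auto simp: L2_kernel_def space_M intro: clinear_op_compose)
  have "(LINT z|M. (norm (K z o\<^sub>L R z))\<^sup>2) \<le> (LINT z|M. B\<^sup>2 * (norm (K z))\<^sup>2)"
    by (rule integral_mono[OF i2 i]) (use le2 in \<open>auto simp: space_M\<close>)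
  then show "(LINT z|M. (norm (K z o\<^sub>L R z))\<^sup>2) \<le> B\<^sup>2 * (LINT z|M. (norm (K z))\<^sup>2)" by simp
qed

lemma L2_kernel_mult_left:
  fixes K :: "complex \<Rightarrow> 'u::chilbert \<Rightarrow>\<^sub>L 'v::chilbert" and R :: "complex \<Rightarrow> 'v \<Rightarrow>\<^sub>L 'w::chilbert"
  assumes K: "L2_kernel M K" and R: "strongly_measurable M R"
    and cl: "\<And>z. z \<in> open_arc \<gamma> \<Longrightarrow> clinear_op (R z)" and le: "\<And>z. z \<in> open_arc \<gamma> \<Longrightarrow> norm (R z) \<le> B"
  shows "L2_kernel M (\<lambda>z. R z o\<^sub>L K z)"
    "(LINT z|M. (norm (R z o\<^sub>L K z))\<^sup>2) \<le> B\<^sup>2 * (LINT z|M. (norm (K z))\<^sup>2)"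
proof -
  have sm: "strongly_measurable M (\<lambda>z. R z o\<^sub>L K z)"
    by (rule strongly_measurable_compose[OF R L2_kernelD(1)[OF K]])
  have i: "integrable M (\<lambda>z. B\<^sup>2 * (norm (K z))\<^sup>2)" using L2_kernelD(3)[OF K] by simp
  have le2: "(norm (R z o\<^sub>L K z))\<^sup>2 \<le> B\<^sup>2 * (norm (K z))\<^sup>2" if "z \<in> open_arc \<gamma>" for z
  proof -
    have "norm (R z o\<^sub>L K z) \<le> B * norm (K z)"
      by (rule order_trans[OF norm_blinfun_compose mult_right_mono[OF le[OF that]]]) simp
    then have "(norm (R z o\<^sub>L K z))\<^sup>2 \<le> (B * norm (K z))\<^sup>2" by (rule power_mono) simp
    then show ?thesis by (simp add: power_mult_distrib)
  qed
  have m: "(\<lambda>z. (norm (R z o\<^sub>L K z))\<^sup>2) \<in> borel_measurable M"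
    using borel_measurable_norm_strongly[OF sm] by measurable
  have i2: "integrable M (\<lambda>z. (norm (R z o\<^sub>L K z))\<^sup>2)"
    by (rule Bochner_Integration.integrable_bound[OF i m]) (use le2 in \<open>auto simp: space_M intro!: AE_I2\<close>)
  then show "L2_kernel M (\<lambda>z. R z o\<^sub>L K z)"
    using sm cl L2_kernelD(2)[OF K] by (auto simp: L2_kernel_def space_M intro: clinear_op_compose)
  have "(LINT z|M. (norm (R z o\<^sub>L K z))\<^sup>2) \<le> (LINT z|M. B\<^sup>2 * (norm (K z))\<^sup>2)"
    by (rule integral_mono[OF i2 i]) (use le2 in \<open>auto simp: space_M\<close>)
  then show "(LINT z|M. (norm (R z o\<^sub>L K z))\<^sup>2) \<le> B\<^sup>2 * (LINT z|M. (norm (K z))\<^sup>2)" by simp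
qed

lemma D_op_class:
  assumes f: "f \<in> L2_fun M"
  shows "(\<lambda>z. (z - \<zeta>) *\<^sub>C f z) \<in> L2_fun M" "D_op \<gamma> (L2_class M f) = L2_class M (\<lambda>z. z *\<^sub>C f z)"
proof -
  have "bounded (path_image \<gamma>)" using arc by (simp add: arc_def bounded_path_image)
  then obtain B where B: "\<And>z. z \<in> path_image \<gamma> \<Longrightarrow> cmod z \<le> B" unfolding bounded_iff by blast
  show "(\<lambda>z. (z - \<zeta>) *\<^sub>C f z) \<in> L2_fun M"
  proof (rule L2_fun_scaleC_bounded[OF _ f])
    show "strongly_measurable M (\<lambda>z. z - \<zeta>)"
      by (intro strongly_measurable_diff strongly_measurable_id_M strongly_measurable_const)
    show "cmod (z - \<zeta>) \<le> B + cmod \<zeta>" if "z \<in> space M" for z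
      using B[of z] that norm_triangle_ineq4[of z \<zeta>] by (force simp: space_M open_arc_def path_image_def)
  qed
  show "D_op \<gamma> (L2_class M f) = L2_class M (\<lambda>z. z *\<^sub>C f z)"
    using f rep_L2_class(2)[OF f] by (auto simp: D_op_def intro!: L2_class_cong)
qed

lemma path_image_subset_closure: "path_image \<gamma> \<subseteq> closure (open_arc \<gamma>)"
proof -
  have "\<gamma> ` closure {0<..<1} \<subseteq> closure (\<gamma> ` {0<..<1})"
    by (rule image_closure_subset) (use cont in \<open>auto simp: closure_subset\<close>)
  then show ?thesis by (simp add: path_image_def open_arc_def)
qed

text \<open>Riccati solutions are compared on small balls around points of the arc.\<close>

lemma finite_ball_cover:
  assumes "\<rho> > 0"
  obtains S where "finite S" "S \<subseteq> path_image \<gamma>" "open_arc \<gamma> \<subseteq> (\<Union>\<zeta>\<in>S. ball \<zeta> \<rho>)"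
proof -
  have "compact (path_image \<gamma>)" using arc by (simp add: arc_def compact_path_image)
  then have "\<exists>k. finite k \<and> k \<subseteq> path_image \<gamma> \<and> path_image \<gamma> \<subseteq> (\<Union>x\<in>k. ball x \<rho>)"

    using seq_compact_imp_totally_bounded[OF compact_imp_seq_compact] assms by blast
  moreover have "open_arc \<gamma> \<subseteq> path_image \<gamma>" by (auto simp: open_arc_def path_image_def)
  ultimately show ?thesis using that by (metis (no_types, lifting) subset_trans)
qed

end

text \<open>The Riccati equations depend on a contour only through these data: the analytic functions \<open>b\<close> and
  \<open>c\<close> enter through continuity on the arc, their singularities at the end points through square
  integrability, and the E-norms through the norms of the kernels.\<close>

locale riccati_setting = smooth_arc \<gamma> for \<gamma> +
  fixes A :: "'a::chilbert \<Rightarrow>\<^sub>L 'a" and b :: "complex \<Rightarrow> 'h::chilbert \<Rightarrow>\<^sub>L 'a" and c :: "complex \<Rightarrow> 'a \<Rightarrow>\<^sub>L 'h"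
    and d :: real
  assumes sa: "selfadjoint A" and spec_real: "spectrum A \<subseteq> \<real>"
    and kb: "L2_kernel M b" and kc: "L2_kernel M c"
    and b_cont: "\<And>z. z \<in> open_arc \<gamma> \<Longrightarrow> isCont b z" and c_cont: "\<And>z. z \<in> open_arc \<gamma> \<Longrightarrow> isCont c z"
    and d_def: "d = spec_dist A \<gamma>" and d_pos: "d > 0"
    and small: "sqrt (LINT z|M. (norm (b z))\<^sup>2) * sqrt (LINT z|M. (norm (c z))\<^sup>2) < d\<^sup>2 / 4"
begin

abbreviation "nB \<equiv> sqrt (LINT z|M. (norm (b z))\<^sup>2)"
abbreviation "nC \<equiv> sqrt (LINT z|M. (norm (c z))\<^sup>2)"
definition "V = (LINT z|M. norm (b z o\<^sub>L c z))"
definition "r = d / 2 - sqrt (d\<^sup>2 / 4 - V)"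

lemma A_clinear: "clinear_op A" using sa by (simp add: selfadjoint_def)

lemma dist_path_image:
  assumes "z \<in> path_image \<gamma>" "a \<in> spectrum A" shows "d \<le> cmod (z - a)"
proof -
  have "setdist (spectrum A) (open_arc \<gamma>) \<le> dist a z"
    using setdist_le_dist[of a "spectrum A" z "closure (open_arc \<gamma>)"] path_image_subset_closure assms
    by auto
  then show ?thesis by (simp add: d_def spec_dist_def dist_norm norm_minus_commute)
qed

lemma open_arc_path_image: "z \<in> open_arc \<gamma> \<Longrightarrow> z \<in> path_image \<gamma>"
  by (auto simp: open_arc_def path_image_def)

lemma nBC_nonneg: "nB \<ge> 0" "nC \<ge> 0"
  by (auto intro!: integral_nonneg_AE)

lemma V_bounds: "0 \<le> V" "V \<le> nB * nC" "V < d\<^sup>2 / 4"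
proof -
  show "0 \<le> V" by (auto simp: V_def intro!: integral_nonneg_AE)
  show "V \<le> nB * nC" unfolding V_def by (rule kernel_compose(3)[OF kb kc])
  then show "V < d\<^sup>2 / 4" using small by linarith
qed

lemma r_bounds: "0 \<le> r" "r < d / 2" "r * (d - r) = V"
proof -
  have "sqrt (d\<^sup>2 / 4 - V) \<le> sqrt (d\<^sup>2 / 4)" using V_bounds by simp
  also have "\<dots> = d / 2" using d_pos by (simp add: real_sqrt_divide)
  finally show "0 \<le> r" by (simp add: r_def)
  show "r < d / 2" using V_bounds by (simp add: r_def)
  have "(sqrt (d\<^sup>2 / 4 - V))\<^sup>2 = d\<^sup>2 / 4 - V" using V_bounds by simp
  then show "r * (d - r) = V" by (simp add: r_def power2_eq_square algebra_simps)
qed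

lemma resolvent_bound:
  assumes "norm T < d" "z \<in> path_image \<gamma>"
  shows "z \<notin> spectrum (A + T)" "norm (resolvent (A + T) z) \<le> 1 / (d - norm T)"
  using resolvent_bound_perturbed[OF sa spec_real dist_path_image[OF assms(2)] assms(1)] by auto

lemma resolvent_on_arc:
  assumes T: "clinear_op T" "norm T < d"
  shows "strongly_measurable M (resolvent (A + T))" "z \<in> open_arc \<gamma> \<Longrightarrow> clinear_op (resolvent (A + T) z)"
    "z \<in> open_arc \<gamma> \<Longrightarrow> norm (resolvent (A + T) z) \<le> 1 / (d - norm T)"
proof -
  have cl: "clinear_op (A + T)" by (rule clinear_op_add[OF A_clinear T(1)])
  show "strongly_measurable M (resolvent (A + T))"
    by (rule strongly_measurable_isCont_M) (rule isCont_resolvent[OF cl resolvent_bound(1)[OF T(2) open_arc_path_image]])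
  show "z \<in> open_arc \<gamma> \<Longrightarrow> clinear_op (resolvent (A + T) z)"
    by (rule clinear_op_resolvent[OF cl resolvent_bound(1)[OF T(2) open_arc_path_image]])
  show "z \<in> open_arc \<gamma> \<Longrightarrow> norm (resolvent (A + T) z) \<le> 1 / (d - norm T)"
    by (rule resolvent_bound(2)[OF T(2) open_arc_path_image])
qed

subsection \<open>The basic equation\<close>

text \<open>The equation for \<open>X\<close> leads to \<open>T = \<integral> b c (A + T - \<mu>)\<inverse>\<close> and the equation for \<open>Y\<close> to
  \<open>T = \<integral> (A + T - \<mu>)\<inverse> b c\<close>; both are treated with weights \<open>P\<close> and \<open>Q\<close> on the two sides.\<close>

definition admissible :: "(complex \<Rightarrow> 'a \<Rightarrow>\<^sub>L 'a) \<Rightarrow> (complex \<Rightarrow> 'a \<Rightarrow>\<^sub>L 'a) \<Rightarrow> bool" where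
  "admissible P Q \<longleftrightarrow> (\<forall>z\<in>open_arc \<gamma>. isCont P z \<and> isCont Q z \<and> clinear_op (P z) \<and> clinear_op (Q z)
     \<and> norm (P z) * norm (Q z) \<le> norm (b z o\<^sub>L c z))"

definition resolvent_integral :: "(complex \<Rightarrow> 'a \<Rightarrow>\<^sub>L 'a) \<Rightarrow> (complex \<Rightarrow> 'a \<Rightarrow>\<^sub>L 'a) \<Rightarrow> ('a \<Rightarrow>\<^sub>L 'a) \<Rightarrow> ('a \<Rightarrow>\<^sub>L 'a)" where
  "resolvent_integral P Q T = arc_integral \<gamma> (\<lambda>z. P z o\<^sub>L resolvent (A + T) z o\<^sub>L Q z)"

lemma bc_props:
  assumes "z \<in> open_arc \<gamma>"
  shows "isCont (\<lambda>z. b z o\<^sub>L c z) z" "clinear_op (b z)" "clinear_op (c z)"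
proof -
  show "isCont (\<lambda>z. b z o\<^sub>L c z) z"
    by (rule bounded_bilinear.isCont[OF bounded_bilinear_blinfun_compose b_cont[OF assms] c_cont[OF assms]])
  show "clinear_op (b z)" "clinear_op (c z)"
    using assms L2_kernelD(2)[OF kb] L2_kernelD(2)[OF kc] by (auto simp: space_M)
qed

lemma admissible_right: "admissible (\<lambda>z. b z o\<^sub>L c z) (\<lambda>z. id_blinfun)"
  and admissible_left: "admissible (\<lambda>z. id_blinfun) (\<lambda>z. b z o\<^sub>L c z)"
proof -
  have n: "norm (b z o\<^sub>L c z) * norm (id_blinfun :: 'a \<Rightarrow>\<^sub>L 'a) \<le> norm (b z o\<^sub>L c z)" for z
    by (rule mult_left_le[OF norm_blinfun_id_le]) simp
  have cl: "clinear_op (b z o\<^sub>L c z)" if "z \<in> open_arc \<gamma>" for z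
    by (rule clinear_op_compose[OF bc_props(2,3)[OF that]])
  show "admissible (\<lambda>z. b z o\<^sub>L c z) (\<lambda>z. id_blinfun)" "admissible (\<lambda>z. id_blinfun) (\<lambda>z. b z o\<^sub>L c z)"
    unfolding admissible_def using n bc_props(1) cl by (simp_all add: mult.commute clinear_op_id)
qed

lemma sandwich:
  assumes PQ: "admissible P Q" and R: "strongly_measurable M R"
    and cl: "\<And>z. z \<in> open_arc \<gamma> \<Longrightarrow> clinear_op (R z)" and le: "\<And>z. z \<in> open_arc \<gamma> \<Longrightarrow> norm (R z) \<le> B"
  shows "strongly_measurable M (\<lambda>z. P z o\<^sub>L R z o\<^sub>L Q z)" "integrable M (\<lambda>z. norm (P z o\<^sub>L R z o\<^sub>L Q z))"
    "norm (arc_integral \<gamma> (\<lambda>z. P z o\<^sub>L R z o\<^sub>L Q z)) \<le> V * B"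
    "clinear_op (arc_integral \<gamma> (\<lambda>z. P z o\<^sub>L R z o\<^sub>L Q z))"
proof -
  have sP: "strongly_measurable M P" and sQ: "strongly_measurable M Q"
    using PQ by (auto simp: admissible_def intro: strongly_measurable_isCont_M)
  show sm: "strongly_measurable M (\<lambda>z. P z o\<^sub>L R z o\<^sub>L Q z)"
    by (intro strongly_measurable_compose sP sQ R)
  have le2: "norm (P z o\<^sub>L R z o\<^sub>L Q z) \<le> norm (b z o\<^sub>L c z) * B" if z: "z \<in> open_arc \<gamma>" for z
  proof -
    have B: "0 \<le> B" by (rule order_trans[OF norm_ge_zero le[OF z]])
    have "norm (P z o\<^sub>L R z o\<^sub>L Q z) \<le> (norm (P z) * norm (R z)) * norm (Q z)"
      by (rule order_trans[OF norm_blinfun_compose mult_right_mono[OF norm_blinfun_compose]]) simp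
    also have "\<dots> = (norm (P z) * norm (Q z)) * norm (R z)" by simp
    also have "\<dots> \<le> norm (b z o\<^sub>L c z) * B"
      by (rule mult_mono) (use PQ z le in \<open>auto simp: admissible_def\<close>)
    finally show ?thesis .
  qed
  have i1: "integrable M (\<lambda>z. norm (b z o\<^sub>L c z) * B)" using kernel_compose(2)[OF kb kc] by simp
  show i: "integrable M (\<lambda>z. norm (P z o\<^sub>L R z o\<^sub>L Q z))"
    by (rule Bochner_Integration.integrable_bound[OF i1 borel_measurable_norm_strongly[OF sm]])
      (use le2 in \<open>auto simp: space_M intro!: AE_I2 order_trans[OF le2 abs_ge_self]\<close>)
  have "norm (arc_integral \<gamma> (\<lambda>z. P z o\<^sub>L R z o\<^sub>L Q z)) \<le> (LINT z|M. norm (P z o\<^sub>L R z o\<^sub>L Q z))"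
    by (rule arc_integral_norm_le[OF sm i])
  also have "\<dots> \<le> (LINT z|M. norm (b z o\<^sub>L c z) * B)"
    by (rule integral_mono[OF i i1]) (use le2 in \<open>auto simp: space_M\<close>)
  finally show "norm (arc_integral \<gamma> (\<lambda>z. P z o\<^sub>L R z o\<^sub>L Q z)) \<le> V * B" by (simp add: V_def)
  show "clinear_op (arc_integral \<gamma> (\<lambda>z. P z o\<^sub>L R z o\<^sub>L Q z))"
    by (rule clinear_op_arc_integral[OF sm i]) (use PQ cl in \<open>auto simp: admissible_def intro!: clinear_op_compose\<close>)
qed

lemma resolvent_integral_bounds:
  assumes PQ: "admissible P Q" and T: "clinear_op T" "norm T < d"
  shows "norm (resolvent_integral P Q T) \<le> V / (d - norm T)" "clinear_op (resolvent_integral P Q T)"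
    "has_arc_integral (\<lambda>z. P z o\<^sub>L resolvent (A + T) z o\<^sub>L Q z) (resolvent_integral P Q T) \<gamma>"
  unfolding resolvent_integral_def
  using sandwich[OF PQ resolvent_on_arc[OF T]] arc_integrable[OF sandwich(1,2)[OF PQ resolvent_on_arc[OF T]]] by simp_all

text \<open>This is the second resolvent identity
  \<open>(A + S - z)\<inverse> - (A + T - z)\<inverse> = (A + S - z)\<inverse> (T - S) (A + T - z)\<inverse>\<close> under the integral.\<close>

lemma resolvent_integral_lipschitz:
  assumes PQ: "admissible P Q" and S: "clinear_op S" "norm S < d" and T: "clinear_op T" "norm T < d"
  shows "norm (resolvent_integral P Q S - resolvent_integral P Q T) \<le> V / ((d - norm S) * (d - norm T)) * norm (S - T)"
proof -
  let ?RS = "resolvent (A + S)" and ?RT = "resolvent (A + T)"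
  note RS = resolvent_on_arc[OF S] and RT = resolvent_on_arc[OF T]
  have eq: "?RS z - ?RT z = ?RS z o\<^sub>L (T - S) o\<^sub>L ?RT z" if z: "z \<in> open_arc \<gamma>" for z
  proof (rule blinfun_eqI)
    fix x
    let ?y = "blinfun_apply (?RT z) x"
    note rS = resolvent_apply[OF resolvent_bound(1)[OF S(2) open_arc_path_image[OF z]]]
    note rT = resolvent_apply[OF resolvent_bound(1)[OF T(2) open_arc_path_image[OF z]]]
    have x: "x = blinfun_apply (A + T) ?y - z *\<^sub>C ?y" by (simp only: rT)
    have "blinfun_apply (?RS z) x = blinfun_apply (?RS z) ((blinfun_apply (A + S) ?y - z *\<^sub>C ?y) + blinfun_apply (T - S) ?y)"
      by (subst x) (simp add: blinfun.add_left blinfun.diff_left algebra_simps)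
    also have "\<dots> = ?y + blinfun_apply (?RS z) (blinfun_apply (T - S) ?y)"
      by (simp only: blinfun.add_right rS)
    finally show "blinfun_apply (?RS z - ?RT z) x = blinfun_apply (?RS z o\<^sub>L (T - S) o\<^sub>L ?RT z) x"
      by (simp add: blinfun.diff_left)
  qed
  define B where "B = norm (S - T) / ((d - norm S) * (d - norm T))"
  have R: "strongly_measurable M (\<lambda>z. ?RS z - ?RT z)" by (rule strongly_measurable_diff[OF RS(1) RT(1)])
  have cl: "clinear_op (?RS z - ?RT z)" if "z \<in> open_arc \<gamma>" for z by (intro clinear_op_diff RS(2) RT(2) that)
  have le: "norm (?RS z - ?RT z) \<le> B" if z: "z \<in> open_arc \<gamma>" for z
  proof -
    have "norm (?RS z - ?RT z) \<le> (norm (?RS z) * norm (T - S)) * norm (?RT z)"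
      unfolding eq[OF z]
      by (rule order_trans[OF norm_blinfun_compose mult_right_mono[OF norm_blinfun_compose]]) simp
    also have "\<dots> \<le> (1 / (d - norm S) * norm (T - S)) * (1 / (d - norm T))"
      by (intro mult_mono RS(3) RT(3) z) (use S T in auto)
    finally show ?thesis by (simp add: B_def norm_minus_commute)
  qed
  have "resolvent_integral P Q S - resolvent_integral P Q T
      = arc_integral \<gamma> (\<lambda>z. (P z o\<^sub>L ?RS z o\<^sub>L Q z) - (P z o\<^sub>L ?RT z o\<^sub>L Q z))"
    unfolding resolvent_integral_def
    by (rule arc_integral_diff[symmetric, OF sandwich(1,2)[OF PQ RS] sandwich(1,2)[OF PQ RT]])
  also have "(\<lambda>z. (P z o\<^sub>L ?RS z o\<^sub>L Q z) - (P z o\<^sub>L ?RT z o\<^sub>L Q z)) = (\<lambda>z. P z o\<^sub>L (?RS z - ?RT z) o\<^sub>L Q z)"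
    by (simp add: blinfun_compose_diff_left blinfun_compose_diff_right)
  also have "norm (arc_integral \<gamma> \<dots>) \<le> V * B" by (rule sandwich(3)[OF PQ R cl le])
  finally show ?thesis by (simp add: B_def)
qed

lemma resolvent_integral_unique:
  assumes PQ: "admissible P Q" and S: "clinear_op S" "norm S < d" and T: "clinear_op T" "norm T < d"
    and fixed: "resolvent_integral P Q S = S" "resolvent_integral P Q T = T"
    and V: "V < (d - norm S) * (d - norm T)"
  shows "S = T"
proof (rule ccontr)
  assume "S \<noteq> T"
  then have pos: "norm (S - T) > 0" by simp
  have q: "0 < (d - norm S) * (d - norm T)" using S T by simp
  have "norm (S - T) \<le> V / ((d - norm S) * (d - norm T)) * norm (S - T)"
    using resolvent_integral_lipschitz[OF PQ S T] fixed by simp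
  also have "\<dots> < 1 * norm (S - T)" by (rule mult_strict_right_mono[OF _ pos]) (use V q in \<open>simp add: divide_less_eq\<close>)
  finally show False by simp
qed

text \<open>As \<open>r\<close> is the smaller root of \<open>r (d - r) = V\<close>, the bound \<open>V / (d - r)\<close> for the map on the ball of radius
  \<open>r\<close> equals \<open>r\<close>, and its Lipschitz constant \<open>V / (d - r)\<^sup>2\<close> is less than \<open>1\<close> because of \<open>r < d / 2\<close>.\<close>

lemma resolvent_integral_fixpoint:
  assumes PQ: "admissible P Q"
  obtains T where "clinear_op T" "norm T \<le> r" "resolvent_integral P Q T = T"
proof -
  let ?S = "{T :: 'a \<Rightarrow>\<^sub>L 'a. clinear_op T} \<inter> cball 0 r"
  have dr: "d - r > d / 2" using r_bounds by simp
  have Vq: "V < (d - r) * (d - r)"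
  proof -
    have "(d / 2) * (d / 2) < (d - r) * (d - r)" using dr d_pos by (intro mult_strict_mono) auto
    then show ?thesis using V_bounds(3) by (simp add: power2_eq_square)
  qed
  have "\<exists>!T\<in>?S. resolvent_integral P Q T = T"
  proof (rule Banach_fix)
    have "closed ?S" by (intro closed_Int closed_clinear_op closed_cball)
    then show "complete ?S" by (simp only: complete_eq_closed)
    have "0 \<in> ?S" using r_bounds(1) by (simp add: clinear_op_def)
    then show "?S \<noteq> {}" by blast
    show "0 \<le> V / ((d - r) * (d - r))" using V_bounds(1) by simp
    show "V / ((d - r) * (d - r)) < 1" using Vq V_bounds(1) by (simp add: divide_less_eq)
    show "resolvent_integral P Q ` ?S \<subseteq> ?S"
    proof (intro subsetI, elim imageE)
      fix S T assume T: "T \<in> ?S" and S: "S = resolvent_integral P Q T"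
      have nT: "clinear_op T" "norm T < d" "norm T \<le> r" using T r_bounds d_pos by auto
      note * = resolvent_integral_bounds[OF PQ nT(1,2)]
      have "V / (d - norm T) \<le> V / (d - r)"
        by (rule divide_left_mono) (use nT V_bounds dr d_pos in auto)
      also have "\<dots> = r" using r_bounds(3) dr d_pos by (simp add: field_simps)
      finally show "S \<in> ?S" using * S by auto
    qed
    fix S T assume "S \<in> ?S" "T \<in> ?S"
    then have S: "clinear_op S" "norm S < d" "norm S \<le> r" and T: "clinear_op T" "norm T < d" "norm T \<le> r"
      using r_bounds d_pos by auto
    have "(d - r) * (d - r) \<le> (d - norm S) * (d - norm T)"
      by (rule mult_mono) (use S T dr d_pos in auto)
    then have "V / ((d - norm S) * (d - norm T)) \<le> V / ((d - r) * (d - r))"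
      using V_bounds(1) dr d_pos S T by (intro divide_left_mono) auto
    then show "dist (resolvent_integral P Q S) (resolvent_integral P Q T) \<le> V / ((d - r) * (d - r)) * dist S T"
      unfolding dist_norm
      by (intro order_trans[OF resolvent_integral_lipschitz[OF PQ S(1,2) T(1,2)] mult_right_mono]) auto
  qed
  then obtain T where "T \<in> ?S" "resolvent_integral P Q T = T" by blast
  then show ?thesis using that by auto
qed

subsection \<open>The operator Z\<close>

abbreviation "Phi \<equiv> resolvent_integral (\<lambda>z. b z o\<^sub>L c z) (\<lambda>z. id_blinfun)"
abbreviation "Psi \<equiv> resolvent_integral (\<lambda>z. id_blinfun) (\<lambda>z. b z o\<^sub>L c z)"

lemma solves_Z_iff:
  assumes "norm T < d"
  shows "solves_Z A b c \<gamma> (A + T) \<longleftrightarrow> clinear_op T \<and> Phi T = T"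
proof
  assume Z: "solves_Z A b c \<gamma> (A + T)"
  have "clinear_op ((A + T) - A)" using Z by (intro clinear_op_diff A_clinear) (auto simp: solves_Z_def)
  then have cl: "clinear_op T" by simp
  obtain I where "has_arc_integral (\<lambda>\<mu>. b \<mu> o\<^sub>L c \<mu> o\<^sub>L resolvent (A + T) \<mu>) I \<gamma>" "A + T = A + I"
    using Z by (auto simp: solves_Z_def)
  then have "Phi T = T"
    using arc_integral_eqI by (simp add: resolvent_integral_def)
  then show "clinear_op T \<and> Phi T = T" using cl by simp
next
  assume T: "clinear_op T \<and> Phi T = T"
  have "spectrum (A + T) \<inter> open_arc \<gamma> = {}"
    using resolvent_bound(1)[OF assms open_arc_path_image] by blast
  moreover have "has_arc_integral (\<lambda>\<mu>. b \<mu> o\<^sub>L c \<mu> o\<^sub>L resolvent (A + T) \<mu>) T \<gamma>"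
    using resolvent_integral_bounds(3)[OF admissible_right _ assms] T by simp
  ultimately show "solves_Z A b c \<gamma> (A + T)"
    using T by (auto simp: solves_Z_def intro: clinear_op_add A_clinear)
qed

text \<open>Uniqueness extends from the ball of radius \<open>r\<close>, which depends on \<open>V\<close>, to the ball of radius \<open>d / 2\<close>. In
  this form it can be used to compare two contours.\<close>

lemma Z_op_props:
  "solves_Z A b c \<gamma> (Z_op A b c \<gamma>)" "norm (Z_op A b c \<gamma> - A) \<le> r"
  "solves_Z A b c \<gamma> (A + T) \<Longrightarrow> norm T \<le> d / 2 \<Longrightarrow> Z_op A b c \<gamma> = A + T"
proof -
  have var: "variation b c \<gamma> = V" by (simp add: variation_def V_def)
  have uniq: "S = T" if S: "solves_Z A b c \<gamma> (A + S)" "norm S \<le> r" and T: "solves_Z A b c \<gamma> (A + T)" "norm T \<le> d / 2" for S T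
  proof (rule resolvent_integral_unique[OF admissible_right])
    show "norm S < d" "norm T < d" using S(2) T(2) r_bounds(2) d_pos by auto
    then show "clinear_op S" "clinear_op T" "Phi S = S" "Phi T = T" using S T solves_Z_iff by auto
    have "(d / 2) * (d / 2) \<le> (d - norm S) * (d - norm T)"
      by (rule mult_mono) (use S(2) T(2) r_bounds(2) d_pos in auto)
    then show "V < (d - norm S) * (d - norm T)" using V_bounds(3) by (simp add: power2_eq_square)
  qed
  obtain T where T: "clinear_op T" "norm T \<le> r" "Phi T = T"
    by (rule resolvent_integral_fixpoint[OF admissible_right])
  have "norm T < d" using T(2) r_bounds d_pos by simp
  then have sZ: "solves_Z A b c \<gamma> (A + T)" using solves_Z_iff T by simp
  have "Z_op A b c \<gamma> = A + T"
    unfolding Z_op_def var d_def[symmetric] r_def[symmetric]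
  proof (rule the_equality)
    show "solves_Z A b c \<gamma> (A + T) \<and> norm (A + T - A) \<le> r" using sZ T(2) by simp
    fix Z assume Z: "solves_Z A b c \<gamma> Z \<and> norm (Z - A) \<le> r"
    have "Z - A = T" by (rule uniq) (use Z sZ T(2) r_bounds(2) in auto)
    then show "Z = A + T" by (simp add: algebra_simps)
  qed
  then show "solves_Z A b c \<gamma> (Z_op A b c \<gamma>)" "norm (Z_op A b c \<gamma> - A) \<le> r"
    and "solves_Z A b c \<gamma> (A + T') \<Longrightarrow> norm T' \<le> d / 2 \<Longrightarrow> Z_op A b c \<gamma> = A + T'" for T'
    using sZ T(2) uniq[OF sZ T(2)] by auto
qed

end

context riccati_setting
begin

subsection \<open>Solutions of the first Riccati equation\<close>

text \<open>With \<open>Z = A + B X\<close> the first Riccati equation reads \<open>X Z - D X = C\<close>, that is \<open>X(\<lambda>) (Z - \<lambda>) = c(\<lambda>)\<close> at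
  each point of the arc. With \<open>Z = A - Y C\<close> the second one reads \<open>Y D - Z Y = B\<close>, and \<open>Y\<close> is the
  integral operator with the kernel \<open>- (Z - \<lambda>)\<inverse> b(\<lambda>)\<close>.\<close>

definition X_kernel :: "('a \<Rightarrow>\<^sub>L 'a) \<Rightarrow> complex \<Rightarrow> 'a \<Rightarrow>\<^sub>L 'h" where
  "X_kernel T z = c z o\<^sub>L resolvent (A + T) z"

definition Y_kernel :: "('a \<Rightarrow>\<^sub>L 'a) \<Rightarrow> complex \<Rightarrow> 'h \<Rightarrow>\<^sub>L 'a" where
  "Y_kernel T z = (- resolvent (A + T) z) o\<^sub>L b z"

lemma sqrt_le_scaled:
  assumes "I \<le> (1 / e)\<^sup>2 * J" "e > 0" shows "sqrt I \<le> sqrt J / e"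
proof -
  have "sqrt I \<le> sqrt ((1 / e)\<^sup>2 * J)" using assms by simp
  also have "\<dots> = sqrt J / e" using assms by (simp add: real_sqrt_mult real_sqrt_divide power_divide)
  finally show ?thesis .
qed

lemma X_kernel:
  assumes T: "clinear_op T" "norm T < d"
  shows "L2_kernel M (X_kernel T)" "sqrt (LINT z|M. (norm (X_kernel T z))\<^sup>2) \<le> nC / (d - norm T)"
proof -
  note k = L2_kernel_mult_right[OF kc resolvent_on_arc[OF T]]
  show "L2_kernel M (X_kernel T)" using k(1) by (simp add: X_kernel_def[abs_def])
  show "sqrt (LINT z|M. (norm (X_kernel T z))\<^sup>2) \<le> nC / (d - norm T)"
    using k(2) T(2) by (intro sqrt_le_scaled) (simp_all add: X_kernel_def)
qed

lemma Y_kernel: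
  assumes T: "clinear_op T" "norm T < d"
  shows "L2_kernel M (Y_kernel T)" "sqrt (LINT z|M. (norm (Y_kernel T z))\<^sup>2) \<le> nB / (d - norm T)"
proof -
  have sm: "strongly_measurable M (\<lambda>z. - resolvent (A + T) z)"
    using strongly_measurable_diff[OF strongly_measurable_const[of M 0] resolvent_on_arc(1)[OF T]] by simp
  note k = L2_kernel_mult_left[OF kb sm, of "1 / (d - norm T)"]
  have cl: "clinear_op (- resolvent (A + T) z)" if "z \<in> open_arc \<gamma>" for z
    by (rule clinear_op_uminus[OF resolvent_on_arc(2)[OF T that]])
  have le: "norm (- resolvent (A + T) z) \<le> 1 / (d - norm T)" if "z \<in> open_arc \<gamma>" for z
    using resolvent_on_arc(3)[OF T that] by simp
  show "L2_kernel M (Y_kernel T)" using k(1)[OF cl le] by (simp add: Y_kernel_def[abs_def])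
  show "sqrt (LINT z|M. (norm (Y_kernel T z))\<^sup>2) \<le> nB / (d - norm T)"
    using k(2)[OF cl le] T(2) by (intro sqrt_le_scaled) (simp_all add: Y_kernel_def)
qed

lemma B_op_X_kernel:
  assumes T: "clinear_op T" "norm T < d"
  shows "B_op b \<gamma> (mult_op M (X_kernel T) x) = blinfun_apply (Phi T) x"
proof -
  have "B_op b \<gamma> (mult_op M (X_kernel T) x) = arc_integral \<gamma> (\<lambda>z. blinfun_apply (b z) (blinfun_apply (X_kernel T z) x))"
    unfolding mult_op_def by (rule B_op_class[OF kb L2_kernel_apply[OF X_kernel(1)[OF T]]])
  also have "\<dots> = arc_integral \<gamma> (\<lambda>z. blinfun_apply (b z o\<^sub>L c z o\<^sub>L resolvent (A + T) z o\<^sub>L id_blinfun) x)"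
    by (simp add: X_kernel_def)
  also have "\<dots> = blinfun_apply (Phi T) x"
    unfolding resolvent_integral_def
    by (rule arc_integral_apply[symmetric, OF sandwich(1,2)[OF admissible_right resolvent_on_arc[OF T]]])
  finally show ?thesis .
qed

lemma X_kernel_shift:
  assumes T: "clinear_op T" "norm T < d" and z: "z \<in> open_arc \<gamma>"
  shows "blinfun_apply (X_kernel T z) (blinfun_apply (A + T) x - \<zeta> *\<^sub>C x)
    = blinfun_apply (c z) x + (z - \<zeta>) *\<^sub>C blinfun_apply (X_kernel T z) x"
proof -
  note r = resolvent_apply(1)[OF resolvent_bound(1)[OF T(2) open_arc_path_image[OF z]]]
  have cl: "clinear_op (X_kernel T z)" using L2_kernelD(2)[OF X_kernel(1)[OF T]] z by (simp add: space_M)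
  have "blinfun_apply (A + T) x - \<zeta> *\<^sub>C x = (blinfun_apply (A + T) x - z *\<^sub>C x) + (z - \<zeta>) *\<^sub>C x"
    by (simp add: scaleC_diff_left)
  then have "blinfun_apply (X_kernel T z) (blinfun_apply (A + T) x - \<zeta> *\<^sub>C x)
    = blinfun_apply (X_kernel T z) (blinfun_apply (A + T) x - z *\<^sub>C x) + (z - \<zeta>) *\<^sub>C blinfun_apply (X_kernel T z) x"
    by (simp only: blinfun.add_right blinfun_apply_clinear[OF cl])
  then show ?thesis by (simp only: X_kernel_def blinfun_apply_blinfun_compose r)
qed

lemma riccati_X_solution:
  assumes T: "clinear_op T" "norm T < d" and fixed: "Phi T = T"
  shows "riccati_X A b c \<gamma> (mult_op M (X_kernel T))"
  unfolding riccati_X_def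
proof (intro conjI allI)
  note k = X_kernel(1)[OF T]
  show "mult_op M (X_kernel T) \<in> bounded_ops whole (HD \<gamma>)" by (rule mult_op_bounded(1)[OF k])
  fix x
  have Bx: "B_op b \<gamma> (mult_op M (X_kernel T) x) = blinfun_apply T x" using B_op_X_kernel[OF T] fixed by simp
  have Xf: "(\<lambda>z. blinfun_apply (X_kernel T z) y) \<in> L2_fun M" for y by (rule L2_kernel_apply[OF k])
  have zf: "(\<lambda>z. z *\<^sub>C blinfun_apply (X_kernel T z) x) \<in> L2_fun M" using D_op_class(1)[OF Xf[of x], of 0] by simp
  have df: "(\<lambda>z. blinfun_apply (X_kernel T z) (blinfun_apply A x) - z *\<^sub>C blinfun_apply (X_kernel T z) x) \<in> L2_fun M"
    using L2_fun_add[OF Xf[of "blinfun_apply A x"] L2_fun_scaleC[OF zf, of "-1"]] by (simp add: scaleC_minus_left)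
  have "vadd (HD \<gamma>) (vminus (HD \<gamma>) (mult_op M (X_kernel T) (blinfun_apply A x)) (D_op \<gamma> (mult_op M (X_kernel T) x)))
       (mult_op M (X_kernel T) (B_op b \<gamma> (mult_op M (X_kernel T) x)))
     = L2_class M (\<lambda>z. blinfun_apply (X_kernel T z) (blinfun_apply A x) - z *\<^sub>C blinfun_apply (X_kernel T z) x
         + blinfun_apply (X_kernel T z) (blinfun_apply T x))"
    unfolding Bx unfolding mult_op_def D_op_class(2)[OF Xf] vminus_L2_class[OF Xf zf] vadd_L2_class[OF df Xf] ..
  also have "\<dots> = L2_class M (\<lambda>z. blinfun_apply (c z) x)"
  proof (rule L2_class_cong, rule AE_I2)
    fix z assume "z \<in> space M"
    then have z: "z \<in> open_arc \<gamma>" by (simp add: space_M)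
    show "blinfun_apply (X_kernel T z) (blinfun_apply A x) - z *\<^sub>C blinfun_apply (X_kernel T z) x
         + blinfun_apply (X_kernel T z) (blinfun_apply T x) = blinfun_apply (c z) x"
      using X_kernel_shift[OF T z, of x 0] by (simp add: blinfun.add_left blinfun.add_right algebra_simps)
  qed
  finally show "vadd (HD \<gamma>) (vminus (HD \<gamma>) (mult_op M (X_kernel T) (blinfun_apply A x)) (D_op \<gamma> (mult_op M (X_kernel T) x)))
       (mult_op M (X_kernel T) (B_op b \<gamma> (mult_op M (X_kernel T) x))) = C_op c \<gamma> x"
    by (simp add: C_op_def)
qed

text \<open>The difference \<open>u\<close> of a solution and of the expected multiplication operator satisfies
  \<open>u (Z x) = \<lambda> u x\<close>, where \<open>Z - \<zeta>\<close> is invertible for every \<open>\<zeta>\<close> on the arc. On a ball around \<open>\<zeta>\<close>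
  smaller than the reciprocal norm of this inverse, iterating \<open>u y = (\<lambda> - \<zeta>) u ((Z - \<zeta>)\<inverse> y)\<close>
  forces \<open>u = 0\<close>, and finitely many such balls cover the arc.\<close>

lemma intertwining_zero:
  fixes u :: "'a \<Rightarrow> complex \<Rightarrow> 'h"
  assumes T: "clinear_op T" "norm T < d"
    and u: "\<And>x. u x \<in> L2_fun M" and bd: "\<And>x. (LINT z|M. (norm (u x z))\<^sup>2) \<le> N * (norm x)\<^sup>2"
    and shift: "\<And>x \<zeta>. AE z in M. u (blinfun_apply (A + T) x - \<zeta> *\<^sub>C x) z = (z - \<zeta>) *\<^sub>C u x z"
  shows "AE z in M. u x z = 0"
proof -
  define K where "K = 1 / (d - norm T)"
  \<comment> \<open>Half the reciprocal of the bound \<open>K\<close> of the inverse, so that each iteration gains the factor \<open>1/4\<close>.\<close>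
  define \<rho> where "\<rho> = (d - norm T) / 2"
  have \<rho>: "\<rho> > 0" and K: "K > 0" and \<rho>K: "\<rho> * K = 1 / 2" using T(2) by (auto simp: \<rho>_def K_def)
  have ball: "AE z in M. z \<in> ball \<zeta> \<rho> \<longrightarrow> u x z = 0" if \<zeta>: "\<zeta> \<in> path_image \<gamma>" for \<zeta>
  proof -
    define R where "R = resolvent (A + T) \<zeta>"
    have nR: "norm R \<le> K" unfolding R_def K_def by (rule resolvent_bound(2)[OF T(2) \<zeta>])
    define f where "f y z = indicat_real (ball \<zeta> \<rho>) z *\<^sub>R u y z" for y z
    have fL2: "f y \<in> L2_fun M" for y unfolding f_def by (intro L2_fun_indicator u sets_M_borel) simp
    define J where "J y = (LINT z|M. (norm (f y z))\<^sup>2)" for y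
    have step: "J y \<le> \<rho>\<^sup>2 * J (blinfun_apply R y)" for y
    proof -
      let ?x = "blinfun_apply R y"
      have "blinfun_apply (A + T) ?x - \<zeta> *\<^sub>C ?x = y"
        unfolding R_def by (rule resolvent_apply(2)[OF resolvent_bound(1)[OF T(2) \<zeta>]])
      then have ae: "AE z in M. u y z = (z - \<zeta>) *\<^sub>C u ?x z" using shift[of ?x \<zeta>] by simp
      have "J y \<le> (LINT z|M. \<rho>\<^sup>2 * (norm (f ?x z))\<^sup>2)"
        unfolding J_def
      proof (rule integral_mono_AE)
        show "integrable M (\<lambda>z. (norm (f y z))\<^sup>2)" by (rule L2_funD(2)[OF fL2])
        show "integrable M (\<lambda>z. \<rho>\<^sup>2 * (norm (f ?x z))\<^sup>2)" using L2_funD(2)[OF fL2] by simp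
        show "AE z in M. (norm (f y z))\<^sup>2 \<le> \<rho>\<^sup>2 * (norm (f ?x z))\<^sup>2"
          using ae
        proof eventually_elim
          fix z assume e: "u y z = (z - \<zeta>) *\<^sub>C u ?x z"
          show "(norm (f y z))\<^sup>2 \<le> \<rho>\<^sup>2 * (norm (f ?x z))\<^sup>2"
          proof (cases "z \<in> ball \<zeta> \<rho>")
            case True
            then have "cmod (z - \<zeta>) \<le> \<rho>" by (simp add: dist_norm norm_minus_commute)
            then show ?thesis using True
              by (simp add: f_def e norm_scaleC power_mult_distrib mult_right_mono power_mono)
          qed (simp add: f_def)
        qed
      qed
      then show ?thesis by (simp add: J_def)
    qed
    have Jbd: "J y \<le> N * (norm y)\<^sup>2" for y
    proof -
      have "J y \<le> (LINT z|M. (norm (u y z))\<^sup>2)"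
        unfolding J_def by (rule integral_mono[OF L2_funD(2)[OF fL2] L2_funD(2)[OF u]]) (simp add: f_def indicator_def)
      then show ?thesis using bd[of y] by linarith
    qed
    have J0: "0 \<le> J y" for y by (auto simp: J_def intro!: integral_nonneg_AE)
    have iter: "J y \<le> (1/4) ^ k * (\<bar>N\<bar> * (norm y)\<^sup>2)" for y k
    proof (induction k arbitrary: y)
      case 0
      have "N * (norm y)\<^sup>2 \<le> \<bar>N\<bar> * (norm y)\<^sup>2" by (intro mult_right_mono) auto
      then show ?case using Jbd[of y] by simp
    next
      case (Suc k)
      have "norm (blinfun_apply R y) \<le> K * norm y"
        by (rule order_trans[OF norm_blinfun mult_right_mono[OF nR]]) simp
      then have "(norm (blinfun_apply R y))\<^sup>2 \<le> K\<^sup>2 * (norm y)\<^sup>2"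
        by (metis norm_ge_zero power_mono power_mult_distrib)
      then have "(1/4) ^ k * (\<bar>N\<bar> * (norm (blinfun_apply R y))\<^sup>2) \<le> (1/4) ^ k * (\<bar>N\<bar> * (K\<^sup>2 * (norm y)\<^sup>2))"
        by (intro mult_left_mono) auto
      then have "J y \<le> \<rho>\<^sup>2 * ((1/4) ^ k * (\<bar>N\<bar> * (K\<^sup>2 * (norm y)\<^sup>2)))"
        using step[of y] Suc[of "blinfun_apply R y"] by (meson mult_left_mono order_trans zero_le_power2)
      also have "\<dots> = (\<rho> * K)\<^sup>2 * ((1/4) ^ k * (\<bar>N\<bar> * (norm y)\<^sup>2))" by (simp add: power_mult_distrib)
      finally show ?case by (simp add: \<rho>K power2_eq_square)
    qed
    have "J x \<le> 0"
    proof (rule LIMSEQ_le_const)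
      show "(\<lambda>k. (1/4) ^ k * (\<bar>N\<bar> * (norm x)\<^sup>2)) \<longlonglongrightarrow> 0"
        by (intro tendsto_mult_left_zero LIMSEQ_power_zero) simp
    qed (use iter in blast)
    then have "J x = 0" using J0[of x] by linarith
    then have "AE z in M. (norm (f x z))\<^sup>2 = 0"
      unfolding J_def using integral_nonneg_eq_0_iff_AE[OF L2_funD(2)[OF fL2]] by simp
    then show ?thesis by eventually_elim (auto simp: f_def indicator_def)
  qed
  obtain S where S: "finite S" "S \<subseteq> path_image \<gamma>" "open_arc \<gamma> \<subseteq> (\<Union>\<zeta>\<in>S. ball \<zeta> \<rho>)"
    by (rule finite_ball_cover[OF \<rho>])
  have "AE z in M. \<forall>\<zeta>\<in>S. z \<in> ball \<zeta> \<rho> \<longrightarrow> u x z = 0"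
    by (rule AE_finite_allI[OF S(1)]) (use ball S(2) in blast)
  then show ?thesis
    by (rule AE_mp) (rule AE_I2, use S(3) in \<open>auto simp: space_M\<close>)
qed

text \<open>The operator \<open>T = B X\<close> turns the Riccati equation into the linear equation \<open>X (A + T) - D X = C\<close>. The
  difference of \<open>X\<close> and of the solution by multiplication satisfies the homogeneous equation and
  vanishes. Inserting the result into \<open>T = B X\<close> yields the fixed point equation.\<close>

lemma riccati_X_form:
  assumes X: "riccati_X A b c \<gamma> X" and small: "nB * op_norm whole (HD \<gamma>) X < d"
  obtains T where "clinear_op T" "norm T \<le> nB * op_norm whole (HD \<gamma>) X" "Phi T = T" "X = mult_op M (X_kernel T)"
proof -
  have Xb: "X \<in> bounded_ops whole (HD \<gamma>)" using X by (simp add: riccati_X_def)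
  have Xin: "X x \<in> vecs (L2 M)" and Xadd: "X (x + y) = vadd (L2 M) (X x) (X y)"
    and Xscale: "X (k *\<^sub>C x) = vscale (L2 M) k (X x)" for x y k
    using bounded_opsD(1-3)[OF Xb] by auto
  define N where "N = op_norm whole (HD \<gamma>) X"
  have N: "N \<ge> 0" "vnorm (HD \<gamma>) (X x) \<le> N * norm x" for x
    using bounded_ops_norm[OF Xb] by (auto simp: N_def)
  have Bb: "B_op b \<gamma> \<in> bounded_ops (HD \<gamma>) whole" by (rule B_op_bounded(1)[OF kb])
  define T where "T = Blinfun (\<lambda>x. B_op b \<gamma> (X x))"
  have BX: "norm (B_op b \<gamma> (X x)) \<le> (nB * N) * norm x" for x
    using order_trans[OF norm_B_op[OF kb Xin] mult_left_mono[OF N(2) nBC_nonneg(1)]] by (simp add: mult_ac)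
  have BXscale: "B_op b \<gamma> (X (k *\<^sub>C x)) = k *\<^sub>C B_op b \<gamma> (X x)" for k x
    using bounded_opsD(3)[OF Bb Xin] by (simp add: Xscale)
  have "bounded_linear (\<lambda>x. B_op b \<gamma> (X x))"
    by (rule bounded_linear_intro[where K = "nB * N"])
      (use bounded_opsD(2)[OF Bb Xin Xin] BX BXscale in \<open>auto simp: Xadd scaleR_scaleC mult.commute\<close>)
  then have Tx: "blinfun_apply T x = B_op b \<gamma> (X x)" for x by (simp add: T_def bounded_linear_Blinfun_apply)
  have Tcl: "clinear_op T" by (simp add: clinear_op_def Tx BXscale)
  have Tn: "norm T \<le> nB * N"
    by (rule norm_blinfun_bound) (use N nBC_nonneg BX in \<open>auto simp: Tx\<close>)
  then have Td: "norm T < d" using small by (simp add: N_def)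
  note k = X_kernel(1)[OF Tcl Td]
  have rL: "rep (X x) \<in> L2_fun M" and rX: "L2_class M (rep (X x)) = X x" for x
    using rep_vecs[OF Xin] by auto
  have rep_add: "AE z in M. rep (X (x + y)) z = rep (X x) z + rep (X y) z" for x y
  proof (rule L2_class_eqD[OF rL])
    show "L2_class M (rep (X (x + y))) = L2_class M (\<lambda>z. rep (X x) z + rep (X y) z)"
      by (simp only: vadd_L2_class[OF rL rL, symmetric] rX) (rule Xadd)
  qed
  have rep_scale: "AE z in M. rep (X (k *\<^sub>C x)) z = k *\<^sub>C rep (X x) z" for k x
  proof (rule L2_class_eqD[OF rL])
    show "L2_class M (rep (X (k *\<^sub>C x))) = L2_class M (\<lambda>z. k *\<^sub>C rep (X x) z)"
      by (simp only: vscale_L2_class[OF rL, symmetric] rX) (rule Xscale)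
  qed
  have ric: "AE z in M. rep (X (blinfun_apply A x)) z - z *\<^sub>C rep (X x) z + rep (X (blinfun_apply T x)) z
      = blinfun_apply (c z) x" for x
  proof -
    have zf: "(\<lambda>z. z *\<^sub>C rep (X x) z) \<in> L2_fun M" using D_op_class(1)[OF rL[of x], of 0] by simp
    have df: "(\<lambda>z. rep (X (blinfun_apply A x)) z - z *\<^sub>C rep (X x) z) \<in> L2_fun M"
      using L2_fun_add[OF rL[of "blinfun_apply A x"] L2_fun_scaleC[OF zf, of "-1"]] by (simp add: scaleC_minus_left)
    have "L2_class M (\<lambda>z. rep (X (blinfun_apply A x)) z - z *\<^sub>C rep (X x) z + rep (X (blinfun_apply T x)) z)
        = vadd (HD \<gamma>) (vminus (HD \<gamma>) (X (blinfun_apply A x)) (D_op \<gamma> (X x))) (X (B_op b \<gamma> (X x)))"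
      using vadd_L2_class[OF df rL] vminus_L2_class[OF rL zf] D_op_class(2)[OF rL[of x]] by (simp add: rX Tx)
    also have "\<dots> = L2_class M (\<lambda>z. blinfun_apply (c z) x)" using X by (simp add: riccati_X_def C_op_def)
    finally show ?thesis by (rule L2_class_eqD[OF L2_fun_add[OF df rL]])
  qed
  define u where "u x z = rep (X x) z - blinfun_apply (X_kernel T z) x" for x z
  have uL: "u x \<in> L2_fun M" for x
    unfolding u_def using L2_fun_add[OF rL L2_fun_scaleC[OF L2_kernel_apply[OF k], of "-1"]] by (simp add: scaleC_minus_left)
  define N2 where "N2 = 2 * N\<^sup>2 + 2 * (LINT z|M. (norm (X_kernel T z))\<^sup>2)"
  have ubd: "(LINT z|M. (norm (u x z))\<^sup>2) \<le> N2 * (norm x)\<^sup>2" for x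
  proof -
    have "(LINT z|M. (norm (u x z))\<^sup>2) \<le> (LINT z|M. 2 * (norm (rep (X x) z))\<^sup>2 + 2 * ((norm (X_kernel T z))\<^sup>2 * (norm x)\<^sup>2))"
    proof (rule integral_mono)
      fix z
      have "(norm (u x z))\<^sup>2 \<le> 2 * (norm (rep (X x) z))\<^sup>2 + 2 * (norm (blinfun_apply (X_kernel T z) x))\<^sup>2"
        unfolding u_def by (simp add: parallelogram)
      moreover have "(norm (blinfun_apply (X_kernel T z) x))\<^sup>2 \<le> (norm (X_kernel T z))\<^sup>2 * (norm x)\<^sup>2"
        by (metis norm_blinfun norm_ge_zero power_mono power_mult_distrib)
      ultimately show "(norm (u x z))\<^sup>2 \<le> 2 * (norm (rep (X x) z))\<^sup>2 + 2 * ((norm (X_kernel T z))\<^sup>2 * (norm x)\<^sup>2)"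
        by linarith
    qed (use L2_funD(2)[OF uL] L2_funD(2)[OF rL] L2_kernelD(3)[OF k] in auto)
    also have "\<dots> = 2 * (LINT z|M. (norm (rep (X x) z))\<^sup>2) + 2 * ((LINT z|M. (norm (X_kernel T z))\<^sup>2) * (norm x)\<^sup>2)"
      using L2_funD(2)[OF rL] L2_kernelD(3)[OF k] by simp
    also have "(LINT z|M. (norm (rep (X x) z))\<^sup>2) = (vnorm (HD \<gamma>) (X x))\<^sup>2"
      using vnorm_L2_class[OF rL[of x]] by (simp add: rX integral_nonneg_AE)
    also have "(vnorm (HD \<gamma>) (X x))\<^sup>2 \<le> (N * norm x)\<^sup>2"
      by (rule power_mono[OF N(2) vnorm_L2_nonneg[OF Xin]])
    finally show ?thesis by (simp add: N2_def power_mult_distrib algebra_simps)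
  qed
  have shift: "AE z in M. u (blinfun_apply (A + T) x - \<zeta> *\<^sub>C x) z = (z - \<zeta>) *\<^sub>C u x z" for x \<zeta>
  proof -
    have e: "blinfun_apply (A + T) x - \<zeta> *\<^sub>C x = (blinfun_apply A x + blinfun_apply T x) + (- \<zeta>) *\<^sub>C x"
      by (simp add: blinfun.add_left scaleC_minus_left)
    have sp: "AE z in M. z \<in> open_arc \<gamma>" by (rule AE_I2) (simp add: space_M)
    show ?thesis
      using rep_add[of "blinfun_apply A x + blinfun_apply T x" "(- \<zeta>) *\<^sub>C x"]
        rep_add[of "blinfun_apply A x" "blinfun_apply T x"] rep_scale[of "- \<zeta>" x] ric[of x] sp
    proof eventually_elim
      case (elim z)
      have "rep (X (blinfun_apply (A + T) x - \<zeta> *\<^sub>C x)) z = blinfun_apply (c z) x + (z - \<zeta>) *\<^sub>C rep (X x) z"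
        unfolding e elim(1,2,3) elim(4)[symmetric] by (simp add: scaleC_diff_left scaleC_minus_left)
      then show ?case
        by (simp only: u_def X_kernel_shift[OF Tcl Td elim(5)] scaleC_diff_right) simp
    qed
  qed
  have "X x = mult_op M (X_kernel T) x" for x
  proof -
    have "AE z in M. u x z = 0" by (rule intertwining_zero[OF Tcl Td uL ubd shift])
    then have "AE z in M. rep (X x) z = blinfun_apply (X_kernel T z) x" by eventually_elim (simp add: u_def)
    then show ?thesis unfolding mult_op_def using L2_class_cong rX[of x] by metis
  qed
  then have Xeq: "X = mult_op M (X_kernel T)" by blast
  have "Phi T = T" by (rule blinfun_eqI) (simp add: B_op_X_kernel[OF Tcl Td, symmetric] Tx Xeq)
  then show ?thesis using that Tcl Tn Xeq by (simp add: N_def)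
qed

subsection \<open>Solutions of the second Riccati equation\<close>

lemma C_op_in: "C_op c \<gamma> x \<in> vecs (L2 M)" "C_op c \<gamma> \<in> bounded_ops whole (L2 M)"
  using mult_op_bounded(1)[OF kc] bounded_opsD(1)[OF mult_op_bounded(1)[OF kc]] by (simp_all add: C_op_mult_op)

lemma Y_kernel_equation:
  assumes T: "clinear_op T" "norm T < d" and f: "f \<in> L2_fun M"
  shows "B_op (Y_kernel T) \<gamma> (L2_class M (\<lambda>z. z *\<^sub>C f z)) - blinfun_apply (A + T) (B_op (Y_kernel T) \<gamma> (L2_class M f))
    = B_op b \<gamma> (L2_class M f)"
proof -
  note k = Y_kernel(1)[OF T]
  have zf: "(\<lambda>z. z *\<^sub>C f z) \<in> L2_fun M" using D_op_class(1)[OF f, of 0] by simp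
  note kf = kernel_apply(1,2)[OF k f] and kz = kernel_apply(1,2)[OF k zf]
  have clAT: "clinear_op (A + T)" by (rule clinear_op_add[OF A_clinear T(1)])
  have "has_arc_integral (\<lambda>z. blinfun_apply (A + T) (blinfun_apply (Y_kernel T z) (f z)))
      (blinfun_apply (A + T) (arc_integral \<gamma> (\<lambda>z. blinfun_apply (Y_kernel T z) (f z)))) \<gamma>"
    by (rule arc_integral_linear[OF kf blinfun.bounded_linear_right blinfun_apply_clinear[OF clAT]])
  then have "has_arc_integral (\<lambda>z. blinfun_apply (Y_kernel T z) (z *\<^sub>C f z) - blinfun_apply (A + T) (blinfun_apply (Y_kernel T z) (f z)))
      (arc_integral \<gamma> (\<lambda>z. blinfun_apply (Y_kernel T z) (z *\<^sub>C f z))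
        - blinfun_apply (A + T) (arc_integral \<gamma> (\<lambda>z. blinfun_apply (Y_kernel T z) (f z)))) \<gamma>"
    using arc_integrable[OF kz] unfolding has_arc_integral_def scaleC_diff_right by (rule has_integral_diff[rotated])
  then have "has_arc_integral (\<lambda>z. blinfun_apply (b z) (f z))
      (arc_integral \<gamma> (\<lambda>z. blinfun_apply (Y_kernel T z) (z *\<^sub>C f z))
        - blinfun_apply (A + T) (arc_integral \<gamma> (\<lambda>z. blinfun_apply (Y_kernel T z) (f z)))) \<gamma>"
  proof (rule arc_integral_cong[rotated])
    fix z assume z: "z \<in> open_arc \<gamma>"
    note r = resolvent_apply(2)[OF resolvent_bound(1)[OF T(2) open_arc_path_image[OF z]], of "blinfun_apply (b z) (f z)"]
    have cl: "clinear_op (Y_kernel T z)" using L2_kernelD(2)[OF k] z by (simp add: space_M)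
    show "blinfun_apply (Y_kernel T z) (z *\<^sub>C f z) - blinfun_apply (A + T) (blinfun_apply (Y_kernel T z) (f z)) = blinfun_apply (b z) (f z)"
      unfolding blinfun_apply_clinear[OF cl]
      using r by (simp add: Y_kernel_def blinfun.minus_left blinfun.minus_right scaleC_minus_right algebra_simps)
  qed
  then show ?thesis
    unfolding B_op_class[OF k zf] B_op_class[OF k f] B_op_class[OF kb f] by (rule arc_integral_eqI[symmetric])
qed

lemma Y_kernel_C:
  assumes T: "clinear_op T" "norm T < d"
  shows "B_op (Y_kernel T) \<gamma> (C_op c \<gamma> x) = - blinfun_apply (Psi T) x"
proof -
  note k = Y_kernel(1)[OF T] and cx = L2_kernel_apply[OF kc, of x]
  note s = sandwich(1,2)[OF admissible_left resolvent_on_arc[OF T]]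
  have "blinfun_apply (Psi T) x = arc_integral \<gamma> (\<lambda>z. blinfun_apply (id_blinfun o\<^sub>L resolvent (A + T) z o\<^sub>L (b z o\<^sub>L c z)) x)"
    unfolding resolvent_integral_def by (rule arc_integral_apply[OF s])
  also have "\<dots> = arc_integral \<gamma> (\<lambda>z. - blinfun_apply (Y_kernel T z) (blinfun_apply (c z) x))"
    by (simp add: Y_kernel_def blinfun.minus_left)
  also have "\<dots> = - arc_integral \<gamma> (\<lambda>z. blinfun_apply (Y_kernel T z) (blinfun_apply (c z) x))"
    by (rule arc_integral_eqI, rule arc_integral_linear[OF kernel_apply(1,2)[OF k cx]])
      (auto intro: bounded_linear_minus bounded_linear_ident simp: scaleC_minus_right)
  finally show ?thesis by (simp add: C_op_def B_op_class[OF k cx])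
qed

lemma riccati_Y_solution:
  assumes T: "clinear_op T" "norm T < d" and fixed: "Psi T = T"
  shows "riccati_Y A b c \<gamma> (B_op (Y_kernel T) \<gamma>)"
  unfolding riccati_Y_def
proof (intro conjI ballI)
  note k = Y_kernel(1)[OF T]
  show "B_op (Y_kernel T) \<gamma> \<in> bounded_ops (HD \<gamma>) whole" by (rule B_op_bounded(1)[OF k])
  fix F :: "(complex \<Rightarrow> 'h) set" assume "F \<in> vecs (HD \<gamma>)"
  then obtain f where f: "f \<in> L2_fun M" "F = L2_class M f" by (auto simp: vecs_L2)
  show "B_op (Y_kernel T) \<gamma> (D_op \<gamma> F) - blinfun_apply A (B_op (Y_kernel T) \<gamma> F)
      + B_op (Y_kernel T) \<gamma> (C_op c \<gamma> (B_op (Y_kernel T) \<gamma> F)) = B_op b \<gamma> F"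
    using Y_kernel_equation[OF T f(1)]
    by (simp add: f(2) D_op_class(2)[OF f(1)] Y_kernel_C[OF T] fixed blinfun.add_left algebra_simps)
qed

text \<open>Here \<open>W (\<lambda> f) = Z (W f)\<close>, so that \<open>W f = (Z - \<zeta>)\<inverse> W ((\<lambda> - \<zeta>) f)\<close>. For \<open>f\<close> supported in a small ball
  around \<open>\<zeta>\<close> the factor \<open>\<lambda> - \<zeta>\<close> is small, and iteration forces \<open>W f = 0\<close>; a general \<open>f\<close> is a finite sum of
  such functions.\<close>

lemma intertwining_zero_dual:
  fixes W :: "(complex \<Rightarrow> 'h) set \<Rightarrow> 'a"
  assumes T: "clinear_op T" "norm T < d"
    and add: "\<And>f g. f \<in> L2_fun M \<Longrightarrow> g \<in> L2_fun M \<Longrightarrow> W (L2_class M (\<lambda>z. f z + g z)) = W (L2_class M f) + W (L2_class M g)"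
    and bd: "\<And>f. f \<in> L2_fun M \<Longrightarrow> norm (W (L2_class M f)) \<le> N * vnorm (L2 M) (L2_class M f)" and N: "N \<ge> 0"
    and shift: "\<And>f \<zeta>. f \<in> L2_fun M \<Longrightarrow> W (L2_class M (\<lambda>z. (z - \<zeta>) *\<^sub>C f z))
        = blinfun_apply (A + T) (W (L2_class M f)) - \<zeta> *\<^sub>C W (L2_class M f)"
    and f: "f \<in> L2_fun M"
  shows "W (L2_class M f) = 0"
proof -
  define K where "K = 1 / (d - norm T)"
  define \<rho> where "\<rho> = (d - norm T) / 2"
  have \<rho>: "\<rho> > 0" and K: "K > 0" and K\<rho>: "K * \<rho> = 1 / 2" using T(2) by (auto simp: \<rho>_def K_def)
  have in_ball: "W (L2_class M g) = 0"
    if \<zeta>: "\<zeta> \<in> path_image \<gamma>" and g: "g \<in> L2_fun M" and g0: "\<And>z. z \<notin> ball \<zeta> \<rho> \<Longrightarrow> g z = 0" for g \<zeta>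
  proof -
    have iter: "norm (W (L2_class M g)) \<le> (1/2) ^ k * (N * vnorm (L2 M) (L2_class M g))"
      if "g \<in> L2_fun M" "\<And>z. z \<notin> ball \<zeta> \<rho> \<Longrightarrow> g z = 0" for g k
      using that
    proof (induction k arbitrary: g)
      case 0
      then show ?case using bd by simp
    next
      case (Suc k)
      let ?g = "\<lambda>z. (z - \<zeta>) *\<^sub>C g z"
      have g': "?g \<in> L2_fun M" by (rule D_op_class(1)[OF Suc.prems(1)])
      have "W (L2_class M g) = blinfun_apply (resolvent (A + T) \<zeta>) (W (L2_class M ?g))"
        unfolding shift[OF Suc.prems(1)] resolvent_apply(1)[OF resolvent_bound(1)[OF T(2) \<zeta>]] ..
      then have "norm (W (L2_class M g)) \<le> norm (resolvent (A + T) \<zeta>) * norm (W (L2_class M ?g))"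
        by (simp add: norm_blinfun)
      also have "\<dots> \<le> K * ((1/2) ^ k * (N * vnorm (L2 M) (L2_class M ?g)))"
        by (intro mult_mono Suc.IH[OF g']) (use Suc.prems K resolvent_bound(2)[OF T(2) \<zeta>] in \<open>auto simp: K_def\<close>)
      also have "\<dots> \<le> K * ((1/2) ^ k * (N * (\<rho> * vnorm (L2 M) (L2_class M g))))"
      proof (intro mult_left_mono)
        have "(LINT z|M. (norm (?g z))\<^sup>2) \<le> (LINT z|M. \<rho>\<^sup>2 * (norm (g z))\<^sup>2)"
        proof (rule integral_mono[OF L2_funD(2)[OF g']])
          show "integrable M (\<lambda>z. \<rho>\<^sup>2 * (norm (g z))\<^sup>2)" using L2_funD(2)[OF Suc.prems(1)] by simp
          fix z
          show "(norm (?g z))\<^sup>2 \<le> \<rho>\<^sup>2 * (norm (g z))\<^sup>2"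
          proof (cases "z \<in> ball \<zeta> \<rho>")
            case True
            then have "cmod (z - \<zeta>) \<le> \<rho>" by (simp add: dist_norm norm_minus_commute)
            then show ?thesis by (simp add: norm_scaleC power_mult_distrib mult_right_mono power_mono)
          qed (simp add: Suc.prems(2))
        qed
        then have "sqrt (LINT z|M. (norm (?g z))\<^sup>2) \<le> sqrt (\<rho>\<^sup>2 * (LINT z|M. (norm (g z))\<^sup>2))" by simp
        then show "vnorm (L2 M) (L2_class M ?g) \<le> \<rho> * vnorm (L2 M) (L2_class M g)"
          using \<rho> by (simp add: vnorm_L2_class[OF g'] vnorm_L2_class[OF Suc.prems(1)] real_sqrt_mult)
      qed (use K N in auto)
      also have "\<dots> = (K * \<rho>) * ((1/2) ^ k * (N * vnorm (L2 M) (L2_class M g)))" by simp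
      finally show ?case by (simp add: K\<rho>)
    qed
    have "norm (W (L2_class M g)) \<le> 0"
    proof (rule LIMSEQ_le_const)
      show "(\<lambda>k. (1/2) ^ k * (N * vnorm (L2 M) (L2_class M g))) \<longlonglongrightarrow> 0"
        by (intro tendsto_mult_left_zero LIMSEQ_power_zero) simp
    qed (use iter[OF g g0] in blast)
    then show ?thesis by simp
  qed
  obtain S where S: "finite S" "S \<subseteq> path_image \<gamma>" "open_arc \<gamma> \<subseteq> (\<Union>\<zeta>\<in>S. ball \<zeta> \<rho>)"
    by (rule finite_ball_cover[OF \<rho>])
  have ind: "(\<lambda>z. indicat_real U z *\<^sub>R f z) \<in> L2_fun M" if "U \<in> sets borel" for U
    by (rule L2_fun_indicator[OF sets_M_borel[OF that] f])
  have "W (L2_class M (\<lambda>z. indicat_real (\<Union>\<zeta>\<in>S'. ball \<zeta> \<rho>) z *\<^sub>R f z)) = 0" if "S' \<subseteq> S" for S'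
    using finite_subset[OF that S(1)] that
  proof (induction S' rule: finite_induct)
    case empty
    have "W (L2_class M (\<lambda>z. 0)) = 0" using add[OF L2_fun_0 L2_fun_0] by simp
    then show ?case by simp
  next
    case (insert \<zeta> S')
    let ?U = "\<Union>\<zeta>\<in>S'. ball \<zeta> \<rho>"
    have U: "?U \<in> sets borel" by (intro borel_open open_UN) auto
    then have V: "ball \<zeta> \<rho> - ?U \<in> sets borel" by auto
    have "(\<lambda>z. indicat_real (\<Union>\<zeta>\<in>insert \<zeta> S'. ball \<zeta> \<rho>) z *\<^sub>R f z)
        = (\<lambda>z. indicat_real ?U z *\<^sub>R f z + indicat_real (ball \<zeta> \<rho> - ?U) z *\<^sub>R f z)"
      by (auto simp: indicator_def)
    moreover have "W (L2_class M (\<lambda>z. indicat_real (ball \<zeta> \<rho> - ?U) z *\<^sub>R f z)) = 0"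
      by (rule in_ball[of \<zeta>, OF _ ind[OF V]]) (use insert.prems S(2) in auto)
    ultimately show ?case using add[OF ind[OF U] ind[OF V]] insert by simp
  qed
  from this[OF order_refl] have "W (L2_class M (\<lambda>z. indicat_real (\<Union>\<zeta>\<in>S. ball \<zeta> \<rho>) z *\<^sub>R f z)) = 0" .
  moreover have "L2_class M (\<lambda>z. indicat_real (\<Union>\<zeta>\<in>S. ball \<zeta> \<rho>) z *\<^sub>R f z) = L2_class M f"
    by (rule L2_class_cong, rule AE_I2) (use S(3) in \<open>auto simp: space_M indicator_def\<close>)
  ultimately show ?thesis by simp
qed

text \<open>The second equation becomes linear through \<open>T = - Y C\<close>.\<close>

lemma riccati_Y_form:
  assumes Y: "riccati_Y A b c \<gamma> Y" and small: "nC * op_norm (HD \<gamma>) whole Y < d"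
  obtains T where "clinear_op T" "norm T \<le> nC * op_norm (HD \<gamma>) whole Y" "Psi T = T" "Y = B_op (Y_kernel T) \<gamma>"
proof -
  have Yb: "Y \<in> bounded_ops (HD \<gamma>) whole" using Y by (simp add: riccati_Y_def)
  define N where "N = op_norm (HD \<gamma>) whole Y"
  have N: "N \<ge> 0" "F \<in> vecs (HD \<gamma>) \<Longrightarrow> norm (Y F) \<le> N * vnorm (HD \<gamma>) F" for F
    using bounded_ops_norm[OF Yb vnorm_L2_nonneg] by (auto simp: N_def)
  define T where "T = Blinfun (\<lambda>x. - Y (C_op c \<gamma> x))"
  have nCx: "vnorm (HD \<gamma>) (C_op c \<gamma> x) \<le> nC * norm x" for x
    unfolding C_op_mult_op by (rule vnorm_mult_op[OF kc])
  have YC: "norm (- Y (C_op c \<gamma> x)) \<le> (nC * N) * norm x" for x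
    using order_trans[OF N(2)[OF C_op_in(1)] mult_left_mono[OF nCx N(1)]] by (simp add: mult_ac)
  have YCscale: "- Y (C_op c \<gamma> (k *\<^sub>C x)) = k *\<^sub>C (- Y (C_op c \<gamma> x))" for k x
    using bounded_opsD(3)[OF C_op_in(2), of x k] bounded_opsD(3)[OF Yb C_op_in(1)] by (simp add: scaleC_minus_right)
  have YCadd: "- Y (C_op c \<gamma> (x + y)) = - Y (C_op c \<gamma> x) + - Y (C_op c \<gamma> y)" for x y
    using bounded_opsD(2)[OF C_op_in(2), of x y] bounded_opsD(2)[OF Yb C_op_in(1) C_op_in(1)] by simp
  have "bounded_linear (\<lambda>x. - Y (C_op c \<gamma> x))"
  proof (rule bounded_linear_intro[where K = "nC * N"])
    show "norm (- Y (C_op c \<gamma> x)) \<le> norm x * (nC * N)" for x using YC[of x] by (simp only: mult.commute)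
    show "- Y (C_op c \<gamma> (t *\<^sub>R x)) = t *\<^sub>R (- Y (C_op c \<gamma> x))" for t x unfolding scaleR_scaleC by (rule YCscale)
  qed (rule YCadd)
  then have Tx: "blinfun_apply T x = - Y (C_op c \<gamma> x)" for x by (simp add: T_def bounded_linear_Blinfun_apply)
  have Tcl: "clinear_op T" unfolding clinear_op_def Tx using YCscale by blast
  have Tn: "norm T \<le> nC * N"
    by (rule norm_blinfun_bound) (use N nBC_nonneg YC in \<open>auto simp: Tx\<close>)
  then have Td: "norm T < d" using small by (simp add: N_def)
  note k = Y_kernel(1)[OF Tcl Td]
  let ?Y0 = "B_op (Y_kernel T) \<gamma>"
  note Y0b = B_op_bounded(1)[OF k]
  let ?nY = "sqrt (LINT z|M. (norm (Y_kernel T z))\<^sup>2)"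
  define W where "W F = Y F - ?Y0 F" for F
  have W0: "W (L2_class M f) = 0" if f: "f \<in> L2_fun M" for f
  proof (rule intertwining_zero_dual[OF Tcl Td _ _ _ _ f, where N = "N + ?nY"])
    show "N + ?nY \<ge> 0" using N(1) by (auto intro!: add_nonneg_nonneg integral_nonneg_AE)
    fix f g :: "complex \<Rightarrow> 'h" and \<zeta> assume f: "f \<in> L2_fun M"
    have "norm (W (L2_class M f)) \<le> norm (Y (L2_class M f)) + norm (?Y0 (L2_class M f))"
      unfolding W_def by (rule norm_triangle_ineq4)
    then show "norm (W (L2_class M f)) \<le> (N + ?nY) * vnorm (L2 M) (L2_class M f)"
      using N(2)[OF L2_class_in[OF f]] norm_B_op[OF k L2_class_in[OF f]] by (simp add: distrib_right)
    show "W (L2_class M (\<lambda>z. f z + g z)) = W (L2_class M f) + W (L2_class M g)" if g: "g \<in> L2_fun M"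
      using bounded_opsD(2)[OF Yb L2_class_in[OF f] L2_class_in[OF g]] bounded_opsD(2)[OF Y0b L2_class_in[OF f] L2_class_in[OF g]]
      by (simp add: W_def vadd_L2_class[OF f g])
    have zf: "(\<lambda>z. z *\<^sub>C f z) \<in> L2_fun M" using D_op_class(1)[OF f, of 0] by simp
    have "Y (D_op \<gamma> (L2_class M f)) - blinfun_apply A (Y (L2_class M f)) + Y (C_op c \<gamma> (Y (L2_class M f))) = B_op b \<gamma> (L2_class M f)"
      using Y L2_class_in[OF f] by (simp add: riccati_Y_def)
    then have "Y (L2_class M (\<lambda>z. z *\<^sub>C f z)) - blinfun_apply (A + T) (Y (L2_class M f)) = B_op b \<gamma> (L2_class M f)"
      by (simp add: D_op_class(2)[OF f] blinfun.add_left Tx algebra_simps)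
    then have 1: "W (L2_class M (\<lambda>z. z *\<^sub>C f z)) = blinfun_apply (A + T) (W (L2_class M f))"
      using Y_kernel_equation[OF Tcl Td f] unfolding W_def blinfun.diff_right by (simp add: algebra_simps)
    have "L2_class M (\<lambda>z. (z - \<zeta>) *\<^sub>C f z) = vadd (L2 M) (L2_class M (\<lambda>z. z *\<^sub>C f z)) (vscale (L2 M) (- \<zeta>) (L2_class M f))"
      unfolding vscale_L2_class[OF f] vadd_L2_class[OF zf L2_fun_scaleC[OF f]]
      by (simp add: scaleC_diff_left scaleC_minus_left)
    then have "W (L2_class M (\<lambda>z. (z - \<zeta>) *\<^sub>C f z)) = W (L2_class M (\<lambda>z. z *\<^sub>C f z)) + (- \<zeta>) *\<^sub>C W (L2_class M f)"
      using bounded_opsD(2)[OF Yb L2_class_in[OF zf] L2_class_in[OF L2_fun_scaleC[OF f, of "- \<zeta>"]]]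
        bounded_opsD(2)[OF Y0b L2_class_in[OF zf] L2_class_in[OF L2_fun_scaleC[OF f, of "- \<zeta>"]]]
        bounded_opsD(3)[OF Yb L2_class_in[OF f], of "- \<zeta>"] bounded_opsD(3)[OF Y0b L2_class_in[OF f], of "- \<zeta>"]
      by (simp add: W_def vscale_L2_class[OF f] scaleC_diff_right)
    then show "W (L2_class M (\<lambda>z. (z - \<zeta>) *\<^sub>C f z)) = blinfun_apply (A + T) (W (L2_class M f)) - \<zeta> *\<^sub>C W (L2_class M f)"
      by (simp add: 1 scaleC_minus_left)
  qed
  have Yeq: "Y = ?Y0"
  proof
    fix F
    show "Y F = ?Y0 F"
    proof (cases "F \<in> vecs (HD \<gamma>)")
      case True
      then show ?thesis using W0 by (auto simp: vecs_L2 W_def)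
    next
      case False
      then show ?thesis
        using PiE_arb[OF bounded_opsD(4)[OF Yb] False] PiE_arb[OF bounded_opsD(4)[OF Y0b] False] by simp
    qed
  qed
  have "Psi T = T"
  proof (rule blinfun_eqI)
    fix x
    have "blinfun_apply T x = - ?Y0 (C_op c \<gamma> x)" by (simp only: Tx Yeq)
    then show "blinfun_apply (Psi T) x = blinfun_apply T x" by (simp add: Y_kernel_C[OF Tcl Td])
  qed
  then show ?thesis using that Tcl Tn Yeq by (simp add: N_def)
qed

subsection \<open>Existence, uniqueness and bounds\<close>

text \<open>The bounds of the theorem involve the smaller root of \<open>x (d - x) = nB nC\<close>, which is at least the
  smaller root \<open>r\<close> of \<open>x (d - x) = V\<close>. The parameters \<open>nL\<close> and \<open>nR\<close> are \<open>nB\<close> and \<open>nC\<close> for the first Riccati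
  equation, and vice versa for the second one.\<close>

lemma radius_bounds:
  fixes nL nR :: real
  assumes n: "nL * nR = nB * nC" "nL > 0" "nR \<ge> 0" and s: "s \<le> nR / (d - t)" "t \<le> r"
  shows "s \<le> (1 / nL) * (d / 2 - sqrt (d\<^sup>2 / 4 - nB * nC))"
    "(1 / nL) * (d / 2 - sqrt (d\<^sup>2 / 4 - nB * nC)) < (1 / nL) * (d - sqrt (nB * nC))"
proof -
  define p where "p = nB * nC"
  define rp where "rp = d / 2 - sqrt (d\<^sup>2 / 4 - p)"
  have p: "0 \<le> p" "p < d\<^sup>2 / 4" "V \<le> p" using nBC_nonneg small V_bounds by (auto simp: p_def)
  have rp2: "rp < d / 2" using p by (simp add: rp_def)
  have "(sqrt (d\<^sup>2 / 4 - p))\<^sup>2 = d\<^sup>2 / 4 - p" using p by simp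
  then have rpp: "rp * (d - rp) = p" by (simp add: rp_def power2_eq_square algebra_simps)
  have "r \<le> rp" unfolding r_def rp_def using p by simp
  then have le: "d - rp \<le> d - t" using s(2) by simp
  have "s \<le> nR / (d - rp)"
    by (rule order_trans[OF s(1) divide_left_mono]) (use le rp2 d_pos n in auto)
  also have "\<dots> = (1 / nL) * rp"
    using rpp n rp2 d_pos by (simp add: p_def field_simps)
  finally show "s \<le> (1 / nL) * (d / 2 - sqrt (d\<^sup>2 / 4 - nB * nC))" by (simp add: rp_def p_def)
  have "sqrt p < sqrt (d\<^sup>2 / 4)" using p by simp
  then have "sqrt p < d / 2" using d_pos by (simp add: real_sqrt_divide)
  then have "rp < d - sqrt p" using rp2 by linarith
  then show "(1 / nL) * (d / 2 - sqrt (d\<^sup>2 / 4 - nB * nC)) < (1 / nL) * (d - sqrt (nB * nC))"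
    unfolding rp_def p_def using n by (intro mult_strict_left_mono) auto
qed

text \<open>Both \<open>d - norm T\<close> and \<open>d - norm S\<close> exceed \<open>sqrt (nB nC)\<close>, the latter because of \<open>norm S < d / 2\<close>, and so their
  product exceeds \<open>V\<close>.\<close>

lemma fixpoint_in_large_ball_unique:
  assumes PQ: "admissible P Q" and S: "clinear_op S" "norm S \<le> r" "resolvent_integral P Q S = S"
    and T: "clinear_op T" "norm T < d - sqrt (nB * nC)" "resolvent_integral P Q T = T"
  shows "T = S"
proof (rule resolvent_integral_unique[OF PQ T(1) _ S(1) _ T(3) S(3)])
  have q: "sqrt (nB * nC) < sqrt (d\<^sup>2 / 4)" using small by simp
  then have q: "sqrt (nB * nC) < d / 2" using d_pos by (simp add: real_sqrt_divide)
  have q0: "0 \<le> sqrt (nB * nC)" using nBC_nonneg by simp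
  show "norm T < d" using T(2) q0 by linarith
  show "norm S < d" using S(2) r_bounds(2) d_pos by linarith
  have "sqrt (nB * nC) * sqrt (nB * nC) < (d - norm T) * (d - norm S)"
    by (rule mult_strict_mono') (use T(2) S(2) r_bounds(2) q q0 in linarith)+
  then show "V < (d - norm T) * (d - norm S)" using V_bounds(2) nBC_nonneg by simp
qed

theorem riccati_solutions:
  shows "\<exists>X Y. riccati_X A b c \<gamma> X \<and> riccati_Y A b c \<gamma> Y \<and>
     (B_op b \<gamma> \<noteq> zero_op (HD \<gamma>) whole \<longrightarrow>
        op_norm whole (HD \<gamma>) X < (1 / nB) * (d - sqrt (nB * nC)) \<and>
        (\<forall>X'. riccati_X A b c \<gamma> X' \<and> op_norm whole (HD \<gamma>) X' < (1 / nB) * (d - sqrt (nB * nC)) \<longrightarrow> X' = X) \<and>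
        E_norm \<gamma> X < top \<and>
        E_norm \<gamma> X \<le> ennreal ((1 / nB) * (d / 2 - sqrt (d\<^sup>2 / 4 - nB * nC)))) \<and>
     (C_op c \<gamma> \<noteq> zero_op whole (HD \<gamma>) \<longrightarrow>
        op_norm (HD \<gamma>) whole Y < (1 / nC) * (d - sqrt (nB * nC)) \<and>
        (\<forall>Y'. riccati_Y A b c \<gamma> Y' \<and> op_norm (HD \<gamma>) whole Y' < (1 / nC) * (d - sqrt (nB * nC)) \<longrightarrow> Y' = Y) \<and>
        E_norm_dual \<gamma> Y < top \<and>
        E_norm_dual \<gamma> Y \<le> ennreal ((1 / nC) * (d / 2 - sqrt (d\<^sup>2 / 4 - nB * nC)))) \<and>
     Z_op A b c \<gamma> = Blinfun (\<lambda>x. blinfun_apply A x + B_op b \<gamma> (X x))"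
proof -
  obtain T where T: "clinear_op T" "norm T \<le> r" "Phi T = T"
    by (rule resolvent_integral_fixpoint[OF admissible_right])
  obtain S where S: "clinear_op S" "norm S \<le> r" "Psi S = S"
    by (rule resolvent_integral_fixpoint[OF admissible_left])
  have Td: "norm T < d" and Sd: "norm S < d" using T S r_bounds d_pos by auto
  define X where "X = mult_op M (X_kernel T)"
  define Y where "Y = B_op (Y_kernel S) \<gamma>"
  note kX = X_kernel[OF T(1) Td] and kY = Y_kernel[OF S(1) Sd]
  have X: "riccati_X A b c \<gamma> X" unfolding X_def by (rule riccati_X_solution[OF T(1) Td T(3)])
  have Y: "riccati_Y A b c \<gamma> Y" unfolding Y_def by (rule riccati_Y_solution[OF S(1) Sd S(3)])
  have EX: "E_norm \<gamma> X = ennreal (sqrt (LINT z|M. (norm (X_kernel T z))\<^sup>2))"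
    unfolding X_def by (rule E_norm_mult_op[OF kX(1)])
  have EY: "E_norm_dual \<gamma> Y = ennreal (sqrt (LINT z|M. (norm (Y_kernel S z))\<^sup>2))"
    unfolding Y_def by (rule E_norm_dual_B_op[OF kY(1)])
  have Z: "Z_op A b c \<gamma> = Blinfun (\<lambda>x. blinfun_apply A x + B_op b \<gamma> (X x))"
  proof -
    have "Z_op A b c \<gamma> = A + T"
      by (rule Z_op_props(3)) (use solves_Z_iff[OF Td] T r_bounds(2) in auto)
    also have "\<dots> = Blinfun (blinfun_apply (A + T))" by (simp add: blinfun_apply_inverse)
    also have "blinfun_apply (A + T) = (\<lambda>x. blinfun_apply A x + B_op b \<gamma> (X x))"
      by (auto simp: X_def B_op_X_kernel[OF T(1) Td] T(3) blinfun.add_left)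
    finally show ?thesis .
  qed
  have partX: "op_norm whole (HD \<gamma>) X < (1 / nB) * (d - sqrt (nB * nC)) \<and>
        (\<forall>X'. riccati_X A b c \<gamma> X' \<and> op_norm whole (HD \<gamma>) X' < (1 / nB) * (d - sqrt (nB * nC)) \<longrightarrow> X' = X) \<and>
        E_norm \<gamma> X < top \<and>
        E_norm \<gamma> X \<le> ennreal ((1 / nB) * (d / 2 - sqrt (d\<^sup>2 / 4 - nB * nC)))"
    if nz: "B_op b \<gamma> \<noteq> zero_op (HD \<gamma>) whole"
  proof -
    have nB: "nB > 0" using kernel_norm_zero_B_op[OF kb] nz nBC_nonneg(1) by (metis order_le_less real_sqrt_eq_0_iff)
    note rb = radius_bounds[OF refl nB nBC_nonneg(2) kX(2) T(2)]
    have "op_norm whole (HD \<gamma>) X < (1 / nB) * (d - sqrt (nB * nC))"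
      unfolding X_def by (rule le_less_trans[OF order_trans[OF mult_op_bounded(2)[OF kX(1)] rb(1)] rb(2)])
    moreover have "X' = X"
      if X': "riccati_X A b c \<gamma> X'" "op_norm whole (HD \<gamma>) X' < (1 / nB) * (d - sqrt (nB * nC))" for X'
    proof -
      have sm: "nB * op_norm whole (HD \<gamma>) X' < d - sqrt (nB * nC)" using X'(2) nB by (simp add: field_simps)
      moreover have "0 \<le> sqrt (nB * nC)" using nBC_nonneg by simp
      ultimately have "nB * op_norm whole (HD \<gamma>) X' < d" by linarith
      then obtain T' where T': "clinear_op T'" "norm T' \<le> nB * op_norm whole (HD \<gamma>) X'" "Phi T' = T'" "X' = mult_op M (X_kernel T')"
        by (rule riccati_X_form[OF X'(1)])
      have "T' = T"
        by (rule fixpoint_in_large_ball_unique[OF admissible_right T T'(1) _ T'(3)]) (use sm T'(2) in linarith)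
      then show ?thesis using T'(4) by (simp add: X_def)
    qed
    ultimately show ?thesis using rb(1) by (auto simp: EX intro: ennreal_leI)
  qed
  have partY: "op_norm (HD \<gamma>) whole Y < (1 / nC) * (d - sqrt (nB * nC)) \<and>
        (\<forall>Y'. riccati_Y A b c \<gamma> Y' \<and> op_norm (HD \<gamma>) whole Y' < (1 / nC) * (d - sqrt (nB * nC)) \<longrightarrow> Y' = Y) \<and>
        E_norm_dual \<gamma> Y < top \<and>
        E_norm_dual \<gamma> Y \<le> ennreal ((1 / nC) * (d / 2 - sqrt (d\<^sup>2 / 4 - nB * nC)))"
    if nz: "C_op c \<gamma> \<noteq> zero_op whole (HD \<gamma>)"
  proof -
    have nC: "nC > 0"
      using kernel_norm_zero_mult_op[OF kc] nz nBC_nonneg(2) unfolding C_op_mult_op by (metis order_le_less real_sqrt_eq_0_iff)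
    note rb = radius_bounds[OF mult.commute nC nBC_nonneg(1) kY(2) S(2)]
    have "op_norm (HD \<gamma>) whole Y < (1 / nC) * (d - sqrt (nB * nC))"
      unfolding Y_def by (rule le_less_trans[OF order_trans[OF B_op_bounded(2)[OF kY(1)] rb(1)] rb(2)])
    moreover have "Y' = Y"
      if Y': "riccati_Y A b c \<gamma> Y'" "op_norm (HD \<gamma>) whole Y' < (1 / nC) * (d - sqrt (nB * nC))" for Y'
    proof -
      have sm: "nC * op_norm (HD \<gamma>) whole Y' < d - sqrt (nB * nC)" using Y'(2) nC by (simp add: field_simps)
      moreover have "0 \<le> sqrt (nB * nC)" using nBC_nonneg by simp
      ultimately have "nC * op_norm (HD \<gamma>) whole Y' < d" by linarith
      then obtain S' where S': "clinear_op S'" "norm S' \<le> nC * op_norm (HD \<gamma>) whole Y'" "Psi S' = S'" "Y' = B_op (Y_kernel S') \<gamma>"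
        by (rule riccati_Y_form[OF Y'(1)])
      have "S' = S"
        by (rule fixpoint_in_large_ball_unique[OF admissible_left S S'(1) _ S'(3)]) (use sm S'(2) in linarith)
      then show ?thesis using S'(4) by (simp add: Y_def)
    qed
    ultimately show ?thesis using rb(1) by (auto simp: EY intro: ennreal_leI)
  qed
  show ?thesis using X Y partX partY Z by blast
qed

end

section \<open>The arc near its end points\<close>

lemma quotient_limit_isCont:
  fixes F :: "complex \<Rightarrow> 'v::cnormed"
  assumes "((\<lambda>w. inverse (w - z) *\<^sub>C (F w - F z)) \<longlongrightarrow> L) (at z)"
  shows "(F \<longlongrightarrow> F z) (at z)"
proof -
  have "((\<lambda>w. w - z) \<longlongrightarrow> z - z) (at z)" by (intro tendsto_intros)
  from bounded_bilinear.tendsto[OF bounded_bilinear_scaleC this assms]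
  have "((\<lambda>w. (w - z) *\<^sub>C (inverse (w - z) *\<^sub>C (F w - F z))) \<longlongrightarrow> 0) (at z)" by simp
  moreover have "\<forall>\<^sub>F w in at z. (w - z) *\<^sub>C (inverse (w - z) *\<^sub>C (F w - F z)) = F w - F z"
    unfolding eventually_at_filter by (intro always_eventually allI impI) (simp add: scaleC_scaleC)
  ultimately have "((\<lambda>w. F w - F z) \<longlongrightarrow> 0) (at z)" by (rule Lim_transform_eventually)
  then show ?thesis by (simp add: LIM_zero_iff)
qed

lemma vholomorphic_isCont:
  assumes F: "vholomorphic_on F D" and D: "open D" "z \<in> D"
  shows "isCont F z"
proof -
  have "\<exists>L. ((\<lambda>w. inverse (w - z) *\<^sub>C (F w - F z)) \<longlongrightarrow> L) (at z within D)"
    using F D(2) unfolding vholomorphic_on_def by (rule bspec)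
  then obtain L where L: "((\<lambda>w. inverse (w - z) *\<^sub>C (F w - F z)) \<longlongrightarrow> L) (at z)"
    unfolding at_within_open[OF D(2,1)] by (rule exE) (rule that)
  show ?thesis unfolding isCont_def by (rule quotient_limit_isCont[OF L])
qed

lemma piecewise_smooth_reversepath:
  assumes "piecewise_smooth \<gamma>" shows "piecewise_smooth (reversepath \<gamma>)"
proof -
  obtain K where K: "finite K" "{0, 1} \<subseteq> K" "K \<subseteq> {0..1::real}"
    "\<forall>s\<in>K. \<forall>t\<in>K. s < t \<and> K \<inter> {s<..<t} = {} \<longrightarrow> smooth_on_interval s t \<gamma>"
    using assms unfolding piecewise_smooth_def by (elim exE conjE) (rule that)
  let ?K = "(\<lambda>x. 1 - x) ` K"
  have "smooth_on_interval (1 - t) (1 - s) (reversepath \<gamma>)"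
    if st: "s \<in> K" "t \<in> K" "1 - t < 1 - s" "?K \<inter> {1 - t<..<1 - s} = {}" for s t
  proof -
    have "K \<inter> {s<..<t} = {}" using st(4) by (auto simp: disjoint_iff)
    then have "smooth_on_interval s t \<gamma>" using K(4) st by auto
    then obtain g where g: "continuous_on {s..t} g"
      "\<And>u. u \<in> {s..t} \<Longrightarrow> (\<gamma> has_vector_derivative g u) (at u within {s..t})" "\<And>u. u \<in> {s..t} \<Longrightarrow> g u \<noteq> 0"
      unfolding smooth_on_interval_def by blast
    have im: "(\<lambda>u. 1 - u) ` {1 - t..1 - s} = {s..t}"
      by simp
    have "(reversepath \<gamma> has_vector_derivative - g (1 - u)) (at u within {1 - t..1 - s})" if u: "u \<in> {1 - t..1 - s}" for u
    proof -
      have "((\<lambda>u. 1 - u) has_real_derivative -1) (at u within {1 - t..1 - s})"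
        by (auto intro!: derivative_eq_intros)
      then have 1: "((\<lambda>u. 1 - u) has_vector_derivative -1) (at u within {1 - t..1 - s})"
        by (simp add: has_real_derivative_iff_has_vector_derivative)
      have "1 - u \<in> {s..t}" using u by auto
      from vector_diff_chain_within[OF 1, unfolded im, OF g(2)[OF this]]
      show ?thesis by (simp add: reversepath_def o_def)
    qed
    moreover have "continuous_on {1 - t..1 - s} (\<lambda>u. - g (1 - u))"
      by (intro continuous_intros continuous_on_compose2[OF g(1)]) auto
    ultimately show ?thesis
      unfolding smooth_on_interval_def using g(3)
      by (intro exI[of _ "\<lambda>u. - g (1 - u)"]) auto
  qed
  then have "\<forall>s\<in>?K. \<forall>t\<in>?K. s < t \<and> ?K \<inter> {s<..<t} = {} \<longrightarrow> smooth_on_interval s t (reversepath \<gamma>)"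
    by blast
  moreover have "{0, 1} \<subseteq> ?K"
    using K(2) imageI[of 0 K "\<lambda>x. 1 - x"] imageI[of 1 K "\<lambda>x. 1 - x"] by simp
  moreover have "?K \<subseteq> {0..1}" using K(3) by auto
  ultimately show ?thesis
    unfolding piecewise_smooth_def using K(1) by (intro exI[of _ ?K]) simp
qed

text \<open>The derivative is continuous up to the starting point and does not vanish there, so that all
  short chords near the starting point lie in a cone around the initial tangent.\<close>

lemma arc_start:
  assumes "piecewise_smooth \<gamma>"
  obtains e v where "0 < e" "e \<le> 1" "v \<noteq> 0"
    "\<And>u t. 0 \<le> u \<Longrightarrow> u \<le> t \<Longrightarrow> t \<le> e \<Longrightarrow> norm (\<gamma> t - \<gamma> u - (t - u) *\<^sub>R v) \<le> (t - u) * (norm v / 3)"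
proof -
  obtain K where K: "finite K" "{0, 1} \<subseteq> K" "K \<subseteq> {0..1::real}"
    "\<forall>s\<in>K. \<forall>t\<in>K. s < t \<and> K \<inter> {s<..<t} = {} \<longrightarrow> smooth_on_interval s t \<gamma>"
    using assms unfolding piecewise_smooth_def by (elim exE conjE) (rule that)
  define k where "k = Min (K - {0})"
  have ne: "K - {0} \<noteq> {}" using K(2) by auto
  have k: "k \<in> K - {0}" unfolding k_def by (rule Min_in[OF _ ne]) (use K(1) in simp)
  have kmin: "k \<le> s" if "s \<in> K - {0}" for s unfolding k_def by (rule Min_le) (use K(1) that in auto)
  have k01: "0 < k" "k \<le> 1" using k K(3) by force+
  have "K \<inter> {0<..<k} = {}" using kmin by force
  then have "smooth_on_interval 0 k \<gamma>" using K(2,4) k k01 by auto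
  then obtain g where g: "continuous_on {0..k} g"
    "\<And>u. u \<in> {0..k} \<Longrightarrow> (\<gamma> has_vector_derivative g u) (at u within {0..k})" "\<And>u. u \<in> {0..k} \<Longrightarrow> g u \<noteq> 0"
    unfolding smooth_on_interval_def by blast
  have v: "g 0 \<noteq> 0" using g(3) k01 by simp
  obtain \<delta> where \<delta>: "\<delta> > 0" "\<And>u. u \<in> {0..k} \<Longrightarrow> dist u 0 < \<delta> \<Longrightarrow> dist (g u) (g 0) < norm (g 0) / 3"
    using g(1)[unfolded continuous_on_iff, rule_format, of 0 "norm (g 0) / 3"] v k01 by auto
  define e where "e = min k (\<delta> / 2)"
  have e: "0 < e" "e \<le> 1" "e \<le> k" "e < \<delta>" using k01 \<delta>(1) by (auto simp: e_def)
  show ?thesis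
  proof (rule that[OF e(1,2) v])
    fix u t assume ut: "0 \<le> u" "u \<le> t" "t \<le> e"
    have "norm (\<gamma> t - \<gamma> u - (t - u) *\<^sub>R g 0) \<le> norm (t - u) * (norm (g 0) / 3)"
    proof (rule vector_differentiable_bound_linearization[where S = "{0..e}"])
      show "(\<gamma> has_vector_derivative g x) (at x within {0..e})" if "x \<in> {0..e}" for x
        by (rule has_vector_derivative_within_subset[OF g(2)]) (use that e in auto)
      show "closed_segment u t \<subseteq> {0..e}" using ut by (simp add: closed_segment_eq_real_ivl)
      show "norm (g x - g 0) \<le> norm (g 0) / 3" if "x \<in> {0..e}" for x
        using \<delta>(2)[of x] that e by (auto simp: dist_norm)
    qed (use e in simp)
    then show "norm (\<gamma> t - \<gamma> u - (t - u) *\<^sub>R g 0) \<le> (t - u) * (norm (g 0) / 3)" using ut by simp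
  qed
qed

text \<open>By the cone condition, the step from \<open>\<gamma> u\<close> to \<open>\<gamma> t\<close> does not make an obtuse angle with the
  displacement \<open>\<gamma> u - \<gamma> 0\<close>; hence the distance from the starting point increases at first.\<close>

lemma arc_start_distance:
  assumes smooth: "piecewise_smooth \<gamma>"
  obtains e k where "0 < e" "e \<le> 1" "k > 0" "\<And>t. 0 \<le> t \<Longrightarrow> t \<le> e \<Longrightarrow> k * t \<le> norm (\<gamma> t - \<gamma> 0)"
    "\<And>u t. 0 \<le> u \<Longrightarrow> u < t \<Longrightarrow> t \<le> e \<Longrightarrow> norm (\<gamma> u - \<gamma> 0) < norm (\<gamma> t - \<gamma> 0)"
proof -
  obtain e v where e: "0 < e" "e \<le> 1" and v: "v \<noteq> 0" and
    lin: "\<And>u t. 0 \<le> u \<Longrightarrow> u \<le> t \<Longrightarrow> t \<le> e \<Longrightarrow> norm (\<gamma> t - \<gamma> u - (t - u) *\<^sub>R v) \<le> (t - u) * (norm v / 3)"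
    by (rule arc_start[OF smooth]) (rule that)
  have low: "(t - u) * (norm v * (2/3)) \<le> norm (\<gamma> t - \<gamma> u)" if "0 \<le> u" "u \<le> t" "t \<le> e" for u t
  proof -
    have "norm ((t - u) *\<^sub>R v) - norm (\<gamma> t - \<gamma> u) \<le> norm (\<gamma> t - \<gamma> u - (t - u) *\<^sub>R v)"
      by (metis norm_minus_commute norm_triangle_ineq2)
    moreover have "norm ((t - u) *\<^sub>R v) = (t - u) * norm v" using that by simp
    moreover have "(t - u) * norm v - (t - u) * (norm v / 3) = (t - u) * (norm v * (2/3))" by (simp add: field_simps)
    ultimately show ?thesis using lin[OF that] by linarith
  qed
  show ?thesis
  proof (rule that[OF e, of "norm v * (2/3)"])
    show "norm v * (2/3) > 0" using v by simp
    show "norm v * (2/3) * t \<le> norm (\<gamma> t - \<gamma> 0)" if "0 \<le> t" "t \<le> e" for t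
      using low[of 0 t] that by (simp add: mult.commute)
    fix u t assume ut: "0 \<le> u" "u < t" "t \<le> e"
    define p where "p = \<gamma> u - \<gamma> 0 - u *\<^sub>R v"
    define q where "q = \<gamma> t - \<gamma> u - (t - u) *\<^sub>R v"
    define n where "n = norm v"
    define s where "s = t - u"
    have n: "n > 0" and s: "s > 0" using v ut by (auto simp: n_def s_def)
    have p: "norm p \<le> u * (n / 3)" using lin[of 0 u] ut by (simp add: p_def n_def)
    have q: "norm q \<le> s * (n / 3)" using lin[of u t] ut by (simp add: q_def n_def s_def)
    have P: "\<gamma> u - \<gamma> 0 = u *\<^sub>R v + p" and Q: "\<gamma> t - \<gamma> u = s *\<^sub>R v + q" by (simp_all add: p_def q_def s_def)
    have "norm v * norm q \<le> n * (s * (n / 3))"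
      unfolding n_def[symmetric] by (rule mult_left_mono[OF q]) (use n in simp)
    then have vq: "- (n * (s * (n / 3))) \<le> inner v q" using Cauchy_Schwarz_ineq2[of v q] by linarith
    have "norm p * norm v \<le> u * (n / 3) * n"
      unfolding n_def[symmetric] by (rule mult_right_mono[OF p]) (use n in simp)
    then have pv: "- (u * (n / 3) * n) \<le> inner p v" using Cauchy_Schwarz_ineq2[of p v] by linarith
    have "norm p * norm q \<le> (u * (n / 3)) * (s * (n / 3))"
      by (rule mult_mono[OF p q]) (use ut n in auto)
    then have pq: "- ((u * (n / 3)) * (s * (n / 3))) \<le> inner p q" using Cauchy_Schwarz_ineq2[of p q] by linarith
    have "inner (\<gamma> u - \<gamma> 0) (\<gamma> t - \<gamma> u) = u * s * n\<^sup>2 + u * inner v q + s * inner p v + inner p q"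
      unfolding P Q by (simp add: inner_add_left inner_add_right n_def dot_square_norm algebra_simps)
    moreover have "- (u * (n * (s * (n / 3)))) \<le> u * inner v q" using mult_left_mono[OF vq ut(1)] by simp
    moreover have "- (s * (u * (n / 3) * n)) \<le> s * inner p v" using mult_left_mono[OF pv, of s] s by simp
    moreover have "u * s * n\<^sup>2 - u * (n * (s * (n / 3))) - s * (u * (n / 3) * n) - (u * (n / 3)) * (s * (n / 3)) = (2/9) * (u * s * n\<^sup>2)"
      by (simp add: power2_eq_square algebra_simps)
    moreover have "0 \<le> (2/9) * (u * s * n\<^sup>2)" using ut s by simp
    ultimately have inn: "0 \<le> inner (\<gamma> u - \<gamma> 0) (\<gamma> t - \<gamma> u)" using pq by linarith
    have "0 < (t - u) * (norm v * (2/3))" using ut v by simp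
    then have "0 < norm (\<gamma> t - \<gamma> u)" using low[of u t] ut by linarith
    then have "0 < (norm (\<gamma> t - \<gamma> u))\<^sup>2" by simp
    moreover have "(norm (\<gamma> t - \<gamma> 0))\<^sup>2 = (norm (\<gamma> u - \<gamma> 0))\<^sup>2 + 2 * inner (\<gamma> u - \<gamma> 0) (\<gamma> t - \<gamma> u) + (norm (\<gamma> t - \<gamma> u))\<^sup>2"
    proof -
      have "\<gamma> t - \<gamma> 0 = (\<gamma> u - \<gamma> 0) + (\<gamma> t - \<gamma> u)" by simp
      then show ?thesis
        by (simp only: power2_norm_eq_inner inner_add_left inner_add_right) (simp add: inner_commute)
    qed
    ultimately have "(norm (\<gamma> u - \<gamma> 0))\<^sup>2 < (norm (\<gamma> t - \<gamma> 0))\<^sup>2" using inn by linarith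
    then show "norm (\<gamma> u - \<gamma> 0) < norm (\<gamma> t - \<gamma> 0)" by (rule power2_less_imp_less) simp
  qed
qed

lemma endpoint_bound:
  fixes G :: "complex \<Rightarrow> 'b::real_normed_vector"
  assumes smooth: "piecewise_smooth g" and cont: "continuous_on {0..1} g"
    and U: "open U" "g 0 \<in> U" and C: "C \<ge> 0" and \<nu>: "\<nu> \<ge> 0"
    and G: "\<And>t. t \<in> {0<..<1} \<Longrightarrow> g t \<in> U \<Longrightarrow> norm (G (g t)) \<le> C * cmod (g t - g 0) powr (- \<nu>)"
  obtains e K where "0 < e" "e < 1" "K \<ge> 0" "\<And>t. 0 < t \<Longrightarrow> t \<le> e \<Longrightarrow> norm (G (g t)) \<le> K * t powr (- \<nu>)"
proof -
  obtain e1 k where e1: "0 < e1" "e1 \<le> 1" "k > 0" "\<And>t. 0 \<le> t \<Longrightarrow> t \<le> e1 \<Longrightarrow> k * t \<le> norm (g t - g 0)"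
    and "\<And>u t. 0 \<le> u \<Longrightarrow> u < t \<Longrightarrow> t \<le> e1 \<Longrightarrow> norm (g u - g 0) < norm (g t - g 0)"
    by (rule arc_start_distance[OF smooth]) (rule that)
  obtain r where r: "r > 0" "ball (g 0) r \<subseteq> U" using U openE by blast
  obtain \<delta> where \<delta>: "\<delta> > 0" "\<And>u. u \<in> {0..1} \<Longrightarrow> dist u 0 < \<delta> \<Longrightarrow> dist (g u) (g 0) < r"
    using cont[unfolded continuous_on_iff, rule_format, of 0 r] r(1) by auto
  define e where "e = min (e1 / 2) (\<delta> / 2)"
  have e: "0 < e" "e < 1" "e \<le> e1" "e < \<delta>" using e1 \<delta>(1) by (auto simp: e_def)
  show ?thesis
  proof (rule that[OF e(1,2), of "C * k powr (- \<nu>)"])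
    show "C * k powr (- \<nu>) \<ge> 0" using C by simp
    fix t assume t: "0 < t" "t \<le> e"
    have "dist (g t) (g 0) < r" using \<delta>(2)[of t] t e by auto
    then have "g t \<in> U" using r(2) by (auto simp: dist_commute)
    then have "norm (G (g t)) \<le> C * cmod (g t - g 0) powr (- \<nu>)" using G[of t] t e by simp
    also have "\<dots> \<le> C * (k * t) powr (- \<nu>)"
      by (intro mult_left_mono powr_mono2' C) (use \<nu> t e e1 in auto)
    also have "\<dots> = C * k powr (- \<nu>) * t powr (- \<nu>)" using e1 t by (simp add: powr_mult)
    finally show "norm (G (g t)) \<le> C * k powr (- \<nu>) * t powr (- \<nu>)" .
  qed
qed

context smooth_arc
begin

lemma integrable_powr_L:
  assumes "a > - 1"
  shows "integrable L (\<lambda>t. t powr a)" "integrable L (\<lambda>t. (1 - t) powr a)"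
proof -
  have "set_integrable lborel {0..1} (\<lambda>t. t powr ((a + 1) - 1) * (1 - t) powr (1 - 1 :: real))"
    by (rule integrable_Beta) (use assms in auto)
  then have "set_integrable lborel {0<..<1} (\<lambda>t. t powr ((a + 1) - 1) * (1 - t) powr (1 - 1 :: real))"
    by (rule set_integrable_subset) auto
  then have "integrable L (\<lambda>t. t powr ((a + 1) - 1) * (1 - t) powr (1 - 1 :: real))"
    by (simp add: set_integrable_def integrable_restrict_space)
  then show "integrable L (\<lambda>t. t powr a)"
    by (rule Bochner_Integration.integrable_cong[THEN iffD1, rotated 2]) (auto simp: space_restrict_space)
  have "set_integrable lborel {0..1} (\<lambda>t. t powr (1 - 1 :: real) * (1 - t) powr ((a + 1) - 1))"
    by (rule integrable_Beta) (use assms in auto)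
  then have "set_integrable lborel {0<..<1} (\<lambda>t. t powr (1 - 1 :: real) * (1 - t) powr ((a + 1) - 1))"
    by (rule set_integrable_subset) auto
  then have "integrable L (\<lambda>t. t powr (1 - 1 :: real) * (1 - t) powr ((a + 1) - 1))"
    by (simp add: set_integrable_def integrable_restrict_space)
  then show "integrable L (\<lambda>t. (1 - t) powr a)"
    by (rule Bochner_Integration.integrable_cong[THEN iffD1, rotated 2]) (auto simp: space_restrict_space)
qed

text \<open>A singularity of order \<open>\<nu> < 1/2\<close> at an end point is square integrable because the arc leaves
  its end points with nonzero speed.\<close>

lemma L2_kernel_endpoint_singularities:
  fixes G :: "complex \<Rightarrow> 'u::chilbert \<Rightarrow>\<^sub>L 'v::chilbert"
  assumes G: "\<And>z. z \<in> open_arc \<gamma> \<Longrightarrow> isCont G z" "\<And>z. z \<in> open_arc \<gamma> \<Longrightarrow> clinear_op (G z)"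
    and C: "C \<ge> 0" and \<nu>: "0 \<le> \<nu>" "\<nu> < 1/2"
    and U: "\<And>\<omega>. \<omega> \<in> {\<gamma> 0, \<gamma> 1} \<Longrightarrow> \<exists>U. open U \<and> \<omega> \<in> U \<and> (\<forall>z\<in>open_arc \<gamma> \<inter> U. norm (G z) \<le> C * cmod (z - \<omega>) powr (- \<nu>))"
  shows "L2_kernel M G"
proof -
  obtain U0 where U0: "open U0" "\<gamma> 0 \<in> U0" "\<And>z. z \<in> open_arc \<gamma> \<Longrightarrow> z \<in> U0 \<Longrightarrow> norm (G z) \<le> C * cmod (z - \<gamma> 0) powr (- \<nu>)"
    using U[of "\<gamma> 0"] by blast
  obtain U1 where U1: "open U1" "\<gamma> 1 \<in> U1" "\<And>z. z \<in> open_arc \<gamma> \<Longrightarrow> z \<in> U1 \<Longrightarrow> norm (G z) \<le> C * cmod (z - \<gamma> 1) powr (- \<nu>)"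
    using U[of "\<gamma> 1"] by blast
  obtain e0 K0 where e0: "0 < e0" "e0 < 1" "K0 \<ge> 0" "\<And>t. 0 < t \<Longrightarrow> t \<le> e0 \<Longrightarrow> norm (G (\<gamma> t)) \<le> K0 * t powr (- \<nu>)"
    by (rule endpoint_bound[OF smooth cont U0(1,2) C \<nu>(1), of G]) (use U0(3) in \<open>auto simp: open_arc_def\<close>)
  have rcont: "continuous_on {0..1} (reversepath \<gamma>)"
    using arc by (simp add: arc_def path_def[symmetric])
  obtain e1 K1 where e1: "0 < e1" "e1 < 1" "K1 \<ge> 0" "\<And>t. 0 < t \<Longrightarrow> t \<le> e1 \<Longrightarrow> norm (G (reversepath \<gamma> t)) \<le> K1 * t powr (- \<nu>)"
  proof (rule endpoint_bound[OF piecewise_smooth_reversepath[OF smooth] rcont U1(1) _ C \<nu>(1), of G])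
    show "reversepath \<gamma> 0 \<in> U1" using U1(2) by (simp add: reversepath_def)
    show "norm (G (reversepath \<gamma> t)) \<le> C * cmod (reversepath \<gamma> t - reversepath \<gamma> 0) powr (- \<nu>)"
      if "t \<in> {0<..<1}" "reversepath \<gamma> t \<in> U1" for t
      using U1(3)[of "\<gamma> (1 - t)"] that by (auto simp: reversepath_def open_arc_def)
  qed (rule that)
  have "compact ((\<lambda>t. G (\<gamma> t)) ` {e0..1 - e1})"
  proof (rule compact_continuous_image)
    show "continuous_on {e0..1 - e1} (\<lambda>t. G (\<gamma> t))"
    proof (rule continuous_on_compose2[of "open_arc \<gamma>" G])
      show "continuous_on (open_arc \<gamma>) G" using G(1) by (intro continuous_at_imp_continuous_on) auto
      show "continuous_on {e0..1 - e1} \<gamma>" by (rule continuous_on_subset[OF cont]) (use e0 e1 in auto)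
    qed (use e0 e1 in \<open>auto simp: open_arc_def\<close>)
  qed simp
  then have "bounded ((\<lambda>t. G (\<gamma> t)) ` {e0..1 - e1})" by (rule compact_imp_bounded)
  then obtain B where "\<forall>x\<in>(\<lambda>t. G (\<gamma> t)) ` {e0..1 - e1}. norm x \<le> B"
    unfolding bounded_iff by (rule exE) (rule that)
  then have B: "norm (G (\<gamma> t)) \<le> B" if "t \<in> {e0..1 - e1}" for t using that by simp
  define K where "K = K0 + K1 + \<bar>B\<bar>"
  have K: "K \<ge> 0" "K0 \<le> K" "K1 \<le> K" "\<bar>B\<bar> \<le> K" using e0 e1 by (auto simp: K_def)
  have bound: "norm (G (\<gamma> t)) \<le> K * (t powr (- \<nu>) + (1 - t) powr (- \<nu>))" if t: "t \<in> {0<..<1}" for t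
  proof -
    have nn: "0 \<le> K * t powr (- \<nu>)" "0 \<le> K * (1 - t) powr (- \<nu>)" using K by auto
    consider "t \<le> e0" | "1 - t \<le> e1" | "t \<in> {e0..1 - e1}" by fastforce
    then show ?thesis
    proof cases
      case 1
      then have "norm (G (\<gamma> t)) \<le> K0 * t powr (- \<nu>)" using e0(4)[of t] t by simp
      also have "\<dots> \<le> K * t powr (- \<nu>)" by (rule mult_right_mono[OF K(2)]) simp
      finally have "norm (G (\<gamma> t)) \<le> K * t powr (- \<nu>)" .
      then show ?thesis using nn by (simp add: distrib_left)
    next
      case 2
      then have "norm (G (\<gamma> t)) \<le> K1 * (1 - t) powr (- \<nu>)"
        using e1(4)[of "1 - t"] t by (simp add: reversepath_def)
      also have "\<dots> \<le> K * (1 - t) powr (- \<nu>)" by (rule mult_right_mono[OF K(3)]) simp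
      finally have "norm (G (\<gamma> t)) \<le> K * (1 - t) powr (- \<nu>)" .
      then show ?thesis using nn by (simp add: distrib_left)
    next
      case 3
      have "1 powr (- \<nu>) \<le> t powr (- \<nu>)" by (rule powr_mono2') (use t \<nu> in auto)
      then have "K * 1 \<le> K * t powr (- \<nu>)" using K by (intro mult_left_mono) auto
      then have "norm (G (\<gamma> t)) \<le> K * t powr (- \<nu>)" using B[OF 3] K by linarith
      then show ?thesis using nn by (simp add: distrib_left)
    qed
  qed
  have sm: "strongly_measurable M G" by (rule strongly_measurable_isCont_M[OF G(1)])
  have m: "(\<lambda>z. (norm (G z))\<^sup>2) \<in> borel_measurable M"
    using borel_measurable_norm_strongly[OF sm] by measurable
  obtain Bd where Bd: "Bd \<ge> 0" "AE t in L. norm (dg t) \<le> Bd" by (rule dg_bounded)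
  have "integrable L (\<lambda>t. norm (dg t) *\<^sub>R (norm (G (\<gamma> t)))\<^sup>2)"
  proof (rule Bochner_Integration.integrable_bound)
    show "integrable L (\<lambda>t. Bd * (K\<^sup>2 * (2 * (t powr (- 2 * \<nu>) + (1 - t) powr (- 2 * \<nu>)))))"
      using integrable_powr_L[of "- 2 * \<nu>"] \<nu> by simp
    show "(\<lambda>t. norm (dg t) *\<^sub>R (norm (G (\<gamma> t)))\<^sup>2) \<in> borel_measurable L"
      using measurable_compose[OF gamma_measurable_M m] by measurable
    have sp: "AE t in L. t \<in> {0<..<1}" by (rule AE_I2) (simp add: space_restrict_space)
    show "AE t in L. norm (norm (dg t) *\<^sub>R (norm (G (\<gamma> t)))\<^sup>2)
        \<le> norm (Bd * (K\<^sup>2 * (2 * (t powr (- 2 * \<nu>) + (1 - t) powr (- 2 * \<nu>)))))"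
      using Bd(2) sp
    proof eventually_elim
      case (elim t)
      define x y where "x = t powr (- \<nu>)" and "y = (1 - t) powr (- \<nu>)"
      have xy: "t powr (- 2 * \<nu>) = x\<^sup>2" "(1 - t) powr (- 2 * \<nu>) = y\<^sup>2"
        by (simp_all add: x_def y_def power2_eq_square flip: powr_add)
      have "(norm (G (\<gamma> t)))\<^sup>2 \<le> (K * (x + y))\<^sup>2"
        unfolding x_def y_def by (rule power_mono[OF bound[OF elim(2)]]) simp
      also have "\<dots> = K\<^sup>2 * (x + y)\<^sup>2" by (simp add: power_mult_distrib)
      also have "\<dots> \<le> K\<^sup>2 * (2 * (x\<^sup>2 + y\<^sup>2))"
      proof (rule mult_left_mono)
        have "0 \<le> (x - y)\<^sup>2" by simp
        then show "(x + y)\<^sup>2 \<le> 2 * (x\<^sup>2 + y\<^sup>2)" by (simp add: power2_eq_square algebra_simps)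
      qed simp
      finally have "norm (dg t) * (norm (G (\<gamma> t)))\<^sup>2 \<le> Bd * (K\<^sup>2 * (2 * (x\<^sup>2 + y\<^sup>2)))"
        by (intro mult_mono elim Bd) auto
      then show ?case unfolding xy by (simp add: order_trans[OF _ abs_ge_self])
    qed
  qed
  then have "integrable M (\<lambda>z. (norm (G z))\<^sup>2)" using integral_M(1)[OF m] by blast
  then show ?thesis using sm G(2) by (simp add: L2_kernel_def space_M)
qed

end

section \<open>Deformation of contours through their end points\<close>

definition half_plane :: "real \<Rightarrow> complex set" where
  "half_plane s = {z. s * Im z \<ge> 0}"

lemma convex_half_plane: "convex (half_plane s)"
proof -
  have "half_plane s = {z. inner (\<i> * of_real s) z \<ge> 0}" by (auto simp: half_plane_def inner_complex_def)
  then show ?thesis using convex_halfspace_ge by metis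
qed

text \<open>The boundary point \<open>a\<close> can be moved out of the half plane without meeting the path.\<close>

lemma winding_number_real_point:
  assumes s: "s = 1 \<or> s = -1" and g: "path g" "pathfinish g = pathstart g" "path_image g \<subseteq> half_plane s"
    and a: "of_real a \<notin> path_image g"
  shows "winding_number g (of_real a) = 0"
proof -
  have "open (- path_image g)" using closed_path_image[OF g(1)] by (simp add: open_Compl)
  then obtain e where e: "e > 0" "ball (of_real a) e \<subseteq> - path_image g"
    using a openE by (metis ComplI)
  define z where "z = complex_of_real a - \<i> * of_real (s * e / 2)"
  have zb: "z \<in> ball (of_real a) e" using e(1) s by (auto simp: z_def dist_norm norm_mult)
  have "winding_number g (of_real a) = winding_number g z"
    by (rule winding_number_eq[OF g(1,2), of _ "ball (of_real a) e"]) (use e zb in auto)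
  also have "z \<notin> half_plane s" using s e(1) by (auto simp: half_plane_def z_def)
  then have "winding_number g z = 0"
    by (rule winding_number_zero_outside[OF g(1) convex_half_plane g(2) _ g(3)])
  finally show ?thesis .
qed

lemma winding_number_part_circlepath_centre:
  assumes "\<rho> > 0"
  shows "winding_number (part_circlepath c \<rho> a b) c = of_real ((b - a) / (2 * pi))"
proof -
  have c: "c \<notin> path_image (part_circlepath c \<rho> a b)" using assms by (auto simp: path_image_part_circlepath')
  have "contour_integral (part_circlepath c \<rho> a b) (\<lambda>w. 1 / (w - c)) = integral {0..1} (\<lambda>x::real. \<i> * of_real (b - a))"
    unfolding contour_integral_integral vector_derivative_part_circlepath
    by (intro integral_cong) (use assms in \<open>simp add: part_circlepath_def field_simps\<close>)
  then have CI: "contour_integral (part_circlepath c \<rho> a b) (\<lambda>w. 1 / (w - c)) = \<i> * of_real (b - a)"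
    by simp
  show ?thesis
    unfolding winding_number_valid_path[OF valid_path_part_circlepath c] CI by simp
qed

lemma convex_cball_minus_boundary:
  fixes c w :: "'a::euclidean_space"
  assumes "dist c w = \<rho>" shows "convex (cball c \<rho> - {w})"
proof (rule convexI)
  fix x y and u v :: real
  assume x: "x \<in> cball c \<rho> - {w}" and y: "y \<in> cball c \<rho> - {w}" and uv: "u \<ge> 0" "v \<ge> 0" "u + v = 1"
  have inb: "u *\<^sub>R x + v *\<^sub>R y \<in> cball c \<rho>"
    using convexD[OF convex_cball] x y uv by blast
  have "u *\<^sub>R x + v *\<^sub>R y \<noteq> w"
  proof
    assume e: "u *\<^sub>R x + v *\<^sub>R y = w"
    show False
    proof (cases "u = 0 \<or> v = 0 \<or> x = y")
      case True
      moreover have "u *\<^sub>R x + v *\<^sub>R x = x" by (metis uv(3) scaleR_add_left scaleR_one)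
      ultimately show False using e x y uv by auto
    next
      case False
      have "u = 1 - v" using uv(3) by simp
      then have "w = (1 - v) *\<^sub>R x + v *\<^sub>R y" using e by simp
      moreover have "0 < v" "v < 1" using False uv by auto
      ultimately have "w \<in> open_segment x y" using False unfolding in_segment by blast
      then have "dist c w < dist c x \<or> dist c w < dist c y" by (rule dist_decreases_open_segment)
      then show False using x y assms by auto
    qed
  qed
  then show "u *\<^sub>R x + v *\<^sub>R y \<in> cball c \<rho> - {w}" using inb by blast
qed

lemma winding_number_convex_eq:
  assumes g: "path g" "path_image g \<subseteq> S" and h: "path h" "path_image h \<subseteq> S" and S: "convex S" "z \<notin> S"
    and ends: "pathstart g = pathstart h" "pathfinish g = pathfinish h"
  shows "winding_number g z = winding_number h z"
proof -
  have z: "z \<notin> path_image g" "z \<notin> path_image h" using g h S by auto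
  have "winding_number (g +++ reversepath h) z = 0"
    by (rule winding_number_zero_outside[OF _ S(1) _ S(2)])
      (use g h ends in \<open>auto simp: path_image_join\<close>)
  then show ?thesis
    using z g h ends by (simp add: winding_number_join winding_number_reversepath)
qed

lemma half_plane_circle_point:
  assumes s: "s = 1 \<or> s = -1" and \<rho>: "\<rho> > 0" and p: "p \<in> sphere (of_real a) \<rho>" "p \<in> half_plane s"
  obtains \<theta> where "\<bar>\<theta>\<bar> \<le> pi / 2" "p = of_real a + of_real \<rho> * cis (\<theta> + s * pi / 2)"
proof -
  define u where "u = - \<i> * of_real s * (p - of_real a) / of_real \<rho>"
  have s2: "s * s = 1" "\<bar>s\<bar> = 1" using s by auto
  have nu: "cmod u = 1" using p(1) \<rho> s2 by (simp add: u_def norm_mult norm_divide dist_norm norm_minus_commute)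
  have u0: "u \<noteq> 0" using nu by auto
  have "Re u \<ge> 0" using p(2) \<rho> by (simp add: u_def half_plane_def)
  then have le: "\<bar>Im (Ln u)\<bar> \<le> pi / 2" using Re_Ln_pos_le[OF u0] by simp
  have "Re (Ln u) = 0" using nu u0 by simp
  then have "Ln u = \<i> * of_real (Im (Ln u))" by (simp add: complex_eq_iff)
  then have cu: "cis (Im (Ln u)) = u" using u0 by (metis cis_conv_exp exp_Ln)
  have cs: "cis (s * pi / 2) = \<i> * of_real s" using s by (auto simp: complex_eq_iff)
  have "cis (Im (Ln u) + s * pi / 2) = u * (\<i> * of_real s)" by (simp only: cis_mult[symmetric] cu cs)
  also have "\<dots> = of_real (s * s) * (p - of_real a) / of_real \<rho>" by (simp add: u_def field_simps)
  finally have "of_real \<rho> * cis (Im (Ln u) + s * pi / 2) = p - of_real a" using \<rho> s2 by simp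
  then show ?thesis using that[OF le] by simp
qed

text \<open>The loop formed by \<open>P\<close> and \<open>Q\<close> enters the disc around the real point \<open>a\<close> only along \<open>Q\<close>, and winds
  around no point of \<open>E\<close> other than \<open>a\<close>. Then \<open>Q\<close> can be replaced by the circular arc \<open>U\<close> in the half plane. The point
  at issue is that \<open>U\<close> does not meet \<open>E\<close>: for \<open>w\<close> in \<open>E\<close> on \<open>U\<close>, the path \<open>Q\<close> could be replaced, inside the
  disc without its boundary point \<open>w\<close>, by the complementary arc \<open>L\<close>, so that \<open>P\<close> and \<open>L\<close> together do not
  wind around \<open>w\<close> and hence not around \<open>a\<close>. But \<open>P\<close> and \<open>U\<close> do not wind around \<open>a\<close> either, while \<open>L\<close> and \<open>U\<close>
  differ by a full turn around \<open>a\<close>.\<close>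

lemma close_with_circular_arc:
  assumes s: "s = 1 \<or> s = -1" and \<rho>: "\<rho> > 0"
    and P: "path P" "path_image P \<subseteq> half_plane s" "path_image P \<inter> ball (of_real a) \<rho> = {}"
    and Q: "path Q" "path_image Q \<subseteq> cball (of_real a) \<rho>"
    and ends: "pathstart Q = pathfinish P" "pathfinish Q = pathstart P"
      "pathstart P \<in> sphere (of_real a) \<rho>" "pathfinish P \<in> sphere (of_real a) \<rho>"
    and E: "\<And>z. z \<in> E \<Longrightarrow> z \<noteq> of_real a \<Longrightarrow> z \<notin> path_image P \<and> z \<notin> path_image Q \<and> winding_number P z + winding_number Q z = 0"
  obtains \<phi> \<psi> where "\<bar>\<psi> - \<phi>\<bar> \<le> pi" "pathstart (part_circlepath (of_real a) \<rho> \<phi> \<psi>) = pathfinish P"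
    "pathfinish (part_circlepath (of_real a) \<rho> \<phi> \<psi>) = pathstart P"
    "path_image (part_circlepath (of_real a) \<rho> \<phi> \<psi>) \<subseteq> half_plane s"
    "path_image (part_circlepath (of_real a) \<rho> \<phi> \<psi>) \<inter> E = {}"
    "\<And>z. z \<in> E \<Longrightarrow> winding_number P z + winding_number (part_circlepath (of_real a) \<rho> \<phi> \<psi>) z = 0"
proof -
  let ?a = "complex_of_real a"
  have Pends: "pathstart P \<in> half_plane s" "pathfinish P \<in> half_plane s" using P(2) by auto
  obtain \<theta> where \<theta>: "\<bar>\<theta>\<bar> \<le> pi / 2" "pathstart P = ?a + of_real \<rho> * cis (\<theta> + s * pi / 2)"
    by (rule half_plane_circle_point[OF s \<rho> ends(3) Pends(1)])
  obtain \<theta>' where \<theta>': "\<bar>\<theta>'\<bar> \<le> pi / 2" "pathfinish P = ?a + of_real \<rho> * cis (\<theta>' + s * pi / 2)"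
    by (rule half_plane_circle_point[OF s \<rho> ends(4) Pends(2)])
  define t where "t = s * pi / 2"
  \<comment> \<open>The full turn by which the arcs \<open>L\<close> and \<open>U\<close> between the same points differ.\<close>
  define k where "k = (if \<theta>' \<le> \<theta> then - 2 * pi else 2 * pi)"
  have cisk: "cis (x + k) = cis x" for x by (auto simp: k_def cis_mult[symmetric] complex_eq_iff)
  define U where "U = part_circlepath ?a \<rho> (\<theta>' + t) (\<theta> + t)"
  define L where "L = part_circlepath ?a \<rho> (\<theta>' + t) (\<theta> + t + k)"
  have pc: "pathstart (part_circlepath ?a \<rho> x y) = ?a + of_real \<rho> * cis x"
    "pathfinish (part_circlepath ?a \<rho> x y) = ?a + of_real \<rho> * cis y" for x y
    by (simp_all add: cis_conv_exp)
  have Uends: "pathstart U = pathfinish P" "pathfinish U = pathstart P"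
    and Lends: "pathstart L = pathfinish P" "pathfinish L = pathstart P"
    unfolding U_def L_def pc cisk \<theta> \<theta>' t_def by simp_all
  have sph: "path_image (part_circlepath ?a \<rho> x y) \<subseteq> sphere ?a \<rho>" for x y
    using \<rho> by (auto simp: path_image_part_circlepath' dist_norm norm_mult)
  have Usph: "path_image U \<subseteq> sphere ?a \<rho>" and Lsph: "path_image L \<subseteq> sphere ?a \<rho>"
    unfolding U_def L_def by (rule sph)+
  have pU: "path U" and pL: "path L" by (simp_all add: U_def L_def)
  have Uhalf: "path_image U \<subseteq> half_plane s"
  proof
    fix w assume "w \<in> path_image U"
    then obtain x where x: "x \<in> closed_segment (\<theta>' + t) (\<theta> + t)" "w = ?a + of_real \<rho> * cis x"
      by (auto simp: U_def path_image_part_circlepath')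
    then have "\<theta>' + t \<le> x \<and> x \<le> \<theta> + t \<or> \<theta> + t \<le> x \<and> x \<le> \<theta>' + t"
      by (auto simp: closed_segment_eq_real_ivl split: if_splits)
    then have "- (pi / 2) \<le> x - t" "x - t \<le> pi / 2"
      using \<theta>(1)[unfolded abs_le_iff] \<theta>'(1)[unfolded abs_le_iff] by linarith+
    then have "cos (x - t) \<ge> 0" by (rule cos_ge_zero)
    moreover have "s * sin x = cos (x - t)"
      using s by (auto simp: t_def cos_diff)
    ultimately have "\<rho> * (s * sin x) \<ge> 0" using \<rho> by simp
    then show "w \<in> half_plane s" by (simp add: x(2) half_plane_def mult.left_commute)
  qed
  have UL: "w = pathstart P \<or> w = pathfinish P" if w: "w \<in> path_image U" "w \<in> path_image L" for w
  proof (rule ccontr)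
    assume n: "\<not> ?thesis"
    obtain x where x: "x \<in> closed_segment (\<theta>' + t) (\<theta> + t)" "w = ?a + of_real \<rho> * cis x"
      using w(1) by (auto simp: U_def path_image_part_circlepath')
    obtain y where y: "y \<in> closed_segment (\<theta>' + t) (\<theta> + t + k)" "w = ?a + of_real \<rho> * cis y"
      using w(2) by (auto simp: L_def path_image_part_circlepath')
    have nx: "x \<noteq> \<theta>' + t" "x \<noteq> \<theta> + t" using n x(2) \<theta>(2) \<theta>'(2) by (auto simp: t_def)
    have "cis x = cis y" using x(2) y(2) \<rho> by simp
    then have "sin x = sin y \<and> cos x = cos y" by (simp add: complex_eq_iff)
    then obtain m :: int where m: "x = y + 2 * pi * m" using sin_cos_eq_iff by blast
    have d: "0 < \<bar>x - y\<bar> \<and> \<bar>x - y\<bar> < 2 * pi"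
      using x(1) y(1) nx \<theta>(1) \<theta>'(1) by (auto simp: k_def closed_segment_eq_real_ivl split: if_splits)
    then have "0 < \<bar>real_of_int m\<bar>" "\<bar>real_of_int m\<bar> < 1" using m by (auto simp: abs_mult)
    moreover from this(2) have "m = 0" by (simp flip: of_int_abs)
    ultimately show False by simp
  qed
  have loopU: "path (P +++ U)" "pathfinish (P +++ U) = pathstart (P +++ U)"
    and imU: "path_image (P +++ U) = path_image P \<union> path_image U"
    using P(1) Uends pU by (auto simp: path_image_join)
  have loopL: "path (P +++ L)" "pathfinish (P +++ L) = pathstart (P +++ L)"
    and imL: "path_image (P +++ L) = path_image P \<union> path_image L"
    using P(1) Lends pL by (auto simp: path_image_join)
  have aP: "?a \<notin> path_image P" using P(3) \<rho> by auto
  have aU: "?a \<notin> path_image U" and aL: "?a \<notin> path_image L" using Usph Lsph \<rho> by auto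
  have wnUa: "winding_number P ?a + winding_number U ?a = 0"
  proof -
    have "winding_number (P +++ U) ?a = 0"
      by (rule winding_number_real_point[OF s loopU]) (use P(2) Uhalf aP aU imU in auto)
    then show ?thesis using P(1) aP aU Uends by (simp add: winding_number_join pU)
  qed
  have spoke: "winding_number g w = winding_number g ?a"
    if g: "path g" "pathfinish g = pathstart g" "path_image g \<inter> ball ?a \<rho> = {}" and w: "w \<in> cball ?a \<rho>" "w \<notin> path_image g" for g w
  proof (rule winding_number_eq[OF g(1,2), of _ "closed_segment ?a w"])
    have "z \<notin> path_image g" if z: "z \<in> closed_segment ?a w" for z
    proof (cases "z = w")
      case False
      have "dist ?a z < \<rho>"
      proof (cases "z = ?a")
        case True
        then show ?thesis using \<rho> by simp
      next
        case n: False
        then have "z \<in> open_segment ?a w" using z False by (simp add: open_segment_def)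
        then have "dist ?a z < dist ?a w"
          using dist_in_open_segment[of z ?a w] by (simp add: dist_commute)
        then show ?thesis using w(1) by simp
      qed
      then show ?thesis using g(3) by auto
    qed (use w in simp)
    then show "closed_segment ?a w \<inter> path_image g = {}" by blast
  qed auto
  have UE: "w \<notin> path_image U" if w: "w \<in> E" for w
  proof
    assume wU: "w \<in> path_image U"
    then have ws: "w \<in> sphere ?a \<rho>" using Usph by blast
    then have wa: "w \<noteq> ?a" using \<rho> by auto
    note Ew = E[OF w wa]
    have wL: "w \<notin> path_image L"
      using UL[OF wU] Ew by (metis pathfinish_in_path_image pathstart_in_path_image)
    have "winding_number Q w = winding_number L w"
      by (rule winding_number_convex_eq[of _ "cball ?a \<rho> - {w}"])
        (use Q Ew wL ends Lends Lsph pL convex_cball_minus_boundary[of ?a w \<rho>] ws in auto)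
    then have "winding_number (P +++ L) w = 0"
      using Ew wL P(1) Lends by (simp add: winding_number_join pL)
    moreover have "winding_number (P +++ L) w = winding_number (P +++ L) ?a"
      by (rule spoke[OF loopL]) (use imL P(3) Lsph Ew wL ws in auto)
    ultimately have "winding_number P ?a + winding_number L ?a = 0"
      using P(1) aP aL Lends by (simp add: winding_number_join pL)
    then have "winding_number L ?a = winding_number U ?a" using wnUa by (metis add_left_cancel)
    then have "complex_of_real ((\<theta> + t + k - (\<theta>' + t)) / (2 * pi)) = complex_of_real ((\<theta> + t - (\<theta>' + t)) / (2 * pi))"
      by (simp only: L_def U_def winding_number_part_circlepath_centre[OF \<rho>])
    then have "k = 0" unfolding of_real_eq_iff by (simp add: divide_cancel_right)
    then show False by (auto simp: k_def split: if_splits)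
  qed
  have wnE: "winding_number P z + winding_number U z = 0" if z: "z \<in> E" for z
  proof (cases "z = ?a")
    case True
    then show ?thesis using wnUa by simp
  next
    case False
    note Ez = E[OF z False]
    show ?thesis
    proof (cases "z \<in> cball ?a \<rho>")
      case True
      have "winding_number (P +++ U) z = winding_number (P +++ U) ?a"
        by (rule spoke[OF loopU]) (use imU P(3) Usph Ez UE[OF z] True in auto)
      then show ?thesis
        using wnUa P(1) aP aU Uends Ez UE[OF z] by (simp add: winding_number_join pU)
    next
      case out: False
      have "winding_number Q z = winding_number U z"
        by (rule winding_number_convex_eq[OF Q _ _ convex_cball out])
          (use ends Uends Usph pU in auto)
      then show ?thesis using Ez by simp
    qed
  qed
  show ?thesis
  proof (rule that[of "\<theta> + t" "\<theta>' + t"], unfold U_def[symmetric])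
    show "\<bar>\<theta> + t - (\<theta>' + t)\<bar> \<le> pi" using \<theta>(1) \<theta>'(1) by auto
    show "path_image U \<inter> E = {}" using UE by blast
  qed (use Uends Uhalf wnE in auto)
qed

text \<open>The distance from the starting point increases up to some parameter and stays away from \<open>0\<close>
  afterwards; hence the arc crosses each small circle around its starting point once.\<close>

lemma arc_crossing:
  assumes g: "arc g" "piecewise_smooth g"
  obtains \<rho>0 k where "\<rho>0 > 0" "k > 0"
    "\<And>\<rho>. 0 < \<rho> \<Longrightarrow> \<rho> < \<rho>0 \<Longrightarrow> \<exists>t. 0 < t \<and> t < 1 \<and> norm (g t - g 0) = \<rho> \<and>
       (\<forall>u\<in>{0..t}. norm (g u - g 0) \<le> \<rho>) \<and> (\<forall>u\<in>{t..1}. \<rho> \<le> norm (g u - g 0)) \<and> k * t \<le> \<rho>"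
proof -
  have cont: "continuous_on {0..1} g" and inj: "inj_on g {0..1}" using g(1) by (auto simp: arc_def path_def)
  obtain e k where e: "0 < e" "e \<le> 1" "k > 0" "\<And>t. 0 \<le> t \<Longrightarrow> t \<le> e \<Longrightarrow> k * t \<le> norm (g t - g 0)"
    and mono: "\<And>u t. 0 \<le> u \<Longrightarrow> u < t \<Longrightarrow> t \<le> e \<Longrightarrow> norm (g u - g 0) < norm (g t - g 0)"
    by (rule arc_start_distance[OF g(2)]) (rule that)
  have cn: "continuous_on {0..1} (\<lambda>u. norm (g u - g 0))" by (intro continuous_intros cont)
  have ce: "continuous_on {e..1} (\<lambda>u. norm (g u - g 0))" by (rule continuous_on_subset[OF cn]) (use e in auto)
  obtain u0 where u0: "u0 \<in> {e..1}" "\<And>u. u \<in> {e..1} \<Longrightarrow> norm (g u0 - g 0) \<le> norm (g u - g 0)"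
    using continuous_attains_inf[OF _ _ ce] e by auto
  define m where "m = norm (g u0 - g 0)"
  have "g u0 \<noteq> g 0" using inj_onD[OF inj, of u0 0] u0(1) e by auto
  then have m: "m > 0" by (simp add: m_def)
  have mono': "norm (g u - g 0) \<le> norm (g t - g 0)" if "0 \<le> u" "u \<le> t" "t \<le> e" for u t
    using mono[of u t] that by (cases "u = t") auto
  show ?thesis
  proof (rule that[OF m e(3)])
    fix \<rho> assume \<rho>: "0 < \<rho>" "\<rho> < m"
    have "\<rho> \<le> norm (g e - g 0)" using u0(2)[of e] e \<rho> by (auto simp: m_def)
    then obtain t where t: "0 \<le> t" "t \<le> e" "norm (g t - g 0) = \<rho>"
      using IVT'[of "\<lambda>u. norm (g u - g 0)" 0 \<rho> e] \<rho> e continuous_on_subset[OF cn, of "{0..e}"] by auto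
    have "t \<noteq> 0" using t(3) \<rho> by auto
    moreover have "t \<noteq> 1" using u0(2)[of t] t e \<rho> by (auto simp: m_def)
    moreover have "\<rho> \<le> norm (g u - g 0)" if u: "u \<in> {t..1}" for u
    proof (cases "u \<le> e")
      case True
      then show ?thesis using mono'[of t u] t u by auto
    next
      case False
      then show ?thesis using u0(2)[of u] u \<rho> by (auto simp: m_def)
    qed
    moreover have "norm (g u - g 0) \<le> \<rho>" if "u \<in> {0..t}" for u using mono'[of u t] t that by auto
    moreover have "k * t \<le> \<rho>" using e(4)[of t] t by simp
    ultimately show "\<exists>t. 0 < t \<and> t < 1 \<and> norm (g t - g 0) = \<rho> \<and>
       (\<forall>u\<in>{0..t}. norm (g u - g 0) \<le> \<rho>) \<and> (\<forall>u\<in>{t..1}. \<rho> \<le> norm (g u - g 0)) \<and> k * t \<le> \<rho>"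
      using t e by (intro exI[of _ t]) auto
  qed
qed

text \<open>Between the parameters \<open>t\<close> and \<open>s\<close> the arc runs outside the discs of radius \<open>\<rho>\<close> around its end points,
  and the parts cut off stay inside.\<close>

definition truncation :: "(real \<Rightarrow> complex) \<Rightarrow> real \<Rightarrow> real \<Rightarrow> real \<Rightarrow> bool" where
  "truncation g \<rho> t s \<longleftrightarrow> 0 < t \<and> t < s \<and> s < 1 \<and> dist (g 0) (g t) = \<rho> \<and> dist (g 1) (g s) = \<rho> \<and>
     (\<forall>u\<in>{0..t}. dist (g 0) (g u) \<le> \<rho>) \<and> (\<forall>u\<in>{t..1}. \<rho> \<le> dist (g 0) (g u)) \<and>
     (\<forall>u\<in>{s..1}. dist (g 1) (g u) \<le> \<rho>) \<and> (\<forall>u\<in>{0..s}. \<rho> \<le> dist (g 1) (g u))"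

lemma truncation_exists:
  assumes g: "arc g" "piecewise_smooth g"
  obtains \<rho>0 \<kappa> where "\<rho>0 > 0" "\<And>\<rho>. 0 < \<rho> \<Longrightarrow> \<rho> < \<rho>0 \<Longrightarrow> \<exists>t s. truncation g \<rho> t s \<and> t \<le> \<kappa> * \<rho> \<and> 1 - s \<le> \<kappa> * \<rho>"
proof -
  obtain \<rho>1 k where 1: "\<rho>1 > 0" "k > 0"
    "\<And>\<rho>. 0 < \<rho> \<Longrightarrow> \<rho> < \<rho>1 \<Longrightarrow> \<exists>t. 0 < t \<and> t < 1 \<and> norm (g t - g 0) = \<rho> \<and>
       (\<forall>u\<in>{0..t}. norm (g u - g 0) \<le> \<rho>) \<and> (\<forall>u\<in>{t..1}. \<rho> \<le> norm (g u - g 0)) \<and> k * t \<le> \<rho>"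
    by (rule arc_crossing[OF g]) (rule that)
  let ?h = "reversepath g"
  have h: "arc ?h" "piecewise_smooth ?h" using g piecewise_smooth_reversepath by (auto simp: arc_reversepath)
  obtain \<rho>2 l where 2: "\<rho>2 > 0" "l > 0"
    "\<And>\<rho>. 0 < \<rho> \<Longrightarrow> \<rho> < \<rho>2 \<Longrightarrow> \<exists>t. 0 < t \<and> t < 1 \<and> norm (?h t - ?h 0) = \<rho> \<and>
       (\<forall>u\<in>{0..t}. norm (?h u - ?h 0) \<le> \<rho>) \<and> (\<forall>u\<in>{t..1}. \<rho> \<le> norm (?h u - ?h 0)) \<and> l * t \<le> \<rho>"
    by (rule arc_crossing[OF h]) (rule that)
  define \<kappa> where "\<kappa> = 1 / k + 1 / l"
  have \<kappa>: "\<kappa> > 0" "1 / k \<le> \<kappa>" "1 / l \<le> \<kappa>" using 1 2 by (auto simp: \<kappa>_def add_pos_pos)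
  show ?thesis
  proof (rule that[of "min (min \<rho>1 \<rho>2) (1 / \<kappa>)"])
    show "min (min \<rho>1 \<rho>2) (1 / \<kappa>) > 0" using 1 2 \<kappa> by simp
    fix \<rho> assume \<rho>: "0 < \<rho>" "\<rho> < min (min \<rho>1 \<rho>2) (1 / \<kappa>)"
    obtain t where t: "0 < t" "t < 1" "norm (g t - g 0) = \<rho>" "\<And>u. u \<in> {0..t} \<Longrightarrow> norm (g u - g 0) \<le> \<rho>"
       "\<And>u. u \<in> {t..1} \<Longrightarrow> \<rho> \<le> norm (g u - g 0)" "k * t \<le> \<rho>"
      using 1(3)[of \<rho>] \<rho> by auto
    obtain v where v: "0 < v" "v < 1" "norm (?h v - ?h 0) = \<rho>" "\<And>u. u \<in> {0..v} \<Longrightarrow> norm (?h u - ?h 0) \<le> \<rho>"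
       "\<And>u. u \<in> {v..1} \<Longrightarrow> \<rho> \<le> norm (?h u - ?h 0)" "l * v \<le> \<rho>"
      using 2(3)[of \<rho>] \<rho> by auto
    have t\<rho>: "t \<le> (1 / k) * \<rho>" and v\<rho>: "v \<le> (1 / l) * \<rho>" using t(6) v(6) 1 2 by (simp_all add: field_simps)
    have "t + v \<le> \<kappa> * \<rho>" using t\<rho> v\<rho> by (simp add: \<kappa>_def distrib_right)
    also have "\<dots> < 1" using \<rho>(2) \<kappa> by (simp add: field_simps)
    finally have tv: "t < 1 - v" by simp
    have hu: "?h u = g (1 - u)" for u by (simp add: reversepath_def)
    have e1: "norm (g u - g 1) \<le> \<rho>" if "u \<in> {1 - v..1}" for u using v(4)[of "1 - u"] that by (simp add: hu)
    have e2: "\<rho> \<le> norm (g u - g 1)" if "u \<in> {0..1 - v}" for u using v(5)[of "1 - u"] that by (simp add: hu)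
    have e3: "norm (g (1 - v) - g 1) = \<rho>" using v(3) by (simp add: hu)
    have "truncation g \<rho> t (1 - v)"
      unfolding truncation_def using t v(1,2) tv e1 e2 e3 by (simp add: dist_norm norm_minus_commute)
    moreover have "(1 / k) * \<rho> \<le> \<kappa> * \<rho>" "(1 / l) * \<rho> \<le> \<kappa> * \<rho>" using mult_right_mono[OF \<kappa>(2), of \<rho>] mult_right_mono[OF \<kappa>(3), of \<rho>] \<rho>(1) by simp_all
    ultimately show "\<exists>t s. truncation g \<rho> t s \<and> t \<le> \<kappa> * \<rho> \<and> 1 - s \<le> \<kappa> * \<rho>"
      using t\<rho> v\<rho> by (intro exI[of _ t] exI[of _ "1 - v"]) auto
  qed
qed

text \<open>Two arcs in the same half plane that wind alike around the complement of \<open>D\<close> are cut off at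
  distance \<open>\<rho>\<close> from their common end points and joined by circular arcs to a loop inside \<open>D\<close>. The
  singular set \<open>K\<close> lies in discs around real points that the loop does not meet, and a loop in the
  half plane does not wind around real points. Each circular arc contributes at most \<open>B \<rho> \<pi>\<close>.\<close>

lemma truncated_deformation:
  fixes g1 g2 :: "real \<Rightarrow> complex" and a b :: real
  assumes s: "s = 1 \<or> s = -1" and D: "open D" "of_real a \<notin> D" "of_real b \<notin> D"
    and g1: "valid_path g1" "g1 0 = of_real a" "g1 1 = of_real b" "path_image g1 \<subseteq> half_plane s" "g1 ` {0<..<1} \<subseteq> D"
    and g2: "valid_path g2" "g2 0 = of_real a" "g2 1 = of_real b" "path_image g2 \<subseteq> half_plane s" "g2 ` {0<..<1} \<subseteq> D"
    and wn: "\<And>z. z \<notin> D \<Longrightarrow> z \<noteq> of_real a \<Longrightarrow> z \<noteq> of_real b \<Longrightarrow> winding_number g1 z = winding_number g2 z"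
    and \<rho>: "\<rho> > 0" "2 * \<rho> < b - a"
    and t1: "truncation g1 \<rho> t1 s1" and t2: "truncation g2 \<rho> t2 s2"
    and K: "closed K" "\<And>z. z \<in> K \<Longrightarrow> \<exists>x r. dist (of_real x) z \<le> r \<and>
        (\<forall>w \<in> path_image g1 \<union> path_image g2 \<union> sphere (of_real a) \<rho> \<union> sphere (of_real b) \<rho>. r < dist (of_real x) w)"
    and f: "f holomorphic_on (D - K)"
    and B: "B \<ge> 0" "\<And>z. z \<in> D - K \<Longrightarrow> z \<in> sphere (of_real a) \<rho> \<union> sphere (of_real b) \<rho> \<Longrightarrow> cmod (f z) \<le> B"
  shows "cmod (contour_integral (subpath t1 s1 g1) f - contour_integral (subpath t2 s2 g2) f) \<le> 2 * (B * \<rho> * pi)"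
proof -
  let ?a = "complex_of_real a" and ?b = "complex_of_real b"
  have ab: "dist ?a ?b > 2 * \<rho>" using \<rho> by (simp add: dist_of_real dist_real_def)
  have p: "path g1" "path g2" using g1(1) g2(1) by (auto simp: valid_path_imp_path)
  note T1 = t1[unfolded truncation_def g1(2,3)] and T2 = t2[unfolded truncation_def g2(2,3)]
  have far1: "\<forall>u\<in>{t1..1}. \<rho> \<le> dist ?a (g1 u)" "\<forall>u\<in>{0..s1}. \<rho> \<le> dist ?b (g1 u)"
    and near1: "\<forall>u\<in>{0..t1}. dist ?a (g1 u) \<le> \<rho>" "\<forall>u\<in>{s1..1}. dist ?b (g1 u) \<le> \<rho>"
    using T1 by blast+
  have far2: "\<forall>u\<in>{t2..1}. \<rho> \<le> dist ?a (g2 u)" "\<forall>u\<in>{0..s2}. \<rho> \<le> dist ?b (g2 u)"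
    and near2: "\<forall>u\<in>{0..t2}. dist ?a (g2 u) \<le> \<rho>" "\<forall>u\<in>{s2..1}. dist ?b (g2 u) \<le> \<rho>"
    using T2 by blast+
  have in1: "t1 \<in> {0..1}" "s1 \<in> {0..1}" "t1 < s1" "0 < t1" "s1 < 1"
    and in2: "t2 \<in> {0..1}" "s2 \<in> {0..1}" "t2 < s2" "0 < t2" "s2 < 1" using T1 T2 by auto
  have z01: "(0::real) \<in> {0..1}" "(1::real) \<in> {0..1}" by auto
  have Dab: "g1 u \<in> D" "g2 u \<in> D" if "u \<in> {0<..<1}" for u using g1(5) g2(5) that by auto
  have im1: "path_image g1 \<subseteq> D \<union> {?a, ?b}" and im2: "path_image g2 \<subseteq> D \<union> {?a, ?b}"
  proof -
    have "g1 u \<in> D \<union> {?a, ?b} \<and> g2 u \<in> D \<union> {?a, ?b}" if "u \<in> {0..1}" for u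
      using Dab[of u] g1(2,3) g2(2,3) that by (cases "u = 0 \<or> u = 1") auto
    then show "path_image g1 \<subseteq> D \<union> {?a, ?b}" "path_image g2 \<subseteq> D \<union> {?a, ?b}"
      unfolding path_image_def by blast+
  qed
  define L1 where "L1 = subpath t1 s1 g1"
  define L2 where "L2 = subpath s2 t2 g2"
  define Qa where "Qa = subpath t2 0 g2 +++ subpath 0 t1 g1"
  define Qb where "Qb = subpath s1 1 g1 +++ subpath 1 s2 g2"
  have sub: "path_image (subpath u v g) = g ` closed_segment u v" for u v and g :: "real \<Rightarrow> complex"
    by (rule path_image_subpath_gen)
  have jQ: "pathfinish (subpath t2 0 g2) = pathstart (subpath 0 t1 g1)" "pathfinish (subpath s1 1 g1) = pathstart (subpath 1 s2 g2)"
    using g1(2,3) g2(2,3) by simp_all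
  have vL: "valid_path L1" "valid_path L2"
    unfolding L1_def L2_def by (intro valid_path_subpath g1(1) g2(1) in1 in2)+
  have pL: "path L1" "path L2" using vL by (auto simp: valid_path_imp_path)
  have psub: "path (subpath u v g1)" "path (subpath u v g2)" if "u \<in> {0..1}" "v \<in> {0..1}" for u v
    using that p by (auto intro: path_subpath)
  have pQ: "path Qa" "path Qb"
    unfolding Qa_def Qb_def by (intro path_join_imp psub jQ in1 in2 z01)+
  have imL1: "path_image L1 = g1 ` {t1..s1}" and imL2: "path_image L2 = g2 ` {t2..s2}"
    using in1 in2 by (auto simp: L1_def L2_def sub closed_segment_eq_real_ivl)
  have imQa: "path_image Qa = g2 ` {0..t2} \<union> g1 ` {0..t1}" and imQb: "path_image Qb = g1 ` {s1..1} \<union> g2 ` {s2..1}"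
    using in1 in2 by (auto simp: Qa_def Qb_def path_image_join[OF jQ(1)] path_image_join[OF jQ(2)] sub closed_segment_eq_real_ivl)
  have endsL: "pathstart L1 = g1 t1" "pathfinish L1 = g1 s1" "pathstart L2 = g2 s2" "pathfinish L2 = g2 t2"
    and endsQ: "pathstart Qa = g2 t2" "pathfinish Qa = g1 t1" "pathstart Qb = g1 s1" "pathfinish Qb = g2 s2"
    by (simp_all add: L1_def L2_def Qa_def Qb_def)
  have LD: "path_image L1 \<subseteq> D" "path_image L2 \<subseteq> D"
    unfolding imL1 imL2 using Dab in1 in2 by auto
  have subs: "path_image L1 \<subseteq> path_image g1" "path_image L2 \<subseteq> path_image g2"
    "path_image Qa \<subseteq> path_image g1 \<union> path_image g2" "path_image Qb \<subseteq> path_image g1 \<union> path_image g2"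
    unfolding imL1 imL2 imQa imQb path_image_def[of g1] path_image_def[of g2] using in1 in2 by auto
  have half: "path_image L1 \<subseteq> half_plane s" "path_image L2 \<subseteq> half_plane s" "path_image Qb \<subseteq> half_plane s"
    using subs g1(4) g2(4) by blast+
  have QbD: "path_image Qb \<subseteq> D \<union> {?b}"
  proof -
    have "g1 u \<in> D \<union> {?b}" if "u \<in> {s1..1}" for u using Dab[of u] g1(3) in1 that by (cases "u = 1") auto
    moreover have "g2 u \<in> D \<union> {?b}" if "u \<in> {s2..1}" for u using Dab[of u] g2(3) in2 that by (cases "u = 1") auto
    ultimately show ?thesis unfolding imQb by blast
  qed
  have w0: "winding_number L1 z + winding_number Qb z + winding_number L2 z + winding_number Qa z = 0"
    if z: "z \<notin> D" "z \<noteq> ?a" "z \<noteq> ?b" for z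
  proof -
    have n: "z \<notin> path_image g1" "z \<notin> path_image g2" using im1 im2 z by auto
    have ns: "z \<notin> path_image (subpath u v g1)" "z \<notin> path_image (subpath u v g2)" if "u \<in> {0..1}" "v \<in> {0..1}" for u v
      using n path_image_subpath_subset that by blast+
    define W1 where "W1 u v = winding_number (subpath u v g1) z" for u v
    define W2 where "W2 u v = winding_number (subpath u v g2) z" for u v
    have c1: "W1 u v + W1 v w = W1 u w" and c2: "W2 u v + W2 v w = W2 u w"
      if "u \<in> {0..1}" "v \<in> {0..1}" "w \<in> {0..1}" for u v w
      unfolding W1_def W2_def using that n p by (simp_all add: winding_number_subpath_combine)
    have Wa: "winding_number Qa z = W2 t2 0 + W1 0 t1" and Wb: "winding_number Qb z = W1 s1 1 + W2 1 s2"
      unfolding Qa_def Qb_def W1_def W2_def by (intro winding_number_join psub jQ ns in1 in2 z01)+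
    have "W1 0 1 = winding_number g1 z" by (simp add: W1_def)
    moreover have "W2 1 0 = - winding_number g2 z"
      unfolding W2_def using winding_number_reversepath[OF p(2) n(2)] reversepath_subpath[of 0 1 g2] by simp
    ultimately have "W1 0 1 + W2 1 0 = 0" using wn[OF z] by simp
    moreover have "W1 0 t1 + W1 t1 s1 = W1 0 s1" "W1 0 s1 + W1 s1 1 = W1 0 1"
      "W2 1 s2 + W2 s2 t2 = W2 1 t2" "W2 1 t2 + W2 t2 0 = W2 1 0"
      using c1 c2 in1 in2 z01 by blast+
    moreover have "winding_number L1 z = W1 t1 s1" "winding_number L2 z = W2 s2 t2"
      by (simp_all add: L1_def L2_def W1_def W2_def)
    ultimately show ?thesis unfolding Wa Wb by (simp add: algebra_simps) (metis add.assoc add.commute)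
  qed
  \<comment> \<open>The part of the loop near \<open>a\<close> is replaced first. At this stage the loop still passes through \<open>b\<close>,
    which is therefore left out of the set to be avoided.\<close>
  define P where "P = L1 +++ (Qb +++ L2)"
  have imP: "path_image P = path_image L1 \<union> path_image Qb \<union> path_image L2"
    using endsL endsQ by (simp add: P_def path_image_join Un_assoc)
  have pP: "path P" using pL pQ endsL endsQ by (simp add: P_def)
  have endsP: "pathstart P = g1 t1" "pathfinish P = g2 t2" using endsL by (simp_all add: P_def)
  have wnP: "winding_number P z = winding_number L1 z + winding_number Qb z + winding_number L2 z"
    if "z \<notin> path_image P" for z
    unfolding P_def using that imP pL pQ endsL endsQ by (simp add: winding_number_join path_image_join)
  obtain \<phi> \<psi> where A1: "\<bar>\<psi> - \<phi>\<bar> \<le> pi" "pathstart (part_circlepath ?a \<rho> \<phi> \<psi>) = pathfinish P"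
    "pathfinish (part_circlepath ?a \<rho> \<phi> \<psi>) = pathstart P"
    "path_image (part_circlepath ?a \<rho> \<phi> \<psi>) \<subseteq> half_plane s"
    "path_image (part_circlepath ?a \<rho> \<phi> \<psi>) \<inter> (- D - {?b}) = {}"
    "\<And>z. z \<in> - D - {?b} \<Longrightarrow> winding_number P z + winding_number (part_circlepath ?a \<rho> \<phi> \<psi>) z = 0"
  proof (rule close_with_circular_arc[OF s \<rho>(1) pP _ _ pQ(1)])
    show "path_image P \<subseteq> half_plane s" unfolding imP by (intro Un_least half)
    have "g1 u \<notin> ball ?a \<rho>" if "u \<in> {t1..1}" for u using bspec[OF far1(1) that] by simp
    moreover have "g2 u \<notin> ball ?a \<rho>" if "u \<in> {t2..1}" for u using bspec[OF far2(1) that] by simp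
    moreover have "{t1..s1} \<subseteq> {t1..1}" "{s1..1} \<subseteq> {t1..1}" "{t2..s2} \<subseteq> {t2..1}" "{s2..1} \<subseteq> {t2..1}"
      using in1 in2 by auto
    ultimately show "path_image P \<inter> ball ?a \<rho> = {}"
      unfolding imP imL1 imL2 imQb by blast
    have "g1 u \<in> cball ?a \<rho>" if "u \<in> {0..t1}" for u using bspec[OF near1(1) that] by simp
    moreover have "g2 u \<in> cball ?a \<rho>" if "u \<in> {0..t2}" for u using bspec[OF near2(1) that] by simp
    ultimately show "path_image Qa \<subseteq> cball ?a \<rho>" unfolding imQa by blast
    show "pathstart P \<in> sphere ?a \<rho>" "pathfinish P \<in> sphere ?a \<rho>" using T1 T2 by (simp_all add: endsP)
    fix z assume "z \<in> - D - {?b}" "z \<noteq> ?a"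
    then have z: "z \<notin> D" "z \<noteq> ?a" "z \<noteq> ?b" by auto
    have n: "z \<notin> path_image g1 \<union> path_image g2" using im1 im2 z by auto
    then have "z \<notin> path_image P" "z \<notin> path_image Qa" using subs imP by auto
    then show "z \<notin> path_image P \<and> z \<notin> path_image Qa \<and> winding_number P z + winding_number Qa z = 0"
      using w0[OF z] by (simp add: wnP)
  qed (simp add: endsP endsQ, simp add: endsP endsQ, rule that)
  define A where "A = part_circlepath ?a \<rho> \<phi> \<psi>"
  have sphA: "path_image A \<subseteq> sphere ?a \<rho>"
    unfolding A_def using \<rho> by (auto simp: path_image_part_circlepath' dist_norm norm_mult)
  have endsA: "pathstart A = g2 t2" "pathfinish A = g1 t1" using A1(2,3) by (simp_all add: A_def endsP)
  have bA: "?b \<notin> path_image A"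
    using sphA ab \<rho>(1) by auto
  then have AD: "path_image A \<subseteq> D" using A1(5) by (auto simp: A_def)
  \<comment> \<open>After the replacement near \<open>b\<close> the loop lies in \<open>D\<close>.\<close>
  define P' where "P' = L2 +++ (A +++ L1)"
  have pA: "path A" "valid_path A" by (simp_all add: A_def)
  have imP': "path_image P' = path_image L2 \<union> path_image A \<union> path_image L1"
    using endsL endsA by (simp add: P'_def path_image_join Un_assoc)
  have vP': "valid_path P'" using vL pA endsL endsA by (simp add: P'_def valid_path_join)
  have pP': "path P'" by (rule valid_path_imp_path[OF vP'])
  have endsP': "pathstart P' = g2 s2" "pathfinish P' = g1 s1" using endsL by (simp_all add: P'_def)
  have wnP': "winding_number P' z = winding_number L2 z + winding_number A z + winding_number L1 z"
    if "z \<notin> path_image P'" for z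
    unfolding P'_def using that imP' pL pA endsL endsA by (simp add: winding_number_join path_image_join)
  have P'D: "path_image P' \<subseteq> D" using imP' LD AD by auto
  obtain \<phi>' \<psi>' where A2: "\<bar>\<psi>' - \<phi>'\<bar> \<le> pi" "pathstart (part_circlepath ?b \<rho> \<phi>' \<psi>') = pathfinish P'"
    "pathfinish (part_circlepath ?b \<rho> \<phi>' \<psi>') = pathstart P'"
    "path_image (part_circlepath ?b \<rho> \<phi>' \<psi>') \<subseteq> half_plane s"
    "path_image (part_circlepath ?b \<rho> \<phi>' \<psi>') \<inter> (- D) = {}"
    "\<And>z. z \<in> - D \<Longrightarrow> winding_number P' z + winding_number (part_circlepath ?b \<rho> \<phi>' \<psi>') z = 0"
  proof (rule close_with_circular_arc[OF s \<rho>(1) pP' _ _ pQ(2)])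
    show "path_image P' \<subseteq> half_plane s" unfolding imP' A_def by (intro Un_least half A1(4))
    have "w \<notin> ball ?b \<rho>" if "w \<in> path_image A" for w
    proof -
      have "dist ?a w = \<rho>" using sphA that by auto
      then show ?thesis using ab dist_triangle[of ?a ?b w] by (auto simp: dist_commute)
    qed
    moreover have "g1 u \<notin> ball ?b \<rho>" if "u \<in> {t1..s1}" for u using bspec[OF far1(2), of u] in1 that by simp
    moreover have "g2 u \<notin> ball ?b \<rho>" if "u \<in> {t2..s2}" for u using bspec[OF far2(2), of u] in2 that by simp
    ultimately show "path_image P' \<inter> ball ?b \<rho> = {}" unfolding imP' imL1 imL2 by blast
    have "g1 u \<in> cball ?b \<rho>" if "u \<in> {s1..1}" for u using bspec[OF near1(2) that] by simp
    moreover have "g2 u \<in> cball ?b \<rho>" if "u \<in> {s2..1}" for u using bspec[OF near2(2) that] by simp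
    ultimately show "path_image Qb \<subseteq> cball ?b \<rho>" unfolding imQb by blast
    show "pathstart P' \<in> sphere ?b \<rho>" "pathfinish P' \<in> sphere ?b \<rho>" using T1 T2 by (simp_all add: endsP')
    fix z assume z: "z \<in> - D" "z \<noteq> ?b"
    then have nP': "z \<notin> path_image P'" and nQ: "z \<notin> path_image Qb" using P'D QbD by auto
    then have nP: "z \<notin> path_image P" using imP imP' by auto
    have "winding_number P z + winding_number A z = 0" using A1(6)[of z] z by (simp add: A_def)
    then show "z \<notin> path_image P' \<and> z \<notin> path_image Qb \<and> winding_number P' z + winding_number Qb z = 0"
      using nP' nQ wnP[OF nP] wnP'[OF nP'] by (simp add: algebra_simps)
  qed (simp add: endsP' endsQ, simp add: endsP' endsQ, rule that)
  define A' where "A' = part_circlepath ?b \<rho> \<phi>' \<psi>'"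
  have sphA': "path_image A' \<subseteq> sphere ?b \<rho>"
    unfolding A'_def using \<rho> by (auto simp: path_image_part_circlepath' dist_norm norm_mult)
  have pA': "path A'" "valid_path A'" by (simp_all add: A'_def)
  have endsA': "pathstart A' = g1 s1" "pathfinish A' = g2 s2" using A2(2,3) by (simp_all add: A'_def endsP')
  have A'D: "path_image A' \<subseteq> D" using A2(5) by (auto simp: A'_def)
  define \<Gamma> where "\<Gamma> = P' +++ A'"
  have v\<Gamma>: "valid_path \<Gamma>" using vP' pA' endsP' endsA' by (simp add: \<Gamma>_def valid_path_join)
  have p\<Gamma>: "path \<Gamma>" by (rule valid_path_imp_path[OF v\<Gamma>])
  have loop: "pathfinish \<Gamma> = pathstart \<Gamma>" using endsP' endsA' by (simp add: \<Gamma>_def)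
  have im\<Gamma>: "path_image \<Gamma> = path_image P' \<union> path_image A'" using endsP' endsA' by (simp add: \<Gamma>_def path_image_join)
  have \<Gamma>half: "path_image \<Gamma> \<subseteq> half_plane s"
    unfolding im\<Gamma> imP' A_def A'_def by (intro Un_least half A1(4) A2(4))
  have \<Gamma>sub: "path_image \<Gamma> \<subseteq> path_image g1 \<union> path_image g2 \<union> sphere ?a \<rho> \<union> sphere ?b \<rho>"
    unfolding im\<Gamma> imP' using subs sphA sphA' by blast
  have \<Gamma>K: "z \<notin> path_image \<Gamma> \<and> winding_number \<Gamma> z = 0" if z: "z \<in> K" for z
  proof -
    obtain x r where x: "dist (of_real x) z \<le> r"
      "\<And>w. w \<in> path_image g1 \<union> path_image g2 \<union> sphere ?a \<rho> \<union> sphere ?b \<rho> \<Longrightarrow> r < dist (of_real x) w"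
      using K(2)[OF z] by blast
    have dis: "cball (of_real x) r \<inter> path_image \<Gamma> = {}"
    proof (rule ccontr)
      assume "cball (of_real x) r \<inter> path_image \<Gamma> \<noteq> {}"
      then obtain w where "w \<in> cball (of_real x) r" "w \<in> path_image \<Gamma>" by blast
      then show False using x(2)[of w] \<Gamma>sub by auto
    qed
    have r: "r \<ge> 0" using x(1) zero_le_dist order_trans by blast
    have xin: "of_real x \<in> cball (of_real x :: complex) r" using r by simp
    have "winding_number \<Gamma> z = winding_number \<Gamma> (of_real x)"
      by (rule winding_number_eq[OF p\<Gamma> loop _ xin convex_connected[OF convex_cball] dis]) (use x(1) in simp)
    also have "\<dots> = 0" by (rule winding_number_real_point[OF s p\<Gamma> loop \<Gamma>half]) (use dis xin in blast)
    finally show ?thesis using dis x(1) by auto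
  qed
  have oDK: "open (D - K)" using D(1) K(1) by (rule open_Diff)
  have \<Gamma>DK: "path_image \<Gamma> \<subseteq> D - K" using \<Gamma>K P'D A'D im\<Gamma> by blast
  have "(f has_contour_integral 0) \<Gamma>"
  proof (rule Cauchy_theorem_global[OF oDK f v\<Gamma> loop \<Gamma>DK])
    fix z assume "z \<notin> D - K"
    then consider "z \<in> K" | "z \<notin> D" by blast
    then show "winding_number \<Gamma> z = 0"
    proof cases
      case 2
      then have "z \<notin> path_image P'" "z \<notin> path_image A'" using P'D A'D by auto
      then show ?thesis
        using A2(6)[of z] 2 pP' pA' endsP' endsA' by (simp add: \<Gamma>_def winding_number_join A'_def)
    qed (use \<Gamma>K in blast)
  qed
  then have int0: "contour_integral \<Gamma> f = 0" by (rule contour_integral_unique)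
  have parts: "path_image L1 \<subseteq> D - K" "path_image L2 \<subseteq> D - K" "path_image A \<subseteq> D - K" "path_image A' \<subseteq> D - K"
    using \<Gamma>DK im\<Gamma> imP' by auto
  have ci: "f contour_integrable_on g" if "valid_path g" "path_image g \<subseteq> D - K" for g
    by (rule contour_integrable_holomorphic_simple[OF f oDK that])
  note ciL1 = ci[OF vL(1) parts(1)] and ciL2 = ci[OF vL(2) parts(2)] and ciA = ci[OF pA(2) parts(3)] and ciA' = ci[OF pA'(2) parts(4)]
  have "contour_integral \<Gamma> f = contour_integral L2 f + (contour_integral A f + contour_integral L1 f) + contour_integral A' f"
    unfolding \<Gamma>_def P'_def using ciL1 ciL2 ciA ciA' vL pA pA' endsL endsA endsA'
    by (simp add: valid_path_join contour_integrable_join)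
  moreover have "contour_integral L2 f = - contour_integral (subpath t2 s2 g2) f"
    using contour_integral_reversepath[OF valid_path_subpath[OF g2(1) in2(1,2)], of f] by (simp add: L2_def reversepath_subpath)
  ultimately have eq: "contour_integral (subpath t1 s1 g1) f - contour_integral (subpath t2 s2 g2) f
      = - (contour_integral A f + contour_integral A' f)"
    using int0 by (simp add: L1_def algebra_simps add_eq_0_iff)
  have bA1: "cmod (contour_integral A f) \<le> B * \<rho> * pi"
  proof -
    have "cmod (contour_integral A f) \<le> B * \<rho> * \<bar>\<psi> - \<phi>\<bar>"
      unfolding A_def
    proof (rule contour_integral_bound_part_circlepath)
      fix x assume "x \<in> path_image (part_circlepath ?a \<rho> \<phi> \<psi>)"
      then have "x \<in> path_image A" by (simp add: A_def)
      then show "cmod (f x) \<le> B" using sphA parts(3) by (intro B(2)) auto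
    qed (use ciA B(1) \<rho> in \<open>simp_all add: A_def\<close>)
    also have "\<dots> \<le> B * \<rho> * pi" by (rule mult_left_mono[OF A1(1)]) (use B \<rho> in simp)
    finally show ?thesis .
  qed
  have bA2: "cmod (contour_integral A' f) \<le> B * \<rho> * pi"
  proof -
    have "cmod (contour_integral A' f) \<le> B * \<rho> * \<bar>\<psi>' - \<phi>'\<bar>"
      unfolding A'_def
    proof (rule contour_integral_bound_part_circlepath)
      fix x assume "x \<in> path_image (part_circlepath ?b \<rho> \<phi>' \<psi>')"
      then have "x \<in> path_image A'" by (simp add: A'_def)
      then show "cmod (f x) \<le> B" using sphA' parts(4) by (intro B(2)) auto
    qed (use ciA' B(1) \<rho> in \<open>simp_all add: A'_def\<close>)
    also have "\<dots> \<le> B * \<rho> * pi" by (rule mult_left_mono[OF A2(1)]) (use B \<rho> in simp)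
    finally show ?thesis .
  qed
  show ?thesis unfolding eq norm_minus_cancel using norm_triangle_ineq[of "contour_integral A f" "contour_integral A' f"] bA1 bA2 by linarith
qed

text \<open>The indefinite integral along the path is continuous at both end points, even if the integrand
  is singular there.\<close>

lemma contour_integral_truncation_limit:
  assumes g: "valid_path g" and f: "f contour_integrable_on g" and \<epsilon>: "\<epsilon> > 0"
  obtains \<delta> where "\<delta> > 0" "\<And>t s. 0 < t \<Longrightarrow> t < s \<Longrightarrow> s < 1 \<Longrightarrow> t < \<delta> \<Longrightarrow> 1 - s < \<delta> \<Longrightarrow>
    cmod (contour_integral (subpath t s g) f - contour_integral g f) < \<epsilon>"
proof -
  define h where "h x = f (g x) * vector_derivative g (at x)" for x
  have hi: "h integrable_on {0..1}" using f by (simp add: contour_integrable_on h_def[abs_def])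
  define \<Phi> where "\<Phi> x = integral {0..x} h" for x
  have cont: "continuous_on {0..1} \<Phi>" unfolding \<Phi>_def by (rule indefinite_integral_continuous_1[OF hi])
  have e2: "\<epsilon> / 2 > 0" using \<epsilon> by simp
  obtain \<delta>1 where \<delta>1: "\<delta>1 > 0" "\<And>x. x \<in> {0..1} \<Longrightarrow> dist x 0 < \<delta>1 \<Longrightarrow> dist (\<Phi> x) (\<Phi> 0) < \<epsilon> / 2"
    using cont[unfolded continuous_on_iff, rule_format, OF _ e2, of 0] by auto
  obtain \<delta>2 where \<delta>2: "\<delta>2 > 0" "\<And>x. x \<in> {0..1} \<Longrightarrow> dist x 1 < \<delta>2 \<Longrightarrow> dist (\<Phi> x) (\<Phi> 1) < \<epsilon> / 2"
    using cont[unfolded continuous_on_iff, rule_format, OF _ e2, of 1] by auto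
  have \<Phi>0: "\<Phi> 0 = 0" by (simp add: \<Phi>_def)
  have \<Phi>1: "\<Phi> 1 = contour_integral g f" unfolding \<Phi>_def h_def contour_integral_integral ..
  show ?thesis
  proof (rule that[of "min \<delta>1 \<delta>2"])
    fix t s :: real assume ts: "0 < t" "t < s" "s < 1" "t < min \<delta>1 \<delta>2" "1 - s < min \<delta>1 \<delta>2"
    have "contour_integral (subpath t s g) f = integral {t..s} h"
      unfolding h_def by (rule contour_integral_subcontour_integral[OF f g]) (use ts in auto)
    moreover have "integral {0..t} h + integral {t..s} h = integral {0..s} h"
      by (rule Henstock_Kurzweil_Integration.integral_combine)
        (use ts integrable_subinterval_real[OF hi] in auto)
    ultimately have eq: "contour_integral (subpath t s g) f - contour_integral g f = (\<Phi> s - \<Phi> 1) - (\<Phi> t - \<Phi> 0)"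
      by (simp add: \<Phi>0 \<Phi>1) (simp add: \<Phi>_def algebra_simps)
    have "cmod (\<Phi> s - \<Phi> 1) < \<epsilon> / 2" using \<delta>2(2)[of s] ts by (simp add: dist_norm)
    moreover have "cmod (\<Phi> t - \<Phi> 0) < \<epsilon> / 2" using \<delta>1(2)[of t] ts by (simp add: dist_norm)
    ultimately show "cmod (contour_integral (subpath t s g) f - contour_integral g f) < \<epsilon>"
      unfolding eq using norm_triangle_ineq4[of "\<Phi> s - \<Phi> 1" "\<Phi> t - \<Phi> 0"] by linarith
  qed (use \<delta>1 \<delta>2 in simp)
qed

text \<open>The integrals over the arcs cut off at distance \<open>\<rho>\<close> from the end points differ by at most
  \<open>2 \<pi> C \<rho>\<^bsup>1 - \<nu>\<^esup>\<close>, the contribution of the two circular arcs, which tends to \<open>0\<close> because of \<open>\<nu> < 1\<close>.\<close>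

theorem contour_integral_deformation:
  fixes g1 g2 :: "real \<Rightarrow> complex" and a b :: real
  assumes s: "s = 1 \<or> s = -1" and ab: "a < b" and D: "open D" "of_real a \<notin> D" "of_real b \<notin> D"
    and g1: "arc g1" "piecewise_smooth g1" "g1 0 = of_real a" "g1 1 = of_real b" "path_image g1 \<subseteq> half_plane s" "g1 ` {0<..<1} \<subseteq> D"
    and g2: "arc g2" "piecewise_smooth g2" "g2 0 = of_real a" "g2 1 = of_real b" "path_image g2 \<subseteq> half_plane s" "g2 ` {0<..<1} \<subseteq> D"
    and wn: "\<And>z. z \<notin> D \<Longrightarrow> z \<noteq> of_real a \<Longrightarrow> z \<noteq> of_real b \<Longrightarrow> winding_number g1 z = winding_number g2 z"
    and K: "closed K" and \<eta>: "\<eta> > 0" "\<And>z. z \<in> K \<Longrightarrow> \<exists>x r. dist (of_real x) z \<le> r \<and>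
        (\<forall>w \<in> path_image g1 \<union> path_image g2. r + \<eta> \<le> dist (of_real x) w)"
    and f: "f holomorphic_on (D - K)"
    and C: "C \<ge> 0" "\<nu> < 1" "\<tau> > 0"
      "\<And>z \<omega>. z \<in> D - K \<Longrightarrow> \<omega> \<in> {of_real a, of_real b} \<Longrightarrow> dist \<omega> z < \<tau> \<Longrightarrow> cmod (f z) \<le> C * dist \<omega> z powr (- \<nu>)"
    and fi: "f contour_integrable_on g1" "f contour_integrable_on g2"
  shows "contour_integral g1 f = contour_integral g2 f"
proof -
  let ?a = "complex_of_real a" and ?b = "complex_of_real b"
  have v1: "valid_path g1" by (rule smooth_arc.valid_path) (rule smooth_arc.intro[OF g1(1,2)])
  have v2: "valid_path g2" by (rule smooth_arc.valid_path) (rule smooth_arc.intro[OF g2(1,2)])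
  obtain R1 \<kappa>1 where R1: "R1 > 0" "\<And>\<rho>. 0 < \<rho> \<Longrightarrow> \<rho> < R1 \<Longrightarrow> \<exists>t s. truncation g1 \<rho> t s \<and> t \<le> \<kappa>1 * \<rho> \<and> 1 - s \<le> \<kappa>1 * \<rho>"
    by (rule truncation_exists[OF g1(1,2)]) (rule that)
  obtain R2 \<kappa>2 where R2: "R2 > 0" "\<And>\<rho>. 0 < \<rho> \<Longrightarrow> \<rho> < R2 \<Longrightarrow> \<exists>t s. truncation g2 \<rho> t s \<and> t \<le> \<kappa>2 * \<rho> \<and> 1 - s \<le> \<kappa>2 * \<rho>"
    by (rule truncation_exists[OF g2(1,2)]) (rule that)
  have "cmod (contour_integral g1 f - contour_integral g2 f) \<le> 0 + \<epsilon>" if \<epsilon>: "\<epsilon> > 0" for \<epsilon>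
  proof -
    have e3: "\<epsilon> / 3 > 0" using \<epsilon> by simp
    obtain \<delta>1 where \<delta>1: "\<delta>1 > 0" "\<And>t s. 0 < t \<Longrightarrow> t < s \<Longrightarrow> s < 1 \<Longrightarrow> t < \<delta>1 \<Longrightarrow> 1 - s < \<delta>1 \<Longrightarrow>
        cmod (contour_integral (subpath t s g1) f - contour_integral g1 f) < \<epsilon> / 3"
      by (rule contour_integral_truncation_limit[OF v1 fi(1) e3]) (rule that)
    obtain \<delta>2 where \<delta>2: "\<delta>2 > 0" "\<And>t s. 0 < t \<Longrightarrow> t < s \<Longrightarrow> s < 1 \<Longrightarrow> t < \<delta>2 \<Longrightarrow> 1 - s < \<delta>2 \<Longrightarrow>
        cmod (contour_integral (subpath t s g2) f - contour_integral g2 f) < \<epsilon> / 3"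
      by (rule contour_integral_truncation_limit[OF v2 fi(2) e3]) (rule that)
    \<comment> \<open>Below \<open>\<rho> = q\<^bsup>1 / (1 - \<nu>)\<^esup>\<close> the circular arcs contribute \<open>2 \<pi> C \<rho>\<^bsup>1 - \<nu>\<^esup> \<le> \<epsilon> / 3\<close>; the summand \<open>1\<close> covers \<open>C = 0\<close>.\<close>
    define q where "q = \<epsilon> / (6 * pi * C + 1)"
    have den: "6 * pi * C + 1 > 0" using C(1) by (intro add_nonneg_pos) auto
    have q: "q > 0" using \<epsilon> den by (simp add: q_def)
    define m where "m = Min {R1, R2, \<tau>, (b - a) / 2, \<eta>, \<delta>1 / (\<bar>\<kappa>1\<bar> + 1), \<delta>2 / (\<bar>\<kappa>2\<bar> + 1), q powr (1 / (1 - \<nu>))}"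
    have "0 < \<delta>1 / (\<bar>\<kappa>1\<bar> + 1)" "0 < \<delta>2 / (\<bar>\<kappa>2\<bar> + 1)" using \<delta>1(1) \<delta>2(1) by (simp_all add: add_nonneg_pos)
    moreover have "0 < q powr (1 / (1 - \<nu>))" using q by simp
    moreover have "0 < (b - a) / 2" using ab by simp
    ultimately have mpos: "m > 0" unfolding m_def using R1(1) R2(1) C(3) \<eta>(1)
      by (subst Min_gr_iff) (simp_all only: finite.intros insert_not_empty ball_simps simp_thms)
    define \<rho> where "\<rho> = m / 2"
    have \<rho>: "\<rho> > 0" "\<rho> < m" using mpos by (auto simp: \<rho>_def)
    have mle: "m \<le> R1" "m \<le> R2" "m \<le> \<tau>" "m \<le> (b - a) / 2" "m \<le> \<eta>" "m \<le> \<delta>1 / (\<bar>\<kappa>1\<bar> + 1)"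
      "m \<le> \<delta>2 / (\<bar>\<kappa>2\<bar> + 1)" "m \<le> q powr (1 / (1 - \<nu>))" unfolding m_def by (rule Min_le; simp)+
    have small: "\<kappa> * \<rho> < \<delta>" if "m \<le> \<delta> / (\<bar>\<kappa>\<bar> + 1)" for \<kappa> \<delta>
    proof -
      have "\<kappa> * \<rho> \<le> (\<bar>\<kappa>\<bar> + 1) * \<rho>" by (rule mult_right_mono) (use \<rho> in auto)
      also have "\<dots> < (\<bar>\<kappa>\<bar> + 1) * m" by (rule mult_strict_left_mono) (use \<rho> in auto)
      also have "\<dots> \<le> \<delta>" using that by (simp add: pos_le_divide_eq mult.commute)
      finally show ?thesis .
    qed
    obtain t1 s1 where t1: "truncation g1 \<rho> t1 s1" "t1 \<le> \<kappa>1 * \<rho>" "1 - s1 \<le> \<kappa>1 * \<rho>" using R1(2)[of \<rho>] \<rho> mle by auto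
    obtain t2 s2 where t2: "truncation g2 \<rho> t2 s2" "t2 \<le> \<kappa>2 * \<rho>" "1 - s2 \<le> \<kappa>2 * \<rho>" using R2(2)[of \<rho>] \<rho> mle by auto
    define B where "B = C * \<rho> powr (- \<nu>)"
    have "cmod (contour_integral (subpath t1 s1 g1) f - contour_integral (subpath t2 s2 g2) f) \<le> 2 * (B * \<rho> * pi)"
    proof (rule truncated_deformation[OF s D v1 g1(3-6) v2 g2(3-6) wn \<rho>(1) _ t1(1) t2(1) K _ f])
      show "2 * \<rho> < b - a" using \<rho> mle by simp
      show "0 \<le> B" using C(1) by (simp add: B_def)
      show "cmod (f z) \<le> B" if "z \<in> D - K" "z \<in> sphere ?a \<rho> \<union> sphere ?b \<rho>" for z
        using C(4)[OF that(1), of ?a] C(4)[OF that(1), of ?b] that(2) \<rho> mle by (auto simp: B_def)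
      fix z assume "z \<in> K"
      then obtain x r where x: "dist (of_real x) z \<le> r"
        "\<And>w. w \<in> path_image g1 \<union> path_image g2 \<Longrightarrow> r + \<eta> \<le> dist (of_real x) w" using \<eta>(2) by blast
      have e: "?a \<in> path_image g1" "?b \<in> path_image g1"
        using g1(3,4) by (metis pathstart_def pathstart_in_path_image, metis pathfinish_def pathfinish_in_path_image)
      have "r < dist (of_real x) w" if "w \<in> sphere \<omega> \<rho>" "\<omega> \<in> path_image g1" for w \<omega>
        using x(2)[of \<omega>] that dist_triangle[of "of_real x" \<omega> w] \<rho> mle by (auto simp: dist_commute)
      moreover have "r < dist (of_real x) w" if "w \<in> path_image g1 \<union> path_image g2" for w
        using x(2)[OF that] \<eta>(1) by simp
      ultimately show "\<exists>x r. dist (complex_of_real x) z \<le> r \<and>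
          (\<forall>w\<in>path_image g1 \<union> path_image g2 \<union> sphere ?a \<rho> \<union> sphere ?b \<rho>. r < dist (complex_of_real x) w)"
        using x(1) e by blast
    qed
    also have "2 * (B * \<rho> * pi) \<le> \<epsilon> / 3"
    proof -
      have "\<rho> powr (1 - \<nu>) \<le> (q powr (1 / (1 - \<nu>))) powr (1 - \<nu>)"
        by (rule powr_mono2) (use \<rho> mle C(2) in auto)
      also have "\<dots> = q" using C(2) q by (simp add: powr_powr)
      finally have "C * \<rho> powr (1 - \<nu>) \<le> C * q" using C(1) by (rule mult_left_mono)
      moreover have "B * \<rho> = C * \<rho> powr (1 - \<nu>)"
        using \<rho>(1) powr_add[of \<rho> "- \<nu>" 1] by (simp add: B_def)
      ultimately have "2 * (B * \<rho> * pi) \<le> 2 * (C * q * pi)" by (simp add: mult_right_mono)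
      also have "\<dots> = (\<epsilon> / 3) * (6 * pi * C / (6 * pi * C + 1))" by (simp add: q_def)
      also have "\<dots> \<le> (\<epsilon> / 3) * 1" by (rule mult_left_mono) (use \<epsilon> den in auto)
      finally show ?thesis by simp
    qed
    finally have mid: "cmod (contour_integral (subpath t1 s1 g1) f - contour_integral (subpath t2 s2 g2) f) \<le> \<epsilon> / 3" .
    have e1: "cmod (contour_integral (subpath t1 s1 g1) f - contour_integral g1 f) < \<epsilon> / 3"
      by (rule \<delta>1(2)) (use t1 small[OF mle(6)] in \<open>auto simp: truncation_def\<close>)
    have e2: "cmod (contour_integral (subpath t2 s2 g2) f - contour_integral g2 f) < \<epsilon> / 3"
      by (rule \<delta>2(2)) (use t2 small[OF mle(7)] in \<open>auto simp: truncation_def\<close>)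
    define X Y Z where "X = contour_integral (subpath t1 s1 g1) f - contour_integral g1 f"
      and "Y = contour_integral (subpath t2 s2 g2) f - contour_integral g2 f"
      and "Z = contour_integral (subpath t1 s1 g1) f - contour_integral (subpath t2 s2 g2) f"
    have "contour_integral g1 f - contour_integral g2 f = Z - X + Y" by (simp add: X_def Y_def Z_def)
    then have "cmod (contour_integral g1 f - contour_integral g2 f) \<le> cmod Z + cmod X + cmod Y"
      using norm_triangle_ineq[of "Z - X" Y] norm_triangle_ineq4[of Z X] by simp
    then show ?thesis using mid e1 e2 by (simp add: X_def Y_def Z_def)
  qed
  then have "cmod (contour_integral g1 f - contour_integral g2 f) \<le> 0" by (rule field_le_epsilon)
  then show ?thesis by simp
qed

section \<open>Independence of the contour\<close>

text \<open>The product rule for operator-valued functions; the complex difference quotient passes through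
  \<open>F z\<close> because this operator is complex-linear.\<close>

lemma quotient_limit_compose:
  fixes F :: "complex \<Rightarrow> 'u::cnormed \<Rightarrow>\<^sub>L 'v::cnormed" and G :: "complex \<Rightarrow> 'w::cnormed \<Rightarrow>\<^sub>L 'u"
  assumes F: "((\<lambda>w. inverse (w - z) *\<^sub>C (F w - F z)) \<longlongrightarrow> F') (at z)"
    and G: "((\<lambda>w. inverse (w - z) *\<^sub>C (G w - G z)) \<longlongrightarrow> G') (at z)" and cl: "clinear_op (F z)"
  shows "((\<lambda>w. inverse (w - z) *\<^sub>C ((F w o\<^sub>L G w) - (F z o\<^sub>L G z))) \<longlongrightarrow> (F' o\<^sub>L G z) + (F z o\<^sub>L G')) (at z)"
proof -
  note lim = bounded_bilinear.tendsto[OF bounded_bilinear_blinfun_compose]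
  have "((\<lambda>w. ((inverse (w - z) *\<^sub>C (F w - F z)) o\<^sub>L G w) + (F z o\<^sub>L (inverse (w - z) *\<^sub>C (G w - G z))))
      \<longlongrightarrow> (F' o\<^sub>L G z) + (F z o\<^sub>L G')) (at z)"
    by (intro tendsto_add lim F G quotient_limit_isCont[OF G] tendsto_const)
  moreover have "((inverse (w - z) *\<^sub>C (F w - F z)) o\<^sub>L G w) + (F z o\<^sub>L (inverse (w - z) *\<^sub>C (G w - G z)))
      = inverse (w - z) *\<^sub>C ((F w o\<^sub>L G w) - (F z o\<^sub>L G z))" for w
    by (simp add: blinfun_compose_scaleC_left blinfun_compose_scaleC_right[OF cl] blinfun_compose_diff_left
        blinfun_compose_diff_right scaleC_diff_right)
  ultimately show ?thesis by simp
qed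

lemma quotient_limit_resolvent:
  fixes T :: "'a::{cnormed, banach} \<Rightarrow>\<^sub>L 'a"
  assumes T: "clinear_op T" and z: "z \<notin> spectrum T"
  shows "((\<lambda>w. inverse (w - z) *\<^sub>C (resolvent T w - resolvent T z)) \<longlongrightarrow> resolvent T z o\<^sub>L resolvent T z) (at z)"
proof (rule Lim_transform_eventually)
  show "((\<lambda>w. resolvent T w o\<^sub>L resolvent T z) \<longlongrightarrow> resolvent T z o\<^sub>L resolvent T z) (at z)"
    by (rule bounded_bilinear.tendsto[OF bounded_bilinear_blinfun_compose isCont_resolvent[OF T z, unfolded isCont_def] tendsto_const])
  have "eventually (\<lambda>w. w \<in> - spectrum T) (at z)"
    using open_resolvent_set z by (intro eventually_at_topological[THEN iffD2]) auto
  moreover have "eventually (\<lambda>w. w \<noteq> z) (at z)" by (simp add: eventually_at_filter)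
  ultimately show "\<forall>\<^sub>F w in at z. resolvent T w o\<^sub>L resolvent T z = inverse (w - z) *\<^sub>C (resolvent T w - resolvent T z)"
    by eventually_elim (simp add: resolvent_identity[OF T z] scaleC_scaleC)
qed

lemma quotient_limit_field_differentiable:
  fixes F :: "complex \<Rightarrow> 'a::chilbert \<Rightarrow>\<^sub>L 'b::chilbert"
  assumes F: "((\<lambda>w. inverse (w - z) *\<^sub>C (F w - F z)) \<longlongrightarrow> L) (at z)"
  shows "(\<lambda>w. cinner (blinfun_apply (F w) x) y) field_differentiable (at z)"
proof -
  have "((\<lambda>w. cinner (blinfun_apply (inverse (w - z) *\<^sub>C (F w - F z)) x) y) \<longlongrightarrow> cinner (blinfun_apply L x) y) (at z)"
    by (intro bounded_bilinear.tendsto[OF bounded_bilinear_cinner] bounded_bilinear.tendsto[OF bounded_bilinear_blinfun_apply] F tendsto_const)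
  moreover have "cinner (blinfun_apply (inverse (w - z) *\<^sub>C (F w - F z)) x) y
      = (cinner (blinfun_apply (F w) x) y - cinner (blinfun_apply (F z) x) y) / (w - z)" for w
    by (simp add: scaleC_blinfun_apply cinner_scaleC_left blinfun.diff_left cinner_diff_left divide_inverse mult.commute)
  ultimately show ?thesis
    unfolding field_differentiable_def has_field_derivative_iff by auto
qed

locale deformation_data =
  fixes A :: "'a::chilbert \<Rightarrow>\<^sub>L 'a"
    and b :: "complex \<Rightarrow> 'h::chilbert \<Rightarrow>\<^sub>L 'a"
    and c :: "complex \<Rightarrow> 'a \<Rightarrow>\<^sub>L 'h"
    and \<alpha> \<beta> C \<nu>b \<nu>c :: real and D :: "complex set" and \<s> :: int
  assumes \<alpha>\<beta>: "\<alpha> < \<beta>" and sa: "selfadjoint A" and spec: "spectrum A \<subseteq> of_real ` {\<alpha><..<\<beta>}"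
    and D: "open D" "of_real ` {\<alpha><..<\<beta>} \<subseteq> D" "of_real \<alpha> \<notin> D" "of_real \<beta> \<notin> D"
    and cl: "\<forall>\<mu>\<in>D. clinear_op (b \<mu>)" "\<forall>\<mu>\<in>D. clinear_op (c \<mu>)"
    and hol: "vholomorphic_on b D" "vholomorphic_on c D"
    and C: "C > 0" and \<nu>: "0 \<le> \<nu>b" "\<nu>b < 1/2" "0 \<le> \<nu>c" "\<nu>c < 1/2"
    and ends: "\<forall>\<omega>\<in>{complex_of_real \<alpha>, complex_of_real \<beta>}. \<exists>U. open U \<and> \<omega> \<in> U \<and>
           (\<forall>\<mu>\<in>D \<inter> U. norm (b \<mu>) \<le> C * cmod (\<mu> - \<omega>) powr (- \<nu>b) \<and>
                        norm (c \<mu>) \<le> C * cmod (\<mu> - \<omega>) powr (- \<nu>c))"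
    and \<s>: "\<s> \<in> {1, -1}"
begin

text \<open>The homotopy of the interval to the arc takes place in \<open>D\<close> with the end points adjoined, so that all
  contours wind alike around every other point outside \<open>D\<close>.\<close>

lemma contour_props:
  assumes "contour \<alpha> \<beta> D \<s> \<gamma>"
  shows "smooth_arc \<gamma>" "arc \<gamma>" "piecewise_smooth \<gamma>" "\<gamma> 0 = of_real \<alpha>" "\<gamma> 1 = of_real \<beta>" "open_arc \<gamma> \<subseteq> D"
    "path_image \<gamma> \<subseteq> half_plane (of_int \<s>)"
    "\<And>z. z \<notin> D \<Longrightarrow> z \<noteq> of_real \<alpha> \<Longrightarrow> z \<noteq> of_real \<beta> \<Longrightarrow>
      winding_number \<gamma> z = winding_number (linepath (of_real \<alpha>) (of_real \<beta>)) z"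
proof -
  note con = assms[unfolded contour_def]
  show "arc \<gamma>" "piecewise_smooth \<gamma>" "\<gamma> 0 = of_real \<alpha>" "\<gamma> 1 = of_real \<beta>"
    using con by (auto simp: pathstart_def pathfinish_def)
  then show "smooth_arc \<gamma>" by (simp add: smooth_arc_def)
  have op: "open_arc \<gamma> \<subseteq> half_part \<s> D \<union> of_real ` {\<alpha><..<\<beta>}" using con by blast
  then show "open_arc \<gamma> \<subseteq> D" using D(2) by (auto simp: half_part_def)
  have "\<gamma> u \<in> half_plane (of_int \<s>)" if "u \<in> {0..1}" for u
  proof (cases "u = 0 \<or> u = 1")
    case True
    then show ?thesis using \<open>\<gamma> 0 = of_real \<alpha>\<close> \<open>\<gamma> 1 = of_real \<beta>\<close> by (auto simp: half_plane_def)
  next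
    case False
    then have "\<gamma> u \<in> open_arc \<gamma>" using that by (auto simp: open_arc_def)
    then show ?thesis using op by (force simp: half_plane_def half_part_def)
  qed
  then show "path_image \<gamma> \<subseteq> half_plane (of_int \<s>)" unfolding path_image_def by blast
  fix z assume z: "z \<notin> D" "z \<noteq> of_real \<alpha>" "z \<noteq> of_real \<beta>"
  have "homotopic_paths (D \<union> {of_real \<alpha>, of_real \<beta>}) (linepath (of_real \<alpha>) (of_real \<beta>)) \<gamma>" using con by blast
  then have "homotopic_paths (- {z}) (linepath (of_real \<alpha>) (of_real \<beta>)) \<gamma>"
    by (rule homotopic_paths_subset) (use z in auto)
  then show "winding_number \<gamma> z = winding_number (linepath (of_real \<alpha>) (of_real \<beta>)) z"
    by (rule winding_number_homotopic_paths[symmetric])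
qed

lemma isCont_bc: "z \<in> D \<Longrightarrow> isCont b z" "z \<in> D \<Longrightarrow> isCont c z"
  using vholomorphic_isCont[OF hol(1) D(1)] vholomorphic_isCont[OF hol(2) D(1)] by auto

lemma kernels:
  assumes \<gamma>: "contour \<alpha> \<beta> D \<s> \<gamma>"
  shows "L2_kernel (arclen \<gamma>) b" "L2_kernel (arclen \<gamma>) c"
proof -
  note p = contour_props[OF \<gamma>]
  have e: "\<omega> \<in> {complex_of_real \<alpha>, complex_of_real \<beta>}" if "\<omega> \<in> {\<gamma> 0, \<gamma> 1}" for \<omega> using that p(4,5) by auto
  show "L2_kernel (arclen \<gamma>) b"
  proof (rule smooth_arc.L2_kernel_endpoint_singularities[OF p(1)])
    show "\<exists>U. open U \<and> \<omega> \<in> U \<and> (\<forall>z\<in>open_arc \<gamma> \<inter> U. norm (b z) \<le> C * cmod (z - \<omega>) powr - \<nu>b)" if "\<omega> \<in> {\<gamma> 0, \<gamma> 1}" for \<omega>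
      using bspec[OF ends e[OF that]] p(6) by blast
  qed (use isCont_bc cl p(6) C \<nu> in auto)
  show "L2_kernel (arclen \<gamma>) c"
  proof (rule smooth_arc.L2_kernel_endpoint_singularities[OF p(1)])
    show "\<exists>U. open U \<and> \<omega> \<in> U \<and> (\<forall>z\<in>open_arc \<gamma> \<inter> U. norm (c z) \<le> C * cmod (z - \<omega>) powr - \<nu>c)" if "\<omega> \<in> {\<gamma> 0, \<gamma> 1}" for \<omega>
      using bspec[OF ends e[OF that]] p(6) by blast
  qed (use isCont_bc cl p(6) C \<nu> in auto)
qed

lemma E_norms:
  assumes \<gamma>: "contour \<alpha> \<beta> D \<s> \<gamma>"
  shows "E_norm_dual \<gamma> (B_op b \<gamma>) = ennreal (sqrt (LINT z|arclen \<gamma>. (norm (b z))\<^sup>2))"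
    "E_norm \<gamma> (C_op c \<gamma>) = ennreal (sqrt (LINT z|arclen \<gamma>. (norm (c z))\<^sup>2))"
  using smooth_arc.E_norm_dual_B_op[OF contour_props(1)[OF \<gamma>] kernels(1)[OF \<gamma>]]
    smooth_arc.E_norm_mult_op[OF contour_props(1)[OF \<gamma>] kernels(2)[OF \<gamma>]]
    smooth_arc.C_op_mult_op[OF contour_props(1)[OF \<gamma>], of c] by auto

lemma setting:
  assumes \<gamma>: "contour \<alpha> \<beta> D \<s> \<gamma>" and small: "smallness A b c \<gamma>"
  shows "riccati_setting \<gamma> A b c (spec_dist A \<gamma>)"
proof -
  note p = contour_props[OF \<gamma>]
  have nn: "sqrt (LINT z|arclen \<gamma>. (norm (b z))\<^sup>2) \<ge> 0" "sqrt (LINT z|arclen \<gamma>. (norm (c z))\<^sup>2) \<ge> 0"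
    by (auto intro!: integral_nonneg_AE)
  have sm: "sqrt (LINT z|arclen \<gamma>. (norm (b z))\<^sup>2) * sqrt (LINT z|arclen \<gamma>. (norm (c z))\<^sup>2) < (spec_dist A \<gamma>)\<^sup>2 / 4"
    using small unfolding smallness_def E_norms[OF \<gamma>] ennreal_mult'[OF nn(1), symmetric]
    by (subst (asm) ennreal_less_iff) (use nn in auto)
  have "spec_dist A \<gamma> \<noteq> 0"
  proof
    assume "spec_dist A \<gamma> = 0"
    then show False using sm mult_nonneg_nonneg[OF nn] by simp
  qed
  then have "spec_dist A \<gamma> > 0" using setdist_pos_le[of "spectrum A" "open_arc \<gamma>"] by (simp add: spec_dist_def order_less_le)
  moreover have "spectrum A \<subseteq> \<real>" using spec by auto
  ultimately show ?thesis
    using p(1,6) sa kernels[OF \<gamma>] isCont_bc sm by (auto simp: riccati_setting_def riccati_setting_axioms_def)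
qed

text \<open>The solution for the contour closer to the spectrum also solves the equation for the other
  one: its spectrum stays within \<open>d / 2\<close> of the spectrum of \<open>A\<close>, hence in discs around real points
  that no contour of distance at least \<open>d\<close> meets.\<close>

lemma Z_op_eq_of_le:
  assumes \<gamma>1: "contour \<alpha> \<beta> D \<s> \<gamma>1" "smallness A b c \<gamma>1" and \<gamma>2: "contour \<alpha> \<beta> D \<s> \<gamma>2" "smallness A b c \<gamma>2"
    and le: "spec_dist A \<gamma>2 \<le> spec_dist A \<gamma>1"
  shows "Z_op A b c \<gamma>1 = Z_op A b c \<gamma>2"
proof -
  interpret R1: riccati_setting \<gamma>1 A b c "spec_dist A \<gamma>1" by (rule setting[OF \<gamma>1])
  interpret R2: riccati_setting \<gamma>2 A b c "spec_dist A \<gamma>2" by (rule setting[OF \<gamma>2])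
  note p1 = contour_props[OF \<gamma>1(1)] and p2 = contour_props[OF \<gamma>2(1)]
  define d where "d = spec_dist A \<gamma>2"
  have d: "d > 0" using R2.d_pos by (simp add: d_def)
  define T where "T = Z_op A b c \<gamma>2 - A"
  have Z2: "Z_op A b c \<gamma>2 = A + T" by (simp add: T_def)
  have nT: "norm T < d / 2" using R2.Z_op_props(2) R2.r_bounds(2) by (simp add: T_def d_def)
  have nT1: "norm T < spec_dist A \<gamma>1" and nT2: "norm T < spec_dist A \<gamma>2" using nT le d by (auto simp: d_def)
  have "clinear_op T \<and> R2.Phi T = T" using R2.solves_Z_iff[OF nT2] R2.Z_op_props(1) by (simp add: Z2)
  then have T: "clinear_op T" "R2.Phi T = T" by auto
  let ?Z = "A + T"
  have clZ: "clinear_op ?Z" by (rule clinear_op_add[OF R2.A_clinear T(1)])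
  define K where "K = spectrum ?Z"
  have K: "closed K" using open_resolvent_set[of ?Z] by (simp add: K_def closed_def)
  define F where "F z = b z o\<^sub>L c z o\<^sub>L resolvent ?Z z o\<^sub>L id_blinfun" for z
  have F1: "strongly_measurable (arclen \<gamma>1) F" "integrable (arclen \<gamma>1) (\<lambda>z. norm (F z))"
    using R1.sandwich(1,2)[OF R1.admissible_right R1.resolvent_on_arc[OF T(1) nT1]] by (simp_all add: F_def[abs_def])
  have F2: "strongly_measurable (arclen \<gamma>2) F" "integrable (arclen \<gamma>2) (\<lambda>z. norm (F z))"
    using R2.sandwich(1,2)[OF R2.admissible_right R2.resolvent_on_arc[OF T(1) nT2]] by (simp_all add: F_def[abs_def])
  have Phi1: "R1.Phi T = arc_integral \<gamma>1 F" and Phi2: "R2.Phi T = arc_integral \<gamma>2 F"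
    by (simp_all add: R1.resolvent_integral_def R2.resolvent_integral_def F_def[abs_def])
  \<comment> \<open>The equation on the first arc is tested by scalar functions, to which the deformation applies.\<close>
  have scalar: "cinner (blinfun_apply (arc_integral \<gamma>1 F) x) y = cinner (blinfun_apply (arc_integral \<gamma>2 F) x) y" for x y
  proof -
    define f where "f z = cinner (blinfun_apply (F z) x) y" for z
    have h: "bounded_linear (\<lambda>S :: 'a \<Rightarrow>\<^sub>L 'a. cinner (blinfun_apply S x) y)"
      by (rule bounded_linear_compose[OF bounded_bilinear.bounded_linear_left[OF bounded_bilinear_cinner] blinfun.bounded_linear_left])
    have hs: "cinner (blinfun_apply (k *\<^sub>C S) x) y = k *\<^sub>C cinner (blinfun_apply S x) y" for k and S :: "'a \<Rightarrow>\<^sub>L 'a"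
      by (simp add: scaleC_blinfun_apply cinner_scaleC_left scaleC_complex_def)
    have i1: "(f has_contour_integral cinner (blinfun_apply (arc_integral \<gamma>1 F) x) y) \<gamma>1"
      using R1.arc_integral_linear[OF F1 h hs]
      by (simp add: has_contour_integral_def has_arc_integral_def f_def scaleC_complex_def mult.commute)
    have i2: "(f has_contour_integral cinner (blinfun_apply (arc_integral \<gamma>2 F) x) y) \<gamma>2"
      using R2.arc_integral_linear[OF F2 h hs]
      by (simp add: has_contour_integral_def has_arc_integral_def f_def scaleC_complex_def mult.commute)
    have near: "\<exists>a. of_real a \<in> spectrum A \<and> dist (of_real a) z \<le> d / 2" if z: "z \<in> K" for z
    proof (rule ccontr)
      assume n: "\<not> ?thesis"
      have "d / 2 \<le> cmod (z - a)" if a: "a \<in> spectrum A" for a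
      proof -
        obtain t where "a = of_real t" using a spec by auto
        then show ?thesis using n a by (auto simp: dist_norm norm_minus_commute not_le less_imp_le)
      qed
      then have "z \<notin> spectrum ?Z" by (rule resolvent_bound_perturbed(1)[OF sa R2.spec_real _ nT])
      then show False using z by (simp add: K_def)
    qed
    have away: "d \<le> dist a w" if "a \<in> spectrum A" "w \<in> path_image \<gamma>1 \<union> path_image \<gamma>2" for a w
      using R1.dist_path_image[of w a] R2.dist_path_image[of w a] that le by (auto simp: d_def dist_norm norm_minus_commute)
    have holf: "f holomorphic_on (D - K)"
    proof -
      have oDK: "open (D - K)" using D(1) K by (rule open_Diff)
      have "f field_differentiable (at z)" if z: "z \<in> D - K" for z
      proof -
        have zD: "z \<in> D" and zK: "z \<notin> spectrum ?Z" using z by (auto simp: K_def)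
        obtain b' where b': "((\<lambda>w. inverse (w - z) *\<^sub>C (b w - b z)) \<longlongrightarrow> b') (at z)"
          using bspec[OF hol(1)[unfolded vholomorphic_on_def] zD] unfolding at_within_open[OF zD D(1)] by (rule exE) (rule that)
        obtain c' where c': "((\<lambda>w. inverse (w - z) *\<^sub>C (c w - c z)) \<longlongrightarrow> c') (at z)"
          using bspec[OF hol(2)[unfolded vholomorphic_on_def] zD] unfolding at_within_open[OF zD D(1)] by (rule exE) (rule that)
        have clbc: "clinear_op (b z)" "clinear_op (b z o\<^sub>L c z)" using cl zD by (auto intro: clinear_op_compose)
        have "((\<lambda>w. inverse (w - z) *\<^sub>C (F w - F z)) \<longlongrightarrow>
            ((b' o\<^sub>L c z) + (b z o\<^sub>L c') o\<^sub>L resolvent ?Z z) + (b z o\<^sub>L c z o\<^sub>L (resolvent ?Z z o\<^sub>L resolvent ?Z z))) (at z)"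
          unfolding F_def compose_id_right
          by (rule quotient_limit_compose[OF quotient_limit_compose[OF b' c' clbc(1)] quotient_limit_resolvent[OF clZ zK] clbc(2)])
        then show ?thesis unfolding f_def by (rule quotient_limit_field_differentiable)
      qed
      then show ?thesis using oDK by (auto simp: holomorphic_on_def intro: field_differentiable_at_within)
    qed
    have sing: "\<exists>e>0. \<forall>z\<in>D. dist \<omega> z < e \<longrightarrow> norm (b z) \<le> C * dist \<omega> z powr (- \<nu>b) \<and> norm (c z) \<le> C * dist \<omega> z powr (- \<nu>c)"
      if \<omega>: "\<omega> \<in> {complex_of_real \<alpha>, complex_of_real \<beta>}" for \<omega>
    proof -
      obtain U where U: "open U \<and> \<omega> \<in> U \<and> (\<forall>\<mu>\<in>D \<inter> U. norm (b \<mu>) \<le> C * cmod (\<mu> - \<omega>) powr (- \<nu>b) \<and>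
          norm (c \<mu>) \<le> C * cmod (\<mu> - \<omega>) powr (- \<nu>c))" using bspec[OF ends \<omega>] by (rule exE) (rule that)
      obtain e where e: "e > 0" "ball \<omega> e \<subseteq> U" using openE[of U \<omega>] U by metis
      have "norm (b z) \<le> C * dist \<omega> z powr (- \<nu>b) \<and> norm (c z) \<le> C * dist \<omega> z powr (- \<nu>c)"
        if "z \<in> D" "dist \<omega> z < e" for z
      proof -
        have "z \<in> D \<inter> U" using e(2) that by auto
        then show ?thesis using bspec[OF conjunct2[OF conjunct2[OF U]], of z] by (simp add: dist_norm norm_minus_commute)
      qed
      then show ?thesis using e(1) by blast
    qed
    have \<alpha>in: "complex_of_real \<alpha> \<in> {complex_of_real \<alpha>, complex_of_real \<beta>}"
      and \<beta>in: "complex_of_real \<beta> \<in> {complex_of_real \<alpha>, complex_of_real \<beta>}" by simp_all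
    obtain e1 where e1: "e1 > 0 \<and> (\<forall>z\<in>D. dist (of_real \<alpha>) z < e1 \<longrightarrow>
        norm (b z) \<le> C * dist (of_real \<alpha>) z powr (- \<nu>b) \<and> norm (c z) \<le> C * dist (of_real \<alpha>) z powr (- \<nu>c))"
      using sing[OF \<alpha>in] by (rule exE) (rule that)
    obtain e2 where e2: "e2 > 0 \<and> (\<forall>z\<in>D. dist (of_real \<beta>) z < e2 \<longrightarrow>
        norm (b z) \<le> C * dist (of_real \<beta>) z powr (- \<nu>b) \<and> norm (c z) \<le> C * dist (of_real \<beta>) z powr (- \<nu>c))"
      using sing[OF \<beta>in] by (rule exE) (rule that)
    define \<rho>1 where "\<rho>1 = min (min e1 e2) (d / 4)"
    have \<rho>1: "\<rho>1 > 0" using e1 e2 d by (simp add: \<rho>1_def)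
    define C' where "C' = C * C * (4 / d) * (norm x * norm y)"
    have C': "C' \<ge> 0" using C d by (simp add: C'_def)
    have bound: "cmod (f z) \<le> C' * dist \<omega> z powr (- (\<nu>b + \<nu>c))"
      if z: "z \<in> D - K" and \<omega>: "\<omega> \<in> {complex_of_real \<alpha>, complex_of_real \<beta>}" and zd: "dist \<omega> z < \<rho>1" for z \<omega>
    proof -
      have bc: "norm (b z) \<le> C * dist \<omega> z powr (- \<nu>b)" "norm (c z) \<le> C * dist \<omega> z powr (- \<nu>c)"
      proof -
        have zD: "z \<in> D" and lt: "dist \<omega> z < e1" "dist \<omega> z < e2" using z zd by (simp_all add: \<rho>1_def)
        have "\<omega> = of_real \<alpha> \<or> \<omega> = of_real \<beta>" using \<omega> by simp
        then have "norm (b z) \<le> C * dist \<omega> z powr (- \<nu>b) \<and> norm (c z) \<le> C * dist \<omega> z powr (- \<nu>c)"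
          using bspec[OF conjunct2[OF e1] zD] bspec[OF conjunct2[OF e2] zD] lt by blast
        then show "norm (b z) \<le> C * dist \<omega> z powr (- \<nu>b)" "norm (c z) \<le> C * dist \<omega> z powr (- \<nu>c)" by auto
      qed
      have "\<omega> \<in> path_image \<gamma>2"
        using \<omega> p2(4,5) by (metis insertE pathfinish_def pathfinish_in_path_image pathstart_def pathstart_in_path_image singletonD)
      then have "d - d / 4 \<le> cmod (z - a)" if "a \<in> spectrum A" for a
        using away[OF that, of \<omega>] zd dist_triangle[of a \<omega> z] by (simp add: \<rho>1_def dist_norm norm_minus_commute)
      moreover have "norm T < d - d / 4" using nT d by simp
      ultimately have "norm (resolvent ?Z z) \<le> 1 / ((d - d / 4) - norm T)"
        by (rule resolvent_bound_perturbed(2)[OF sa R2.spec_real])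
      also have "\<dots> \<le> 1 / (d / 4)" by (rule divide_left_mono) (use nT d in auto)
      finally have R: "norm (resolvent ?Z z) \<le> 4 / d" by simp
      have "cmod (f z) \<le> norm (blinfun_apply (F z) x) * norm y" unfolding f_def by (rule cinner_norm_le)
      also have "\<dots> \<le> (norm (F z) * norm x) * norm y" by (intro mult_right_mono norm_blinfun) simp
      also have "norm (F z) \<le> (norm (b z) * norm (c z)) * norm (resolvent ?Z z)"
        unfolding F_def compose_id_right
        by (rule order_trans[OF norm_blinfun_compose mult_right_mono[OF norm_blinfun_compose]]) simp
      also have "\<dots> \<le> ((C * dist \<omega> z powr (- \<nu>b)) * (C * dist \<omega> z powr (- \<nu>c))) * (4 / d)"
        by (intro mult_mono bc R) (use C in auto)
      finally have "cmod (f z) \<le> ((C * dist \<omega> z powr (- \<nu>b)) * (C * dist \<omega> z powr (- \<nu>c))) * (4 / d) * norm x * norm y"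
        by (simp add: mult_right_mono)
      also have "\<dots> = C' * (dist \<omega> z powr (- \<nu>b) * dist \<omega> z powr (- \<nu>c))" by (simp add: C'_def mult_ac)
      also have "dist \<omega> z powr (- \<nu>b) * dist \<omega> z powr (- \<nu>c) = dist \<omega> z powr (- (\<nu>b + \<nu>c))"
        by (simp add: powr_add[symmetric])
      finally show ?thesis .
    qed
    have "contour_integral \<gamma>1 f = contour_integral \<gamma>2 f"
    proof (rule contour_integral_deformation[where s = "of_int \<s>" and a = \<alpha> and b = \<beta> and D = D and K = K and \<eta> = "d / 2"
          and C = C' and \<nu> = "\<nu>b + \<nu>c" and \<tau> = \<rho>1])
      show "real_of_int \<s> = 1 \<or> real_of_int \<s> = - 1" using \<s> by auto
      show "winding_number \<gamma>1 z = winding_number \<gamma>2 z"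
        if "z \<notin> D" "z \<noteq> complex_of_real \<alpha>" "z \<noteq> complex_of_real \<beta>" for z
        using p1(8)[OF that] p2(8)[OF that] by simp
      show "\<gamma>1 ` {0<..<1} \<subseteq> D" "\<gamma>2 ` {0<..<1} \<subseteq> D" using p1(6) p2(6) by (auto simp: open_arc_def)
      show "\<exists>x r. dist (complex_of_real x) z \<le> r \<and> (\<forall>w\<in>path_image \<gamma>1 \<union> path_image \<gamma>2. r + d / 2 \<le> dist (complex_of_real x) w)"
        if z: "z \<in> K" for z
      proof -
        obtain a where "of_real a \<in> spectrum A" "dist (of_real a) z \<le> d / 2" using near[OF z] by blast
        then show ?thesis using away by (intro exI[of _ a] exI[of _ "d / 2"]) auto
      qed
      show "f contour_integrable_on \<gamma>1" "f contour_integrable_on \<gamma>2"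
        using i1 i2 by (auto simp: contour_integrable_on_def)
    qed (use \<alpha>\<beta> D p1 p2 K d holf C' \<nu> \<rho>1 bound in auto)
    then show ?thesis using i1 i2 by (simp add: contour_integral_unique)
  qed
  have "arc_integral \<gamma>1 F = arc_integral \<gamma>2 F"
  proof (rule blinfun_eqI)
    fix x
    have "cinner (blinfun_apply (arc_integral \<gamma>1 F) x - blinfun_apply (arc_integral \<gamma>2 F) x) y = 0" for y
      using scalar[of x y] by (simp add: cinner_diff_left)
    then show "blinfun_apply (arc_integral \<gamma>1 F) x = blinfun_apply (arc_integral \<gamma>2 F) x"
      using cinner_eq_zeroD by fastforce
  qed
  then have "R1.Phi T = T" using T(2) by (simp add: Phi1 Phi2)
  then have "solves_Z A b c \<gamma>1 (A + T)" using R1.solves_Z_iff[OF nT1] T(1) by simp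
  then have "Z_op A b c \<gamma>1 = A + T" by (rule R1.Z_op_props(3)) (use nT le in \<open>simp add: d_def\<close>)
  then show ?thesis by (simp add: Z2)
qed

end

theorem theorem4p9:
  fixes A :: "'a::chilbert \<Rightarrow>\<^sub>L 'a"
    and \<b> :: "complex \<Rightarrow> 'h::chilbert \<Rightarrow>\<^sub>L 'a"
    and \<c> :: "complex \<Rightarrow> 'a \<Rightarrow>\<^sub>L 'h"
    and \<alpha> \<beta> C \<nu>\<^sub>b \<nu>\<^sub>c :: real
    and D :: "complex set"
    and \<s> :: int
    and \<gamma> :: "real \<Rightarrow> complex"
  defines "d \<equiv> spec_dist A \<gamma>"
    and "nB \<equiv> enn2real (E_norm_dual \<gamma> (B_op \<b> \<gamma>))"
    and "nC \<equiv> enn2real (E_norm \<gamma> (C_op \<c> \<gamma>))"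
  assumes "\<alpha> < \<beta>"
    and "selfadjoint A"
    and "spectrum A \<subseteq> of_real ` {\<alpha><..<\<beta>}"
    and "open D" and "connected D"
    and "of_real ` {\<alpha><..<\<beta>} \<subseteq> D" and "of_real \<alpha> \<notin> D" and "of_real \<beta> \<notin> D"
    and "\<forall>\<mu>\<in>D. clinear_op (\<b> \<mu>)" and "\<forall>\<mu>\<in>D. clinear_op (\<c> \<mu>)"
    and "vholomorphic_on \<b> D" and "vholomorphic_on \<c> D"
    and "C > 0" and "0 \<le> \<nu>\<^sub>b" and "\<nu>\<^sub>b < 1/2" and "0 \<le> \<nu>\<^sub>c" and "\<nu>\<^sub>c < 1/2"
    and "\<forall>\<omega>\<in>{complex_of_real \<alpha>, complex_of_real \<beta>}. \<exists>U. open U \<and> \<omega> \<in> U \<and>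
           (\<forall>\<mu>\<in>D \<inter> U. norm (\<b> \<mu>) \<le> C * cmod (\<mu> - \<omega>) powr (- \<nu>\<^sub>b) \<and>
                        norm (\<c> \<mu>) \<le> C * cmod (\<mu> - \<omega>) powr (- \<nu>\<^sub>c))"
    and "\<s> \<in> {1, -1}"
    and "contour \<alpha> \<beta> D \<s> \<gamma>"
    and "smallness A \<b> \<c> \<gamma>"
  shows "\<exists>X Y. riccati_X A \<b> \<c> \<gamma> X \<and> riccati_Y A \<b> \<c> \<gamma> Y \<and>
     (B_op \<b> \<gamma> \<noteq> zero_op (HD \<gamma>) whole \<longrightarrow>
        op_norm whole (HD \<gamma>) X < (1 / nB) * (d - sqrt (nB * nC)) \<and>
        (\<forall>X'. riccati_X A \<b> \<c> \<gamma> X' \<and>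
              op_norm whole (HD \<gamma>) X' < (1 / nB) * (d - sqrt (nB * nC)) \<longrightarrow> X' = X) \<and>
        E_norm \<gamma> X < top \<and>
        E_norm \<gamma> X \<le> ennreal ((1 / nB) * (d / 2 - sqrt (d\<^sup>2 / 4 - nB * nC)))) \<and>
     (C_op \<c> \<gamma> \<noteq> zero_op whole (HD \<gamma>) \<longrightarrow>
        op_norm (HD \<gamma>) whole Y < (1 / nC) * (d - sqrt (nB * nC)) \<and>
        (\<forall>Y'. riccati_Y A \<b> \<c> \<gamma> Y' \<and>
              op_norm (HD \<gamma>) whole Y' < (1 / nC) * (d - sqrt (nB * nC)) \<longrightarrow> Y' = Y) \<and>
        E_norm_dual \<gamma> Y < top \<and>
        E_norm_dual \<gamma> Y \<le> ennreal ((1 / nC) * (d / 2 - sqrt (d\<^sup>2 / 4 - nB * nC)))) \<and>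
     solves_Z A \<b> \<c> \<gamma> (Z_op A \<b> \<c> \<gamma>) \<and>
     Z_op A \<b> \<c> \<gamma> = Blinfun (\<lambda>x. blinfun_apply A x + B_op \<b> \<gamma> (X x)) \<and>
     (\<forall>\<gamma>'. contour \<alpha> \<beta> D \<s> \<gamma>' \<and> smallness A \<b> \<c> \<gamma>' \<longrightarrow>
           Z_op A \<b> \<c> \<gamma>' = Z_op A \<b> \<c> \<gamma>)"
proof -
  interpret deformation_data A \<b> \<c> \<alpha> \<beta> C \<nu>\<^sub>b \<nu>\<^sub>c D \<s>
    by (rule deformation_data.intro) (fact assms)+
  interpret riccati_setting \<gamma> A \<b> \<c> d
    unfolding d_def by (rule setting) (fact assms)+
  have nB: "nB = sqrt (LINT z|arclen \<gamma>. (norm (\<b> z))\<^sup>2)" and nC: "nC = sqrt (LINT z|arclen \<gamma>. (norm (\<c> z))\<^sup>2)"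
    unfolding nB_def nC_def E_norms[OF \<open>contour \<alpha> \<beta> D \<s> \<gamma>\<close>] using nBC_nonneg by simp_all
  have indep: "\<forall>\<gamma>'. contour \<alpha> \<beta> D \<s> \<gamma>' \<and> smallness A \<b> \<c> \<gamma>' \<longrightarrow> Z_op A \<b> \<c> \<gamma>' = Z_op A \<b> \<c> \<gamma>"
  proof (intro allI impI)
    fix \<gamma>' assume \<gamma>': "contour \<alpha> \<beta> D \<s> \<gamma>' \<and> smallness A \<b> \<c> \<gamma>'"
    note \<gamma> = \<open>contour \<alpha> \<beta> D \<s> \<gamma>\<close> \<open>smallness A \<b> \<c> \<gamma>\<close>
    show "Z_op A \<b> \<c> \<gamma>' = Z_op A \<b> \<c> \<gamma>"
      using Z_op_eq_of_le[OF \<gamma> conjunct1[OF \<gamma>'] conjunct2[OF \<gamma>']] Z_op_eq_of_le[OF conjunct1[OF \<gamma>'] conjunct2[OF \<gamma>'] \<gamma>]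
      by (cases "spec_dist A \<gamma> \<le> spec_dist A \<gamma>'") auto
  qed
  show ?thesis
    using riccati_solutions indep Z_op_props(1) unfolding nB nC
    by (elim exE conjE) (intro exI conjI; assumption)
qed

end
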